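(* Let $V$ be a finite-dimensional graded vector space over a field of characteristic $0$. (a) Let $(\mathcal C(V),\{\ ,\ \},\Omega)$ be a Pinczon Lie algebra. Write $\Omega=\Omega_Q$, $Q=\sum_kQ_k$, with $Q_k:S^k(V[1])\to V[1]$. Then $Q$ is a structure of $L_\infty$ algebra on $V$, and each $Q_k$ is $B$-quadratic for the bilinear form $B$ coming from the bracket. (b) Conversely, if $b$ is a non-degenerate symmetric bilinear form on $V$ (of degree $0$), any $B$-quadratic structure $Q$ of $L_\infty$ algebra on $V$ defines a unique structure of Pinczon Lie algebra on $V$ (namely the Pinczon bracket associated to $b$ together with $\Omega=\Omega_Q$).
   Context: Degrees and signs. $|x|$ is the degree of $x$ in $V$; $V[1]$ is $V$ with shifted degree $\deg(x)=|x|-1$; scalars have degree $0$. All formulas use Koszul's sign rule: in any relation between homogeneous objects, the first term has sign $+$ and every other term is implicitly multiplied by the sign of the permutation of the odd letters (vectors, maps, forms) relating it to the first term. A multilinear form $\Omega$ on $V[1]$ has degree $d$ if $\Omega(x_1,\dots,x_k)=0$ unless $d+\sum\deg(x_j)=0$. Symmetric bilinear forms of degree $0$: $b(x,y)=(-1)^{|x||y|}b(y,x)$, and $b(x,y)=0$ unless $|x|+|y|=0$; associated form on $V[1]$: $B(x,y)=(-1)^{\deg x}b(x,y)$. Cyclic forms and Pinczon brackets. A $(k+1)$-linear form $\Omega$ on $V[1]$ is cyclic if $\Omega(x_{k+1},x_1,\dots,x_k)=\Omega(x_1,\dots,x_{k+1})$; $\mathcal C^k$ is the space of $k$-linear cyclic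 forms, $\mathcal C(V)$ the space of all cyclic forms. $\Omega^{Cycl}$ is the sum of $\Omega$ over all cyclic permutations of its variables, $A\odot B=(A\otimes B)^{Cycl}$, $\iota_x\Omega=\Omega(x,\cdot,\dots,\cdot)$. A Pinczon bracket on $\mathcal C(V)$ is a bilinear map $\{\ ,\ \}$ such that: (1) $\{\mathcal C^{k+1},\mathcal C^{k'+1}\}\subset\mathcal C^{k+k'}$; (2) it makes $\mathcal C(V)$ a graded Lie algebra (for the grading $\deg-2$) with center $\mathcal C^0$; (3) for linear forms, $\{\alpha,(\beta_1\otimes\dots\otimes\beta_k)^{Cycl}\}=\sum_j\{\alpha,\beta_j\}(\beta_1\otimes\dots\hat{\beta_j}\dots\otimes\beta_k)^{Cycl}$. Pinczon brackets correspond bijectively to degree $0$ symmetric non-degenerate forms $b$ on $V$ through $\{\Omega,\Omega'\}=\sum_i\iota_{e_i}\Omega\odot\iota_{e'_i}\Omega'$, where $b(e_i,e'_j)=\delta_{ij}$; "the form $B$ coming from the bracket" is the form associated to this $b$. Symmetric tensors. $S^k(V[1])\subset\otimes^kV[1]$ is spanned by $x_1\cdot\ldots\cdot x_k=\sum_{\sigma\in\mathfrak S_k}x_{\sigma(1)}\otimes\dots\otimes x_{\sigma(k)}$, $S^+(V[1])=\bigoplus_{k\ge1}S^k(V[1])$, with coproduct $\Delta(x_1\cdot\ldots\cdot x_k)=\sum_{I\sqcup J=[1,k],\,0<\#I<k}x_{\cdot I}\bigotimes x_{\cdot J}$, where $x_{\cdot I}=x_{i_1}\cdot\ldots\cdot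 x_{i_r}$ for $I=\{i_1<\dots<i_r\}$. A coderivation is determined by its Taylor coefficients $Q_k:S^k(V[1])\to V[1]$, $k\ge1$; a symmetric $k$-linear map on $V[1]$ is identified with a map on $S^k(V[1])$ by restriction to symmetric tensors. An $L_\infty$ structure on $V$ is a degree $1$ coderivation $Q$ of $(S^+(V[1]),\Delta)$ with $[Q,Q]=0$. For a multilinear form $\Omega$, $\Omega^{Sym}(x_1,\dots,x_n)=\sum_{\sigma\in\mathfrak S_n}\Omega(x_{\sigma(1)},\dots,x_{\sigma(n)})$. For symmetric forms, $\{\Omega,\Omega'\}|=(\{\Omega,\Omega'\})^{Sym}$ is the bracket induced by the Pinczon bracket on the quotient of $\mathcal C(V)$ consisting of the restrictions of cyclic forms to symmetric tensors. Structures. For a symmetric $k$-linear $Q_k$ with values in $V[1]$, $\Omega_{Q_k}(x_1,\dots,x_{k+1})=B(Q_k(x_1,\dots,x_k),x_{k+1})$, $\Omega_Q=\sum_{k\ge1}\Omega_{Q_k}$ (possibly infinite formal sums). $Q_k$ is $B$-quadratic if $\Omega_{Q_k}$ is cyclic (hence symmetric); $Q$ is $B$-quadratic if all $Q_k$ are. A Pinczon Lie algebra $(\mathcal C(V),\{\ ,\ \},\Omega)$ is a Pinczon bracket on $\mathcal C(V)$ and a degree $3$ symmetric form $\Omega$ on $V[1]$ (with components of arity at least $2$) such that $\{\Omega,\Omega\}|=0$.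
   Formalization: The axiom "with center C^0", false for V≠0, is replaced by: C^0 is central and central forms restrict to constants on symmetric tensors; B is read off from brackets of linear forms, and uniqueness in (b) is for the bracket given by the contraction formula of b. *)

theory Defs
  imports
    Complex_Main
    "HOL-Library.Function_Algebras"
    "HOL-Combinatorics.Permutations"
begin

text \<open>
  Multilinear forms are functions on lists of vectors; the restriction to lists of length
  \<open>k\<close> is the component of arity \<open>k\<close>, so that a function on all lists is a (possibly
  infinite) formal sum of forms.  Addition and zero of forms are pointwise.

  Degree lists \<open>ds\<close> always hold degrees in \<open>V[1]\<close>: a vector of degree \<open>d\<close> in
  \<open>V[1]\<close> has degree \<open>d + 1\<close> in \<open>V\<close>.
\<close>

type_synonym ('v, 'k) form = "'v list \<Rightarrow> 'k"
type_synonym ('v, 'k) tensor = "('v, 'k) form \<Rightarrow> 'k"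
type_synonym ('v, 'k) tensor2 = "('v list \<Rightarrow> 'v list \<Rightarrow> 'k) \<Rightarrow> 'k"

definition sg :: "int \<Rightarrow> 'k::ring_1" where
  "sg n = (if even n then 1 else - 1)"

text \<open>Koszul sign of the rearrangement \<open>x\<^sub>1 \<dots> x\<^sub>n \<mapsto> x\<^bsub>\<sigma>(1)\<^esub> \<dots> x\<^bsub>\<sigma>(n)\<^esub>\<close>.\<close>

definition ksign :: "int list \<Rightarrow> (nat \<Rightarrow> nat) \<Rightarrow> 'k::comm_ring_1" where
  "ksign ds \<sigma> = (\<Prod>(i, j) \<in> {(i, j). i < j \<and> j < length ds \<and> \<sigma> j < \<sigma> i}. sg (ds ! \<sigma> i * ds ! \<sigma> j))"

text \<open>Koszul sign of \<open>x\<^sub>1 \<dots> x\<^sub>n \<mapsto> x\<^sub>I x\<^sub>J\<close>, \<open>J\<close> the complement of \<open>I\<close>.\<close>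

definition usign :: "int list \<Rightarrow> nat set \<Rightarrow> 'k::comm_ring_1" where
  "usign ds I = (\<Prod>(j, i) \<in> {(j, i). j < i \<and> i < length ds \<and> i \<in> I \<and> j \<notin> I}. sg (ds ! j * ds ! i))"

definition fscale :: "'k::times \<Rightarrow> ('a \<Rightarrow> 'k) \<Rightarrow> 'a \<Rightarrow> 'k" where
  "fscale c f = (\<lambda>x. c * f x)"

definition fspan :: "('a \<Rightarrow> 'k::field) set \<Rightarrow> ('a \<Rightarrow> 'k) set" where
  "fspan S = module.span fscale S"

definition flinear_on :: "('a \<Rightarrow> 'k::field) set \<Rightarrow> (('a \<Rightarrow> 'k) \<Rightarrow> 'b \<Rightarrow> 'k) \<Rightarrow> bool" where
  "flinear_on S L \<longleftrightarrow>
     (\<forall>t\<in>S. \<forall>u\<in>S. L (t + u) = L t + L u) \<and> (\<forall>c. \<forall>t\<in>S. L (fscale c t) = fscale c (L t))"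

definition comp_arity :: "nat \<Rightarrow> ('v list \<Rightarrow> 'a::zero) \<Rightarrow> 'v list \<Rightarrow> 'a" where
  "comp_arity k F = (\<lambda>xs. if length xs = k then F xs else 0)"

locale fd_graded_space = vector_space scale
  for scale :: "'k::field_char_0 \<Rightarrow> 'v::ab_group_add \<Rightarrow> 'v" (infixr \<open>*s\<close> 75) +
  fixes gr :: "int \<Rightarrow> 'v set"
  assumes subspace_gr: "subspace (gr n)"
    and graded: "\<exists>!f. (\<forall>n. f n \<in> gr n) \<and> finite {n. f n \<noteq> 0} \<and> (\<Sum>n | f n \<noteq> 0. f n) = v"
    and finite_dim: "\<exists>A. finite A \<and> span A = UNIV"
begin

definition hcomp :: "int \<Rightarrow> 'v \<Rightarrow> 'v" where
  "hcomp m v =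
     (THE f. (\<forall>n. f n \<in> gr n) \<and> finite {n. f n \<noteq> 0} \<and> (\<Sum>n | f n \<noteq> 0. f n) = v) m"

definition homog :: "int list \<Rightarrow> 'v list \<Rightarrow> bool" where
  "homog ds xs \<longleftrightarrow> list_all2 (\<lambda>d x. x \<in> gr (d + 1)) ds xs"

definition degs :: "int set" where
  "degs = {d. gr (d + 1) \<noteq> {0}}"

text \<open>
  Multilinear extension: \<open>G ds xs\<close> is an expression multilinear in \<open>xs\<close>, meant for
  homogeneous arguments \<open>xs\<close> of degrees \<open>ds\<close> (and involving Koszul signs).
\<close>

definition mext :: "(int list \<Rightarrow> 'v list \<Rightarrow> 'k) \<Rightarrow> ('v, 'k) form" where
  "mext G xs = (\<Sum>ds | length ds = length xs \<and> set ds \<subseteq> degs.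
                  G ds (map2 (\<lambda>d x. hcomp (d + 1) x) ds xs))"


subsection \<open>Cyclic and symmetric forms\<close>

definition mform :: "('v, 'k) form \<Rightarrow> bool" where
  "mform F \<longleftrightarrow> (\<forall>xs i. i < length xs \<longrightarrow> Vector_Spaces.linear scale (*) (\<lambda>v. F (xs[i := v])))"

definition cyclic :: "('v, 'k) form \<Rightarrow> bool" where
  "cyclic F \<longleftrightarrow> mform F \<and>
     (\<forall>d ds x xs. homog (d # ds) (x # xs) \<longrightarrow> F (x # xs) = sg (d * sum_list ds) * F (xs @ [x]))"

definition symmetric :: "('v, 'k) form \<Rightarrow> bool" where
  "symmetric F \<longleftrightarrow> mform F \<and>
     (\<forall>ds xs \<sigma>. homog ds xs \<and> \<sigma> permutes {..<length xs} \<longrightarrow>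
        F (permute_list \<sigma> xs) = ksign ds \<sigma> * F xs)"

definition has_degree :: "int \<Rightarrow> ('v, 'k) form \<Rightarrow> bool" where
  "has_degree d F \<longleftrightarrow> (\<forall>ds xs. homog ds xs \<and> F xs \<noteq> 0 \<longrightarrow> d + sum_list ds = 0)"

definition cyc :: "nat \<Rightarrow> ('v, 'k) form set" where
  "cyc k = {F. cyclic F \<and> (\<forall>xs. length xs \<noteq> k \<longrightarrow> F xs = 0)}"

definition cyc_all :: "('v, 'k) form set" where
  "cyc_all = {F. cyclic F \<and> (\<exists>n. \<forall>xs. length xs > n \<longrightarrow> F xs = 0)}"

text \<open>The cyclic permutations of no variables at all consist of the identity only.\<close>

definition Cycl :: "('v, 'k) form \<Rightarrow> ('v, 'k) form" where
  "Cycl F = mext (\<lambda>ds xs. \<Sum>j<max 1 (length xs).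
      sg (sum_list (take j ds) * sum_list (drop j ds)) * F (rotate j xs))"

definition Sym :: "('v, 'k) form \<Rightarrow> ('v, 'k) form" where
  "Sym F = mext (\<lambda>ds xs. \<Sum>\<sigma> | \<sigma> permutes {..<length xs}. ksign ds \<sigma> * F (permute_list \<sigma> xs))"

text \<open>
  \<open>\<beta>\<^sub>1 \<otimes> \<dots> \<otimes> \<beta>\<^sub>k\<close> for linear forms.  In the sign, \<open>\<beta>\<^sub>j\<close> passes \<open>x\<^sub>i\<close> for \<open>i < j\<close>,
  and \<open>\<beta>\<^sub>j(x\<^sub>j)\<close> vanishes unless \<open>\<beta>\<^sub>j\<close> and \<open>x\<^sub>j\<close> have opposite degrees.
\<close>

definition tensor_lin :: "('v, 'k) form list \<Rightarrow> ('v, 'k) form" where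
  "tensor_lin \<beta>s = mext (\<lambda>ds xs. if length xs = length \<beta>s
      then sg (\<Sum>(i, j) \<in> {(i, j). i < j \<and> j < length xs}. ds ! i * ds ! j) *
           (\<Prod>i<length xs. (\<beta>s ! i) [xs ! i])
      else 0)"


subsection \<open>Pinczon brackets\<close>

definition center :: "(('v, 'k) form \<Rightarrow> ('v, 'k) form \<Rightarrow> ('v, 'k) form) \<Rightarrow> ('v, 'k) form set" where
  "center br = {F \<in> cyc_all. \<forall>G\<in>cyc_all. br F G = 0}"

definition bilinear_bracket :: "(('v, 'k) form \<Rightarrow> ('v, 'k) form \<Rightarrow> ('v, 'k) form) \<Rightarrow> bool" where
  "bilinear_bracket br \<longleftrightarrow>
     (\<forall>F\<in>cyc_all. flinear_on cyc_all (br F)) \<and>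
     (\<forall>G\<in>cyc_all. flinear_on cyc_all (\<lambda>F. br F G))"

definition graded_lie :: "(('v, 'k) form \<Rightarrow> ('v, 'k) form \<Rightarrow> ('v, 'k) form) \<Rightarrow> bool" where
  "graded_lie br \<longleftrightarrow>
     (\<forall>d d' F G. F \<in> cyc_all \<and> G \<in> cyc_all \<and> has_degree d F \<and> has_degree d' G \<longrightarrow>
        has_degree ((d - 2) + (d' - 2) + 2) (br F G) \<and>
        br F G = fscale (- sg ((d - 2) * (d' - 2))) (br G F) \<and>
        (\<forall>H\<in>cyc_all. br F (br G H) =
           br (br F G) H + fscale (sg ((d - 2) * (d' - 2))) (br G (br F H))))"

text \<open>
  The centre is compared with the constants \<open>cyc 0\<close> after restriction to symmetric tensors
  (a form restricts to zero there iff its \<open>Sym\<close> vanishes).  The literal equality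
  \<open>center br = cyc 0\<close> fails for the bracket of every non-degenerate form on a space
  \<open>V \<noteq> 0\<close>: if \<open>dim V = 1\<close> the cube of a non-zero linear form is central, and
  if \<open>dim V \<ge> 2\<close> the cyclic class of \<open>\<omega> \<otimes> \<omega>\<close> is central, where \<open>\<omega>\<close> is the bilinear
  form of degree 2 inverse to the bracket of linear forms.  The condition used here still forces
  the bracket to be non-degenerate on linear forms.

  The first conjunct only fixes the values of \<open>br\<close> outside of its domain.
\<close>

definition pinczon_bracket :: "(('v, 'k) form \<Rightarrow> ('v, 'k) form \<Rightarrow> ('v, 'k) form) \<Rightarrow> bool" where
  "pinczon_bracket br \<longleftrightarrow>
     (\<forall>F G. F \<notin> cyc_all \<or> G \<notin> cyc_all \<longrightarrow> br F G = 0) \<and>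
     bilinear_bracket br \<and>
     (\<forall>k k'. \<forall>F\<in>cyc (k + 1). \<forall>G\<in>cyc (k' + 1). br F G \<in> cyc (k + k')) \<and>
     graded_lie br \<and>
     cyc 0 \<subseteq> center br \<and> Sym ` center br \<subseteq> cyc 0 \<and>
     (\<forall>\<alpha>\<in>cyc 1. \<forall>\<beta>s \<delta>s. \<beta>s \<noteq> [] \<and> list_all2 (\<lambda>\<delta> \<beta>. \<beta> \<in> cyc 1 \<and> has_degree \<delta> \<beta>) \<delta>s \<beta>s \<longrightarrow>
        br \<alpha> (Cycl (tensor_lin \<beta>s)) =
        (\<Sum>j<length \<beta>s. fscale (sg (\<delta>s ! j * sum_list (take j \<delta>s)) * br \<alpha> (\<beta>s ! j) [])
                          (Cycl (tensor_lin (take j \<beta>s @ drop (Suc j) \<beta>s)))))"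

text \<open>
  The bracket of formal sums.  The constants being central, its component of arity \<open>n\<close> is
  the sum of the \<open>{F\<^bsub>k+1\<^esub>, G\<^bsub>k'+1\<^esub>}\<close> with \<open>k + k' = n\<close>.
\<close>

definition formal_bracket ::
  "(('v, 'k) form \<Rightarrow> ('v, 'k) form \<Rightarrow> ('v, 'k) form) \<Rightarrow> ('v, 'k) form \<Rightarrow> ('v, 'k) form \<Rightarrow> ('v, 'k) form"
where
  "formal_bracket br F G = (\<lambda>xs. \<Sum>k\<le>length xs.
      br (comp_arity (k + 1) F) (comp_arity (length xs - k + 1) G) xs)"

definition pinczon_lie ::
  "(('v, 'k) form \<Rightarrow> ('v, 'k) form \<Rightarrow> ('v, 'k) form) \<Rightarrow> ('v, 'k) form \<Rightarrow> bool" where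
  "pinczon_lie br \<Omega> \<longleftrightarrow>
     pinczon_bracket br \<and> symmetric \<Omega> \<and> has_degree 3 \<Omega> \<and>
     (\<forall>xs. length xs < 2 \<longrightarrow> \<Omega> xs = 0) \<and> Sym (formal_bracket br \<Omega> \<Omega>) = 0"


subsection \<open>Bilinear forms and brackets\<close>

definition nondeg_form :: "('v \<Rightarrow> 'v \<Rightarrow> 'k) \<Rightarrow> bool" where
  "nondeg_form b \<longleftrightarrow>
     (\<forall>x. Vector_Spaces.linear scale (*) (b x)) \<and>
     (\<forall>y. Vector_Spaces.linear scale (*) (\<lambda>x. b x y)) \<and>
     (\<forall>m n. \<forall>x\<in>gr m. \<forall>y\<in>gr n. b x y = sg (m * n) * b y x \<and> (m + n \<noteq> 0 \<longrightarrow> b x y = 0)) \<and>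
     (\<forall>x. (\<forall>y. b x y = 0) \<longrightarrow> x = 0)"

definition shifted_form :: "('v \<Rightarrow> 'v \<Rightarrow> 'k) \<Rightarrow> 'v \<Rightarrow> 'v \<Rightarrow> 'k" where
  "shifted_form b x y = (\<Sum>d\<in>degs. sg d * b (hcomp (d + 1) x) y)"

definition dual_bases :: "('v \<Rightarrow> 'v \<Rightarrow> 'k) \<Rightarrow> int list \<Rightarrow> 'v list \<Rightarrow> 'v list \<Rightarrow> bool" where
  "dual_bases b \<epsilon>s es es' \<longleftrightarrow>
     homog \<epsilon>s es \<and> distinct es \<and> independent (set es) \<and> span (set es) = UNIV \<and>
     length es' = length es \<and>
     (\<forall>i<length es. \<forall>j<length es. b (es ! i) (es' ! j) = (if i = j then 1 else 0))"

text \<open>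
  \<open>\<Sum>\<^sub>i \<iota>\<^bsub>e\<^sub>i\<^esub>F \<odot> \<iota>\<^bsub>e'\<^sub>i\<^esub>G\<close> for \<open>F\<close> of arity \<open>k + 1\<close>.  The Koszul sign
  is that of \<open>F G e e' x y \<mapsto> F e x G e' y\<close>, with \<open>x\<close> the first \<open>k\<close> variables: \<open>e'\<close> has the
  parity of \<open>e\<close>, and a non-zero term requires \<open>F\<close> and \<open>G\<close> to have the parities of \<open>e x\<close>
  and of \<open>e' y\<close>.
\<close>

definition contraction ::
  "nat \<Rightarrow> int list \<Rightarrow> 'v list \<Rightarrow> 'v list \<Rightarrow> ('v, 'k) form \<Rightarrow> ('v, 'k) form \<Rightarrow> ('v, 'k) form" where
  "contraction k \<epsilon>s es es' F G = Cycl (mext (\<lambda>ds xs. \<Sum>i<length es.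
      (let e = \<epsilon>s ! i; p = sum_list (take k ds); q = sum_list (drop k ds) in
       sg ((e + q) * (e + p) + e * p) * F (es ! i # take k xs) * G (es' ! i # drop k xs))))"

definition contracts ::
  "(('v, 'k) form \<Rightarrow> ('v, 'k) form \<Rightarrow> ('v, 'k) form) \<Rightarrow> ('v \<Rightarrow> 'v \<Rightarrow> 'k) \<Rightarrow> nat \<Rightarrow> nat \<Rightarrow> bool" where
  "contracts br b k k' \<longleftrightarrow>
     (\<forall>F\<in>cyc (k + 1). \<forall>G\<in>cyc (k' + 1). \<forall>\<epsilon>s es es'.
        dual_bases b \<epsilon>s es es' \<longrightarrow> br F G = contraction k \<epsilon>s es es' F G)"

text \<open>
  The form coming from a bracket is read off from the brackets of linear forms, which
  determine it; the bracket associated to a form is given by the contraction formula in all arities.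
\<close>

definition form_of_bracket ::
  "(('v, 'k) form \<Rightarrow> ('v, 'k) form \<Rightarrow> ('v, 'k) form) \<Rightarrow> ('v \<Rightarrow> 'v \<Rightarrow> 'k) \<Rightarrow> bool" where
  "form_of_bracket br b \<longleftrightarrow> nondeg_form b \<and> contracts br b 0 0"

definition bracket_of_form ::
  "('v \<Rightarrow> 'v \<Rightarrow> 'k) \<Rightarrow> (('v, 'k) form \<Rightarrow> ('v, 'k) form \<Rightarrow> ('v, 'k) form) \<Rightarrow> bool" where
  "bracket_of_form b br \<longleftrightarrow> (\<forall>k k'. contracts br b k k')"


subsection \<open>Symmetric tensors and \<open>L\<^sub>\<infinity>\<close> structures\<close>

text \<open>
  A tensor is the functional "evaluation" on multilinear forms: \<open>x\<^sub>1 \<otimes> \<dots> \<otimes> x\<^sub>k\<close> is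
  \<open>F \<mapsto> F(x\<^sub>1, \<dots>, x\<^sub>k)\<close>.  This realises the tensor algebra faithfully, since multilinear forms
  separate tensors.  Elements of the tensor product of two such spaces are functionals on
  functions that are multilinear in two lists of arguments.
\<close>

definition pure :: "'v list \<Rightarrow> ('v, 'k) tensor" where
  "pure xs = (\<lambda>F. if mform F then F xs else 0)"

definition tprod :: "('v, 'k) tensor \<Rightarrow> ('v, 'k) tensor \<Rightarrow> ('v, 'k) tensor2" where
  "tprod t u = (\<lambda>G. if (\<forall>xs. mform (G xs)) \<and> (\<forall>ys. mform (\<lambda>xs. G xs ys))
                     then t (\<lambda>xs. u (G xs)) else 0)"

text \<open>\<open>sprod ds xs\<close> is \<open>x\<^sub>1 \<cdot> \<dots> \<cdot> x\<^sub>k\<close> for homogeneous \<open>xs\<close> of degrees \<open>ds\<close>.\<close>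

definition sprod :: "int list \<Rightarrow> 'v list \<Rightarrow> ('v, 'k) tensor" where
  "sprod ds xs = (\<Sum>\<sigma> | \<sigma> permutes {..<length xs}. fscale (ksign ds \<sigma>) (pure (permute_list \<sigma> xs)))"

definition Splus :: "('v, 'k) tensor set" where
  "Splus = fspan {sprod ds xs | ds xs. homog ds xs \<and> xs \<noteq> []}"

definition Splus_deg :: "int \<Rightarrow> ('v, 'k) tensor set" where
  "Splus_deg d = fspan {sprod ds xs | ds xs. homog ds xs \<and> xs \<noteq> [] \<and> sum_list ds = d}"

definition coproduct :: "(('v, 'k) tensor \<Rightarrow> ('v, 'k) tensor2) \<Rightarrow> bool" where
  "coproduct \<Delta> \<longleftrightarrow> flinear_on Splus \<Delta> \<and>
     (\<forall>ds xs. homog ds xs \<and> xs \<noteq> [] \<longrightarrow>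
        \<Delta> (sprod ds xs) = (\<Sum>I | I \<noteq> {} \<and> I \<subset> {..<length xs}.
           fscale (usign ds I) (tprod (sprod (nths ds I) (nths xs I)) (sprod (nths ds (- I)) (nths xs (- I))))))"

text \<open>
  A coderivation \<open>D\<close> of degree 1: \<open>\<Delta> \<circ> D = (D \<otimes> id + id \<otimes> D) \<circ> \<Delta>\<close>, evaluated on the
  spanning symmetric products, with \<open>(id \<otimes> D)(t \<otimes> u) = (-1)\<^bsup>deg t\<^esup> t \<otimes> D u\<close>.
\<close>

definition coderivation1 ::
  "(('v, 'k) tensor \<Rightarrow> ('v, 'k) tensor2) \<Rightarrow> (('v, 'k) tensor \<Rightarrow> ('v, 'k) tensor) \<Rightarrow> bool" where
  "coderivation1 \<Delta> D \<longleftrightarrow> flinear_on Splus D \<and>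
     (\<forall>d. \<forall>t\<in>Splus_deg d. D t \<in> Splus_deg (d + 1)) \<and>
     (\<forall>ds xs. homog ds xs \<and> xs \<noteq> [] \<longrightarrow>
        \<Delta> (D (sprod ds xs)) = (\<Sum>I | I \<noteq> {} \<and> I \<subset> {..<length xs}.
           (let dI = nths ds I; t = sprod dI (nths xs I); u = sprod (nths ds (- I)) (nths xs (- I)) in
            fscale (usign ds I) (tprod (D t) u + fscale (sg (sum_list dI)) (tprod t (D u))))))"

text \<open>
  A formal sum \<open>Q = \<Sum>\<^sub>k Q\<^sub>k\<close>, \<open>k \<ge> 1\<close>, of symmetric \<open>k\<close>-linear maps on \<open>V[1]\<close> with values
  in \<open>V[1]\<close>: \<open>Q\<^sub>k\<close> is the restriction of \<open>q\<close> to lists of length \<open>k\<close>.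
\<close>

definition symmetric_maps :: "('v list \<Rightarrow> 'v) \<Rightarrow> bool" where
  "symmetric_maps q \<longleftrightarrow> q [] = 0 \<and>
     (\<forall>xs i. i < length xs \<longrightarrow> Vector_Spaces.linear scale scale (\<lambda>v. q (xs[i := v]))) \<and>
     (\<forall>ds xs \<sigma>. homog ds xs \<and> \<sigma> permutes {..<length xs} \<longrightarrow>
        q (permute_list \<sigma> xs) = ksign ds \<sigma> *s q xs)"

text \<open>
  The Taylor coefficients of \<open>D\<close>, i.e. its component with values in \<open>S\<^sup>1(V[1]) = V[1]\<close>, are the
  restrictions of the \<open>Q\<^sub>k\<close> to symmetric tensors: \<open>Q\<^sub>k(x\<^sub>1 \<cdot> \<dots> \<cdot> x\<^sub>k)\<close> is the sum of the
  \<open>\<plusminus> Q\<^sub>k(x\<^bsub>\<sigma>(1)\<^esub>, \<dots>, x\<^bsub>\<sigma>(k)\<^esub>)\<close> (without a factor \<open>1/k!\<close>).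
\<close>

definition taylor_coeffs :: "(('v, 'k) tensor \<Rightarrow> ('v, 'k) tensor) \<Rightarrow> ('v list \<Rightarrow> 'v) \<Rightarrow> bool" where
  "taylor_coeffs D q \<longleftrightarrow>
     (\<forall>ds xs. homog ds xs \<and> xs \<noteq> [] \<longrightarrow>
        (\<lambda>F. if mform F then D (sprod ds xs) (comp_arity 1 F) else 0) =
        pure [\<Sum>\<sigma> | \<sigma> permutes {..<length xs}. ksign ds \<sigma> *s q (permute_list \<sigma> xs)])"

text \<open>\<open>D\<close> being odd, \<open>[D, D] = D \<circ> D + D \<circ> D\<close>.\<close>

definition L_infinity :: "('v list \<Rightarrow> 'v) \<Rightarrow> bool" where
  "L_infinity q \<longleftrightarrow>
     (\<exists>\<Delta> D. coproduct \<Delta> \<and> coderivation1 \<Delta> D \<and> (\<forall>t\<in>Splus. D (D t) + D (D t) = 0) \<and>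
        taylor_coeffs D q)"

definition form_of_maps :: "('v \<Rightarrow> 'v \<Rightarrow> 'k) \<Rightarrow> ('v list \<Rightarrow> 'v) \<Rightarrow> ('v, 'k) form" where
  "form_of_maps b q xs = (if length xs < 2 then 0 else shifted_form b (q (butlast xs)) (last xs))"

definition B_quadratic :: "('v \<Rightarrow> 'v \<Rightarrow> 'k) \<Rightarrow> ('v list \<Rightarrow> 'v) \<Rightarrow> bool" where
  "B_quadratic b q \<longleftrightarrow> (\<forall>k\<ge>1. comp_arity (k + 1) (form_of_maps b q) \<in> cyc (k + 1))"

end

end

theory Submission
  imports Defs
begin

text \<open>
  On words of homogeneous vectors, brackets, symmetrisations and coderivations are signed sums over
  the ways to cut a word into pieces.  The bracket of linear forms determines \<open>b\<close>, and through the Jacobi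
  identity it determines the symmetrised bracket of any two forms, which is therefore the
  symmetrisation of a contraction in dual bases.  Contracting \<open>\<Omega>\<^sub>Q\<close> with itself yields a multiple of
  \<open>B((Q \<circ> Q)(x\<^sub>1, \<dots>, x\<^sub>n), y)\<close>, so \<open>{\<Omega>, \<Omega>}| = 0\<close> holds iff the Taylor coefficients of
  \<open>Q \<circ> Q\<close> vanish.  As \<open>Q \<circ> Q\<close> is a coderivation, its vanishing follows by induction on the arity: the
  coproduct kills only tensors of arity one.
\<close>

text \<open>Letters carry their degrees, so every Koszul sign is a function of words, and a sum over
  permutations becomes a recursion inserting one letter at a time; subsets of positions appear only
  where the coproduct has to be matched. Many sign identities fail as identities in the degrees and
  hold only for nonzero summands, where the degrees of the forms fix parities. Hence parity, not
  degree, is carried through the Jacobi identity.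

  Central forms beyond the constants are allowed, so the Jacobi argument recovers a bracket from
  linear forms only after symmetrisation: bracketing with \<open>b_form a\<close> puts
  \<open>a\<close> into the first slot and rotates the rest, and symmetrising gives the value at a
  word beginning with \<open>a\<close> up to an invertible factor. Characteristic 0 enters here, in
  the factor 2 between the self-bracket and the square of \<open>q\<close>, and in the factorials of
  the unnormalised Taylor coefficients.

  Tensors are functionals on forms, so the coproduct and the coderivation are transposes of
  operators on forms; that the coderivation preserves the span of symmetric products then needs a
  proof.\<close>

lemma sg_0 [simp]: "sg 0 = 1" by (simp add: sg_def)

lemma sg_add: "sg (a + b) = (sg a * sg b :: 'k::comm_ring_1)"
  by (auto simp: sg_def)

lemma sg_sq [simp]: "sg a * sg a = (1 :: 'k::comm_ring_1)" "sg a * (sg a * x) = (x :: 'k::comm_ring_1)"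
  "sg a * (x * sg a) = (x :: 'k::comm_ring_1)"
  by (auto simp: sg_def)

lemma sg_eqI: "even (a + b) \<Longrightarrow> sg a = sg b"
  by (auto simp: sg_def)

definition wdeg :: "(int \<times> 'a) list \<Rightarrow> int" where
  "wdeg w = sum_list (map fst w)"

lemma wdeg_simps [simp]:
  "wdeg [] = 0" "wdeg (a # w) = fst a + wdeg w" "wdeg (u @ v) = wdeg u + wdeg v"
  by (simp_all add: wdeg_def)

lemma wdeg_mset: "mset z = mset w \<Longrightarrow> wdeg z = wdeg w"
  unfolding wdeg_def by (metis mset_map sum_mset_sum_list)


subsection \<open>Deconcatenation\<close>

text \<open>Recursion on the word, instead of a sum over cut positions, turns coassociativity and
  the insertion rules into plain list inductions; \<open>dec_conv\<close> is the closed form. Both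
  pieces may be empty.\<close>

primrec dec :: "('a list \<Rightarrow> 'a list \<Rightarrow> 'k::comm_ring_1) \<Rightarrow> 'a list \<Rightarrow> 'k" where
  "dec \<psi> [] = \<psi> [] []"
| "dec \<psi> (a # w) = \<psi> [] (a # w) + dec (\<lambda>u. \<psi> (a # u)) w"

lemma dec_conv: "dec \<psi> w = (\<Sum>r\<le>length w. \<psi> (take r w) (drop r w))"
proof (induction w arbitrary: \<psi>)
  case (Cons a w)
  show ?case
    by (simp add: Cons sum.atMost_Suc_shift del: sum.atMost_Suc)
qed simp

lemma dec_cong:
  assumes "\<And>u v. w = u @ v \<Longrightarrow> \<psi> u v = \<phi> u v"
  shows "dec \<psi> w = dec \<phi> w"
  unfolding dec_conv by (rule sum.cong) (auto intro: assms)

lemma dec_add: "dec (\<lambda>u v. \<psi> u v + \<phi> u v) w = dec \<psi> w + dec \<phi> w"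
  by (simp add: dec_conv sum.distrib)

lemma dec_diff: "dec (\<lambda>u v. \<psi> u v - \<phi> u v) w = dec \<psi> w - dec \<phi> w"
  by (simp add: dec_conv sum_subtractf)

lemma dec_mult: "dec (\<lambda>u v. c * \<psi> u v) w = c * dec \<psi> w"
  by (simp add: dec_conv sum_distrib_left)

lemma dec_0 [simp]: "dec (\<lambda>u v. 0) w = 0"
  by (simp add: dec_conv)

lemma dec_sum: "dec (\<lambda>u v. \<Sum>i\<in>A. \<psi> i u v) w = (\<Sum>i\<in>A. dec (\<psi> i) w)"
  by (simp add: dec_conv sum.swap[of _ A])

lemma dec_dec_swap: "dec (\<lambda>u v. dec (\<lambda>x y. \<psi> u v x y) z) w = dec (\<lambda>x y. dec (\<lambda>u v. \<psi> u v x y) w) z"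
  unfolding dec_conv by (rule sum.swap)

text \<open>The cut falls either before the letter \<open>a\<close>, hence in \<open>y\<close>, or
  after it, hence in \<open>x\<close>.\<close>

lemma dec_append: "dec \<psi> (y @ a # x) =
    dec (\<lambda>y1 y2. \<psi> y1 (y2 @ a # x)) y + dec (\<lambda>x1 x2. \<psi> (y @ a # x1) x2) x"
  by (induction y arbitrary: \<psi>) (simp_all add: add.assoc)

text \<open>Coassociativity of deconcatenation: a word cut into three pieces does not remember which
  cut was made first.\<close>

lemma dec_assoc: "dec (\<lambda>x y. dec (\<lambda>x1 x2. \<Phi> x1 x2 y) x) w = dec (\<lambda>x1 z. dec (\<Phi> x1) z) w"
  by (induction w arbitrary: \<Phi>) (simp_all add: dec_add algebra_simps)

lemma dec_Nil_left: "dec (\<lambda>u v. if u = [] then f v else 0) w = f w"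
  by (cases w) simp_all

lemma dec_single:
  assumes "r \<le> length w"
  shows "dec (\<lambda>u v. if length u = r then f u v else 0) w = f (take r w) (drop r w)"
proof -
  have "dec (\<lambda>u v. if length u = r then f u v else 0) w =
      (\<Sum>s\<le>length w. if s = r then f (take r w) (drop r w) else 0)"
    unfolding dec_conv by (rule sum.cong) auto
  then show ?thesis using assms by simp
qed


subsection \<open>Rotations\<close>

text \<open>The signed action of the cyclic shift on functions of words. The multilinear forms fixed
  by it on homogeneous words are the cyclic ones (\<open>cyclic_iff\<close>).\<close>

definition rot1 :: "((int \<times> 'a) list \<Rightarrow> 'k::comm_ring_1) \<Rightarrow> (int \<times> 'a) list \<Rightarrow> 'k" where
  "rot1 \<phi> w = (case w of [] \<Rightarrow> \<phi> [] | a # z \<Rightarrow> sg (fst a * wdeg z) * \<phi> (z @ [a]))"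

definition rot :: "((int \<times> 'a) list \<Rightarrow> 'k::comm_ring_1) \<Rightarrow> (int \<times> 'a) list \<Rightarrow> 'k" where
  "rot \<phi> w = (\<Sum>j<max 1 (length w). (rot1 ^^ j) \<phi> w)"

text \<open>The bound includes \<open>j = length w\<close>: a full turn returns the word with
  trivial sign, which is what closes the sums over rotations.\<close>

lemma rot1_pow:
  "j \<le> length w \<Longrightarrow> (rot1 ^^ j) \<phi> w = sg (wdeg (take j w) * wdeg (drop j w)) * \<phi> (drop j w @ take j w)"
proof (induction j arbitrary: \<phi>)
  case (Suc j)
  then have *: "drop j w = w ! j # drop (Suc j) w" "take (Suc j) w = take j w @ [w ! j]"
    by (simp_all add: Cons_nth_drop_Suc take_Suc_conv_app_nth)
  have "(rot1 ^^ Suc j) \<phi> w = (rot1 ^^ j) (rot1 \<phi>) w"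
    by (simp add: funpow_swap1)
  also have "\<dots> = sg (wdeg (take j w) * wdeg (drop j w)) * rot1 \<phi> (drop j w @ take j w)"
    using Suc by simp
  also have "\<dots> = sg (wdeg (take (Suc j) w) * wdeg (drop (Suc j) w)) * \<phi> (drop (Suc j) w @ take (Suc j) w)"
    unfolding * rot1_def by (auto simp: sg_def)
  finally show ?case .
qed simp

lemma rot_conv: "rot \<phi> w = (\<Sum>j<max 1 (length w). sg (wdeg (take j w) * wdeg (drop j w)) * \<phi> (rotate j w))"
  unfolding rot_def
proof (rule sum.cong[OF refl])
  fix j assume j: "j \<in> {..<max 1 (length w)}"
  show "(rot1 ^^ j) \<phi> w = sg (wdeg (take j w) * wdeg (drop j w)) * \<phi> (rotate j w)"
  proof (cases "w = []")
    case False
    then have "j < length w" using j by (auto simp: max_def split: if_splits)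
    then show ?thesis by (simp add: rot1_pow rotate_drop_take)
  qed (use j in simp)
qed

lemma rot_cong:
  assumes "\<And>x y. w = x @ y \<Longrightarrow> \<phi> (y @ x) = \<phi>' (y @ x)"
  shows "rot \<phi> w = rot \<phi>' w"
  unfolding rot_conv
proof (rule sum.cong[OF refl])
  fix j :: nat
  have "rotate j w = drop (j mod length w) w @ take (j mod length w) w"
    by (rule rotate_drop_take)
  then show "sg (wdeg (take j w) * wdeg (drop j w)) * \<phi> (rotate j w) =
      sg (wdeg (take j w) * wdeg (drop j w)) * \<phi>' (rotate j w)"
    using assms[of "take (j mod length w) w" "drop (j mod length w) w"] by simp
qed

lemma rot_add: "rot (\<lambda>z. f z + g z) w = rot f w + rot g w"
  by (simp add: rot_conv sum.distrib algebra_simps)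

lemma rot_mult: "rot (\<lambda>z. c * f z) w = c * rot f w"
  by (simp add: rot_conv sum_distrib_left algebra_simps)

lemma rot_sum: "rot (\<lambda>z. \<Sum>i\<in>A. f i z) w = (\<Sum>i\<in>A. rot (f i) w)"
  by (simp add: rot_conv sum_distrib_left sum.swap[of _ A])

lemma rot_rot1: "rot (rot1 \<phi>) w = rot \<phi> w"
proof (cases "w = []")
  case False
  then have n: "max 1 (length w) = length w" by (cases w) auto
  have "rot (rot1 \<phi>) w = (\<Sum>j<length w. (rot1 ^^ Suc j) \<phi> w)"
    unfolding rot_def n by (simp add: funpow_swap1)
  also have "\<dots> = (\<Sum>j<Suc (length w). (rot1 ^^ j) \<phi> w) - \<phi> w"
    by (simp add: sum.lessThan_Suc_shift del: sum.lessThan_Suc)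
  \<comment> \<open>The extra term of the full turn equals the subtracted term of no turn.\<close>
  also have "\<dots> = (\<Sum>j<length w. (rot1 ^^ j) \<phi> w)"
    by (simp add: rot1_pow)
  finally show ?thesis unfolding rot_def n .
qed (simp add: rot_def rot1_def)

lemma rot1_rot: "rot1 (rot \<phi>) w = rot \<phi> w"
proof -
  have "rot1 (rot \<phi>) w = (\<Sum>j<max 1 (length w). rot1 ((rot1 ^^ j) \<phi>) w)"
    by (cases w) (simp_all add: rot1_def rot_def sum_distrib_left del: sum.lessThan_Suc)
  also have "\<dots> = rot (rot1 \<phi>) w"
    by (simp add: rot_def funpow_swap1)
  finally show ?thesis by (simp add: rot_rot1)
qed

lemma rot_rot1_pow: "rot ((rot1 ^^ m) \<phi>) w = rot \<phi> w"
  by (induction m) (simp_all add: rot_rot1)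

text \<open>Exchanging the pieces of a cut after \<open>r\<close> letters is the
  \<open>r\<close>-fold shift of the function that cuts after \<open>n - r\<close> letters, and
  \<open>rot\<close> does not see shifts.\<close>

lemma rot_dec_swap:
  "rot (dec \<psi>) w = rot (dec (\<lambda>u v. sg (wdeg u * wdeg v) * \<psi> v u)) w"
proof -
  define n where "n = length w"
  define P where "P r z = \<psi> (take r z) (drop r z)" for r z
  have "rot (dec (\<lambda>u v. sg (wdeg u * wdeg v) * \<psi> v u)) w = rot (\<lambda>z. \<Sum>r\<le>n. (rot1 ^^ r) (P (n - r)) z) w"
    unfolding dec_conv
    by (rule rot_cong) (auto simp: n_def P_def rot1_pow add.commute intro!: sum.cong)
  also have "\<dots> = (\<Sum>r\<le>n. rot (P (n - r)) w)"
    by (simp add: rot_sum rot_rot1_pow)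
  also have "\<dots> = (\<Sum>r\<le>n. rot (P r) w)"
    by (rule sum.reindex_bij_witness[of _ "\<lambda>r. n - r" "\<lambda>r. n - r"]) auto
  also have "\<dots> = rot (dec \<psi>) w"
    unfolding rot_sum[symmetric] dec_conv by (rule rot_cong) (simp add: n_def P_def add.commute)
  finally show ?thesis by simp
qed

text \<open>Rotations are indexed by what follows \<open>a\<close>: the rest is x @ y and the
  rotated word is y a x. The unrotated word is counted as the full turn, with \<open>y\<close>
  empty.\<close>

lemma rot_Cons:
  "rot \<phi> (a # v) = dec (\<lambda>x y. sg (wdeg y * (fst a + wdeg x)) * \<phi> (y @ a # x)) v"
proof -
  let ?f = "\<lambda>j. (rot1 ^^ j) \<phi> (a # v)"
  have "rot \<phi> (a # v) = (\<Sum>j<Suc (length v). ?f j)"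
    by (simp add: rot_def max_def)
  also have "\<dots> = (\<Sum>j<Suc (length v). ?f (Suc j))"
    using rot1_pow[of "Suc (length v)" "a # v" \<phi>]
    by (subst sum.lessThan_Suc_shift) (simp add: add.commute)
  also have "\<dots> = (\<Sum>j\<le>length v. sg (wdeg (drop j v) * (fst a + wdeg (take j v))) * \<phi> (drop j v @ a # take j v))"
    unfolding lessThan_Suc_atMost
    by (rule sum.cong[OF refl], subst rot1_pow) (simp_all add: algebra_simps)
  finally show ?thesis by (simp add: dec_conv)
qed

text \<open>In cyclic order the word reads a, u2, u3, u4. A rotation followed by a cut leaves one
  piece u4 a u2 containing \<open>a\<close> and one piece u3; the two summands say which of them
  comes first. This is the inner bracket of a double bracket, with \<open>a\<close> the basis vector
  fed in by the outer one.\<close>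

lemma rot_dec_Cons:
  "rot (dec \<psi>) (a # v) = dec (\<lambda>u2 z. dec (\<lambda>u3 u4.
      sg (wdeg u4 * (fst a + wdeg u2 + wdeg u3)) * \<psi> (u4 @ a # u2) u3 +
      sg ((wdeg u3 + wdeg u4) * (fst a + wdeg u2)) * \<psi> u3 (u4 @ a # u2)) z) v"
proof -
  have "rot (dec \<psi>) (a # v) =
      dec (\<lambda>u2 z. dec (\<lambda>u3 u4. sg (wdeg z * (fst a + wdeg u2)) * \<psi> u3 (u4 @ a # u2)) z) v +
      dec (\<lambda>x u4. dec (\<lambda>u2 u3. sg (wdeg u4 * (fst a + wdeg x)) * \<psi> (u4 @ a # u2) u3) x) v"
    unfolding rot_Cons dec_append distrib_left dec_add dec_mult ..
  also have "dec (\<lambda>u2 z. dec (\<lambda>u3 u4. sg (wdeg z * (fst a + wdeg u2)) * \<psi> u3 (u4 @ a # u2)) z) v =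
      dec (\<lambda>u2 z. dec (\<lambda>u3 u4. sg ((wdeg u3 + wdeg u4) * (fst a + wdeg u2)) * \<psi> u3 (u4 @ a # u2)) z) v"
    by (intro dec_cong) simp
  also have "dec (\<lambda>x u4. dec (\<lambda>u2 u3. sg (wdeg u4 * (fst a + wdeg x)) * \<psi> (u4 @ a # u2) u3) x) v =
      dec (\<lambda>x u4. dec (\<lambda>u2 u3. sg (wdeg u4 * (fst a + wdeg u2 + wdeg u3)) * \<psi> (u4 @ a # u2) u3) x) v"
    by (intro dec_cong) (simp add: add.assoc)
  also have "\<dots> = dec (\<lambda>u2 z. dec (\<lambda>u3 u4. sg (wdeg u4 * (fst a + wdeg u2 + wdeg u3)) * \<psi> (u4 @ a # u2) u3) z) v"
    by (rule dec_assoc)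
  finally show ?thesis by (simp only: dec_add add.commute)
qed


subsection \<open>Signed sums over permutations\<close>

definition ins :: "int \<times> 'a \<Rightarrow> ((int \<times> 'a) list \<Rightarrow> 'k::comm_ring_1) \<Rightarrow> (int \<times> 'a) list \<Rightarrow> 'k" where
  "ins a f w = dec (\<lambda>u v. sg (fst a * wdeg u) * f (u @ a # v)) w"

text \<open>The signed sum over all permutations in recursive form: the first letter is inserted at
  every position of the permuted rest. \<open>sum_permutes\<close> identifies it with the sum
  weighted by \<open>ksign\<close>.\<close>

primrec symsum :: "(int \<times> 'a) list \<Rightarrow> ((int \<times> 'a) list \<Rightarrow> 'k::comm_ring_1) \<Rightarrow> 'k" where
  "symsum [] f = f []"
| "symsum (a # w) f = symsum w (ins a f)"

lemma ins_cong:
  assumes "\<And>u v. w = u @ v \<Longrightarrow> f (u @ a # v) = g (u @ a # v)"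
  shows "ins a f w = ins a g w"
  unfolding ins_def by (rule dec_cong) (simp add: assms)

lemma symsum_cong:
  assumes "\<And>z. mset z = mset w \<Longrightarrow> f z = g z"
  shows "symsum w f = symsum w g"
  using assms
proof (induction w arbitrary: f g)
  case (Cons a w)
  show ?case unfolding symsum.simps
    by (rule Cons.IH, rule ins_cong) (simp add: Cons.prems)
qed simp

lemma ins_add: "ins a (\<lambda>z. f z + g z) = (\<lambda>w. ins a f w + ins a g w)"
  by (rule ext) (simp add: ins_def dec_add distrib_left)

lemma ins_mult: "ins a (\<lambda>z. c * f z) = (\<lambda>w. c * ins a f w)"
  by (rule ext) (simp add: ins_def dec_mult[symmetric] mult.left_commute)

lemma ins_sum: "ins a (\<lambda>z. \<Sum>i\<in>A. f i z) = (\<lambda>w. \<Sum>i\<in>A. ins a (f i) w)"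
  by (rule ext) (simp add: ins_def dec_sum sum_distrib_left)

lemma symsum_add: "symsum w (\<lambda>z. f z + g z) = symsum w f + symsum w g"
  by (induction w arbitrary: f g) (simp_all add: ins_add)

lemma symsum_mult: "symsum w (\<lambda>z. c * f z) = c * symsum w f"
  by (induction w arbitrary: f) (simp_all add: ins_mult)

lemma symsum_0 [simp]: "symsum w (\<lambda>z. 0) = 0"
  using symsum_mult[of w 0 "\<lambda>_. 0"] by simp

lemma symsum_sum: "symsum w (\<lambda>z. \<Sum>i\<in>A. f i z) = (\<Sum>i\<in>A. symsum w (f i))"
  by (induction w arbitrary: f) (simp_all add: ins_sum)

lemma symsum_dec_swap_args: "symsum w (\<lambda>z. dec (\<lambda>u v. f z u v) y) = dec (\<lambda>u v. symsum w (\<lambda>z. f z u v)) y"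
  unfolding dec_conv by (rule symsum_sum)

text \<open>Insertion is a graded derivation for cuts: the new letter joins the left piece, or joins
  the right one after passing the whole left piece.\<close>

lemma ins_dec:
  "ins a (dec \<psi>) w = dec (\<lambda>u v. ins a (\<lambda>x. \<psi> x v) u + sg (fst a * wdeg u) * ins a (\<psi> u) v) w"
proof -
  have "ins a (dec \<psi>) w =
     dec (\<lambda>u v. dec (\<lambda>y1 y2. sg (fst a * wdeg u) * \<psi> y1 (y2 @ a # v)) u) w +
     dec (\<lambda>u v. dec (\<lambda>x1 x2. sg (fst a * wdeg u) * \<psi> (u @ a # x1) x2) v) w"
    by (simp add: ins_def dec_append distrib_left dec_add dec_mult)
  also have "dec (\<lambda>u v. dec (\<lambda>y1 y2. sg (fst a * wdeg u) * \<psi> y1 (y2 @ a # v)) u) w =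
      dec (\<lambda>u v. dec (\<lambda>y1 y2. sg (fst a * (wdeg y1 + wdeg y2)) * \<psi> y1 (y2 @ a # v)) u) w"
    by (intro dec_cong) simp
  also have "\<dots> = dec (\<lambda>u v. sg (fst a * wdeg u) * ins a (\<psi> u) v) w"
    by (simp add: dec_assoc ins_def dec_mult[symmetric] distrib_left sg_add mult.assoc)
  also have "dec (\<lambda>u v. dec (\<lambda>x1 x2. sg (fst a * wdeg u) * \<psi> (u @ a # x1) x2) v) w =
      dec (\<lambda>u v. ins a (\<lambda>x. \<psi> x v) u) w"
    by (simp add: dec_assoc[symmetric] ins_def)
  finally show ?thesis by (simp add: dec_add add.commute)
qed

lemma ins_dec_fun:
  "ins a (dec \<psi>) = dec (\<lambda>u v. ins a (\<lambda>x. \<psi> x v) u + sg (fst a * wdeg u) * ins a (\<psi> u) v)"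
  by (rule ext) (rule ins_dec)

lemma ins_wdeg: "ins a (\<lambda>z. h (wdeg z) * f z) w = h (fst a + wdeg w) * ins a f w"
  unfolding ins_def dec_mult[symmetric]
  by (rule dec_cong) (simp add: algebra_simps)

lemma symsum_wdeg: "symsum w (\<lambda>z. h (wdeg z) * f z) = h (wdeg w) * symsum w f"
proof -
  have "symsum w (\<lambda>z. h (wdeg z) * f z) = symsum w (\<lambda>z. h (wdeg w) * f z)"
    by (rule symsum_cong) (auto dest: wdeg_mset)
  then show ?thesis by (simp add: symsum_mult)
qed

text \<open>Cocommutativity after symmetrisation. The induction works because the signed exchange of
  the two pieces commutes with the derivation \<open>ins_dec\<close>.\<close>

lemma symsum_dec_swap:
  "symsum w (dec \<psi>) = symsum w (dec (\<lambda>u v. sg (wdeg u * wdeg v) * \<psi> v u))"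
proof (induction w arbitrary: \<psi>)
  case (Cons a w)
  let ?op = "\<lambda>\<psi> u v. sg (wdeg u * wdeg v) * \<psi> v u"
  let ?i = "\<lambda>\<psi> u v. ins a (\<lambda>x. \<psi> x v) u + sg (fst a * wdeg u) * ins a (\<psi> u) v"
  have "symsum (a # w) (dec \<psi>) = symsum w (\<lambda>z. dec (?i \<psi>) z)"
    by (simp add: ins_dec_fun)
  also have "\<dots> = symsum w (dec (?op (?i \<psi>)))"
    by (rule Cons.IH)
  also have "?op (?i \<psi>) = ?i (?op \<psi>)"
  proof (intro ext)
    fix u v
    have 1: "ins a (\<lambda>x. sg (wdeg x * wdeg v) * \<psi> v x) u = sg ((fst a + wdeg u) * wdeg v) * ins a (\<psi> v) u"
      by (rule ins_wdeg)
    have 2: "ins a (\<lambda>x. sg (wdeg u * wdeg x) * \<psi> x u) v = sg (wdeg u * (fst a + wdeg v)) * ins a (\<lambda>x. \<psi> x u) v"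
      by (rule ins_wdeg)
    show "?op (?i \<psi>) u v = ?i (?op \<psi>) u v"
      unfolding 1 2 by (auto simp: sg_def)
  qed
  also have "symsum w (dec (?i (?op \<psi>))) = symsum (a # w) (dec (?op \<psi>))"
    by (simp add: ins_dec_fun)
  finally show ?case .
qed simp

text \<open>A shift is the exchange of a one-letter piece with the rest. The indicator in
  \<open>?\<psi>\<close> selects that single cut, so \<open>symsum_dec_swap\<close> applies.\<close>

lemma symsum_rot1: "symsum w (rot1 \<phi>) = symsum w \<phi>"
proof (cases "w = []")
  case False
  let ?\<psi> = "\<lambda>u v. if length u = 1 then sg (wdeg u * wdeg v) * \<phi> (v @ u) else 0"
  have "symsum w (rot1 \<phi>) = symsum w (dec ?\<psi>)"
  proof (rule symsum_cong)
    fix z assume "mset z = mset w"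
    then obtain a y where z: "z = a # y" using False by (cases z) auto
    show "rot1 \<phi> z = dec ?\<psi> z"
      by (subst dec_single) (auto simp: z rot1_def)
  qed
  also have "\<dots> = symsum w (dec (\<lambda>u v. sg (wdeg u * wdeg v) * ?\<psi> v u))"
    by (rule symsum_dec_swap)
  also have "\<dots> = symsum w \<phi>"
  proof (rule symsum_cong)
    fix z assume "mset z = mset w"
    then have *: "z \<noteq> []" using False by auto
    have "dec (\<lambda>u v. sg (wdeg u * wdeg v) * ?\<psi> v u) z =
        dec (\<lambda>u v. if length u = length z - 1 then \<phi> (u @ v) else 0) z"
    proof (rule dec_cong)
      fix u v assume "z = u @ v"
      then show "sg (wdeg u * wdeg v) * ?\<psi> v u = (if length u = length z - 1 then \<phi> (u @ v) else 0)"
        using * by (cases v; cases u) (auto simp: sg_def)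
    qed
    also have "\<dots> = \<phi> z" by (subst dec_single) auto
    finally show "dec (\<lambda>u v. sg (wdeg u * wdeg v) * ?\<psi> v u) z = \<phi> z" .
  qed
  finally show ?thesis .
qed (simp add: rot1_def)

lemma symsum_rot: "symsum w (rot \<phi>) = of_nat (max 1 (length w)) * symsum w \<phi>"
proof -
  have 1: "symsum w ((rot1 ^^ j) \<phi>) = symsum w \<phi>" for j
    by (induction j) (simp_all add: symsum_rot1)
  have "symsum w (rot \<phi>) = symsum w (\<lambda>z. \<Sum>j<max 1 (length w). (rot1 ^^ j) \<phi> z)"
    by (rule symsum_cong) (auto simp: rot_def dest: mset_eq_length)
  then show ?thesis by (simp add: symsum_sum 1)
qed


subsection \<open>The coproduct of a symmetric product\<close>

lemma wdeg_nths_Cons: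
  "wdeg (nths (a # w) I) = (if 0 \<in> I then fst a else 0) + wdeg (nths w {j. Suc j \<in> I})"
  by (simp add: nths_Cons)

lemma sum_nths: "(\<Sum>i | i < length ds \<and> i \<in> I. ds ! i) = sum_list (nths ds I)" for ds :: "int list"
proof (induction ds arbitrary: I)
  case (Cons d ds)
  have "{i. i < length (d # ds) \<and> i \<in> I} = (if 0 \<in> I then {0} else {}) \<union> Suc ` {i. i < length ds \<and> i \<in> {j. Suc j \<in> I}}"
    by (auto simp: image_iff less_Suc_eq_0_disj)
  then have "(\<Sum>i | i < length (d # ds) \<and> i \<in> I. (d # ds) ! i) =
      (if 0 \<in> I then d else 0) + (\<Sum>i | i < length ds \<and> i \<in> {j. Suc j \<in> I}. ds ! i)"
    by (simp only:, subst sum.union_disjoint) (auto simp: sum.reindex)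
  then show ?case
    unfolding Cons.IH by (simp add: nths_Cons)
qed simp

lemma prod_sg: "finite A \<Longrightarrow> (\<Prod>i\<in>A. sg (f i)) = (sg (\<Sum>i\<in>A. f i) :: 'k::comm_ring_1)"
  by (induction A rule: finite_induct) (simp_all add: sg_add)

lemma usign_Nil [simp]: "usign [] I = 1"
  by (simp add: usign_def)

text \<open>If the first letter stays in the complement, all letters of \<open>I\<close> have to
  move past it; otherwise it is already in place.\<close>

lemma usign_Cons:
  "(usign (d # ds) I :: 'k::comm_ring_1) =
     (if 0 \<in> I then 1 else sg (d * sum_list (nths ds {j. Suc j \<in> I}))) * usign ds {j. Suc j \<in> I}"
proof -
  let ?I = "{j. Suc j \<in> I}"
  let ?S = "{(j, i). j < i \<and> i < length ds \<and> i \<in> ?I \<and> j \<notin> ?I}"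
  let ?T = "{i. i < length ds \<and> i \<in> ?I}"
  let ?A = "if 0 \<in> I then {} else (\<lambda>i. (0 :: nat, Suc i)) ` ?T"
  let ?f = "\<lambda>p. sg ((d # ds) ! fst p * (d # ds) ! snd p) :: 'k"
  have fin: "finite ?S" by (rule finite_subset[of _ "{..<length ds} \<times> {..<length ds}"]) auto
  have eq: "{(j, i). j < i \<and> i < length (d # ds) \<and> i \<in> I \<and> j \<notin> I} = ?A \<union> (\<lambda>(j, i). (Suc j, Suc i)) ` ?S"
    by (auto simp: image_iff less_Suc_eq_0_disj gr0_conv_Suc split: if_splits)
  have inj: "inj_on (\<lambda>(j, i). (Suc j, Suc i)) ?S" by (auto simp: inj_on_def)
  have "(\<Prod>i\<in>?T. sg (d * ds ! i)) = (sg (d * sum_list (nths ds ?I)) :: 'k)"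
    by (simp only: prod_sg finite_Collect_conjI[OF disjI1, OF finite_Collect_less_nat]
        sum_distrib_left[symmetric] sum_nths)
  then have A: "prod ?f ?A = (if 0 \<in> I then 1 else sg (d * sum_list (nths ds ?I)))"
    by (simp add: prod.reindex inj_on_def)
  have B: "prod ?f ((\<lambda>(j, i). (Suc j, Suc i)) ` ?S) = usign ds ?I"
    unfolding prod.reindex[OF inj] usign_def by (rule prod.cong) auto
  have "usign (d # ds) I = prod ?f (?A \<union> (\<lambda>(j, i). (Suc j, Suc i)) ` ?S)"
    unfolding usign_def eq by (simp only: case_prod_unfold)
  also have "\<dots> = prod ?f ?A * prod ?f ((\<lambda>(j, i). (Suc j, Suc i)) ` ?S)"
    by (rule prod.union_disjoint) (use fin in auto)
  finally show ?thesis unfolding A B .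
qed

lemma sum_Pow_Suc: "(\<Sum>I\<in>Pow {..<Suc n}. f I) =
    (\<Sum>I\<in>Pow {..<n}. f (insert 0 (Suc ` I))) + (\<Sum>I\<in>Pow {..<n}. f (Suc ` I))"
proof -
  have 1: "Pow {..<Suc n} = (\<lambda>I. insert 0 (Suc ` I)) ` Pow {..<n} \<union> (\<lambda>I. Suc ` I) ` Pow {..<n}"
  proof (intro equalityI subsetI)
    fix I assume "I \<in> Pow {..<Suc n}"
    then have "I \<subseteq> {..<Suc n}" by simp
    let ?J = "{j. Suc j \<in> I}"
    have J: "?J \<in> Pow {..<n}" using \<open>I \<subseteq> _\<close> by auto
    have "I = insert 0 (Suc ` ?J) \<or> I = Suc ` ?J"
    proof (cases "0 \<in> I")
      case True
      then have "I = insert 0 (Suc ` ?J)" by (auto simp: image_iff) (metis not0_implies_Suc)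
      then show ?thesis ..
    next
      case False
      then have "I = Suc ` ?J" by (auto simp: image_iff) (metis not0_implies_Suc)
      then show ?thesis ..
    qed
    then show "I \<in> (\<lambda>I. insert 0 (Suc ` I)) ` Pow {..<n} \<union> (\<lambda>I. Suc ` I) ` Pow {..<n}"
      using J by blast
  qed auto
  have 2: "inj_on (\<lambda>I. insert 0 (Suc ` I)) (Pow {..<n})"
  proof (rule inj_onI)
    fix I J assume "insert 0 (Suc ` I) = insert 0 (Suc ` J)"
    then have "insert 0 (Suc ` I) - {0} = insert 0 (Suc ` J) - {0}" by simp
    then have "Suc ` I = Suc ` J" by auto
    then show "I = J" by (simp add: inj_image_eq_iff)
  qed
  have 3: "inj_on (\<lambda>I. Suc ` I) (Pow {..<n})"
    by (auto simp: inj_on_def inj_image_eq_iff)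
  show ?thesis
    unfolding 1
    by (subst sum.union_disjoint) (auto simp: sum.reindex 2 3)
qed

text \<open>Unshuffling: permuting a word and then cutting it amounts to choosing the set
  \<open>I\<close> of letters of the left piece and permuting both pieces separately. This is the
  bridge from cuts to the coproduct, which is defined by subsets; here \<open>I\<close> may still be
  empty or full.\<close>

lemma symsum_dec:
  "symsum w (dec \<psi>) = (\<Sum>I\<in>Pow {..<length w}.
     usign (map fst w) I * symsum (nths w I) (\<lambda>u. symsum (nths w (- I)) (\<psi> u)))"
proof (induction w arbitrary: \<psi>)
  case (Cons a w)
  have s0: "{j. j = 0 \<or> j \<in> Suc ` I} = insert 0 (Suc ` I)" for I by auto
  have s1: "{j. Suc j \<in> insert 0 (Suc ` I)} = I" "{j. Suc j \<in> Suc ` I} = I"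
    "{j. Suc j \<in> - insert 0 (Suc ` I)} = - I" "{j. Suc j \<in> - (Suc ` I)} = - I" for I by auto
  let ?S = "\<lambda>I \<psi>. symsum (nths w I) (\<lambda>u. symsum (nths w (- I)) (\<psi> u))"
  have n: "nths (a # w) (insert 0 (Suc ` I)) = a # nths w I"
    "nths (a # w) (- insert 0 (Suc ` I)) = nths w (- I)"
    "nths (a # w) (Suc ` I) = nths w I"
    "nths (a # w) (- (Suc ` I)) = a # nths w (- I)" for I
    unfolding nths_Cons s1 by auto
  have 1: "symsum (a # nths w I) (\<lambda>u. symsum (nths w (- I)) (\<psi> u)) = ?S I (\<lambda>u v. ins a (\<lambda>x. \<psi> x v) u)" for I
    by (simp add: ins_def[abs_def] symsum_dec_swap_args symsum_mult)
  have 2: "sg (fst a * wdeg (nths w I)) * symsum (nths w I) (\<lambda>u. symsum (a # nths w (- I)) (\<psi> u)) =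
      ?S I (\<lambda>u v. sg (fst a * wdeg u) * ins a (\<psi> u) v)" for I
    unfolding symsum_wdeg[of "nths w I" "\<lambda>d. sg (fst a * d)", symmetric]
    by (simp add: symsum_mult)
  have u: "usign (map fst (a # w)) (insert 0 (Suc ` I)) = usign (map fst w) I"
    "usign (map fst (a # w)) (Suc ` I) = sg (fst a * wdeg (nths w I)) * usign (map fst w) I" for I
    unfolding list.map usign_Cons s1 by (auto simp: wdeg_def nths_map)
  have "symsum (a # w) (dec \<psi>) = symsum w (dec (\<lambda>u v. ins a (\<lambda>x. \<psi> x v) u + sg (fst a * wdeg u) * ins a (\<psi> u) v))"
    by (simp add: ins_dec_fun)
  also have "\<dots> = (\<Sum>I\<in>Pow {..<length w}. usign (map fst w) I * ?S I (\<lambda>u v. ins a (\<lambda>x. \<psi> x v) u)) +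
     (\<Sum>I\<in>Pow {..<length w}. usign (map fst w) I * ?S I (\<lambda>u v. sg (fst a * wdeg u) * ins a (\<psi> u) v))"
    unfolding Cons.IH by (simp add: symsum_add algebra_simps sum.distrib)
  also have "\<dots> = (\<Sum>I\<in>Pow {..<length (a # w)}. usign (map fst (a # w)) I *
      symsum (nths (a # w) I) (\<lambda>u. symsum (nths (a # w) (- I)) (\<psi> u)))"
    unfolding length_Cons sum_Pow_Suc n u 1 2[symmetric] by (simp add: algebra_simps)
  finally show ?case .
qed simp

text \<open>By \<open>symsum_dec\<close> the pieces are symmetrised independently, so the third
  piece is a spectator and cocommutativity acts inside the first one.\<close>

lemma symsum_dec_swap_left:
  "symsum w (dec (\<lambda>x y. dec (\<lambda>u v. \<Phi> u v y) x)) =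
   symsum w (dec (\<lambda>x y. dec (\<lambda>u v. sg (wdeg u * wdeg v) * \<Phi> v u y) x))"
proof -
  have "symsum z (\<lambda>x. symsum z' (\<lambda>y. dec (\<lambda>u v. \<Phi> u v y) x)) =
     symsum z (\<lambda>x. symsum z' (\<lambda>y. dec (\<lambda>u v. sg (wdeg u * wdeg v) * \<Phi> v u y) x))" for z z'
  proof -
    have "symsum z (\<lambda>x. symsum z' (\<lambda>y. dec (\<lambda>u v. \<Phi> u v y) x)) =
        symsum z (dec (\<lambda>u v. symsum z' (\<Phi> u v)))"
      by (simp only: symsum_dec_swap_args[of z' "\<lambda>y u v. \<Phi> u v y"])
    also have "\<dots> = symsum z (dec (\<lambda>u v. sg (wdeg u * wdeg v) * symsum z' (\<Phi> v u)))"
      by (rule symsum_dec_swap)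
    also have "\<dots> = symsum z (\<lambda>x. symsum z' (\<lambda>y. dec (\<lambda>u v. sg (wdeg u * wdeg v) * \<Phi> v u y) x))"
      by (simp only: symsum_dec_swap_args[of z' "\<lambda>y u v. sg (wdeg u * wdeg v) * \<Phi> v u y"] symsum_mult)
    finally show ?thesis .
  qed
  then show ?thesis by (simp only: symsum_dec)
qed

subsection \<open>Recursion for the Koszul sign\<close>

text \<open>Products over pairs of positions as a list recursion, so that inserting one entry
  changes them by an explicit factor (\<open>pairprod_append_Cons\<close>). \<open>ksign\<close> is
  brought into this form by \<open>ksign_conv\<close>.\<close>

primrec pairprod :: "('a \<Rightarrow> 'a \<Rightarrow> 'k::comm_ring_1) \<Rightarrow> 'a list \<Rightarrow> 'k" where
  "pairprod g [] = 1"
| "pairprod g (a # w) = (\<Prod>b\<leftarrow>w. g a b) * pairprod g w"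

lemma pairprod_append_Cons:
  "pairprod g (x @ a # y) = (\<Prod>b\<leftarrow>x. g b a) * (\<Prod>b\<leftarrow>y. g a b) * pairprod g (x @ y)"
  by (induction x) (simp_all add: algebra_simps)

lemma pairprod_map: "pairprod g (map h w) = pairprod (\<lambda>a b. g (h a) (h b)) w"
  by (induction w) (simp_all add: comp_def)

lemma prod_pairs_eq_pairprod:
  "(\<Prod>(i, j) \<in> {(i, j). i < j \<and> j < n}. g (\<sigma> i) (\<sigma> j)) = pairprod g (map \<sigma> [0..<n])"
proof (induction n arbitrary: \<sigma>)
  case (Suc n)
  let ?S = "{(i, j). i < j \<and> j < n}"
  have fin: "finite ?S" by (rule finite_subset[of _ "{..<n} \<times> {..<n}"]) auto
  have eq: "{(i, j). i < j \<and> j < Suc n} = (\<lambda>j. (0, Suc j)) ` {..<n} \<union> (\<lambda>(i, j). (Suc i, Suc j)) ` ?S"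
    by (auto simp: image_iff less_Suc_eq_0_disj gr0_conv_Suc)
  have inj: "inj_on (\<lambda>(i, j). (Suc i, Suc j)) ?S" by (auto simp: inj_on_def)
  have "(\<Prod>(i, j) \<in> {(i, j). i < j \<and> j < Suc n}. g (\<sigma> i) (\<sigma> j)) =
      (\<Prod>j<n. g (\<sigma> 0) (\<sigma> (Suc j))) * (\<Prod>(i, j) \<in> ?S. g (\<sigma> (Suc i)) (\<sigma> (Suc j)))"
    unfolding eq
    by (subst prod.union_disjoint) (use fin in \<open>auto simp: prod.reindex[OF inj] prod.reindex inj_on_def case_prod_unfold\<close>)
  also have "(\<Prod>(i, j) \<in> ?S. g (\<sigma> (Suc i)) (\<sigma> (Suc j))) = pairprod g (map (\<lambda>i. \<sigma> (Suc i)) [0..<n])"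
    by (rule Suc)
  also have "(\<Prod>j<n. g (\<sigma> 0) (\<sigma> (Suc j))) = (\<Prod>b\<leftarrow>map (\<lambda>i. \<sigma> (Suc i)) [0..<n]. g (\<sigma> 0) b)"
    by (simp add: prod.list_conv_set_nth atLeast0LessThan comp_def)
  also have "\<dots> * pairprod g (map (\<lambda>i. \<sigma> (Suc i)) [0..<n]) = pairprod g (map \<sigma> [0..<Suc n])"
    by (simp only: upt_conv_Cons[OF zero_less_Suc] map_Suc_upt[symmetric] list.map pairprod.simps map_map comp_def)
  finally show ?case .
qed simp

lemma ksign_conv:
  "(ksign ds \<sigma> :: 'k::comm_ring_1) = pairprod (\<lambda>a b. if b < a then sg (ds ! a * ds ! b) else 1) (map \<sigma> [0..<length ds])"
proof -
  have fin: "finite {(i, j). i < j \<and> j < length ds}"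
    by (rule finite_subset[of _ "{..<length ds} \<times> {..<length ds}"]) auto
  have "(ksign ds \<sigma> :: 'k) = (\<Prod>(i, j) \<in> {(i, j). i < j \<and> j < length ds}.
     if \<sigma> j < \<sigma> i then sg (ds ! \<sigma> i * ds ! \<sigma> j) else 1)"
    unfolding ksign_def by (rule prod.mono_neutral_cong_left[OF fin]) (auto split: if_splits)
  then show ?thesis
    using prod_pairs_eq_pairprod[of "\<lambda>a b. if b < a then sg (ds ! a * ds ! b) else 1 :: 'k" \<sigma> "length ds"] by simp
qed

text \<open>The permutation taking \<open>x\<^sub>0 \<dots> x\<^sub>n\<close> to \<open>x\<^sub>1 \<dots> x\<^sub>n\<close> permuted by \<open>\<sigma>\<close>, with \<open>x\<^sub>0\<close> inserted at position \<open>p\<close>.\<close>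

definition insperm :: "nat \<Rightarrow> (nat \<Rightarrow> nat) \<Rightarrow> nat \<Rightarrow> nat" where
  "insperm p \<sigma> i = (if i < p then Suc (\<sigma> i) else if i = p then 0 else Suc (\<sigma> (i - 1)))"

lemma insperm_permutes:
  assumes "p \<le> n" "\<sigma> permutes {..<n}"
  shows "insperm p \<sigma> permutes {..<Suc n}"
proof (rule bij_imp_permutes)
  have "inj \<sigma>" using assms(2) by (rule permutes_inj)
  then have inj: "inj (insperm p \<sigma>)"
    by (intro injI) (auto simp: insperm_def inj_eq split: if_splits)
  have 1: "insperm p \<sigma> i < Suc n" if "i < Suc n" for i
  proof -
    have "\<sigma> k < n" if "k < n" for k
      using permutes_in_image[OF assms(2), of k] that by simp
    then show ?thesis using that assms(1) by (auto simp: insperm_def)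
  qed
  then have "insperm p \<sigma> ` {..<Suc n} = {..<Suc n}"
    by (intro endo_inj_surj) (auto intro: inj_on_subset[OF inj])
  then show "bij_betw (insperm p \<sigma>) {..<Suc n} {..<Suc n}"
    using inj_on_subset[OF inj] by (auto simp: bij_betw_def)
  show "insperm p \<sigma> i = i" if "i \<notin> {..<Suc n}" for i
    using that assms permutes_not_in[OF assms(2), of "i - 1"] by (auto simp: insperm_def)
qed

lemma map_insperm:
  assumes "p \<le> n"
  shows "map (insperm p \<sigma>) [0..<Suc n] = map (Suc \<circ> \<sigma>) [0..<p] @ 0 # map (Suc \<circ> \<sigma>) [p..<n]"
proof (rule nth_equalityI)
  fix i assume "i < length (map (insperm p \<sigma>) [0..<Suc n])"
  then have "i < Suc n" by simp
  then show "map (insperm p \<sigma>) [0..<Suc n] ! i = (map (Suc \<circ> \<sigma>) [0..<p] @ 0 # map (Suc \<circ> \<sigma>) [p..<n]) ! i"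
    using assms by (auto simp: insperm_def nth_append nth_Cons' simp del: upt_Suc)
qed (use assms in simp)

lemma bij_insperm:
  "bij_betw (\<lambda>(p, \<sigma>). insperm p \<sigma>) ({..n} \<times> {\<sigma>. \<sigma> permutes {..<n}}) {\<sigma>. \<sigma> permutes {..<Suc n}}"
proof -
  let ?A = "{..n} \<times> {\<sigma>. \<sigma> permutes {..<n}}"
  have inj: "inj_on (\<lambda>(p, \<sigma>). insperm p \<sigma>) ?A"
  proof (rule inj_onI, clarify)
    fix p \<sigma> p' \<sigma>'
    assume eq: "insperm p \<sigma> = insperm p' \<sigma>'"
    have z: "insperm p \<sigma> i = 0 \<longleftrightarrow> i = p" for p \<sigma> i by (simp add: insperm_def)
    have p: "p = p'" using z[of p \<sigma> p] z[of p' \<sigma>' p] by (simp add: eq)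
    have "\<sigma> i = \<sigma>' i" for i
      using fun_cong[OF eq, of "if i < p then i else Suc i"] p by (auto simp: insperm_def split: if_splits)
    then show "p = p' \<and> \<sigma> = \<sigma>'" using p by auto
  qed
  \<comment> \<open>Surjectivity by counting: both sides have (n + 1) n! elements.\<close>
  have "(\<lambda>(p, \<sigma>). insperm p \<sigma>) ` ?A = {\<sigma>. \<sigma> permutes {..<Suc n}}"
  proof (rule card_subset_eq)
    show "finite {\<sigma>. \<sigma> permutes {..<Suc n}}" by (rule finite_permutations) simp
    show "(\<lambda>(p, \<sigma>). insperm p \<sigma>) ` ?A \<subseteq> {\<sigma>. \<sigma> permutes {..<Suc n}}"
      by (auto intro: insperm_permutes)
    show "card ((\<lambda>(p, \<sigma>). insperm p \<sigma>) ` ?A) = card {\<sigma>. \<sigma> permutes {..<Suc n}}"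
      by (subst card_image[OF inj]) (simp add: card_cartesian_product card_permutations[of "{..<n}" n] card_permutations[of "{..<Suc n}" "Suc n"])
  qed
  with inj show ?thesis by (simp add: bij_betw_def)
qed

lemma permute_list_insperm:
  assumes "p \<le> length w" "\<sigma> permutes {..<length w}"
  shows "permute_list (insperm p \<sigma>) (a # w) = take p (permute_list \<sigma> w) @ a # drop p (permute_list \<sigma> w)"
proof -
  have "permute_list (insperm p \<sigma>) (a # w) = map ((!) (a # w)) (map (insperm p \<sigma>) [0..<Suc (length w)])"
    by (simp add: permute_list_def comp_def del: upt_Suc)
  also have "\<dots> = map (\<lambda>i. w ! \<sigma> i) [0..<p] @ a # map (\<lambda>i. w ! \<sigma> i) [p..<length w]"
    by (simp add: map_insperm assms(1) del: upt_Suc)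
  finally show ?thesis using assms(1) by (simp add: permute_list_def take_map drop_map)
qed

text \<open>The index 0 is the smallest, so it forms inversions exactly with the \<open>p\<close>
  letters placed before it.\<close>

lemma ksign_insperm:
  assumes "p \<le> length ds" "\<sigma> permutes {..<length ds}"
  shows "(ksign (d # ds) (insperm p \<sigma>) :: 'a::comm_ring_1) = sg (d * sum_list (take p (permute_list \<sigma> ds))) * ksign ds \<sigma>"
proof -
  let ?g = "\<lambda>a b. if b < a then sg ((d # ds) ! a * (d # ds) ! b) else 1"
  have "ksign (d # ds) (insperm p \<sigma>) = pairprod ?g (map (Suc \<circ> \<sigma>) [0..<p] @ 0 # map (Suc \<circ> \<sigma>) [p..<length ds])"
    using map_insperm[OF assms(1)] by (simp add: ksign_conv del: upt_Suc)
  also have "\<dots> = (\<Prod>b\<leftarrow>map (Suc \<circ> \<sigma>) [0..<p]. ?g b 0) * pairprod ?g (map (Suc \<circ> \<sigma>) ([0..<p] @ [p..<length ds]))"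
    unfolding pairprod_append_Cons map_append by (simp add: comp_def map_replicate_const)
  also have "[0..<p] @ [p..<length ds] = [0..<length ds]"
    using assms(1) upt_add_eq_append[of 0 p "length ds - p"] by simp
  also have "pairprod ?g (map (Suc \<circ> \<sigma>) [0..<length ds]) = ksign ds \<sigma>"
    unfolding ksign_conv pairprod_map by (simp cong: if_cong)
  also have "(\<Prod>b\<leftarrow>map (Suc \<circ> \<sigma>) [0..<p]. ?g b 0) = (\<Prod>b\<leftarrow>map (\<lambda>i. ds ! \<sigma> i) [0..<p]. sg (d * b))"
    by (simp add: comp_def mult.commute)
  also have "(\<Prod>b\<leftarrow>bs. sg (d * b)) = (sg (d * sum_list bs) :: 'a)" for bs
    by (induction bs) (simp_all add: sg_add distrib_left)
  finally show ?thesis using assms(1) by (simp add: permute_list_def take_map)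
qed

lemma sum_permutes_Suc:
  "(\<Sum>\<sigma> | \<sigma> permutes {..<Suc n}. f \<sigma>) = (\<Sum>\<sigma> | \<sigma> permutes {..<n}. \<Sum>p\<le>n. f (insperm p \<sigma>))"
proof -
  have "(\<Sum>\<sigma> | \<sigma> permutes {..<Suc n}. f \<sigma>) =
      (\<Sum>x\<in>{..n} \<times> {\<sigma>. \<sigma> permutes {..<n}}. f ((\<lambda>(p, \<sigma>). insperm p \<sigma>) x))"
    by (rule sum.reindex_bij_betw[OF bij_insperm, symmetric])
  then show ?thesis
    unfolding sum.swap[of "\<lambda>\<sigma> p. f (insperm p \<sigma>)" "{..n}"] sum.cartesian_product
    by (simp only: case_prod_unfold)
qed

text \<open>The bridge from the permutation sums of the definitions to \<open>symsum\<close>; read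
  backwards, it also shows that \<open>symsum\<close> is a finite linear combination of
  evaluations.\<close>

lemma sum_permutes:
  "(\<Sum>\<sigma> | \<sigma> permutes {..<length w}. ksign (map fst w) \<sigma> * f (permute_list \<sigma> w)) = symsum w f"
proof (induction w arbitrary: f)
  case (Cons a w)
  have "(\<Sum>\<sigma> | \<sigma> permutes {..<length (a # w)}. ksign (map fst (a # w)) \<sigma> * f (permute_list \<sigma> (a # w))) =
    (\<Sum>\<sigma> | \<sigma> permutes {..<length w}. ksign (map fst w) \<sigma> * ins a f (permute_list \<sigma> w))"
    unfolding length_Cons sum_permutes_Suc
  proof (rule sum.cong[OF refl])
    fix \<sigma> assume "\<sigma> \<in> {\<sigma>. \<sigma> permutes {..<length w}}"
    then have \<sigma>: "\<sigma> permutes {..<length w}" by simp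
    have "(\<Sum>p\<le>length w. ksign (map fst (a # w)) (insperm p \<sigma>) * f (permute_list (insperm p \<sigma>) (a # w))) =
      (\<Sum>p\<le>length w. ksign (map fst w) \<sigma> * (sg (fst a * wdeg (take p (permute_list \<sigma> w))) *
         f (take p (permute_list \<sigma> w) @ a # drop p (permute_list \<sigma> w))))"
    proof (rule sum.cong[OF refl])
      fix p assume "p \<in> {..length w}"
      then show "ksign (map fst (a # w)) (insperm p \<sigma>) * f (permute_list (insperm p \<sigma>) (a # w)) =
        ksign (map fst w) \<sigma> * (sg (fst a * wdeg (take p (permute_list \<sigma> w))) *
         f (take p (permute_list \<sigma> w) @ a # drop p (permute_list \<sigma> w)))"
        using \<sigma>
        by (simp add: ksign_insperm permute_list_insperm permute_list_map take_map wdeg_def mult_ac)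
    qed
    then show "(\<Sum>p\<le>length w. ksign (map fst (a # w)) (insperm p \<sigma>) * f (permute_list (insperm p \<sigma>) (a # w))) =
       ksign (map fst w) \<sigma> * ins a f (permute_list \<sigma> w)"
      by (simp add: ins_def dec_conv sum_distrib_left)
  qed
  then show ?case unfolding Cons.IH[of "ins a f"] by simp
qed (simp add: ksign_def)

context fd_graded_space
begin

lemma linear_scalar_iff:
  "Vector_Spaces.linear scale (*) f \<longleftrightarrow> (\<forall>x y. f (x + y) = f x + f y) \<and> (\<forall>c x. f (c *s x) = c * f x)"
proof -
  have "vector_space ((*) :: 'k \<Rightarrow> 'k \<Rightarrow> 'k)" by unfold_locales (simp_all add: algebra_simps)
  then show ?thesis using vector_space_axioms by (simp add: Vector_Spaces.linear_iff)
qed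

lemma linear_scale_iff:
  "Vector_Spaces.linear scale scale f \<longleftrightarrow> (\<forall>x y. f (x + y) = f x + f y) \<and> (\<forall>c x. f (c *s x) = c *s f x)"
  using vector_space_axioms by (simp add: Vector_Spaces.linear_iff)


subsection \<open>Multilinear forms\<close>

lemma mform_iff:
  "mform F \<longleftrightarrow> (\<forall>u x y v. F (u @ (x + y) # v) = F (u @ x # v) + F (u @ y # v)) \<and>
     (\<forall>u c x v. F (u @ (c *s x) # v) = c * F (u @ x # v))"
proof (intro iffI conjI allI)
  assume F: "mform F"
  fix u :: "'v list" and x y c v
  have "Vector_Spaces.linear scale (*) (\<lambda>z. F ((u @ x # v)[length u := z]))"
    using F unfolding mform_def by (metis add_Suc_right length_append length_Cons less_add_Suc1)
  then show "F (u @ (x + y) # v) = F (u @ x # v) + F (u @ y # v)" "F (u @ (c *s x) # v) = c * F (u @ x # v)"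
    by (simp_all add: linear_scalar_iff)
next
  assume *: "(\<forall>u x y v. F (u @ (x + y) # v) = F (u @ x # v) + F (u @ y # v)) \<and>
     (\<forall>u c x v. F (u @ (c *s x) # v) = c * F (u @ x # v))"
  show "mform F"
    unfolding mform_def linear_scalar_iff by (simp add: upd_conv_take_nth_drop *)
qed

lemma mformI:
  assumes "\<And>u x y v. F (u @ (x + y) # v) = F (u @ x # v) + F (u @ y # v)"
    "\<And>u c x v. F (u @ (c *s x) # v) = c * F (u @ x # v)"
  shows "mform F"
  using assms by (simp add: mform_iff)

lemma mform_addD: "mform F \<Longrightarrow> F (u @ (x + y) # v) = F (u @ x # v) + F (u @ y # v)"
  and mform_scaleD: "mform F \<Longrightarrow> F (u @ (c *s x) # v) = c * F (u @ x # v)"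
  by (simp_all add: mform_iff)

lemma mform_addD_Cons: "mform F \<Longrightarrow> F ((x + y) # v) = F (x # v) + F (y # v)"
  and mform_scaleD_Cons: "mform F \<Longrightarrow> F ((c *s x) # v) = c * F (x # v)"
  using mform_addD[of F "[]"] mform_scaleD[of F "[]"] by simp_all

lemma mform_zero: "mform F \<Longrightarrow> 0 \<in> set xs \<Longrightarrow> F xs = 0"
  using mform_scaleD[of F _ 0 0] by (metis mult_zero_left scale_zero_left split_list)

lemma mform_sum_Cons: "mform F \<Longrightarrow> F ((\<Sum>i\<in>A. f i) # v) = (\<Sum>i\<in>A. F (f i # v))"
  by (induction A rule: infinite_finite_induct) (simp_all add: mform_addD_Cons mform_zero)

lemma mform_0 [intro]: "mform 0" "mform (\<lambda>_. 0)"
  by (auto intro: mformI)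

lemma mform_add: "mform F \<Longrightarrow> mform G \<Longrightarrow> mform (\<lambda>xs. F xs + G xs)"
  by (rule mformI) (simp_all add: mform_addD mform_scaleD algebra_simps)

lemma mform_mult: "mform F \<Longrightarrow> mform (\<lambda>xs. c * F xs)"
  by (rule mformI) (simp_all add: mform_addD mform_scaleD algebra_simps)

lemma mform_sum: "(\<And>i. i \<in> A \<Longrightarrow> mform (F i)) \<Longrightarrow> mform (\<lambda>xs. \<Sum>i\<in>A. F i xs)"
  by (induction A rule: infinite_finite_induct) (auto simp: mform_add)

text \<open>Multilinearity only compares lists of equal length, so the range of summation may depend
  on the length.\<close>

lemma mform_sum_length:
  "(\<And>n i. i \<in> A n \<Longrightarrow> mform (F i)) \<Longrightarrow> mform (\<lambda>xs. \<Sum>i\<in>A (length xs). F i xs)"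
  using mform_sum[of _ F] by (intro mformI; simp add: mform_iff)

lemma mform_if_length: "mform F \<Longrightarrow> mform (\<lambda>xs. if P (length xs) then F xs else 0)"
  by (rule mformI) (simp_all add: mform_addD mform_scaleD)

lemma mform_comp_arity: "mform F \<Longrightarrow> mform (comp_arity k F)"
  unfolding comp_arity_def by (rule mform_if_length)

lemma mform_append_left: "mform F \<Longrightarrow> mform (\<lambda>xs. F (ys @ xs))"
  by (rule mformI) (simp_all add: mform_addD[of F "ys @ u" for u, simplified] mform_scaleD[of F "ys @ u" for u, simplified])

lemma mform_Cons: "mform F \<Longrightarrow> mform (\<lambda>xs. F (y # xs))"
  using mform_append_left[of F "[y]"] by simp

lemma mform_append_right: "mform F \<Longrightarrow> mform (\<lambda>xs. F (xs @ ys))"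
  by (rule mformI) (simp_all add: mform_addD mform_scaleD)

lemma mform_take_drop:
  assumes "mform F" "mform G"
  shows "mform (\<lambda>xs. F (take r xs) * G (drop r xs))"
proof (rule mformI)
  fix u :: "'v list" and x y v c
  show "F (take r (u @ (x + y) # v)) * G (drop r (u @ (x + y) # v)) =
      F (take r (u @ x # v)) * G (drop r (u @ x # v)) + F (take r (u @ y # v)) * G (drop r (u @ y # v))"
    using assms by (cases "r \<le> length u")
      (auto simp: take_Cons' drop_Cons' mform_addD algebra_simps)
  show "F (take r (u @ (c *s x) # v)) * G (drop r (u @ (c *s x) # v)) =
      c * (F (take r (u @ x # v)) * G (drop r (u @ x # v)))"
    using assms by (cases "r \<le> length u")
      (auto simp: take_Cons' drop_Cons' mform_scaleD algebra_simps)
qed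

text \<open>It is enough that the entry of each slot is carried unchanged to some slot and that its
  destination and the other entries do not depend on it.\<close>

lemma mform_rearrange:
  assumes "mform F" "\<And>u v. \<exists>u' v'. \<forall>x. R (u @ x # v) = u' @ x # v'"
  shows "mform (\<lambda>xs. F (R xs))"
proof (rule mformI)
  fix u v :: "'v list" and x y c
  obtain u' v' where "\<forall>x. R (u @ x # v) = u' @ x # v'" using assms(2) by blast
  then show "F (R (u @ (x + y) # v)) = F (R (u @ x # v)) + F (R (u @ y # v))"
    "F (R (u @ (c *s x) # v)) = c * F (R (u @ x # v))"
    using assms(1) by (simp_all add: mform_addD mform_scaleD)
qed

lemma rotate_rearrange: "\<exists>u' v'. \<forall>x. rotate j (u @ x # v) = u' @ x # v'"
proof (induction j)
  case (Suc j)
  then obtain u' v' where *: "\<forall>x. rotate j (u @ x # v) = u' @ x # v'" by blast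
  show ?case
  proof (cases u')
    case Nil
    then have "\<forall>x. rotate (Suc j) (u @ x # v) = v' @ x # []" using * by simp
    then show ?thesis by blast
  next
    case (Cons a u'')
    then have "\<forall>x. rotate (Suc j) (u @ x # v) = u'' @ x # (v' @ [a])" using * by simp
    then show ?thesis by blast
  qed
qed auto

lemma permute_rearrange:
  fixes u v :: "'v list"
  assumes "\<sigma> permutes {..<Suc (length u + length v)}"
  shows "\<exists>u' v'. \<forall>x. permute_list \<sigma> (u @ x # v) = u' @ x # v'"
proof -
  let ?n = "Suc (length u + length v)"
  have inj: "inj \<sigma>" using assms by (rule permutes_inj)
  obtain p where p: "\<sigma> p = length u" "p < ?n"
    using assms permutes_image[OF assms] by (metis (no_types, lifting) imageE le_add1 le_imp_less_Suc lessThan_iff)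
  define f where "f x i = (u @ x # v) ! \<sigma> i" for x i
  have f: "f x i = f y i" if "i \<noteq> p" for x y i
    using that p inj by (metis f_def inj_eq nth_append nth_Cons' diff_is_0_eq not_less_iff_gr_or_eq not_less)
  have "permute_list \<sigma> (u @ x # v) = map (f 0) [0..<p] @ x # map (f 0) [Suc p..<?n]" for x
  proof -
    have "[0..<?n] = [0..<p] @ p # [Suc p..<?n]"
      using p(2) by (metis le0 upt_add_eq_append upt_conv_Cons le_add_diff_inverse less_imp_le_nat add_0)
    then have "permute_list \<sigma> (u @ x # v) = map (f x) [0..<p] @ f x p # map (f x) [Suc p..<?n]"
      by (simp add: permute_list_def f_def del: upt_Suc)
    moreover have "f x p = x" by (simp add: f_def p)
    moreover have "map (f x) [0..<p] = map (f 0) [0..<p]" "map (f x) [Suc p..<?n] = map (f 0) [Suc p..<?n]"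
      by (auto intro: f)
    ultimately show ?thesis by simp
  qed
  then show ?thesis by blast
qed


subsection \<open>Homogeneous components and homogeneous bases\<close>

lemma hcomp_spec:
  "(\<forall>n. hcomp n v \<in> gr n) \<and> finite {n. hcomp n v \<noteq> 0} \<and> (\<Sum>n | hcomp n v \<noteq> 0. hcomp n v) = v"
  unfolding hcomp_def by (rule theI'[OF graded])

lemma hcomp_in [simp]: "hcomp n v \<in> gr n"
  using hcomp_spec by blast

lemma hcomp_unique:
  assumes "\<And>n. f n \<in> gr n" "finite A" "\<And>n. n \<notin> A \<Longrightarrow> f n = 0" "(\<Sum>n\<in>A. f n) = v"
  shows "hcomp m v = f m"
proof -
  have fin: "finite {n. f n \<noteq> 0}" by (rule finite_subset[OF _ assms(2)]) (use assms(3) in auto)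
  have "(\<Sum>n | f n \<noteq> 0. f n) = (\<Sum>n\<in>A. f n)"
    by (rule sum.mono_neutral_left) (use assms in auto)
  then have "(THE f. (\<forall>n. f n \<in> gr n) \<and> finite {n. f n \<noteq> 0} \<and> (\<Sum>n | f n \<noteq> 0. f n) = v) = f"
    using assms fin by (intro the1_equality[OF graded]) auto
  then show ?thesis by (simp add: hcomp_def)
qed

lemma gr_0 [simp]: "0 \<in> gr n" and gr_add: "x \<in> gr n \<Longrightarrow> y \<in> gr n \<Longrightarrow> x + y \<in> gr n"
  and gr_scale: "x \<in> gr n \<Longrightarrow> c *s x \<in> gr n"
  using subspace_gr by (auto simp: subspace_0 subspace_add subspace_scale)

lemma gr_sum: "(\<And>i. i \<in> A \<Longrightarrow> f i \<in> gr n) \<Longrightarrow> (\<Sum>i\<in>A. f i) \<in> gr n"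
  using subspace_gr by (rule subspace_sum)

lemma hcomp_sum_superset:
  assumes "finite A" "{n. hcomp n v \<noteq> 0} \<subseteq> A"
  shows "(\<Sum>n\<in>A. hcomp n v) = v"
proof -
  have "(\<Sum>n\<in>A. hcomp n v) = (\<Sum>n | hcomp n v \<noteq> 0. hcomp n v)"
    by (rule sum.mono_neutral_right) (use assms in auto)
  then show ?thesis using hcomp_spec[of v] by simp
qed

lemma hcomp_add: "hcomp m (x + y) = hcomp m x + hcomp m y"
proof (rule hcomp_unique[of _ "{n. hcomp n x \<noteq> 0} \<union> {n. hcomp n y \<noteq> 0}"])
  show "(\<Sum>n\<in>{n. hcomp n x \<noteq> 0} \<union> {n. hcomp n y \<noteq> 0}. hcomp n x + hcomp n y) = x + y"
    using hcomp_spec[of x] hcomp_spec[of y] by (simp add: sum.distrib hcomp_sum_superset)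
qed (use hcomp_spec[of x] hcomp_spec[of y] in \<open>auto intro: gr_add\<close>)

lemma hcomp_scale: "hcomp m (c *s x) = c *s hcomp m x"
proof (rule hcomp_unique[of _ "{n. hcomp n x \<noteq> 0}"])
  show "(\<Sum>n\<in>{n. hcomp n x \<noteq> 0}. c *s hcomp n x) = c *s x"
    using hcomp_spec[of x] by (simp add: scale_sum_right[symmetric])
qed (use hcomp_spec[of x] in \<open>auto intro: gr_scale\<close>)

lemma hcomp_gr: "v \<in> gr n \<Longrightarrow> hcomp m v = (if m = n then v else 0)"
  by (rule hcomp_unique[of _ "{n}"]) auto

lemma hcomp_0 [simp]: "hcomp m 0 = 0"
  using hcomp_gr[of 0 m m] by simp

text \<open>A maximal independent subset of the union of the graded pieces; that union spans because
  every vector is the sum of its homogeneous components.\<close>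

lemma homogeneous_basis:
  obtains \<epsilon>s es where "homog \<epsilon>s es" "distinct es" "independent (set es)" "span (set es) = UNIV"
proof -
  have "v \<in> span (\<Union>n. gr n)" for v
  proof -
    have "(\<Sum>n | hcomp n v \<noteq> 0. hcomp n v) \<in> span (\<Union>n. gr n)"
      by (rule span_sum) (use hcomp_in in \<open>blast intro: span_base\<close>)
    then show ?thesis using hcomp_spec[of v] by simp
  qed
  moreover obtain B where B: "B \<subseteq> (\<Union>n. gr n)" "independent B" "(\<Union>n. gr n) \<subseteq> span B"
    by (rule maximal_independent_subset)
  ultimately have sp: "span B = UNIV"
    by (metis UNIV_eq_I span_mono span_span subset_eq)
  obtain A where "finite A" "span A = UNIV" using finite_dim by blast
  then have "finite B" using independent_span_bound[of A B] B(2) by auto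
  then obtain es where es: "set es = B" "distinct es" using finite_distinct_list by blast
  have "\<forall>x\<in>B. \<exists>d. x \<in> gr (d + 1)"
  proof
    fix x assume "x \<in> B"
    then obtain n where "x \<in> gr n" using B(1) by auto
    then have "x \<in> gr (n - 1 + 1)" by simp
    then show "\<exists>d. x \<in> gr (d + 1)" by blast
  qed
  then obtain \<delta> where "\<And>x. x \<in> B \<Longrightarrow> x \<in> gr (\<delta> x + 1)" by metis
  then have "homog (map \<delta> es) es"
    using es by (simp add: homog_def list_all2_map1 list_all2_same)
  then show ?thesis using that es B(2) sp by blast
qed

text \<open>In a degree that no vector of a homogeneous basis has, the component map vanishes on the
  basis and hence everywhere.\<close>

lemma finite_degs: "finite degs"
proof -
  obtain \<epsilon>s es where es: "homog \<epsilon>s es" "span (set es) = UNIV"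
    using homogeneous_basis by metis
  have "degs \<subseteq> set \<epsilon>s"
  proof (rule subsetI, rule ccontr)
    fix d assume d: "d \<in> degs" "d \<notin> set \<epsilon>s"
    have "subspace {x. hcomp (d + 1) x = 0}"
      by (auto intro!: subspaceI simp: hcomp_add hcomp_scale)
    moreover have "set es \<subseteq> {x. hcomp (d + 1) x = 0}"
    proof
      fix x assume "x \<in> set es"
      then obtain i where i: "i < length es" "x = es ! i" by (auto simp: in_set_conv_nth)
      then have "x \<in> gr (\<epsilon>s ! i + 1)" "\<epsilon>s ! i \<noteq> d"
        using es(1) d(2) by (auto simp: homog_def list_all2_conv_all_nth)
      then show "x \<in> {x. hcomp (d + 1) x = 0}" by (simp add: hcomp_gr)
    qed
    ultimately have "UNIV \<subseteq> {x. hcomp (d + 1) x = 0}"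
      using span_minimal es(2) by blast
    then have "hcomp (d + 1) x = 0" for x by blast
    then have "x = 0" if "x \<in> gr (d + 1)" for x using hcomp_gr[OF that, of "d + 1"] by simp
    then have "gr (d + 1) = {0}" using gr_0 by blast
    then show False using d(1) by (simp add: degs_def)
  qed
  then show ?thesis by (rule finite_subset) simp
qed

lemma hcomp_degs: "(\<Sum>d\<in>degs. hcomp (d + 1) v) = v"
proof -
  have "{n. hcomp n v \<noteq> 0} \<subseteq> (\<lambda>d. d + 1) ` degs"
  proof
    fix n assume n: "n \<in> {n. hcomp n v \<noteq> 0}"
    have "gr (n - 1 + 1) \<noteq> {0}"
      unfolding diff_add_cancel using n hcomp_in[of n v] by blast
    then have "n - 1 \<in> degs" unfolding degs_def by (rule CollectI)
    then show "n \<in> (\<lambda>d. d + 1) ` degs" by (rule rev_image_eqI) simp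
  qed
  then have "(\<Sum>n\<in>(\<lambda>d. d + 1) ` degs. hcomp n v) = v"
    using finite_degs by (intro hcomp_sum_superset) auto
  then show ?thesis by (simp add: sum.reindex)
qed


subsection \<open>Words of homogeneous letters\<close>

text \<open>A letter is a pair of a degree in V[1] and a vector of that degree. Storing the degree
  keeps signs well defined even for the zero vector, which lies in every graded piece.\<close>

definition hw :: "(int \<times> 'v) list \<Rightarrow> bool" where
  "hw w \<longleftrightarrow> (\<forall>a\<in>set w. snd a \<in> gr (fst a + 1))"

definition ev :: "('v, 'k) form \<Rightarrow> (int \<times> 'v) list \<Rightarrow> 'k" where
  "ev F w = F (map snd w)"

lemma hw_simps [simp]: "hw []" "hw (a # w) \<longleftrightarrow> snd a \<in> gr (fst a + 1) \<and> hw w"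
  "hw (u @ v) \<longleftrightarrow> hw u \<and> hw v"
  by (auto simp: hw_def)

lemma hw_mset: "mset z = mset w \<Longrightarrow> hw w \<Longrightarrow> hw z"
  unfolding hw_def by (metis mset_eq_setD)

lemma homog_iff_hw: "homog ds xs \<longleftrightarrow> length ds = length xs \<and> hw (zip ds xs)"
  unfolding homog_def hw_def by (auto simp: list_all2_iff case_prod_unfold)

lemma homog_map_iff [simp]: "homog (map fst w) (map snd w) \<longleftrightarrow> hw w"
  unfolding homog_iff_hw by (simp add: zip_map_fst_snd)

lemma homogE:
  assumes "homog ds xs"
  obtains w where "hw w" "ds = map fst w" "xs = map snd w"
  using assms that[of "zip ds xs"] by (auto simp: homog_iff_hw)

lemma length_homog: "homog ds xs \<Longrightarrow> length ds = length xs"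
  by (simp add: homog_iff_hw)

lemma lists_Suc_reindex:
  "(\<Sum>ds | length ds = Suc n \<and> set ds \<subseteq> D. f ds) = (\<Sum>d\<in>D. \<Sum>ds | length ds = n \<and> set ds \<subseteq> D. f (d # ds))"
proof -
  have eq: "{ds. length ds = Suc n \<and> set ds \<subseteq> D} = (\<lambda>(d, ds). d # ds) ` (D \<times> {ds. length ds = n \<and> set ds \<subseteq> D})"
    by (auto simp: length_Suc_conv image_iff)
  have "inj_on (\<lambda>(d, ds). d # ds) (D \<times> {ds. length ds = n \<and> set ds \<subseteq> D})"
    by (auto simp: inj_on_def)
  then show ?thesis
    unfolding eq by (simp add: sum.reindex sum.cartesian_product case_prod_unfold)
qed

lemma mext_const:
  assumes "mform F"
  shows "mext (\<lambda>ds. F) xs = F xs"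
  using assms
proof (induction xs arbitrary: F)
  case (Cons x xs)
  have "mext (\<lambda>ds. F) (x # xs) = (\<Sum>d\<in>degs. mext (\<lambda>ds ys. F (hcomp (d + 1) x # ys)) xs)"
    by (simp add: mext_def lists_Suc_reindex)
  also have "\<dots> = (\<Sum>d\<in>degs. F (hcomp (d + 1) x # xs))"
    by (simp add: Cons.IH[OF mform_Cons[OF Cons.prems]])
  also have "\<dots> = F ((\<Sum>d\<in>degs. hcomp (d + 1) x) # xs)"
    by (rule mform_sum_Cons[OF Cons.prems, symmetric])
  finally show ?case by (simp add: hcomp_degs)
next
  case Nil
  have "{ds. length ds = length ([] :: 'v list) \<and> set ds \<subseteq> degs} = {[]}" by auto
  then show ?case by (simp add: mext_def)
qed

text \<open>Splitting every argument into homogeneous components recovers a multilinear form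
  (\<open>mext_const\<close>). This reduces identities of forms to homogeneous words of a fixed
  length.\<close>

lemma mform_eqI:
  assumes "mform F" "mform G" "\<And>w. hw w \<Longrightarrow> length w = length xs \<Longrightarrow> ev F w = ev G w"
  shows "F xs = G xs"
proof -
  have "mext (\<lambda>ds. F) xs = mext (\<lambda>ds. G) xs"
    unfolding mext_def
  proof (rule sum.cong[OF refl])
    fix ds assume ds: "ds \<in> {ds. length ds = length xs \<and> set ds \<subseteq> degs}"
    let ?w = "zip ds (map2 (\<lambda>d x. hcomp (d + 1) x) ds xs)"
    have "hw ?w" by (auto simp: hw_def set_zip)
    moreover have "map snd ?w = map2 (\<lambda>d x. hcomp (d + 1) x) ds xs" using ds by simp
    ultimately show "F (map2 (\<lambda>d x. hcomp (d + 1) x) ds xs) = G (map2 (\<lambda>d x. hcomp (d + 1) x) ds xs)"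
      using assms(3)[of ?w] ds by (simp add: ev_def)
  qed
  then show ?thesis using assms by (simp add: mext_const)
qed

text \<open>On a homogeneous word every other degree list picks a zero component of some letter, so
  a single summand of the multilinear extension survives.\<close>

lemma ev_mext:
  assumes G: "\<And>ds. mform (G ds)" and "hw w"
  shows "ev (mext G) w = G (map fst w) (map snd w)"
proof -
  let ?ds = "map fst w" and ?xs = "map snd w"
  let ?D = "{ds. length ds = length w \<and> set ds \<subseteq> degs}"
  let ?h = "\<lambda>ds. map2 (\<lambda>d x. hcomp (d + 1) x) ds ?xs"
  have fin: "finite ?D" using finite_lists_length_eq[OF finite_degs, of "length w"] by (simp add: conj_commute)
  have *: "G ds (?h ds) = 0" if "ds \<in> ?D - {?ds}" for ds
  proof -
    have len: "length ds = length w" "ds \<noteq> ?ds" using that by auto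
    then obtain i where i: "i < length w" "ds ! i \<noteq> ?ds ! i" by (metis length_map nth_equalityI)
    have "snd (w ! i) \<in> gr (fst (w ! i) + 1)" using \<open>hw w\<close> i(1) by (simp add: hw_def)
    then have "?h ds ! i = 0" using i len by (simp add: hcomp_gr)
    then have "0 \<in> set (?h ds)" using i len by (metis (no_types, lifting) length_map map_fst_zip nth_mem)
    then show ?thesis using G mform_zero by blast
  qed
  have h: "?h ?ds = ?xs"
  proof (rule nth_equalityI)
    fix i assume "i < length (?h ?ds)"
    then have i: "i < length w" by simp
    then have "snd (w ! i) \<in> gr (fst (w ! i) + 1)" using \<open>hw w\<close> by (simp add: hw_def)
    then show "?h ?ds ! i = ?xs ! i" using i by (simp add: hcomp_gr case_prod_unfold)
  qed simp
  have "ev (mext G) w = (\<Sum>ds\<in>?D. G ds (?h ds))" by (simp add: ev_def mext_def)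
  also have "\<dots> = (\<Sum>ds\<in>?D \<inter> {?ds}. G ds (?h ds))"
    by (rule sum.mono_neutral_right[OF fin]) (use * in auto)
  also have "\<dots> = G ?ds ?xs"
  proof (cases "?ds \<in> ?D")
    case True
    then show ?thesis using h by simp
  next
    case False
    \<comment> \<open>The degree list of \<open>w\<close> is missing from the range of summation
      only if some letter has a degree outside \<open>degs\<close>. That letter is then the zero
      vector and both sides vanish.\<close>
    then obtain a where a: "a \<in> set w" "fst a \<notin> degs" by auto
    then have "snd a = 0" using \<open>hw w\<close> by (auto simp: hw_def degs_def)
    then have "0 \<in> set ?xs" using a by force
    then have "G ?ds ?xs = 0" using G mform_zero by blast
    then show ?thesis using False by simp
  qed
  finally show ?thesis .
qed

lemma mform_mext:
  assumes G: "\<And>ds. mform (G ds)"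
  shows "mform (mext G)"
proof -
  have eq: "map2 (\<lambda>d x. hcomp (d + 1) x) ds (u @ x # v) =
      map2 (\<lambda>d x. hcomp (d + 1) x) (take (length u) ds) u @ hcomp (ds ! length u + 1) x #
      map2 (\<lambda>d x. hcomp (d + 1) x) (drop (Suc (length u)) ds) v"
    if "length ds = Suc (length u + length v)" for ds u x v
  proof -
    define ds1 d ds2 where "ds1 = take (length u) ds" and "d = ds ! length u" and "ds2 = drop (Suc (length u)) ds"
    have ds: "ds = ds1 @ d # ds2" and len: "length ds1 = length u"
      using that by (simp_all add: ds1_def d_def ds2_def id_take_nth_drop)
    show ?thesis unfolding ds by (simp add: len nth_append)
  qed
  show ?thesis
  proof (rule mformI)
    fix u x y v c
    show "mext G (u @ (x + y) # v) = mext G (u @ x # v) + mext G (u @ y # v)"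
      unfolding mext_def by (simp add: eq hcomp_add mform_addD[OF G] sum.distrib cong: sum.cong_simp)
    show "mext G (u @ (c *s x) # v) = c * mext G (u @ x # v)"
      unfolding mext_def by (simp add: eq hcomp_scale mform_scaleD[OF G] sum_distrib_left cong: sum.cong_simp)
  qed
qed

lemma mform_rot_summand:
  assumes "mform F"
  shows "mform (\<lambda>xs. \<Sum>j<max 1 (length xs). (c j :: 'k) * F (rotate j xs))"
  by (rule mform_sum_length[of "\<lambda>n. {..<max 1 n}" "\<lambda>j xs. c j * F (rotate j xs)"])
     (intro mform_mult mform_rearrange[OF assms] rotate_rearrange)

lemma mform_Cycl: "mform F \<Longrightarrow> mform (Cycl F)"
  unfolding Cycl_def by (intro mform_mext mform_rot_summand)

lemma ev_Cycl: "mform F \<Longrightarrow> hw w \<Longrightarrow> ev (Cycl F) w = rot (ev F) w"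
  unfolding Cycl_def
  by (subst ev_mext, rule mform_rot_summand)
     (simp_all add: rot_conv ev_def wdeg_def take_map drop_map rotate_map)

lemma mform_Sym_summand:
  assumes "mform F"
  shows "mform (\<lambda>xs. \<Sum>\<sigma> | \<sigma> permutes {..<length xs}. (c \<sigma> :: 'k) * F (permute_list \<sigma> xs))"
proof (rule mformI)
  fix u v :: "'v list" and x y r
  have "F (permute_list \<sigma> (u @ (x + y) # v)) = F (permute_list \<sigma> (u @ x # v)) + F (permute_list \<sigma> (u @ y # v)) \<and>
    F (permute_list \<sigma> (u @ (r *s x) # v)) = r * F (permute_list \<sigma> (u @ x # v))"
    if "\<sigma> permutes {..<Suc (length u + length v)}" for \<sigma>
    using permute_rearrange[OF that] assms by (auto simp: mform_addD mform_scaleD)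
  then show "(\<Sum>\<sigma> | \<sigma> permutes {..<length (u @ (x + y) # v)}. c \<sigma> * F (permute_list \<sigma> (u @ (x + y) # v))) =
     (\<Sum>\<sigma> | \<sigma> permutes {..<length (u @ x # v)}. c \<sigma> * F (permute_list \<sigma> (u @ x # v))) +
     (\<Sum>\<sigma> | \<sigma> permutes {..<length (u @ y # v)}. c \<sigma> * F (permute_list \<sigma> (u @ y # v)))"
    "(\<Sum>\<sigma> | \<sigma> permutes {..<length (u @ (r *s x) # v)}. c \<sigma> * F (permute_list \<sigma> (u @ (r *s x) # v))) =
     r * (\<Sum>\<sigma> | \<sigma> permutes {..<length (u @ x # v)}. c \<sigma> * F (permute_list \<sigma> (u @ x # v)))"
    by (simp_all add: sum.distrib sum_distrib_left algebra_simps cong: sum.cong_simp)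
qed

lemma mform_Sym: "mform F \<Longrightarrow> mform (Sym F)"
  unfolding Sym_def by (intro mform_mext mform_Sym_summand)

lemma ev_Sym: "mform F \<Longrightarrow> hw w \<Longrightarrow> ev (Sym F) w = symsum w (ev F)"
  unfolding Sym_def sum_permutes[symmetric]
  by (subst ev_mext, rule mform_Sym_summand)
     (auto intro!: sum.cong simp: ev_def permute_list_map)

lemma cyclic_iff:
  "cyclic F \<longleftrightarrow> mform F \<and> (\<forall>w. hw w \<longrightarrow> rot1 (ev F) w = ev F w)"
proof -
  have "(\<forall>d ds x xs. homog (d # ds) (x # xs) \<longrightarrow> F (x # xs) = sg (d * sum_list ds) * F (xs @ [x])) \<longleftrightarrow>
     (\<forall>w. hw w \<longrightarrow> rot1 (ev F) w = ev F w)" (is "?L \<longleftrightarrow> ?R")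
  proof
    assume L: ?L
    show ?R
    proof (intro allI impI)
      fix w :: "(int \<times> 'v) list" assume "hw w"
      show "rot1 (ev F) w = ev F w"
      proof (cases w)
        case (Cons a z)
        then have "homog (fst a # map fst z) (snd a # map snd z)" using \<open>hw w\<close> homog_map_iff[of w] by simp
        then show ?thesis using L Cons by (simp add: rot1_def ev_def wdeg_def)
      qed (simp add: rot1_def)
    qed
  next
    assume R: ?R
    show ?L
    proof (intro allI impI)
      fix d ds x xs assume "homog (d # ds) (x # xs)"
      then obtain w where w: "hw w" "d # ds = map fst w" "x # xs = map snd w" by (rule homogE)
      then obtain a z where "w = a # z" by (cases w) auto
      then show "F (x # xs) = sg (d * sum_list ds) * F (xs @ [x])"
        using R[rule_format, OF w(1)] w by (simp add: rot1_def ev_def wdeg_def)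
    qed
  qed
  then show ?thesis by (simp add: cyclic_def)
qed

lemma rot1_cong_hw:
  assumes "\<And>z. hw z \<Longrightarrow> f z = g z" "hw w"
  shows "rot1 f w = rot1 g w"
  using assms(2) by (cases w) (auto simp: rot1_def assms(1))

lemma cyclic_append:
  assumes "cyclic F" "hw u" "hw v"
  shows "ev F (u @ v) = sg (wdeg u * wdeg v) * ev F (v @ u)"
proof -
  have "(rot1 ^^ j) (ev F) w = ev F w" if "hw w" for j w
    using that
  proof (induction j arbitrary: w)
    case (Suc j)
    have "rot1 ((rot1 ^^ j) (ev F)) w = rot1 (ev F) w"
      using Suc.IH Suc.prems by (rule rot1_cong_hw)
    then show ?case using assms(1) Suc.prems by (simp add: cyclic_iff)
  qed simp
  from this[of "u @ v" "length u"] show ?thesis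
    using assms by (simp add: rot1_pow)
qed

lemma cyclic_Cycl: "mform F \<Longrightarrow> cyclic (Cycl F)"
  unfolding cyclic_iff
proof (intro conjI allI impI mform_Cycl)
  fix w :: "(int \<times> 'v) list" assume F: "mform F" and w: "hw w"
  have "rot1 (ev (Cycl F)) w = rot1 (rot (ev F)) w"
    using ev_Cycl[OF F] w by (rule rot1_cong_hw)
  then show "rot1 (ev (Cycl F)) w = ev (Cycl F) w"
    using w F by (simp add: rot1_rot ev_Cycl)
qed

lemma rot_cyclic:
  assumes "cyclic F" "hw w"
  shows "rot (ev F) w = of_nat (max 1 (length w)) * ev F w"
proof -
  have "sg (wdeg (take j w) * wdeg (drop j w)) * ev F (rotate j w) = ev F w" if "j < max 1 (length w)" for j
  proof (cases "w = []")
    case False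
    then have "j < length w" using that by (cases w) auto
    then show ?thesis
      using cyclic_append[of F "take j w" "drop j w"] assms hw_simps(3)[of "take j w" "drop j w"]
      by (simp add: rotate_drop_take)
  qed (use that in simp)
  then show ?thesis by (simp add: rot_conv)
qed

lemma has_degree_iff: "has_degree d F \<longleftrightarrow> (\<forall>w. hw w \<and> ev F w \<noteq> 0 \<longrightarrow> d + wdeg w = 0)"
  unfolding has_degree_def
proof (intro iffI allI impI)
  fix w :: "(int \<times> 'v) list"
  assume "\<forall>ds xs. homog ds xs \<and> F xs \<noteq> 0 \<longrightarrow> d + sum_list ds = 0" "hw w \<and> ev F w \<noteq> 0"
  then show "d + wdeg w = 0" unfolding wdeg_def ev_def by (metis homog_map_iff)
next
  fix ds xs
  assume *: "\<forall>w. hw w \<and> ev F w \<noteq> 0 \<longrightarrow> d + wdeg w = 0" "homog ds xs \<and> F xs \<noteq> 0"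
  then obtain w where "hw w" "ds = map fst w" "xs = map snd w" using homogE by metis
  then show "d + sum_list ds = 0" using * by (auto simp: wdeg_def ev_def)
qed

end

context fd_graded_space
begin

subsection \<open>Spaces of cyclic forms\<close>

lemma sum_apply: "(\<Sum>i\<in>A. F i) x = (\<Sum>i\<in>A. F i x)" for F :: "_ \<Rightarrow> _ \<Rightarrow> 'c::comm_monoid_add"
  by (induction A rule: infinite_finite_induct) auto

lemma cyc_all_cyclic: "F \<in> cyc_all \<Longrightarrow> cyclic F"
  and cyc_all_mform: "F \<in> cyc_all \<Longrightarrow> mform F"
  by (auto simp: cyc_all_def cyclic_def)

lemma cyc_subset: "F \<in> cyc k \<Longrightarrow> F \<in> cyc_all"
  unfolding cyc_def cyc_all_def by (auto intro!: exI[of _ k])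

lemma cyc_arity: "F \<in> cyc k \<Longrightarrow> length xs \<noteq> k \<Longrightarrow> F xs = 0"
  by (simp add: cyc_def)

lemma cyc_allE:
  assumes "F \<in> cyc_all"
  obtains n where "\<And>xs. length xs > n \<Longrightarrow> F xs = 0"
  using assms by (auto simp: cyc_all_def)

lemma cyclic_add: "cyclic F \<Longrightarrow> cyclic G \<Longrightarrow> cyclic (F + G)"
  unfolding cyclic_def plus_fun_def by (auto simp: mform_add distrib_left)

lemma cyclic_fscale: "cyclic F \<Longrightarrow> cyclic (fscale c F)"
  unfolding cyclic_def fscale_def by (auto simp: mform_mult)

lemma cyclic_0: "cyclic 0"
  unfolding cyclic_def by auto

lemma cyc_all_0: "0 \<in> cyc_all" and cyc_0: "0 \<in> cyc k"
  by (auto simp: cyc_all_def cyc_def cyclic_0)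

lemma cyc_all_add: "F \<in> cyc_all \<Longrightarrow> G \<in> cyc_all \<Longrightarrow> F + G \<in> cyc_all"
proof -
  assume F: "F \<in> cyc_all" and G: "G \<in> cyc_all"
  obtain n m where "\<And>xs. length xs > n \<Longrightarrow> F xs = 0" "\<And>xs. length xs > m \<Longrightarrow> G xs = 0"
    using F G cyc_allE by metis
  then have "\<forall>xs. length xs > max n m \<longrightarrow> (F + G) xs = 0" by simp
  then show ?thesis using F G cyclic_add unfolding cyc_all_def by blast
qed

lemma cyc_all_fscale: "F \<in> cyc_all \<Longrightarrow> fscale c F \<in> cyc_all"
  by (auto simp: cyc_all_def cyclic_fscale) (auto simp: fscale_def)

lemma cyc_all_sum: "(\<And>i. i \<in> A \<Longrightarrow> F i \<in> cyc_all) \<Longrightarrow> (\<Sum>i\<in>A. F i) \<in> cyc_all"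
  by (induction A rule: infinite_finite_induct) (auto simp: cyc_all_0 cyc_all_add)

lemma cyclic_comp_arity: "cyclic F \<Longrightarrow> cyclic (comp_arity k F)"
proof -
  assume F: "cyclic F"
  then have "mform (comp_arity k F)" by (simp add: cyclic_def mform_comp_arity)
  moreover have "length ds = length xs" if "homog (d # ds) (x # xs)" for d ds x xs
    using length_homog[OF that] by simp
  ultimately show ?thesis using F unfolding cyclic_def by (auto simp: comp_arity_def)
qed

lemma cyc_comp_arity: "cyclic F \<Longrightarrow> comp_arity k F \<in> cyc k"
  by (simp add: cyc_def cyclic_comp_arity) (simp add: comp_arity_def)

lemma sum_comp_arity: "(\<And>xs. length xs > n \<Longrightarrow> F xs = 0) \<Longrightarrow> F = (\<Sum>k\<le>n. comp_arity k F)"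
  by (rule ext) (auto simp: comp_arity_def sum_apply intro: leI)

text \<open>Signs see degrees only modulo 2, and an arbitrary form is a sum of just two forms of
  definite parity (\<open>parity_decomp\<close>). This handles the argument of the Jacobi identity
  that is not assumed to be homogeneous.\<close>

definition parity :: "int \<Rightarrow> ('v, 'k) form \<Rightarrow> bool" where
  "parity d F \<longleftrightarrow> (\<forall>w. hw w \<and> ev F w \<noteq> 0 \<longrightarrow> even (d + wdeg w))"

lemma has_degree_parity: "has_degree d F \<Longrightarrow> parity d F"
  unfolding parity_def has_degree_iff by (metis even_zero)

definition parity_part :: "int \<Rightarrow> ('v, 'k) form \<Rightarrow> ('v, 'k) form" where
  "parity_part p F = mext (\<lambda>ds xs. if even (p + sum_list ds) then F xs else 0)"

lemma mform_if: "mform F \<Longrightarrow> mform (\<lambda>xs. if c then F xs else 0)"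
  by (cases c) auto

lemma ev_parity_part:
  "mform F \<Longrightarrow> hw w \<Longrightarrow> ev (parity_part p F) w = (if even (p + wdeg w) then ev F w else 0)"
  unfolding parity_part_def by (subst ev_mext) (auto simp: mform_if ev_def wdeg_def)

lemma mform_parity_part: "mform F \<Longrightarrow> mform (parity_part p F)"
  unfolding parity_part_def by (intro mform_mext mform_if)

lemma parity_parity_part: "mform F \<Longrightarrow> parity p (parity_part p F)"
  by (auto simp: parity_def ev_parity_part split: if_splits)

lemma cyc_all_parity_part:
  assumes "F \<in> cyc_all"
  shows "parity_part p F \<in> cyc_all"
proof -
  have F: "mform F" "cyclic F" using assms by (simp_all add: cyc_all_mform cyc_all_cyclic)
  have "rot1 (ev (parity_part p F)) w = ev (parity_part p F) w" if "hw w" for w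
  proof -
    have "rot1 (ev (parity_part p F)) w = (if even (p + wdeg w) then rot1 (ev F) w else 0)"
      using that by (cases w) (auto simp: rot1_def ev_parity_part F add.commute)
    then show ?thesis using that F by (simp add: ev_parity_part cyclic_iff)
  qed
  then have "cyclic (parity_part p F)" using F by (simp add: cyclic_iff mform_parity_part)
  moreover obtain n where n: "\<And>xs. length xs > n \<Longrightarrow> F xs = 0" using assms cyc_allE by metis
  have "parity_part p F xs = 0" if "length xs > n" for xs
    unfolding parity_part_def mext_def by (rule sum.neutral) (use that n in auto)
  ultimately show ?thesis unfolding cyc_all_def by blast
qed

lemma parity_decomp:
  assumes "mform F"
  shows "F = parity_part 0 F + parity_part 1 F"
proof
  fix xs
  show "F xs = (parity_part 0 F + parity_part 1 F) xs"
  proof (rule mform_eqI[OF assms])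
    show "mform (parity_part 0 F + parity_part 1 F)"
      unfolding plus_fun_def by (intro mform_add mform_parity_part assms)
    fix w :: "(int \<times> 'v) list" assume "hw w"
    then have "ev F w = ev (parity_part 0 F) w + ev (parity_part 1 F) w"
      by (simp add: ev_parity_part assms)
    then show "ev F w = ev (parity_part 0 F + parity_part 1 F) w"
      by (simp add: ev_def)
  qed
qed


subsection \<open>Dual bases of a non-degenerate form\<close>

lemma linear_sum_scale:
  assumes "Vector_Spaces.linear scale (*) f"
  shows "f (\<Sum>i\<in>A. c i *s x i) = (\<Sum>i\<in>A. c i * f (x i))"
proof -
  have "f 0 = 0" using assms unfolding linear_scalar_iff by (metis mult_zero_left scale_zero_left)
  then show ?thesis
    using assms by (induction A rule: infinite_finite_induct) (simp_all add: linear_scalar_iff)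
qed

lemma nondeg_hcomp:
  assumes b: "nondeg_form b"
  shows "x \<in> gr m \<Longrightarrow> b x z = b x (hcomp (- m) z)" "x \<in> gr m \<Longrightarrow> b z x = b (hcomp (- m) z) x"
proof -
  let ?S = "{n. hcomp n z \<noteq> 0}"
  have fin: "finite ?S" and z: "z = (\<Sum>n\<in>?S. 1 *s hcomp n z)" using hcomp_spec[of z] by simp_all
  have lin: "Vector_Spaces.linear scale (*) (b y)" "Vector_Spaces.linear scale (*) (\<lambda>x. b x y)" for y
    using b by (simp_all add: nondeg_form_def)
  have 0: "b y 0 = 0" "b 0 y = 0" for y
    using linear_sum_scale[OF lin(1), where A = "{}"] linear_sum_scale[OF lin(2), where A = "{}"] by simp_all
  assume x: "x \<in> gr m"
  have orth: "b x (hcomp n z) = 0" "b (hcomp n z) x = 0" if "n \<noteq> - m" for n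
    using b x that hcomp_in[of n z] unfolding nondeg_form_def by (metis add.inverse_unique add.commute)+
  have "b x z = (\<Sum>n\<in>?S. b x (hcomp n z))"
    using linear_sum_scale[OF lin(1)[of x], of "\<lambda>_. 1" "\<lambda>n. hcomp n z" ?S] z by simp
  also have "\<dots> = (\<Sum>n\<in>?S. if n = - m then b x (hcomp (- m) z) else 0)"
    by (rule sum.cong) (auto simp: orth)
  finally show "b x z = b x (hcomp (- m) z)" using fin by (auto simp: 0)
  have "b z x = (\<Sum>n\<in>?S. b (hcomp n z) x)"
    using linear_sum_scale[OF lin(2)[of x], of "\<lambda>_. 1" "\<lambda>n. hcomp n z" ?S] z by simp
  also have "\<dots> = (\<Sum>n\<in>?S. if n = - m then b (hcomp (- m) z) x else 0)"
    by (rule sum.cong) (auto simp: orth)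
  finally show "b z x = b (hcomp (- m) z) x" using fin by (auto simp: 0)
qed

lemma sg_nonzero [simp]: "sg n \<noteq> (0 :: 'k)"
  by (simp add: sg_def)

text \<open>Graded symmetry carries nondegeneracy from one argument to the other, but only for
  homogeneous vectors, so the vanishing is checked component by component.\<close>

lemma nondeg_right:
  assumes b: "nondeg_form b" and z: "\<And>x. b x z = 0"
  shows "z = 0"
proof -
  have lin: "Vector_Spaces.linear scale (*) (b z)" using b by (simp add: nondeg_form_def)
  have gr: "b z x = 0" if x: "x \<in> gr m" for x m
  proof -
    have "b z x = b (hcomp (- m) z) x" by (rule nondeg_hcomp(2)[OF b x])
    also have "\<dots> = sg (- m * m) * b x (hcomp (- m) z)"
      using b x hcomp_in[of "- m" z] unfolding nondeg_form_def by blast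
    also have "\<dots> = 0" using nondeg_hcomp(1)[OF b x, of z] z by simp
    finally show ?thesis .
  qed
  have "b z y = 0" for y
  proof -
    have "b z y = b z (\<Sum>d\<in>degs. 1 *s hcomp (d + 1) y)" by (simp add: hcomp_degs)
    also have "\<dots> = (\<Sum>d\<in>degs. 1 * b z (hcomp (d + 1) y))" by (rule linear_sum_scale[OF lin])
    finally show ?thesis using gr[OF hcomp_in] by simp
  qed
  then show ?thesis using b by (simp add: nondeg_form_def)
qed

end

locale graded_dual = fd_graded_space scale gr
  for scale :: "'k::field_char_0 \<Rightarrow> 'v::ab_group_add \<Rightarrow> 'v" (infixr \<open>*s\<close> 75) and gr :: "int \<Rightarrow> 'v set" +
  fixes b :: "'v \<Rightarrow> 'v \<Rightarrow> 'k" and \<epsilon>s :: "int list" and es es' :: "'v list"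
  assumes nondeg: "nondeg_form b" and dual: "dual_bases b \<epsilon>s es es'"
begin

abbreviation "N \<equiv> length es"
abbreviation "\<epsilon> i \<equiv> \<epsilon>s ! i"
abbreviation "E i \<equiv> (\<epsilon>s ! i, es ! i)"
text \<open>\<open>b\<close> pairs degree m of V only with degree -m. In V[1] the partner of a
  vector of degree e therefore has degree -2 - e; \<open>es'_in\<close> proves it.\<close>

abbreviation "E' i \<equiv> (- 2 - \<epsilon>s ! i, es' ! i)"

lemma blin: "Vector_Spaces.linear scale (*) (b x)" "Vector_Spaces.linear scale (*) (\<lambda>x. b x y)"
  using nondeg by (simp_all add: nondeg_form_def)

lemma b_add: "b (x + y) z = b x z + b y z" "b x (y + z) = b x y + b x z"
  "b (c *s x) z = c * b x z" "b x (c *s z) = c * b x z"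
  using blin by (simp_all add: linear_scalar_iff)

lemma b_diff: "b (x - y) z = b x z - b y z" "b x (y - z) = b x y - b x z"
  by (metis b_add(1) diff_add_cancel add_diff_cancel_right') (metis b_add(2) diff_add_cancel add_diff_cancel_right')

lemma b_dual: "i < N \<Longrightarrow> j < N \<Longrightarrow> b (es ! i) (es' ! j) = (if i = j then 1 else 0)"
  using dual by (simp add: dual_bases_def)

lemma es_in: "i < N \<Longrightarrow> es ! i \<in> gr (\<epsilon> i + 1)"
  using dual by (auto simp: dual_bases_def homog_def list_all2_conv_all_nth)

lemma eq_0_if_orth_es:
  assumes "\<And>i. i < N \<Longrightarrow> b (es ! i) z = 0"
  shows "z = 0"
proof (rule nondeg_right[OF nondeg])
  fix x
  have "subspace {x. b x z = 0}"
    by (rule subspaceI) (use b_add(3)[of 0 0 z] in \<open>simp_all add: b_add\<close>)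
  moreover have "set es \<subseteq> {x. b x z = 0}" using assms by (auto simp: in_set_conv_nth)
  ultimately have "span (set es) \<subseteq> {x. b x z = 0}" by (intro span_minimal)
  then show "b x z = 0" using dual by (auto simp: dual_bases_def)
qed

lemma expand_es': "y = (\<Sum>i<N. b (es ! i) y *s es' ! i)"
proof -
  have "y - (\<Sum>i<N. b (es ! i) y *s es' ! i) = 0"
  proof (rule eq_0_if_orth_es)
    fix j assume j: "j < N"
    have "b (es ! j) (\<Sum>i<N. b (es ! i) y *s es' ! i) = (\<Sum>i<N. b (es ! i) y * b (es ! j) (es' ! i))"
      by (rule linear_sum_scale[OF blin(1)])
    also have "\<dots> = (\<Sum>i<N. if j = i then b (es ! i) y else 0)"
      by (rule sum.cong) (use j in \<open>auto simp: b_dual\<close>)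
    finally show "b (es ! j) (y - (\<Sum>i<N. b (es ! i) y *s es' ! i)) = 0"
      using j by (simp add: b_diff)
  qed
  then show ?thesis by simp
qed

lemma expand_es: "x = (\<Sum>i<N. b x (es' ! i) *s es ! i)"
proof -
  let ?z = "x - (\<Sum>i<N. b x (es' ! i) *s es ! i)"
  have *: "b ?z (es' ! j) = 0" if j: "j < N" for j
  proof -
    have "b (\<Sum>i<N. b x (es' ! i) *s es ! i) (es' ! j) = (\<Sum>i<N. b x (es' ! i) * b (es ! i) (es' ! j))"
      by (rule linear_sum_scale[OF blin(2)])
    also have "\<dots> = (\<Sum>i<N. if j = i then b x (es' ! i) else 0)"
      by (rule sum.cong) (use j in \<open>auto simp: b_dual\<close>)
    finally show ?thesis using j by (simp add: b_diff)
  qed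
  have "b ?z y = 0" for y
  proof -
    have "b ?z (\<Sum>i<N. b (es ! i) y *s es' ! i) = (\<Sum>i<N. b (es ! i) y * b ?z (es' ! i))"
      by (rule linear_sum_scale[OF blin(1)])
    then show ?thesis using * by (simp flip: expand_es')
  qed
  then have "?z = 0" using nondeg unfolding nondeg_form_def by blast
  then show ?thesis by simp
qed

lemma b_orth: "x \<in> gr m \<Longrightarrow> y \<in> gr n \<Longrightarrow> m + n \<noteq> 0 \<Longrightarrow> b x y = 0"
  and b_sym: "x \<in> gr m \<Longrightarrow> y \<in> gr n \<Longrightarrow> b x y = sg (m * n) * b y x"
  using nondeg unfolding nondeg_form_def by blast+

text \<open>The part of es'_i outside the expected degree is orthogonal to every basis vector, hence
  zero.\<close>

lemma es'_in: 
  assumes "i < N"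
  shows "es' ! i \<in> gr (- 2 - \<epsilon> i + 1)"
proof -
  let ?m = "\<epsilon> i + 1"
  have "es' ! i - hcomp (- ?m) (es' ! i) = 0"
  proof (rule eq_0_if_orth_es)
    fix j assume j: "j < N"
    show "b (es ! j) (es' ! i - hcomp (- ?m) (es' ! i)) = 0"
    proof (cases "\<epsilon> j = \<epsilon> i")
      case True
      then show ?thesis using nondeg_hcomp(1)[OF nondeg es_in[OF j], of "es' ! i"] by (simp add: b_diff)
    next
      case False
      then have "b (es ! j) (hcomp (- ?m) (es' ! i)) = 0"
        by (intro b_orth[OF es_in[OF j] hcomp_in]) simp
      moreover have "b (es ! j) (es' ! i) = 0" using False b_dual[OF j assms] by auto
      ultimately show ?thesis by (simp add: b_diff)
    qed
  qed
  then have "es' ! i = hcomp (- ?m) (es' ! i)" by simp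
  then have "es' ! i \<in> gr (- ?m)" by (metis hcomp_in)
  moreover have "- ?m = - 2 - \<epsilon> i + 1" by simp
  ultimately show ?thesis by (simp only:)
qed

text \<open>The weights \<open>wt\<close> absorb signs depending on the parity of the basis vector.\<close>

lemma casimir_swap:
  assumes \<phi>: "\<And>y. Vector_Spaces.linear scale (*) (\<lambda>x. \<phi> x y)" "\<And>x. Vector_Spaces.linear scale (*) (\<phi> x)"
    and wt: "\<And>m n. even (m + n) \<Longrightarrow> wt m = wt n"
  shows "(\<Sum>i<N. wt (\<epsilon> i) * \<phi> (es ! i) (es' ! i)) = - (\<Sum>i<N. sg (\<epsilon> i) * wt (\<epsilon> i) * \<phi> (es' ! i) (es ! i))"
proof -
  have A: "\<phi> (es ! i) (es' ! i) = (\<Sum>k<N. \<Sum>l<N. b (es ! k) (es ! i) * (b (es' ! i) (es' ! l) * \<phi> (es' ! k) (es ! l)))"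
    if "i < N" for i
  proof -
    have "\<phi> (es ! i) (es' ! i) = \<phi> (\<Sum>k<N. b (es ! k) (es ! i) *s es' ! k) (\<Sum>l<N. b (es' ! i) (es' ! l) *s es ! l)"
      by (simp flip: expand_es expand_es')
    also have "\<dots> = (\<Sum>k<N. b (es ! k) (es ! i) * \<phi> (es' ! k) (\<Sum>l<N. b (es' ! i) (es' ! l) *s es ! l))"
      by (rule linear_sum_scale[OF \<phi>(1)])
    also have "\<dots> = (\<Sum>k<N. b (es ! k) (es ! i) * (\<Sum>l<N. b (es' ! i) (es' ! l) * \<phi> (es' ! k) (es ! l)))"
      by (simp only: linear_sum_scale[OF \<phi>(2)])
    finally show ?thesis by (simp only: sum_distrib_left)
  qed
  have B: "wt (\<epsilon> i) * (b (es ! k) (es ! i) * (b (es' ! i) (es' ! l) * z)) =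
      (- sg (\<epsilon> l) * wt (\<epsilon> l) * z) * (b (es' ! l) (es' ! i) * b (es ! k) (es ! i))" if "i < N" "l < N" for i k l z
  proof (cases "\<epsilon> i + \<epsilon> l = - 2")
    case True
    then have "even (\<epsilon> i + \<epsilon> l)" by simp
    then have "wt (\<epsilon> i) = wt (\<epsilon> l)" by (rule wt)
    moreover have "b (es' ! i) (es' ! l) = sg ((- 2 - \<epsilon> i + 1) * (- 2 - \<epsilon> l + 1)) * b (es' ! l) (es' ! i)"
      using that by (intro b_sym es'_in)
    moreover have "sg ((- 2 - \<epsilon> i + 1) * (- 2 - \<epsilon> l + 1)) = (- sg (\<epsilon> l) :: 'k)"
      using \<open>even (\<epsilon> i + \<epsilon> l)\<close> by (simp add: sg_def)
    ultimately show ?thesis by simp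
  next
    case False
    then have "b (es' ! i) (es' ! l) = 0" "b (es' ! l) (es' ! i) = 0"
      using that by (auto intro!: b_orth[OF es'_in es'_in])
    then show ?thesis by simp
  qed
  have C: "(\<Sum>i<N. b (es' ! l) (es' ! i) * b (es ! k) (es ! i)) = (if k = l then 1 else 0)" if "k < N" "l < N" for k l
  proof -
    have "(\<Sum>i<N. b (es' ! l) (es' ! i) * b (es ! k) (es ! i)) = b (es ! k) (\<Sum>i<N. b (es' ! l) (es' ! i) *s es ! i)"
      by (rule linear_sum_scale[OF blin(1), symmetric])
    then show ?thesis using that by (simp add: b_dual flip: expand_es)
  qed
  have "(\<Sum>i<N. wt (\<epsilon> i) * \<phi> (es ! i) (es' ! i)) =
      (\<Sum>i<N. \<Sum>k<N. \<Sum>l<N. (- sg (\<epsilon> l) * wt (\<epsilon> l) * \<phi> (es' ! k) (es ! l)) * (b (es' ! l) (es' ! i) * b (es ! k) (es ! i)))"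
    by (rule sum.cong[OF refl]) (simp add: A sum_distrib_left B)
  also have "\<dots> = (\<Sum>k<N. \<Sum>l<N. \<Sum>i<N. (- sg (\<epsilon> l) * wt (\<epsilon> l) * \<phi> (es' ! k) (es ! l)) * (b (es' ! l) (es' ! i) * b (es ! k) (es ! i)))"
    by (subst sum.swap) (intro sum.cong refl sum.swap)
  also have "\<dots> = (\<Sum>k<N. \<Sum>l<N. if k = l then - sg (\<epsilon> l) * wt (\<epsilon> l) * \<phi> (es' ! k) (es ! l) else 0)"
    unfolding sum_distrib_left[symmetric] by (intro sum.cong refl) (simp add: C)
  also have "\<dots> = - (\<Sum>i<N. sg (\<epsilon> i) * wt (\<epsilon> i) * \<phi> (es' ! i) (es ! i))"
    by (simp add: sum_negf)
  finally show ?thesis .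
qed

text \<open>The Casimir tensor, the sum of the es_i tensor es'_i, is the same for all dual bases.
  The weights survive the change of basis because \<open>b\<close> pairs es_i with fs'_j only if
  es_i and fs_j have equal degrees.\<close>

lemma casimir_indep:
  assumes "graded_dual scale gr b \<delta>s fs fs'"
    and \<phi>: "\<And>y. Vector_Spaces.linear scale (*) (\<lambda>x. \<phi> x y)" "\<And>x. Vector_Spaces.linear scale (*) (\<phi> x)"
  shows "(\<Sum>i<N. wt (\<epsilon> i) * \<phi> (es ! i) (es' ! i)) = (\<Sum>j<length fs. wt (\<delta>s ! j) * \<phi> (fs ! j) (fs' ! j))"
proof -
  interpret f: graded_dual scale gr b \<delta>s fs fs' by fact
  have A: "\<phi> (es ! i) (es' ! i) = (\<Sum>j<length fs. b (es ! i) (fs' ! j) * \<phi> (fs ! j) (es' ! i))" for i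
  proof -
    have "\<phi> (\<Sum>j<length fs. b (es ! i) (fs' ! j) *s fs ! j) (es' ! i) = (\<Sum>j<length fs. b (es ! i) (fs' ! j) * \<phi> (fs ! j) (es' ! i))"
      by (rule linear_sum_scale[OF \<phi>(1)])
    then show ?thesis by (simp flip: f.expand_es)
  qed
  have B: "wt (\<epsilon> i) * b (es ! i) (fs' ! j) = wt (\<delta>s ! j) * b (es ! i) (fs' ! j)" if "i < N" "j < length fs" for i j
    using b_orth[OF es_in[OF that(1)] f.es'_in[OF that(2)]] by (cases "\<epsilon> i = \<delta>s ! j") auto
  have "(\<Sum>i<N. wt (\<epsilon> i) * \<phi> (es ! i) (es' ! i)) =
      (\<Sum>i<N. \<Sum>j<length fs. wt (\<delta>s ! j) * (b (es ! i) (fs' ! j) * \<phi> (fs ! j) (es' ! i)))"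
    unfolding A sum_distrib_left
    by (intro sum.cong refl) (simp add: B mult.assoc[symmetric])
  also have "\<dots> = (\<Sum>j<length fs. wt (\<delta>s ! j) * (\<Sum>i<N. b (es ! i) (fs' ! j) * \<phi> (fs ! j) (es' ! i)))"
    by (subst sum.swap) (simp add: sum_distrib_left)
  also have "\<dots> = (\<Sum>j<length fs. wt (\<delta>s ! j) * \<phi> (fs ! j) (fs' ! j))"
  proof (intro sum.cong refl)
    fix j
    have "\<phi> (fs ! j) (\<Sum>i<N. b (es ! i) (fs' ! j) *s es' ! i) = (\<Sum>i<N. b (es ! i) (fs' ! j) * \<phi> (fs ! j) (es' ! i))"
      by (rule linear_sum_scale[OF \<phi>(2)])
    then show "wt (\<delta>s ! j) * (\<Sum>i<N. b (es ! i) (fs' ! j) * \<phi> (fs ! j) (es' ! i)) = wt (\<delta>s ! j) * \<phi> (fs ! j) (fs' ! j)"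
      by (simp flip: expand_es')
  qed
  finally show ?thesis .
qed


subsection \<open>The bracket of a non-degenerate form\<close>

text \<open>All cuts are summed because a form may have components of several arities; for a form of
  arity k + 1 only the cut after k letters survives (\<open>contraction_eq_brk\<close>). The sign is
  that of \<open>contraction\<close>, written with the degrees of the two pieces.\<close>

definition ctr :: "((int \<times> 'v) list \<Rightarrow> 'k) \<Rightarrow> ((int \<times> 'v) list \<Rightarrow> 'k) \<Rightarrow> (int \<times> 'v) list \<Rightarrow> 'k" where
  "ctr f g = dec (\<lambda>u v. \<Sum>i<N. sg ((\<epsilon> i + wdeg v) * (\<epsilon> i + wdeg u) + \<epsilon> i * wdeg u) * (f (E i # u) * g (E' i # v)))"

definition ctrf :: "('v, 'k) form \<Rightarrow> ('v, 'k) form \<Rightarrow> ('v, 'k) form" where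
  "ctrf F G = mext (\<lambda>ds xs. \<Sum>r\<le>length xs. \<Sum>i<N.
     sg ((\<epsilon> i + sum_list (drop r ds)) * (\<epsilon> i + sum_list (take r ds)) + \<epsilon> i * sum_list (take r ds)) *
       (F (es ! i # take r xs) * G (es' ! i # drop r xs)))"

text \<open>The value 0 off \<open>cyc_all\<close> is the one prescribed by
  \<open>pinczon_bracket\<close>.\<close>

definition brk :: "('v, 'k) form \<Rightarrow> ('v, 'k) form \<Rightarrow> ('v, 'k) form" where
  "brk F G = (if F \<in> cyc_all \<and> G \<in> cyc_all then Cycl (ctrf F G) else 0)"

lemma mform_ctrf_summand:
  assumes "mform F" "mform G"
  shows "mform (\<lambda>xs. \<Sum>r\<le>length xs. \<Sum>i<N. (c r i :: 'k) * (F (es ! i # take r xs) * G (es' ! i # drop r xs)))"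
  by (rule mform_sum_length[of "\<lambda>n. {..n}" "\<lambda>r xs. \<Sum>i<N. c r i * (F (es ! i # take r xs) * G (es' ! i # drop r xs))"])
     (intro mform_sum mform_mult mform_take_drop[of "\<lambda>xs. F (es ! i # xs)" "\<lambda>xs. G (es' ! i # xs)" for i] mform_Cons assms)

lemma mform_ctrf: "mform F \<Longrightarrow> mform G \<Longrightarrow> mform (ctrf F G)"
  unfolding ctrf_def by (intro mform_mext mform_ctrf_summand)

lemma ev_ctrf: "mform F \<Longrightarrow> mform G \<Longrightarrow> hw w \<Longrightarrow> ev (ctrf F G) w = ctr (ev F) (ev G) w"
  unfolding ctrf_def ctr_def dec_conv
  by (subst ev_mext, rule mform_ctrf_summand) (simp_all add: ev_def wdeg_def take_map drop_map)

lemma hw_E [simp]: "i < N \<Longrightarrow> hw (E i # u) \<longleftrightarrow> hw u" "i < N \<Longrightarrow> hw (E' i # u) \<longleftrightarrow> hw u"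
  using es_in es'_in by simp_all

lemma rot_cong_hw:
  assumes "\<And>z. hw z \<Longrightarrow> length z = length w \<Longrightarrow> wdeg z = wdeg w \<Longrightarrow> \<phi> z = \<phi>' z" "hw w"
  shows "rot \<phi> w = rot \<phi>' w"
  by (rule rot_cong) (use assms in \<open>auto intro!: assms(1)\<close>)

lemma ev_brk: "F \<in> cyc_all \<Longrightarrow> G \<in> cyc_all \<Longrightarrow> hw w \<Longrightarrow> ev (brk F G) w = rot (ctr (ev F) (ev G)) w"
  by (auto simp: brk_def ev_Cycl mform_ctrf cyc_all_mform ev_ctrf intro!: rot_cong_hw)

lemma cyclic_brk: "cyclic (brk F G)"
  by (simp add: brk_def cyclic_0 cyclic_Cycl mform_ctrf cyc_all_mform)

lemma mform_brk: "mform (brk F G)"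
  using cyclic_brk by (simp add: cyclic_def)

lemma brk_eqI:
  assumes "mform H" "\<And>w. hw w \<Longrightarrow> ev (brk F G) w = ev H w"
  shows "brk F G = H"
  by (rule ext, rule mform_eqI[OF mform_brk assms(1)]) (use assms in auto)

lemma ctr_eq_0:
  assumes "\<And>u v i. w = u @ v \<Longrightarrow> i < N \<Longrightarrow> f (E i # u) = 0 \<or> g (E' i # v) = 0"
  shows "ctr f g w = 0"
proof -
  have "ctr f g w = dec (\<lambda>u v. 0) w"
    unfolding ctr_def by (rule dec_cong) (use assms in \<open>force intro!: sum.neutral\<close>)
  then show ?thesis by simp
qed

lemma rot_0 [simp]: "rot (\<lambda>_. 0) w = 0"
  by (simp add: rot_conv)

text \<open>The common support argument behind the statements on arity, degree and parity of a
  bracket: rotations preserve length and total degree, so vanishing is checked cut by cut.\<close>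

lemma brk_eq_0:
  assumes F: "F \<in> cyc_all" "G \<in> cyc_all" "hw w"
    and "\<And>u v i. hw u \<Longrightarrow> hw v \<Longrightarrow> wdeg u + wdeg v = wdeg w \<Longrightarrow> length u + length v = length w \<Longrightarrow> i < N \<Longrightarrow>
      ev F (E i # u) = 0 \<or> ev G (E' i # v) = 0"
  shows "ev (brk F G) w = 0"
proof -
  have "rot (ctr (ev F) (ev G)) w = rot (\<lambda>_. 0) w"
    by (rule rot_cong_hw[OF _ \<open>hw w\<close>], rule ctr_eq_0) (use assms in auto)
  then show ?thesis using assms by (simp add: ev_brk)
qed

lemma brk_arity:
  assumes "F \<in> cyc_all" "G \<in> cyc_all"
    "\<And>u v :: 'v list. length u + length v = length xs + 2 \<Longrightarrow> u \<noteq> [] \<Longrightarrow> v \<noteq> [] \<Longrightarrow> F u = 0 \<or> G v = 0"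
  shows "brk F G xs = 0"
proof -
  have "brk F G xs = (0 :: ('v, 'k) form) xs"
  proof (rule mform_eqI[OF mform_brk])
    fix w :: "(int \<times> 'v) list" assume "hw w" "length w = length xs"
    then show "ev (brk F G) w = ev 0 w"
      using assms by (subst brk_eq_0) (auto simp: ev_def intro!: assms(3))
  qed auto
  then show ?thesis by simp
qed

lemma brk_cyc: "F \<in> cyc (k + 1) \<Longrightarrow> G \<in> cyc (k' + 1) \<Longrightarrow> brk F G \<in> cyc (k + k')"
  unfolding cyc_def[of "k + k'"]
proof (intro CollectI conjI allI impI cyclic_brk)
  fix xs :: "'v list" assume F: "F \<in> cyc (k + 1)" and G: "G \<in> cyc (k' + 1)" and len: "length xs \<noteq> k + k'"
  show "brk F G xs = 0"
  proof (rule brk_arity)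
    fix u v :: "'v list" assume "length u + length v = length xs + 2"
    then have "length u \<noteq> k + 1 \<or> length v \<noteq> k' + 1" using len by linarith
    then show "F u = 0 \<or> G v = 0" using cyc_arity[OF F] cyc_arity[OF G] by blast
  qed (use F G cyc_subset in auto)
qed

lemma brk_cyc_all: "brk F G \<in> cyc_all"
proof (cases "F \<in> cyc_all \<and> G \<in> cyc_all")
  case True
  obtain n m where n: "\<And>xs. length xs > n \<Longrightarrow> F xs = 0" and m: "\<And>xs. length xs > m \<Longrightarrow> G xs = 0"
    using True cyc_allE by metis
  have "brk F G xs = 0" if "length xs > n + m" for xs
  proof (rule brk_arity)
    fix u v :: "'v list" assume "length u + length v = length xs + 2"
    then have "length u > n \<or> length v > m" using that by linarith
    then show "F u = 0 \<or> G v = 0" using n m by blast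
  qed (use True in auto)
  then show ?thesis using cyclic_brk unfolding cyc_all_def by blast
next
  case False
  then have "brk F G = 0" by (simp only: brk_def if_False)
  then show ?thesis by (simp add: cyc_all_0)
qed

lemma ctr_add: "ctr (\<lambda>w. f w + f' w) g w = ctr f g w + ctr f' g w" "ctr f (\<lambda>w. g w + g' w) w = ctr f g w + ctr f g' w"
  by (simp_all add: ctr_def algebra_simps sum.distrib dec_add)

lemma ctr_mult: "ctr (\<lambda>w. c * f w) g w = c * ctr f g w" "ctr f (\<lambda>w. c * g w) w = c * ctr f g w"
  by (simp_all add: ctr_def dec_mult[symmetric] sum_distrib_left mult_ac)

lemma ev_add: "ev (F + G) = (\<lambda>w. ev F w + ev G w)" and ev_fscale: "ev (fscale c F) = (\<lambda>w. c * ev F w)"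
  by (auto simp: ev_def fscale_def)

lemma mform_plus: "mform F \<Longrightarrow> mform G \<Longrightarrow> mform (F + G)" and mform_fscale: "mform F \<Longrightarrow> mform (fscale c F)"
  unfolding plus_fun_def fscale_def by (auto intro: mform_add mform_mult)

lemma brk_add_left: "F \<in> cyc_all \<Longrightarrow> F' \<in> cyc_all \<Longrightarrow> G \<in> cyc_all \<Longrightarrow> brk (F + F') G = brk F G + brk F' G"
  and brk_add_right: "F \<in> cyc_all \<Longrightarrow> G \<in> cyc_all \<Longrightarrow> G' \<in> cyc_all \<Longrightarrow> brk F (G + G') = brk F G + brk F G'"
  and brk_fscale_left: "F \<in> cyc_all \<Longrightarrow> G \<in> cyc_all \<Longrightarrow> brk (fscale c F) G = fscale c (brk F G)"
  and brk_fscale_right: "F \<in> cyc_all \<Longrightarrow> G \<in> cyc_all \<Longrightarrow> brk F (fscale c G) = fscale c (brk F G)"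
  by (rule brk_eqI; simp add: mform_plus mform_fscale mform_brk ev_brk cyc_all_add cyc_all_fscale ev_add ev_fscale
      ctr_add[abs_def] ctr_mult[abs_def] rot_add rot_mult)+

lemma bilinear_brk: "bilinear_bracket brk"
  by (simp add: bilinear_bracket_def flinear_on_def brk_add_left brk_add_right brk_fscale_left brk_fscale_right)

lemma brk_degree:
  assumes "F \<in> cyc_all" "G \<in> cyc_all" "has_degree d F" "has_degree d' G"
  shows "has_degree (d + d' - 2) (brk F G)"
  unfolding has_degree_iff
proof (intro allI impI, rule ccontr)
  fix w :: "(int \<times> 'v) list" assume w: "hw w \<and> ev (brk F G) w \<noteq> 0" and neq: "d + d' - 2 + wdeg w \<noteq> 0"
  have "ev (brk F G) w = 0"
  proof (rule brk_eq_0)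
    fix u v i assume h: "hw u" "hw v" "wdeg u + wdeg v = wdeg w" "i < N"
    have "ev F (E i # u) \<noteq> 0 \<longrightarrow> d + wdeg (E i # u) = 0" "ev G (E' i # v) \<noteq> 0 \<longrightarrow> d' + wdeg (E' i # v) = 0"
      using assms(3,4) h unfolding has_degree_iff by (metis hw_E)+
    then show "ev F (E i # u) = 0 \<or> ev G (E' i # v) = 0" using neq h(3) by auto
  qed (use assms w in auto)
  then show False using w by simp
qed

lemma brk_parity:
  assumes "F \<in> cyc_all" "G \<in> cyc_all" "parity d F" "parity d' G"
  shows "parity (d + d') (brk F G)"
  unfolding parity_def
proof (intro allI impI, rule ccontr)
  fix w :: "(int \<times> 'v) list" assume w: "hw w \<and> ev (brk F G) w \<noteq> 0" and neq: "odd (d + d' + wdeg w)"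
  have "ev (brk F G) w = 0"
  proof (rule brk_eq_0)
    fix u v i assume h: "hw u" "hw v" "wdeg u + wdeg v = wdeg w" "i < N"
    have "ev F (E i # u) \<noteq> 0 \<longrightarrow> even (d + wdeg (E i # u))" "ev G (E' i # v) \<noteq> 0 \<longrightarrow> even (d' + wdeg (E' i # v))"
      using assms(3,4) h unfolding parity_def by (metis hw_E)+
    then show "ev F (E i # u) = 0 \<or> ev G (E' i # v) = 0" using neq h(3)[symmetric] by auto
  qed (use assms w in auto)
  then show False using w by simp
qed

end

text \<open>Two signs need to agree only where the factor is nonzero; there the degree conditions on
  the forms involved become available.\<close>

lemma sg_cong: "(X \<noteq> 0 \<Longrightarrow> even (p + q)) \<Longrightarrow> sg p * X = sg q * (X :: 'k::comm_ring_1)"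
  by (cases "X = 0") (auto simp: sg_def)

lemma dec_append_args: "dec (\<lambda>u v. g (u @ v)) w = of_nat (length w + 1) * g w"
  by (simp add: dec_conv)

context graded_dual
begin

lemma casimir_words:
  assumes "mform F" "mform G" and wt: "\<And>m n. even (m + n) \<Longrightarrow> wt m = wt n"
  shows "(\<Sum>i<N. wt (\<epsilon> i) * (ev F (u @ E i # u') * ev G (v @ E' i # v'))) =
    - (\<Sum>i<N. sg (\<epsilon> i) * wt (\<epsilon> i) * (ev F (u @ E' i # u') * ev G (v @ E i # v')))"
proof -
  let ?\<phi> = "\<lambda>x y. F (map snd u @ x # map snd u') * G (map snd v @ y # map snd v')"
  have "(\<Sum>i<N. wt (\<epsilon> i) * ?\<phi> (es ! i) (es' ! i)) = - (\<Sum>i<N. sg (\<epsilon> i) * wt (\<epsilon> i) * ?\<phi> (es' ! i) (es ! i))"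
    by (rule casimir_swap[OF _ _ wt])
       (auto simp: linear_scalar_iff mform_addD mform_scaleD assms algebra_simps)
  then show ?thesis by (simp add: ev_def)
qed

text \<open>Rotation allows the two pieces to be exchanged, and \<open>casimir_words\<close>
  exchanges the two dual bases at the cost of a minus sign, which is the antisymmetry. The remaining
  signs depend only on the parities of the two forms.\<close>

lemma rot_ctr_antisym:
  assumes F: "F \<in> cyc_all" "parity d F" and G: "G \<in> cyc_all" "parity d' G" and w: "hw w"
  shows "rot (ctr (ev F) (ev G)) w = - (sg (d * d') * rot (ctr (ev G) (ev F)) w)"
proof -
  have "rot (ctr (ev F) (ev G)) w = rot (dec (\<lambda>u v. sg (wdeg u * wdeg v) * (\<Sum>i<N.
      sg ((\<epsilon> i + wdeg u) * (\<epsilon> i + wdeg v) + \<epsilon> i * wdeg v) * (ev F (E i # v) * ev G (E' i # u))))) w"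
    unfolding ctr_def by (rule rot_dec_swap)
  also have "\<dots> = rot (\<lambda>z. - sg (d * d') * ctr (ev G) (ev F) z) w"
  proof (rule rot_cong_hw[OF _ w], unfold ctr_def dec_mult[symmetric], rule dec_cong)
    fix z u v assume z: "hw z" "z = u @ v"
    let ?wt = "\<lambda>n. sg ((n + wdeg u) * (n + wdeg v) + n * wdeg v) :: 'k"
    have cas: "(\<Sum>i<N. ?wt (\<epsilon> i) * (ev F (E i # v) * ev G (E' i # u))) =
        - (\<Sum>i<N. sg (\<epsilon> i) * ?wt (\<epsilon> i) * (ev F (E' i # v) * ev G (E i # u)))"
      using casimir_words[OF cyc_all_mform[OF F(1)] cyc_all_mform[OF G(1)], of ?wt "[]" v "[]" u]
      by (auto simp: sg_def)
    have tw: "sg (wdeg u * wdeg v) * (sg (\<epsilon> i) * ?wt (\<epsilon> i) * (ev F (E' i # v) * ev G (E i # u))) =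
       sg (d * d') * (sg ((\<epsilon> i + wdeg v) * (\<epsilon> i + wdeg u) + \<epsilon> i * wdeg u) * (ev G (E i # u) * ev F (E' i # v)))"
      if i: "i < N" for i
    proof (cases "ev F (E' i # v) = 0 \<or> ev G (E i # u) = 0")
      case False
      then have "even (d + wdeg (E' i # v))" "even (d' + wdeg (E i # u))"
        using F(2) G(2) z i unfolding parity_def by (metis hw_E hw_simps(3))+
      then have "sg (wdeg u * wdeg v) * (sg (\<epsilon> i) * ?wt (\<epsilon> i)) =
          sg (d * d') * (sg ((\<epsilon> i + wdeg v) * (\<epsilon> i + wdeg u) + \<epsilon> i * wdeg u) :: 'k)"
        unfolding sg_add[symmetric] by (intro sg_eqI) (auto simp: even_mult_iff)
      then show ?thesis by (simp add: mult.assoc[symmetric] mult.commute[of "ev G _"])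
    qed auto
    show "sg (wdeg u * wdeg v) * (\<Sum>i<N. sg ((\<epsilon> i + wdeg u) * (\<epsilon> i + wdeg v) + \<epsilon> i * wdeg v) *
          (ev F (E i # v) * ev G (E' i # u))) =
       - sg (d * d') * (\<Sum>i<N. sg ((\<epsilon> i + wdeg v) * (\<epsilon> i + wdeg u) + \<epsilon> i * wdeg u) *
          (ev G (E i # u) * ev F (E' i # v)))"
      unfolding cas mult_minus_right mult_minus_left sum_distrib_left sum_negf
      by (intro arg_cong[of _ _ uminus] sum.cong refl, rule tw, simp)
  qed
  also have "\<dots> = - sg (d * d') * rot (ctr (ev G) (ev F)) w" by (rule rot_mult)
  finally show ?thesis by simp
qed

lemma brk_antisym:
  assumes "F \<in> cyc_all" "parity d F" "G \<in> cyc_all" "parity d' G"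
  shows "brk F G = fscale (- sg (d * d')) (brk G F)"
proof (rule brk_eqI)
  fix w :: "(int \<times> 'v) list" assume w: "hw w"
  show "ev (brk F G) w = ev (fscale (- sg (d * d')) (brk G F)) w"
    unfolding ev_fscale ev_brk[OF assms(1,3) w] ev_brk[OF assms(3,1) w] rot_ctr_antisym[OF assms w] by simp
qed (simp add: mform_fscale mform_brk)


subsection \<open>The Jacobi identity\<close>

text \<open>In order, modulo 2: the sign of the outer contraction, of the rotation that brings u4 to
  the front, of the inner contraction, and of the cyclic move inside the middle form. The letters p,
  q, r, s are the degrees of the four words and e, f those of the two basis vectors.\<close>

definition sgM :: "int \<Rightarrow> int \<Rightarrow> int \<Rightarrow> int \<Rightarrow> int \<Rightarrow> int \<Rightarrow> int" where
  "sgM e f p q r s = (e + q + r + s) * (e + p) + e * p + s * (e + q + r) + (f + r) * (f + s + e + q) +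
     f * (s + e + q) + (f + s) * (e + q)"

definition T where
  "T f g h u1 u2 u3 u4 = (\<Sum>i<N. \<Sum>j<N. sg (sgM (\<epsilon> i) (\<epsilon> j) (wdeg u1) (wdeg u2) (wdeg u3) (wdeg u4)) *
     (f (E i # u1) * (g (E' i # u2 @ E j # u4) * h (E' j # u3)) :: 'k))"

text \<open>The terms of an iterated bracket in which \<open>g\<close> is contracted with both \<open>f\<close> and \<open>h\<close>; the
  Jacobi identity expresses that each such term comes from two of the three double brackets.\<close>

definition M where
  "M f g h = rot (dec (\<lambda>x y. dec (\<lambda>u1 u2. dec (\<lambda>u3 u4. T f g h u1 u2 u3 u4) y) x))"

text \<open>By \<open>rot_dec_Cons\<close> the vector fed into the inner bracket lands in the piece
  of \<open>G\<close> or in that of \<open>H\<close>, and the form that receives it becomes the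
  middle one of a chain of two contractions.\<close>

lemma brk_brk:
  assumes F: "F \<in> cyc_all" and G: "G \<in> cyc_all" "parity dG G" and H: "H \<in> cyc_all" "parity dH H" and w: "hw w"
  shows "ev (brk F (brk G H)) w = M (ev F) (ev G) (ev H) w - sg (dG * dH) * M (ev F) (ev H) (ev G) w"
proof -
  let ?f = "ev F" and ?g = "ev G" and ?h = "ev H" and ?c = "sg (dG * dH) :: 'k"
  have inner: "(\<Sum>i<N. sg ((\<epsilon> i + wdeg (u2 @ u3 @ u4)) * (\<epsilon> i + wdeg u1) + \<epsilon> i * wdeg u1) * (?f (E i # u1) *
      (sg (wdeg u4 * (fst (E' i) + wdeg u2 + wdeg u3)) *
         (\<Sum>j<N. sg ((\<epsilon> j + wdeg u3) * (\<epsilon> j + wdeg (u4 @ E' i # u2)) + \<epsilon> j * wdeg (u4 @ E' i # u2)) *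
            (?g (E j # u4 @ E' i # u2) * ?h (E' j # u3))) +
       sg ((wdeg u3 + wdeg u4) * (fst (E' i) + wdeg u2)) *
         (\<Sum>j<N. sg ((\<epsilon> j + wdeg (u4 @ E' i # u2)) * (\<epsilon> j + wdeg u3) + \<epsilon> j * wdeg u3) *
            (?g (E j # u3) * ?h (E' j # u4 @ E' i # u2)))))) =
      T ?f ?g ?h u1 u2 u3 u4 - ?c * T ?f ?h ?g u1 u2 u3 u4" (is "sum ?L _ = _")
    if hw: "hw u1" "hw u2" "hw u3" "hw u4" for u1 u2 u3 u4
  proof -
    let ?p = "wdeg u1" and ?q = "wdeg u2" and ?r = "wdeg u3" and ?s = "wdeg u4"
    let ?S1 = "\<lambda>i. sg ((\<epsilon> i + (?q + (?r + ?s))) * (\<epsilon> i + ?p) + \<epsilon> i * ?p) :: 'k"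
    \<comment> \<open>The vector es'_i landed in the piece of \<open>G\<close>; cyclicity of
      \<open>G\<close> brings it to the front.\<close>
    have A: "?S1 i * (?f (E i # u1) * (sg (?s * (- 2 - \<epsilon> i + ?q + ?r)) *
         (\<Sum>j<N. sg ((\<epsilon> j + ?r) * (\<epsilon> j + (?s + (- 2 - \<epsilon> i + ?q))) + \<epsilon> j * (?s + (- 2 - \<epsilon> i + ?q))) *
            (?g (E j # u4 @ E' i # u2) * ?h (E' j # u3))))) =
       (\<Sum>j<N. sg (sgM (\<epsilon> i) (\<epsilon> j) ?p ?q ?r ?s) * (?f (E i # u1) * (?g (E' i # u2 @ E j # u4) * ?h (E' j # u3))))"
      if i: "i < N" for i
    proof -
      have tw: "?S1 i * (?f (E i # u1) * (sg (?s * (- 2 - \<epsilon> i + ?q + ?r)) *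
         (sg ((\<epsilon> j + ?r) * (\<epsilon> j + (?s + (- 2 - \<epsilon> i + ?q))) + \<epsilon> j * (?s + (- 2 - \<epsilon> i + ?q))) *
            (?g (E j # u4 @ E' i # u2) * ?h (E' j # u3))))) =
        sg (sgM (\<epsilon> i) (\<epsilon> j) ?p ?q ?r ?s) * (?f (E i # u1) * (?g (E' i # u2 @ E j # u4) * ?h (E' j # u3)))"
        if j: "j < N" for j
      proof -
        have "?g ((E j # u4) @ (E' i # u2)) = sg (wdeg (E j # u4) * wdeg (E' i # u2)) * ?g ((E' i # u2) @ (E j # u4))"
          by (rule cyclic_append[OF cyc_all_cyclic[OF G(1)]]) (use hw i j in \<open>simp_all del: hw_simps(2)\<close>)
        then have g: "?g (E j # u4 @ E' i # u2) = sg ((\<epsilon> j + ?s) * (- 2 - \<epsilon> i + ?q)) * ?g (E' i # u2 @ E j # u4)"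
          by simp
        \<comment> \<open>Both exponents are polynomials in the degrees, so their congruence modulo
          2 is a propositional statement about parities.\<close>
        have sgn: "?S1 i * (sg (?s * (- 2 - \<epsilon> i + ?q + ?r)) *
          (sg ((\<epsilon> j + ?r) * (\<epsilon> j + (?s + (- 2 - \<epsilon> i + ?q))) + \<epsilon> j * (?s + (- 2 - \<epsilon> i + ?q))) *
            sg ((\<epsilon> j + ?s) * (- 2 - \<epsilon> i + ?q)))) = sg (sgM (\<epsilon> i) (\<epsilon> j) ?p ?q ?r ?s)"
          unfolding sg_add[symmetric] sgM_def by (intro sg_eqI) (simp, argo?)
        have tw: "?S1 i * (?f (E i # u1) * (sg (?s * (- 2 - \<epsilon> i + ?q + ?r)) *
         (sg ((\<epsilon> j + ?r) * (\<epsilon> j + (?s + (- 2 - \<epsilon> i + ?q))) + \<epsilon> j * (?s + (- 2 - \<epsilon> i + ?q))) *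
            (?g (E j # u4 @ E' i # u2) * ?h (E' j # u3))))) =
          (?S1 i * (sg (?s * (- 2 - \<epsilon> i + ?q + ?r)) *
          (sg ((\<epsilon> j + ?r) * (\<epsilon> j + (?s + (- 2 - \<epsilon> i + ?q))) + \<epsilon> j * (?s + (- 2 - \<epsilon> i + ?q))) *
            sg ((\<epsilon> j + ?s) * (- 2 - \<epsilon> i + ?q))))) * (?f (E i # u1) * (?g (E' i # u2 @ E j # u4) * ?h (E' j # u3)))"
          unfolding g by (simp only: mult_ac)
        then show ?thesis unfolding sgn .
      qed
      show ?thesis unfolding sum_distrib_left by (intro sum.cong refl, rule tw) simp
    qed
    \<comment> \<open>The vector es'_i landed in the piece of \<open>H\<close>. Exchanging the inner
      dual bases gives \<open>G\<close> and \<open>H\<close> each other's roles, hence the minus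
      sign and the factor from their parities.\<close>
    have B: "?S1 i * (?f (E i # u1) * (sg ((?r + ?s) * (- 2 - \<epsilon> i + ?q)) *
         (\<Sum>j<N. sg ((\<epsilon> j + (?s + (- 2 - \<epsilon> i + ?q))) * (\<epsilon> j + ?r) + \<epsilon> j * ?r) *
            (?g (E j # u3) * ?h (E' j # u4 @ E' i # u2))))) =
       - (?c * (\<Sum>j<N. sg (sgM (\<epsilon> i) (\<epsilon> j) ?p ?q ?r ?s) * (?f (E i # u1) * (?h (E' i # u2 @ E j # u4) * ?g (E' j # u3)))))"
      if i: "i < N" for i
    proof -
      let ?wt = "\<lambda>n. sg ((n + (?s + (- 2 - \<epsilon> i + ?q))) * (n + ?r) + n * ?r) :: 'k"
      have cas: "(\<Sum>j<N. ?wt (\<epsilon> j) * (?g (E j # u3) * ?h (E' j # u4 @ E' i # u2))) =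
        - (\<Sum>j<N. sg (\<epsilon> j) * ?wt (\<epsilon> j) * (?g (E' j # u3) * ?h (E j # u4 @ E' i # u2)))"
        using casimir_words[OF cyc_all_mform[OF G(1)] cyc_all_mform[OF H(1)], of ?wt "[]" u3 "[]" "u4 @ E' i # u2"]
        by (auto simp: sg_def)
      have tw: "?S1 i * (?f (E i # u1) * (sg ((?r + ?s) * (- 2 - \<epsilon> i + ?q)) *
         (sg (\<epsilon> j) * ?wt (\<epsilon> j) * (?g (E' j # u3) * ?h (E j # u4 @ E' i # u2))))) =
         ?c * (sg (sgM (\<epsilon> i) (\<epsilon> j) ?p ?q ?r ?s) * (?f (E i # u1) * (?h (E' i # u2 @ E j # u4) * ?g (E' j # u3))))"
        if j: "j < N" for j
      proof -
        have "?h ((E j # u4) @ (E' i # u2)) = sg (wdeg (E j # u4) * wdeg (E' i # u2)) * ?h ((E' i # u2) @ (E j # u4))"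
          by (rule cyclic_append[OF cyc_all_cyclic[OF H(1)]]) (use hw i j in \<open>simp_all del: hw_simps(2)\<close>)
        then have h: "?h (E j # u4 @ E' i # u2) = sg ((\<epsilon> j + ?s) * (- 2 - \<epsilon> i + ?q)) * ?h (E' i # u2 @ E j # u4)"
          by simp
        show ?thesis
        proof (cases "?g (E' j # u3) = 0 \<or> ?h (E' i # u2 @ E j # u4) = 0")
          case False
          then have "even (dG + wdeg (E' j # u3))" "even (dH + wdeg (E' i # u2 @ E j # u4))"
            using G(2) H(2) hw i j unfolding parity_def by (metis hw_E hw_simps(3))+
          then have sgn: "?S1 i * (sg ((?r + ?s) * (- 2 - \<epsilon> i + ?q)) * (sg (\<epsilon> j) * (?wt (\<epsilon> j) *
             sg ((\<epsilon> j + ?s) * (- 2 - \<epsilon> i + ?q))))) = ?c * sg (sgM (\<epsilon> i) (\<epsilon> j) ?p ?q ?r ?s)"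
            unfolding sg_add[symmetric] sgM_def by (intro sg_eqI) (simp, argo?)
          have "?S1 i * (?f (E i # u1) * (sg ((?r + ?s) * (- 2 - \<epsilon> i + ?q)) *
            (sg (\<epsilon> j) * ?wt (\<epsilon> j) * (?g (E' j # u3) * ?h (E j # u4 @ E' i # u2))))) =
            (?S1 i * (sg ((?r + ?s) * (- 2 - \<epsilon> i + ?q)) * (sg (\<epsilon> j) * (?wt (\<epsilon> j) *
             sg ((\<epsilon> j + ?s) * (- 2 - \<epsilon> i + ?q)))))) * (?f (E i # u1) * (?h (E' i # u2 @ E j # u4) * ?g (E' j # u3)))"
            unfolding h by (simp only: mult_ac)
          then show ?thesis unfolding sgn by (simp only: mult.assoc)
        qed (use h in auto)
      qed
      show ?thesis unfolding cas mult_minus_right sum_distrib_left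
        by (intro arg_cong[of _ _ uminus] sum.cong refl, rule tw) simp
    qed
    have dl: "x * (y * (r + r')) = x * (y * r) + x * (y * r')" for x y r r' :: 'k
      by (simp add: distrib_left)
    have "?L i = (\<Sum>j<N. sg (sgM (\<epsilon> i) (\<epsilon> j) ?p ?q ?r ?s) * (?f (E i # u1) * (?g (E' i # u2 @ E j # u4) * ?h (E' j # u3)))) +
       - (?c * (\<Sum>j<N. sg (sgM (\<epsilon> i) (\<epsilon> j) ?p ?q ?r ?s) * (?f (E i # u1) * (?h (E' i # u2 @ E j # u4) * ?g (E' j # u3)))))"
      if "i < N" for i
      unfolding wdeg_simps fst_conv dl A[OF that] B[OF that] ..
    then have "sum ?L {..<N} = (\<Sum>i<N. (\<Sum>j<N. sg (sgM (\<epsilon> i) (\<epsilon> j) ?p ?q ?r ?s) * (?f (E i # u1) * (?g (E' i # u2 @ E j # u4) * ?h (E' j # u3)))) +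
       - (?c * (\<Sum>j<N. sg (sgM (\<epsilon> i) (\<epsilon> j) ?p ?q ?r ?s) * (?f (E i # u1) * (?h (E' i # u2 @ E j # u4) * ?g (E' j # u3))))))"
      by (intro sum.cong refl) simp
    then show ?thesis
      unfolding T_def sum.distrib sum_negf sum_distrib_left[symmetric] by simp
  qed
  have "ctr ?f (ev (brk G H)) z =
    dec (\<lambda>x y. dec (\<lambda>u1 u2. dec (\<lambda>u3 u4. T ?f ?g ?h u1 u2 u3 u4) y) x) z -
    ?c * dec (\<lambda>x y. dec (\<lambda>u1 u2. dec (\<lambda>u3 u4. T ?f ?h ?g u1 u2 u3 u4) y) x) z" if z: "hw z" for z
  proof -
    have "ctr ?f (ev (brk G H)) z = dec (\<lambda>u1 v. dec (\<lambda>u2 y. dec (\<lambda>u3 u4.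
        T ?f ?g ?h u1 u2 u3 u4 - ?c * T ?f ?h ?g u1 u2 u3 u4) y) v) z"
      unfolding ctr_def
    proof (rule dec_cong)
      fix u1 v assume "z = u1 @ v"
      then have hw: "hw u1" "hw v" using z by auto
      have "(\<Sum>i<N. sg ((\<epsilon> i + wdeg v) * (\<epsilon> i + wdeg u1) + \<epsilon> i * wdeg u1) * (?f (E i # u1) * ev (brk G H) (E' i # v))) =
        (\<Sum>i<N. sg ((\<epsilon> i + wdeg v) * (\<epsilon> i + wdeg u1) + \<epsilon> i * wdeg u1) * (?f (E i # u1) * rot (ctr ?g ?h) (E' i # v)))"
        by (rule sum.cong) (use hw G H in \<open>auto simp: ev_brk simp del: hw_simps(2)\<close>)
      also have "\<dots> = dec (\<lambda>u2 y. dec (\<lambda>u3 u4. T ?f ?g ?h u1 u2 u3 u4 - ?c * T ?f ?h ?g u1 u2 u3 u4) y) v"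
        unfolding ctr_def rot_dec_Cons dec_mult[symmetric] dec_sum[symmetric]
      proof (intro dec_cong)
        fix u2 y u3 u4 assume "v = u2 @ y" "y = u3 @ u4"
        then have v: "v = u2 @ u3 @ u4" and "hw u2" "hw u3" "hw u4" using hw by auto
        then show "(\<Sum>i<N. sg ((\<epsilon> i + wdeg v) * (\<epsilon> i + wdeg u1) + \<epsilon> i * wdeg u1) * (?f (E i # u1) *
          (sg (wdeg u4 * (fst (E' i) + wdeg u2 + wdeg u3)) *
             (\<Sum>j<N. sg ((\<epsilon> j + wdeg u3) * (\<epsilon> j + wdeg (u4 @ E' i # u2)) + \<epsilon> j * wdeg (u4 @ E' i # u2)) *
                (?g (E j # u4 @ E' i # u2) * ?h (E' j # u3))) +
           sg ((wdeg u3 + wdeg u4) * (fst (E' i) + wdeg u2)) *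
             (\<Sum>j<N. sg ((\<epsilon> j + wdeg (u4 @ E' i # u2)) * (\<epsilon> j + wdeg u3) + \<epsilon> j * wdeg u3) *
                (?g (E j # u3) * ?h (E' j # u4 @ E' i # u2)))))) =
          T ?f ?g ?h u1 u2 u3 u4 - ?c * T ?f ?h ?g u1 u2 u3 u4"
          unfolding v using inner hw(1) by blast
      qed
      finally show "(\<Sum>i<N. sg ((\<epsilon> i + wdeg v) * (\<epsilon> i + wdeg u1) + \<epsilon> i * wdeg u1) * (?f (E i # u1) * ev (brk G H) (E' i # v))) =
        dec (\<lambda>u2 y. dec (\<lambda>u3 u4. T ?f ?g ?h u1 u2 u3 u4 - ?c * T ?f ?h ?g u1 u2 u3 u4) y) v" .
    qed
    then show ?thesis by (simp only: dec_diff dec_mult dec_assoc)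
  qed
  then have "ev (brk F (brk G H)) w = rot (\<lambda>z.
     dec (\<lambda>x y. dec (\<lambda>u1 u2. dec (\<lambda>u3 u4. T ?f ?g ?h u1 u2 u3 u4) y) x) z +
     (- ?c) * dec (\<lambda>x y. dec (\<lambda>u1 u2. dec (\<lambda>u3 u4. T ?f ?h ?g u1 u2 u3 u4) y) x) z) w"
    unfolding ev_brk[OF F brk_cyc_all w] by (intro rot_cong_hw[OF _ w]) simp
  then show ?thesis unfolding rot_add rot_mult M_def by simp
qed

text \<open>The chain of two contractions read from its other end: rotation exchanges the outer
  pieces, each of the two Casimir tensors is swapped, with cancelling minus signs, and cyclicity
  reverses the two pieces of the middle form.\<close>

lemma M_swap:
  assumes F: "F \<in> cyc_all" "parity dF F" and G: "G \<in> cyc_all" "parity dG G" and H: "H \<in> cyc_all" "parity dH H"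
    and w: "hw w"
  shows "M (ev F) (ev G) (ev H) w = sg ((dF + dG) * dH + dF * dG) * M (ev H) (ev G) (ev F) w"
proof -
  let ?f = "ev F" and ?g = "ev G" and ?h = "ev H" and ?c = "sg ((dF + dG) * dH + dF * dG) :: 'k"
  have inner: "sg (wdeg (u1 @ u2) * wdeg (u3 @ u4)) * T ?f ?g ?h u3 u4 u1 u2 = ?c * T ?h ?g ?f u1 u2 u3 u4"
    if hw: "hw u1" "hw u2" "hw u3" "hw u4" for u1 u2 u3 u4
  proof -
    let ?p = "wdeg u1" and ?q = "wdeg u2" and ?r = "wdeg u3" and ?s = "wdeg u4"
    let ?W = "\<lambda>m n. sg (sgM m n ?r ?s ?p ?q) :: 'k"
    have "(\<Sum>j<N. ?W (\<epsilon> i) (\<epsilon> j) * (?f (E i # u3) * (?g (E' i # u4 @ E j # u2) * ?h (E' j # u1)))) =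
      - (\<Sum>j<N. sg (\<epsilon> j) * ?W (\<epsilon> i) (\<epsilon> j) * (?f (E i # u3) * (?g (E' i # u4 @ E' j # u2) * ?h (E j # u1))))" for i
    proof -
      have "(\<Sum>j<N. ?W (\<epsilon> i) (\<epsilon> j) * (?g ((E' i # u4) @ E j # u2) * ?h ([] @ E' j # u1))) =
        - (\<Sum>j<N. sg (\<epsilon> j) * ?W (\<epsilon> i) (\<epsilon> j) * (?g ((E' i # u4) @ E' j # u2) * ?h ([] @ E j # u1)))"
        by (rule casimir_words) (use F G H in \<open>auto simp: cyc_all_mform sgM_def sg_def\<close>)
      then have "?f (E i # u3) * (\<Sum>j<N. ?W (\<epsilon> i) (\<epsilon> j) * (?g ((E' i # u4) @ E j # u2) * ?h ([] @ E' j # u1))) =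
        ?f (E i # u3) * - (\<Sum>j<N. sg (\<epsilon> j) * ?W (\<epsilon> i) (\<epsilon> j) * (?g ((E' i # u4) @ E' j # u2) * ?h ([] @ E j # u1)))"
        by (simp only:)
      then show ?thesis by (simp add: sum_distrib_left mult_ac)
    qed
    then have "T ?f ?g ?h u3 u4 u1 u2 = - (\<Sum>i<N. \<Sum>j<N. sg (\<epsilon> j) * ?W (\<epsilon> i) (\<epsilon> j) *
        (?f (E i # u3) * (?g (E' i # u4 @ E' j # u2) * ?h (E j # u1))))"
      unfolding T_def by (simp add: sum_negf)
    also have "\<dots> = - (\<Sum>j<N. \<Sum>i<N. sg (\<epsilon> j) * ?W (\<epsilon> i) (\<epsilon> j) *
        (?f (E i # u3) * (?g (E' i # u4 @ E' j # u2) * ?h (E j # u1))))"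
      by (subst sum.swap) (rule refl)
    also have "\<dots> = - (\<Sum>j<N. - (\<Sum>i<N. sg (\<epsilon> i) * (sg (\<epsilon> j) * ?W (\<epsilon> i) (\<epsilon> j)) *
        (?f (E' i # u3) * (?g (E i # u4 @ E' j # u2) * ?h (E j # u1)))))"
    proof (intro arg_cong[of _ _ uminus] sum.cong refl)
      fix j
      have "(\<Sum>i<N. (sg (\<epsilon> j) * ?W (\<epsilon> i) (\<epsilon> j)) * (?f ([] @ E i # u3) * ?g ([] @ E' i # u4 @ E' j # u2))) =
        - (\<Sum>i<N. sg (\<epsilon> i) * (sg (\<epsilon> j) * ?W (\<epsilon> i) (\<epsilon> j)) * (?f ([] @ E' i # u3) * ?g ([] @ E i # u4 @ E' j # u2)))"
        by (rule casimir_words[where wt = "\<lambda>n. sg (\<epsilon> j) * ?W n (\<epsilon> j)"]) (use F G H in \<open>auto simp: cyc_all_mform sgM_def sg_def\<close>)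
      then have "(\<Sum>i<N. (sg (\<epsilon> j) * ?W (\<epsilon> i) (\<epsilon> j)) * (?f ([] @ E i # u3) * ?g ([] @ E' i # u4 @ E' j # u2))) * ?h (E j # u1) =
        - (\<Sum>i<N. sg (\<epsilon> i) * (sg (\<epsilon> j) * ?W (\<epsilon> i) (\<epsilon> j)) * (?f ([] @ E' i # u3) * ?g ([] @ E i # u4 @ E' j # u2))) * ?h (E j # u1)"
        by (simp only:)
      then show "(\<Sum>i<N. sg (\<epsilon> j) * ?W (\<epsilon> i) (\<epsilon> j) *
        (?f (E i # u3) * (?g (E' i # u4 @ E' j # u2) * ?h (E j # u1)))) = - (\<Sum>i<N. sg (\<epsilon> i) * (sg (\<epsilon> j) * ?W (\<epsilon> i) (\<epsilon> j)) *
        (?f (E' i # u3) * (?g (E i # u4 @ E' j # u2) * ?h (E j # u1))))"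
        by (simp add: sum_distrib_right mult.assoc)
    qed
    finally have T: "T ?f ?g ?h u3 u4 u1 u2 = (\<Sum>j<N. \<Sum>i<N. sg (\<epsilon> i) * (sg (\<epsilon> j) * ?W (\<epsilon> i) (\<epsilon> j)) *
        (?f (E' i # u3) * (?g (E i # u4 @ E' j # u2) * ?h (E j # u1))))"
      by (simp add: sum_negf)
    have tw: "sg ((?p + ?q) * (?r + ?s)) * (sg (\<epsilon> i) * (sg (\<epsilon> j) * ?W (\<epsilon> i) (\<epsilon> j)) *
        (?f (E' i # u3) * (?g (E i # u4 @ E' j # u2) * ?h (E j # u1)))) =
      ?c * (sg (sgM (\<epsilon> j) (\<epsilon> i) ?p ?q ?r ?s) * (?h (E j # u1) * (?g (E' j # u2 @ E i # u4) * ?f (E' i # u3))))"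
      if i: "i < N" and j: "j < N" for i j
    proof -
      have "?g ((E i # u4) @ (E' j # u2)) = sg (wdeg (E i # u4) * wdeg (E' j # u2)) * ?g ((E' j # u2) @ (E i # u4))"
        by (rule cyclic_append[OF cyc_all_cyclic[OF G(1)]]) (use hw i j in \<open>simp_all del: hw_simps(2)\<close>)
      then have g: "?g (E i # u4 @ E' j # u2) = sg ((\<epsilon> i + ?s) * (- 2 - \<epsilon> j + ?q)) * ?g (E' j # u2 @ E i # u4)"
        by simp
      show ?thesis
      proof (cases "?h (E j # u1) = 0 \<or> ?g (E' j # u2 @ E i # u4) = 0 \<or> ?f (E' i # u3) = 0")
        case False
        then have "even (dH + wdeg (E j # u1))" "even (dG + wdeg (E' j # u2 @ E i # u4))" "even (dF + wdeg (E' i # u3))"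
          using F(2) G(2) H(2) hw i j unfolding parity_def by (metis hw_E hw_simps(3))+
        then have sgn: "sg ((?p + ?q) * (?r + ?s)) * (sg (\<epsilon> i) * (sg (\<epsilon> j) * (?W (\<epsilon> i) (\<epsilon> j) *
           sg ((\<epsilon> i + ?s) * (- 2 - \<epsilon> j + ?q))))) = ?c * sg (sgM (\<epsilon> j) (\<epsilon> i) ?p ?q ?r ?s)"
          unfolding sg_add[symmetric] sgM_def by (intro sg_eqI) (simp, argo?)
        have "sg ((?p + ?q) * (?r + ?s)) * (sg (\<epsilon> i) * (sg (\<epsilon> j) * ?W (\<epsilon> i) (\<epsilon> j)) *
            (?f (E' i # u3) * (?g (E i # u4 @ E' j # u2) * ?h (E j # u1)))) =
          (sg ((?p + ?q) * (?r + ?s)) * (sg (\<epsilon> i) * (sg (\<epsilon> j) * (?W (\<epsilon> i) (\<epsilon> j) *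
           sg ((\<epsilon> i + ?s) * (- 2 - \<epsilon> j + ?q)))))) * (?h (E j # u1) * (?g (E' j # u2 @ E i # u4) * ?f (E' i # u3)))"
          unfolding g by (simp only: mult_ac)
        then show ?thesis unfolding sgn by (simp only: mult.assoc)
      qed (use g in auto)
    qed
    show ?thesis unfolding T T_def[of ?h] sum_distrib_left wdeg_simps
      by (intro sum.cong refl, rule tw) simp_all
  qed
  have "M ?f ?g ?h w = rot (dec (\<lambda>x y. sg (wdeg x * wdeg y) * dec (\<lambda>u1 u2. dec (\<lambda>u3 u4. T ?f ?g ?h u1 u2 u3 u4) x) y)) w"
    unfolding M_def by (rule rot_dec_swap)
  also have "\<dots> = rot (\<lambda>z. ?c * dec (\<lambda>x y. dec (\<lambda>u1 u2. dec (\<lambda>u3 u4. T ?h ?g ?f u1 u2 u3 u4) y) x) z) w"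
  proof (rule rot_cong_hw[OF _ w], unfold dec_mult[symmetric], rule dec_cong)
    fix z x y assume z: "hw z" "z = x @ y"
    have "dec (\<lambda>u1 u2. dec (\<lambda>u3 u4. sg (wdeg x * wdeg y) * T ?f ?g ?h u1 u2 u3 u4) x) y =
      dec (\<lambda>u1 u2. dec (\<lambda>u3 u4. sg (wdeg x * wdeg y) * T ?f ?g ?h u3 u4 u1 u2) y) x"
      by (rule dec_dec_swap)
    also have "\<dots> = dec (\<lambda>u1 u2. dec (\<lambda>u3 u4. ?c * T ?h ?g ?f u1 u2 u3 u4) y) x"
    proof (intro dec_cong)
      fix u1 u2 u3 u4 assume "x = u1 @ u2" "y = u3 @ u4"
      then show "sg (wdeg x * wdeg y) * T ?f ?g ?h u3 u4 u1 u2 = ?c * T ?h ?g ?f u1 u2 u3 u4"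
        using inner z by auto
    qed
    finally show "dec (\<lambda>u1 u2. dec (\<lambda>u3 u4. sg (wdeg x * wdeg y) * T ?f ?g ?h u1 u2 u3 u4) x) y =
      dec (\<lambda>u1 u2. dec (\<lambda>u3 u4. ?c * T ?h ?g ?f u1 u2 u3 u4) y) x" .
  qed
  finally show ?thesis by (simp add: rot_mult M_def)
qed

text \<open>Antisymmetry puts all three double brackets into nested form; \<open>brk_brk\<close>
  then gives six chains, one for each order of the forms, and \<open>M_swap\<close> identifies them
  in pairs with the same middle form.\<close>

lemma jacobi_parity:
  assumes F: "F \<in> cyc_all" "parity dF F" and G: "G \<in> cyc_all" "parity dG G" and H: "H \<in> cyc_all" "parity dH H"
    and w: "hw w"
  shows "ev (brk F (brk G H)) w = ev (brk (brk F G) H) w + sg (dF * dG) * ev (brk G (brk F H)) w"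
proof -
  let ?f = "ev F" and ?g = "ev G" and ?h = "ev H"
  have "ev (brk (brk F G) H) w = - (sg ((dF + dG) * dH) * ev (brk H (brk F G)) w)"
    using brk_antisym[OF brk_cyc_all brk_parity[OF F(1) G(1) F(2) G(2)] H] by (simp add: ev_fscale)
  moreover have "ev (brk H (brk F G)) w = M ?h ?f ?g w - sg (dF * dG) * M ?h ?g ?f w"
    by (rule brk_brk) (use assms in auto)
  moreover have "ev (brk F (brk G H)) w = M ?f ?g ?h w - sg (dG * dH) * M ?f ?h ?g w"
    by (rule brk_brk) (use assms in auto)
  moreover have "ev (brk G (brk F H)) w = M ?g ?f ?h w - sg (dF * dH) * M ?g ?h ?f w"
    by (rule brk_brk) (use assms in auto)
  moreover have "M ?f ?g ?h w = sg ((dF + dG) * dH + dF * dG) * M ?h ?g ?f w"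
    "M ?f ?h ?g w = sg ((dF + dH) * dG + dF * dH) * M ?g ?h ?f w"
    "M ?h ?f ?g w = sg ((dH + dF) * dG + dH * dF) * M ?g ?f ?h w"
    by (rule M_swap; use assms in auto)+
  ultimately show ?thesis by (simp add: sg_def)
qed

text \<open>The definition of \<open>graded_lie\<close> does not restrict the third argument, so it
  is split into its two parity parts.\<close>

lemma jacobi:
  assumes F: "F \<in> cyc_all" "parity dF F" and G: "G \<in> cyc_all" "parity dG G" and H: "H \<in> cyc_all"
  shows "brk F (brk G H) = brk (brk F G) H + fscale (sg (dF * dG)) (brk G (brk F H))"
proof (rule brk_eqI)
  fix w :: "(int \<times> 'v) list" assume w: "hw w"
  let ?H = "\<lambda>p. parity_part p H"
  have H': "?H p \<in> cyc_all" "parity p (?H p)" for p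
    using H by (simp_all add: cyc_all_parity_part parity_parity_part cyc_all_mform)
  have lin: "brk F (brk G H) = brk F (brk G (?H 0)) + brk F (brk G (?H 1))"
    "brk (brk F G) H = brk (brk F G) (?H 0) + brk (brk F G) (?H 1)"
    "brk G (brk F H) = brk G (brk F (?H 0)) + brk G (brk F (?H 1))"
    by (subst parity_decomp[OF cyc_all_mform[OF H]],
        simp only: brk_add_right F G H' brk_cyc_all)+
  show "ev (brk F (brk G H)) w = ev (brk (brk F G) H + fscale (sg (dF * dG)) (brk G (brk F H))) w"
    unfolding lin ev_add ev_fscale
    by (simp add: jacobi_parity[OF F G H' w] algebra_simps)
qed (simp add: mform_plus mform_fscale mform_brk)

lemma graded_lie_brk: "graded_lie brk"
  unfolding graded_lie_def
proof (intro allI impI)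
  fix d d' F G
  assume *: "F \<in> cyc_all \<and> G \<in> cyc_all \<and> has_degree d F \<and> has_degree d' G"
  have sg: "sg ((d - 2) * (d' - 2)) = (sg (d * d') :: 'k)" by (rule sg_eqI) simp
  have d: "(d - 2) + (d' - 2) + 2 = d + d' - 2" by simp
  show "has_degree ((d - 2) + (d' - 2) + 2) (brk F G) \<and>
        brk F G = fscale (- sg ((d - 2) * (d' - 2))) (brk G F) \<and>
        (\<forall>H\<in>cyc_all. brk F (brk G H) =
           brk (brk F G) H + fscale (sg ((d - 2) * (d' - 2))) (brk G (brk F H)))"
    unfolding sg d
  proof (intro conjI ballI)
    have F: "F \<in> cyc_all" "parity d F" and G: "G \<in> cyc_all" "parity d' G"
      using * has_degree_parity by auto
    show "has_degree (d + d' - 2) (brk F G)" using * by (intro brk_degree) auto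
    show "brk F G = fscale (- sg (d * d')) (brk G F)" by (rule brk_antisym[OF F G])
    show "brk F (brk G H) = brk (brk F G) H + fscale (sg (d * d')) (brk G (brk F H))" if "H \<in> cyc_all" for H
      by (rule jacobi[OF F G that])
  qed
qed

end

lemma sum_pairs_Suc:
  "(\<Sum>(i, j) \<in> {(i, j). i < j \<and> j < Suc n}. f i j) =
   (\<Sum>j<n. f 0 (Suc j)) + (\<Sum>(i, j) \<in> {(i, j). i < j \<and> j < n}. f (Suc i) (Suc j))"
  for f :: "nat \<Rightarrow> nat \<Rightarrow> int"
proof -
  let ?S = "{(i, j). i < j \<and> j < n}"
  have fin: "finite ?S" by (rule finite_subset[of _ "{..<n} \<times> {..<n}"]) auto
  have eq: "{(i, j). i < j \<and> j < Suc n} = (\<lambda>j. (0, Suc j)) ` {..<n} \<union> (\<lambda>(i, j). (Suc i, Suc j)) ` ?S"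
    by (auto simp: image_iff less_Suc_eq_0_disj gr0_conv_Suc)
  have inj: "inj_on (\<lambda>(i, j). (Suc i, Suc j)) ?S" by (auto simp: inj_on_def)
  show ?thesis
    unfolding eq
    by (subst sum.union_disjoint) (use fin in \<open>auto simp: sum.reindex[OF inj] sum.reindex inj_on_def case_prod_unfold\<close>)
qed

context fd_graded_space
begin

subsection \<open>Linear forms and their tensor products\<close>

definition lf :: "('v \<Rightarrow> 'k) \<Rightarrow> ('v, 'k) form" where
  "lf \<phi> xs = (case xs of [x] \<Rightarrow> \<phi> x | _ \<Rightarrow> 0)"

lemma lf_simps [simp]: "lf \<phi> [x] = \<phi> x" "lf \<phi> [] = 0" "lf \<phi> (x # y # xs) = 0"
  by (simp_all add: lf_def)

lemma lf_cyc:
  assumes "Vector_Spaces.linear scale (*) \<phi>"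
  shows "lf \<phi> \<in> cyc 1"
proof -
  have lin: "\<phi> (x + y) = \<phi> x + \<phi> y" "\<phi> (c *s x) = c * \<phi> x" for x y c
    using assms by (auto simp: linear_scalar_iff)
  have eq: "lf \<phi> (u @ x # v) = (if u = [] \<and> v = [] then \<phi> x else 0)" for u x v
    by (cases u; cases v; cases "tl u") (auto simp: lf_def split: list.splits)
  have "mform (lf \<phi>)" by (rule mformI) (simp_all add: eq lin)
  moreover have "lf \<phi> (x # xs) = sg (d * sum_list ds) * lf \<phi> (xs @ [x])" if "homog (d # ds) (x # xs)" for d ds x xs
    using length_homog[OF that] eq[of "[]" x xs] eq[of xs x "[]"] by (cases xs) auto
  ultimately have "cyclic (lf \<phi>)" unfolding cyclic_def by blast
  moreover have "lf \<phi> xs = 0" if "length xs \<noteq> 1" for xs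
    using that by (auto simp: lf_def split: list.splits)
  ultimately show ?thesis by (simp add: cyc_def)
qed

lemma cyc1_lf:
  assumes "\<alpha> \<in> cyc 1"
  shows "\<alpha> = lf (\<lambda>x. \<alpha> [x])" and "Vector_Spaces.linear scale (*) (\<lambda>x. \<alpha> [x])"
proof -
  show "\<alpha> = lf (\<lambda>x. \<alpha> [x])"
    by (rule ext) (use cyc_arity[OF assms] in \<open>auto simp: lf_def split: list.splits\<close>)
  show "Vector_Spaces.linear scale (*) (\<lambda>x. \<alpha> [x])"
    using cyc_all_mform[OF cyc_subset[OF assms]] by (auto simp: linear_scalar_iff mform_addD_Cons mform_scaleD_Cons)
qed

lemma has_degree_linear:
  assumes "\<beta> \<in> cyc 1"
  shows "has_degree \<delta> \<beta> \<longleftrightarrow> (\<forall>d. \<forall>x\<in>gr (d + 1). \<beta> [x] \<noteq> 0 \<longrightarrow> \<delta> + d = 0)"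
proof
  assume *: "has_degree \<delta> \<beta>"
  show "\<forall>d. \<forall>x\<in>gr (d + 1). \<beta> [x] \<noteq> 0 \<longrightarrow> \<delta> + d = 0"
  proof (intro allI ballI impI)
    fix d x assume "x \<in> gr (d + 1)" "\<beta> [x] \<noteq> 0"
    then show "\<delta> + d = 0" using *[unfolded has_degree_iff, rule_format, of "[(d, x)]"] by (simp add: ev_def)
  qed
next
  assume *: "\<forall>d. \<forall>x\<in>gr (d + 1). \<beta> [x] \<noteq> 0 \<longrightarrow> \<delta> + d = 0"
  show "has_degree \<delta> \<beta>"
    unfolding has_degree_iff
  proof (intro allI impI)
    fix w :: "(int \<times> 'v) list" assume w: "hw w \<and> ev \<beta> w \<noteq> 0"
    then have "length w = 1" using cyc_arity[OF assms, of "map snd w"] by (auto simp: ev_def)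
    then obtain a where "w = [a]" by (cases w) auto
    then show "\<delta> + wdeg w = 0" using * w by (auto simp: ev_def)
  qed
qed

primrec tlv :: "('v, 'k) form list \<Rightarrow> 'v list \<Rightarrow> 'k" where
  "tlv [] xs = (if xs = [] then 1 else 0)"
| "tlv (\<beta> # \<beta>s) xs = (case xs of [] \<Rightarrow> 0 | x # ys \<Rightarrow> \<beta> [x] * tlv \<beta>s ys)"

text \<open>The version of \<open>tensor_lin\<close> for words: its sign exponent, a sum over pairs
  of positions, is split off letter by letter, each letter being paired with all later ones.\<close>

primrec tlw :: "('v, 'k) form list \<Rightarrow> (int \<times> 'v) list \<Rightarrow> 'k" where
  "tlw [] w = (if w = [] then 1 else 0)"
| "tlw (\<beta> # \<beta>s) w = (case w of [] \<Rightarrow> 0 | a # z \<Rightarrow> sg (fst a * wdeg z) * \<beta> [snd a] * tlw \<beta>s z)"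

lemma tlv_conv: "tlv \<beta>s xs = (if length xs = length \<beta>s then \<Prod>i<length xs. (\<beta>s ! i) [xs ! i] else 0)"
proof (induction \<beta>s arbitrary: xs)
  case (Cons \<beta> \<beta>s)
  then show ?case by (cases xs) (simp_all add: prod.lessThan_Suc_shift del: prod.lessThan_Suc)
qed simp

lemma mform_tlv:
  assumes "\<And>\<beta>. \<beta> \<in> set \<beta>s \<Longrightarrow> mform \<beta>"
  shows "mform (tlv \<beta>s)"
  using assms
proof (induction \<beta>s)
  case (Cons \<beta> \<beta>s)
  then have IH: "mform (tlv \<beta>s)" and \<beta>: "mform \<beta>" by auto
  show ?case
  proof (rule mformI)
    fix u v x y c
    show "tlv (\<beta> # \<beta>s) (u @ (x + y) # v) = tlv (\<beta> # \<beta>s) (u @ x # v) + tlv (\<beta> # \<beta>s) (u @ y # v)"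
      "tlv (\<beta> # \<beta>s) (u @ (c *s x) # v) = c * tlv (\<beta> # \<beta>s) (u @ x # v)"
      by (cases u; simp add: mform_addD[OF IH] mform_scaleD[OF IH] mform_addD_Cons[OF \<beta>] mform_scaleD_Cons[OF \<beta>] algebra_simps)+
  qed
qed (auto intro: mformI)

lemma tensor_lin_conv:
  "tensor_lin \<beta>s = mext (\<lambda>ds xs. sg (\<Sum>(i, j) \<in> {(i, j). i < j \<and> j < length \<beta>s}. ds ! i * ds ! j) * tlv \<beta>s xs)"
  unfolding tensor_lin_def by (intro arg_cong[of _ _ mext] ext) (auto simp: tlv_conv)

lemma mform_tensor_lin: "(\<And>\<beta>. \<beta> \<in> set \<beta>s \<Longrightarrow> mform \<beta>) \<Longrightarrow> mform (tensor_lin \<beta>s)"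
  unfolding tensor_lin_conv by (intro mform_mext mform_mult mform_tlv)

lemma ev_tensor_lin:
  assumes "\<And>\<beta>. \<beta> \<in> set \<beta>s \<Longrightarrow> mform \<beta>" "hw w"
  shows "ev (tensor_lin \<beta>s) w = tlw \<beta>s w"
proof -
  have "sg (\<Sum>(i, j) \<in> {(i, j). i < j \<and> j < length \<beta>s}. map fst w ! i * map fst w ! j) * tlv \<beta>s (map snd w) = tlw \<beta>s w" for w
  proof (induction \<beta>s arbitrary: w)
    case (Cons \<beta> \<beta>s)
    show ?case
    proof (cases w)
      case w: (Cons a z)
      show ?thesis
      proof (cases "length z = length \<beta>s")
        case True
        have "(\<Sum>j<length \<beta>s. fst a * map fst z ! j) = fst a * wdeg z"
          by (simp add: wdeg_def sum_list_sum_nth sum_distrib_left True atLeast0LessThan)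
        then show ?thesis using Cons[of z]
          by (simp add: w sum_pairs_Suc sg_add)
      next
        case False
        then have "tlv \<beta>s (map snd z) = 0" by (simp add: tlv_conv)
        then show ?thesis using Cons[of z] by (simp add: w)
      qed
    qed simp
  qed simp
  then show ?thesis
    unfolding tensor_lin_conv using assms by (subst ev_mext) (auto intro!: mform_mult mform_tlv)
qed

abbreviation homog_forms :: "int list \<Rightarrow> ('v, 'k) form list \<Rightarrow> bool" where
  "homog_forms \<delta>s \<beta>s \<equiv> list_all2 (\<lambda>\<delta> \<beta>. \<beta> \<in> cyc 1 \<and> has_degree \<delta> \<beta>) \<delta>s \<beta>s"

lemma homog_forms_mform: "homog_forms \<delta>s \<beta>s \<Longrightarrow> \<beta> \<in> set \<beta>s \<Longrightarrow> mform \<beta>"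
  by (auto simp: list_all2_conv_all_nth in_set_conv_nth intro!: cyc_all_mform cyc_subset)

lemma tlw_length: "tlw \<beta>s w \<noteq> 0 \<Longrightarrow> length w = length \<beta>s"
  by (induction \<beta>s arbitrary: w) (auto split: if_splits list.splits)

lemma tlw_degree:
  "homog_forms \<delta>s \<beta>s \<Longrightarrow> hw w \<Longrightarrow> tlw \<beta>s w \<noteq> 0 \<Longrightarrow> sum_list \<delta>s + wdeg w = 0"
proof (induction \<delta>s \<beta>s arbitrary: w rule: list_all2_induct)
  case (Cons \<delta> \<delta>s \<beta> \<beta>s)
  then obtain a z where w: "w = a # z" by (cases w) auto
  then have "\<delta> + fst a = 0"
    using Cons has_degree_linear[of \<beta> \<delta>] by auto
  moreover have "sum_list \<delta>s + wdeg z = 0"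
    using Cons w by auto
  ultimately show ?case by (simp add: w)
qed (auto split: if_splits)

lemma cyclic_tensor:
  assumes "homog_forms \<delta>s \<beta>s"
  shows "Cycl (tensor_lin \<beta>s) \<in> cyc (length \<beta>s)"
    and "hw w \<Longrightarrow> ev (Cycl (tensor_lin \<beta>s)) w = rot (tlw \<beta>s) w"
    and "has_degree (sum_list \<delta>s) (Cycl (tensor_lin \<beta>s))"
proof -
  have m: "mform \<beta>" if "\<beta> \<in> set \<beta>s" for \<beta> using assms that by (rule homog_forms_mform)
  then have mt: "mform (tensor_lin \<beta>s)" by (rule mform_tensor_lin)
  show *: "ev (Cycl (tensor_lin \<beta>s)) w = rot (tlw \<beta>s) w" if "hw w" for w
    unfolding ev_Cycl[OF mt that]
    by (rule rot_cong) (use that in \<open>auto intro!: ev_tensor_lin m\<close>)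
  have 0: "ev (Cycl (tensor_lin \<beta>s)) w = 0"
    if "hw w" "\<And>z. hw z \<Longrightarrow> length z = length w \<Longrightarrow> wdeg z = wdeg w \<Longrightarrow> tlw \<beta>s z = 0" for w
  proof -
    have "rot (tlw \<beta>s) w = rot (\<lambda>_. 0) w"
      by (rule rot_cong) (use that(1) in \<open>auto intro!: that(2)\<close>)
    then show ?thesis using *[OF that(1)] by (simp add: rot_conv)
  qed
  have "Cycl (tensor_lin \<beta>s) xs = 0" if "length xs \<noteq> length \<beta>s" for xs
  proof -
    have "Cycl (tensor_lin \<beta>s) xs = (0 :: ('v, 'k) form) xs"
    proof (rule mform_eqI[OF mform_Cycl[OF mt]])
      fix w :: "(int \<times> 'v) list" assume w: "hw w" "length w = length xs"
      have "ev (Cycl (tensor_lin \<beta>s)) w = 0"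
        by (rule 0[OF w(1)]) (use w that tlw_length in force)
      then show "ev (Cycl (tensor_lin \<beta>s)) w = ev 0 w" by (simp add: ev_def)
    qed auto
    then show ?thesis by simp
  qed
  then show "Cycl (tensor_lin \<beta>s) \<in> cyc (length \<beta>s)"
    using cyclic_Cycl[OF mt] by (simp add: cyc_def)
  show "has_degree (sum_list \<delta>s) (Cycl (tensor_lin \<beta>s))"
    unfolding has_degree_iff
  proof (intro allI impI, rule ccontr)
    fix w :: "(int \<times> 'v) list" assume w: "hw w \<and> ev (Cycl (tensor_lin \<beta>s)) w \<noteq> 0" "sum_list \<delta>s + wdeg w \<noteq> 0"
    have "ev (Cycl (tensor_lin \<beta>s)) w = 0"
      by (rule 0) (use w tlw_degree[OF assms] in \<open>auto, metis\<close>)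
    then show False using w by simp
  qed
qed

text \<open>Taking homogeneous components commutes with the expansion in a homogeneous basis. Hence
  a coordinate functional vanishes on homogeneous vectors of any degree but that of its basis
  vector, and has the opposite degree as a form.\<close>

lemma homogeneous_coordinates:
  obtains \<epsilon>s es and cs :: "nat \<Rightarrow> 'v \<Rightarrow> 'k" where
    "homog \<epsilon>s es" "distinct es" "independent (set es)" "span (set es) = UNIV"
    "\<And>i. Vector_Spaces.linear scale (*) (cs i)"
    "\<And>x. x = (\<Sum>i<length es. cs i x *s es ! i)"
    "\<And>i j. i < length es \<Longrightarrow> j < length es \<Longrightarrow> cs i (es ! j) = (if i = j then 1 else 0)"
    "\<And>i. i < length es \<Longrightarrow> has_degree (- (\<epsilon>s ! i)) (lf (cs i))"
proof -
  obtain \<epsilon>s es where es: "homog \<epsilon>s es" "distinct es" "independent (set es)" "span (set es) = UNIV"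
    using homogeneous_basis by blast
  define cs where "cs i x = representation (set es) x (es ! i)" for i x
  have lin: "Vector_Spaces.linear scale (*) (cs i)" for i
    unfolding linear_scalar_iff cs_def
    using es(3,4) by (simp add: representation_add representation_scale)
  have exp: "x = (\<Sum>i<length es. cs i x *s es ! i)" for x
  proof -
    have "x = (\<Sum>y\<in>set es. representation (set es) x y *s y)"
      using es(3,4) by (intro sum_representation_eq[symmetric]) auto
    also have "\<dots> = (\<Sum>i<length es. cs i x *s es ! i)"
      unfolding cs_def by (rule sum.reindex_bij_betw[OF bij_betw_nth, symmetric]) (use es(2) in auto)
    finally show ?thesis .
  qed
  have dual: "cs i (es ! j) = (if i = j then 1 else 0)" if "i < length es" "j < length es" for i j
    using that es(2,3) by (simp add: cs_def representation_basis nth_eq_iff_index_eq)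
  have deg: "has_degree (- (\<epsilon>s ! i)) (lf (cs i))" if i: "i < length es" for i
    unfolding has_degree_linear[OF lf_cyc[OF lin]]
  proof (intro allI ballI impI, rule ccontr)
    fix d x assume x: "x \<in> gr (d + 1)" "lf (cs i) [x] \<noteq> 0" "- (\<epsilon>s ! i) + d \<noteq> 0"
    have hsum: "hcomp m (\<Sum>j\<in>A. c j *s y j) = (\<Sum>j\<in>A. c j *s hcomp m (y j))" for m c y and A :: "nat set"
      by (induction A rule: infinite_finite_induct) (auto simp: hcomp_add hcomp_scale)
    have "x = hcomp (d + 1) x" using x(1) by (simp add: hcomp_gr)
    also have "\<dots> = (\<Sum>j<length es. cs j x *s hcomp (d + 1) (es ! j))"
      by (subst exp[of x], rule hsum)
    finally have "cs i x = cs i (\<Sum>j<length es. cs j x *s hcomp (d + 1) (es ! j))"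
      by (rule arg_cong)
    also have "\<dots> = (\<Sum>j<length es. cs j x * cs i (hcomp (d + 1) (es ! j)))"
      by (rule linear_sum_scale[OF lin])
    also have "\<dots> = 0"
    proof (rule sum.neutral, rule ballI)
      fix j assume j: "j \<in> {..<length es}"
      then have "es ! j \<in> gr (\<epsilon>s ! j + 1)" using es(1) by (auto simp: homog_def list_all2_conv_all_nth)
      then have "hcomp (d + 1) (es ! j) = (if d = \<epsilon>s ! j then es ! j else 0)" by (simp add: hcomp_gr)
      moreover have "cs i 0 = 0" using linear_sum_scale[OF lin, where A = "{}"] by simp
      ultimately show "cs j x * cs i (hcomp (d + 1) (es ! j)) = 0"
        using dual[OF i] j x(3) by auto
    qed
    finally show False using x(2) by simp
  qed
  show ?thesis by (rule that[OF es lin exp dual deg])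
qed

text \<open>Coordinates expand any multilinear form of arity \<open>n\<close> into products of
  coordinate functionals. Cyclising a form that is already cyclic multiplies it by \<open>n\<close>,
  so the expansion may be cyclised and divided by \<open>n\<close>.\<close>

lemma cyc_spanned:
  assumes F: "F \<in> cyc n" and n: "n \<ge> 1"
  obtains I :: "nat list set" and c \<delta>s \<beta>s where "finite I"
    "F = (\<Sum>i\<in>I. fscale (c i) (Cycl (tensor_lin (\<beta>s i))))"
    "\<And>i. i \<in> I \<Longrightarrow> homog_forms (\<delta>s i) (\<beta>s i) \<and> length (\<beta>s i) = n"
proof -
  obtain \<epsilon>s es and cs :: "nat \<Rightarrow> 'v \<Rightarrow> 'k" where
    "homog \<epsilon>s es" "distinct es" "independent (set es)" "span (set es) = UNIV"
    and lin: "\<And>i. Vector_Spaces.linear scale (*) (cs i)"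
    and exp: "\<And>x. x = (\<Sum>i<length es. cs i x *s es ! i)"
    and "\<And>i j. i < length es \<Longrightarrow> j < length es \<Longrightarrow> cs i (es ! j) = (if i = j then 1 else 0)"
    and deg: "\<And>i. i < length es \<Longrightarrow> has_degree (- (\<epsilon>s ! i)) (lf (cs i))"
    by (rule homogeneous_coordinates) (rule that)
  define L where "L = map (\<lambda>i. lf (cs i))"
  define I where "I n = {is. length is = n \<and> set is \<subseteq> {..<length es}}" for n
  have finI: "finite (I n)" for n
    using finite_lists_length_eq[of "{..<length es}" n] by (simp add: I_def conj_commute)
  define D where "D = map (\<lambda>i. - (\<epsilon>s ! i))"
  have hf: "homog_forms (D is) (L is)" if "is \<in> I n" for "is" n
  proof -
    have "is ! i < length es" if "i < length is" for i
      using \<open>is \<in> I n\<close> nth_mem[OF that] by (auto simp: I_def)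
    then show ?thesis using deg lf_cyc[OF lin] by (auto simp: D_def L_def list_all2_conv_all_nth)
  qed
  have "\<exists>c. \<forall>w. hw w \<and> length w = n \<longrightarrow> ev F w = (\<Sum>is\<in>I n. c is * tlw (L is) w)" if "mform F" for F n
    using that
  proof (induction n arbitrary: F)
    case 0
    have "I 0 = {[]}" by (auto simp: I_def)
    then show ?case by (intro exI[of _ "\<lambda>_. F []"]) (auto simp: ev_def L_def)
  next
    case (Suc n)
    have "\<forall>i. \<exists>c. \<forall>w. hw w \<and> length w = n \<longrightarrow> ev (\<lambda>xs. F (es ! i # xs)) w = (\<Sum>is\<in>I n. c is * tlw (L is) w)"
      using Suc.IH mform_Cons[OF Suc.prems] by blast
    then obtain c where c: "\<And>i w. hw w \<Longrightarrow> length w = n \<Longrightarrow> ev (\<lambda>xs. F (es ! i # xs)) w = (\<Sum>is\<in>I n. c i is * tlw (L is) w)"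
      by metis
    \<comment> \<open>The sign cancels the one that \<open>tlw\<close> attaches to its first letter;
      the degrees of the coordinate functionals are the negatives of those of the letters.\<close>
    define c' where "c' is = sg (\<epsilon>s ! hd is * sum_list (D (tl is))) * c (hd is) (tl is)" for "is"
    have "ev F w = (\<Sum>is\<in>I (Suc n). c' is * tlw (L is) w)" if hw: "hw w" and len: "length w = Suc n" for w
    proof -
      obtain a z where w: "w = a # z" using len by (cases w) auto
      have "ev F w = F ((\<Sum>i<length es. cs i (snd a) *s es ! i) # map snd z)"
        using exp[of "snd a"] by (simp add: w ev_def)
      also have "\<dots> = (\<Sum>i<length es. cs i (snd a) * ev (\<lambda>xs. F (es ! i # xs)) z)"
        by (simp add: mform_sum_Cons[OF Suc.prems] mform_scaleD_Cons[OF Suc.prems] ev_def)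
      also have "\<dots> = (\<Sum>i<length es. \<Sum>is\<in>I n. cs i (snd a) * (c i is * tlw (L is) z))"
        using that w by (simp add: c sum_distrib_left)
      also have "\<dots> = (\<Sum>i<length es. \<Sum>is\<in>I n. c' (i # is) * tlw (L (i # is)) w)"
      proof (intro sum.cong refl)
        fix i "is" assume i: "i \<in> {..<length es}" and "is": "is \<in> I n"
        show "cs i (snd a) * (c i is * tlw (L is) z) = c' (i # is) * tlw (L (i # is)) w"
        proof (cases "cs i (snd a) = 0 \<or> tlw (L is) z = 0")
          case False
          have "\<epsilon>s ! i = fst a"
            using deg[of i] i False that w unfolding has_degree_linear[OF lf_cyc[OF lin]] by auto
          moreover have "sum_list (D is) = - wdeg z"
            using tlw_degree[OF hf[OF "is"], of z] False that w by simp
          ultimately have "sg (\<epsilon>s ! i * sum_list (D is)) = (sg (fst a * wdeg z) :: 'k)"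
            by (intro sg_eqI) simp
          then show ?thesis by (simp add: c'_def L_def w mult_ac)
        qed (auto simp: c'_def L_def w)
      qed
      also have "\<dots> = (\<Sum>is\<in>I (Suc n). c' is * tlw (L is) w)"
        unfolding I_def by (rule lists_Suc_reindex[symmetric])
      finally show ?thesis .
    qed
    then show ?case by blast
  qed
  then obtain c where c: "\<And>w. hw w \<Longrightarrow> length w = n \<Longrightarrow> ev F w = (\<Sum>is\<in>I n. c is * tlw (L is) w)"
    using cyc_all_mform[OF cyc_subset[OF F]] by metis
  \<comment> \<open>The division by \<open>n\<close> undoes the multiplicity of cyclising
    \<open>F\<close>.\<close>
  let ?S = "\<Sum>is\<in>I n. fscale (c is / of_nat n) (Cycl (tensor_lin (L is)))"
  have ct: "Cycl (tensor_lin (L is)) \<in> cyc n" if "is \<in> I n" for "is"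
    using cyclic_tensor(1)[OF hf[OF that]] that by (simp add: I_def L_def)
  have S: "?S \<in> cyc_all"
    by (intro cyc_all_sum cyc_all_fscale) (use ct cyc_subset in blast)
  have "F = ?S"
  proof
    fix xs
    show "F xs = ?S xs"
    proof (cases "length xs = n")
      case True
      show ?thesis
      proof (rule mform_eqI[OF cyc_all_mform[OF cyc_subset[OF F]] cyc_all_mform[OF S]])
        fix w :: "(int \<times> 'v) list" assume w: "hw w" "length w = length xs"
        have "of_nat n * ev F w = rot (ev F) w"
          using rot_cyclic[OF cyc_all_cyclic[OF cyc_subset[OF F]] w(1)] w True n by simp
        also have "\<dots> = rot (\<lambda>z. \<Sum>is\<in>I n. c is * tlw (L is) z) w"
        proof (rule rot_cong)
          fix x y assume "w = x @ y"
          then have "hw (y @ x)" "length (y @ x) = n" using w True by auto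
          then show "ev F (y @ x) = (\<Sum>is\<in>I n. c is * tlw (L is) (y @ x))" by (rule c)
        qed
        also have "\<dots> = (\<Sum>is\<in>I n. c is * ev (Cycl (tensor_lin (L is))) w)"
          unfolding rot_sum rot_mult by (intro sum.cong refl) (simp add: cyclic_tensor(2)[OF hf w(1)])
        finally have "ev F w = (\<Sum>is\<in>I n. c is * ev (Cycl (tensor_lin (L is))) w) / of_nat n"
          using n by (simp add: field_simps)
        then show "ev F w = ev ?S w"
          by (simp add: ev_def sum_apply fscale_def sum_divide_distrib)
      qed
    next
      case False
      then have "?S xs = 0" using cyc_arity[OF ct] by (simp add: sum_apply fscale_def)
      then show ?thesis using cyc_arity[OF F False] by simp
    qed
  qed
  then show ?thesis
    by (rule that[OF finI]) (use hf in \<open>auto simp: I_def L_def\<close>)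
qed

lemma flinear_sum:
  assumes "flinear_on cyc_all L" "\<And>i. i \<in> A \<Longrightarrow> F i \<in> cyc_all"
  shows "L (\<Sum>i\<in>A. fscale (c i) (F i)) = (\<Sum>i\<in>A. fscale (c i) (L (F i)))"
proof -
  have 0: "L 0 = 0"
  proof -
    have "L (fscale 0 0) = fscale 0 (L 0)" using assms(1) cyc_all_0 by (auto simp: flinear_on_def)
    moreover have "fscale 0 (0 :: ('v, 'k) form) = 0" "fscale 0 (L 0) = 0" by (auto simp: fscale_def)
    ultimately show ?thesis by simp
  qed
  show ?thesis
    using assms(2)
  proof (induction A rule: infinite_finite_induct)
    case (insert i A)
    then have IH: "L (\<Sum>i\<in>A. fscale (c i) (F i)) = (\<Sum>i\<in>A. fscale (c i) (L (F i)))"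
      and F: "F i \<in> cyc_all" "\<And>j. j \<in> A \<Longrightarrow> F j \<in> cyc_all" by auto
    have add: "L (fscale (c i) (F i) + (\<Sum>i\<in>A. fscale (c i) (F i))) = L (fscale (c i) (F i)) + L (\<Sum>i\<in>A. fscale (c i) (F i))"
      using assms(1) F unfolding flinear_on_def by (blast intro: cyc_all_sum cyc_all_fscale)
    have scale: "L (fscale (c i) (F i)) = fscale (c i) (L (F i))"
      using assms(1) F unfolding flinear_on_def by blast
    show ?case unfolding sum.insert[OF insert(1,2)] add scale IH ..
  qed (simp_all add: 0)
qed

text \<open>Used to compare brackets, whose axioms speak of homogeneous forms and of cyclised
  products of linear forms, on arbitrary cyclic forms.\<close>

lemma flinear_cyc_eqI:
  assumes "flinear_on cyc_all L" "flinear_on cyc_all L'" "F \<in> cyc n" "n \<ge> 1"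
    and "\<And>\<delta>s \<beta>s. homog_forms \<delta>s \<beta>s \<Longrightarrow> length \<beta>s = n \<Longrightarrow> L (Cycl (tensor_lin \<beta>s)) = L' (Cycl (tensor_lin \<beta>s))"
  shows "L F = L' F"
proof -
  obtain I :: "nat list set" and c \<delta>s \<beta>s where "finite I"
    and F: "F = (\<Sum>i\<in>I. fscale (c i) (Cycl (tensor_lin (\<beta>s i))))"
    and I: "\<And>i. i \<in> I \<Longrightarrow> homog_forms (\<delta>s i) (\<beta>s i) \<and> length (\<beta>s i) = n"
    by (rule cyc_spanned[OF assms(3,4)]) (rule that)
  have mem: "Cycl (tensor_lin (\<beta>s i)) \<in> cyc_all" if "i \<in> I" for i
    using cyclic_tensor(1) I[OF that] cyc_subset by blast
  have "L F = (\<Sum>i\<in>I. fscale (c i) (L (Cycl (tensor_lin (\<beta>s i)))))"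
    unfolding F by (rule flinear_sum[OF assms(1) mem])
  also have "\<dots> = (\<Sum>i\<in>I. fscale (c i) (L' (Cycl (tensor_lin (\<beta>s i)))))"
  proof (rule sum.cong[OF refl])
    fix i assume "i \<in> I"
    then have "L (Cycl (tensor_lin (\<beta>s i))) = L' (Cycl (tensor_lin (\<beta>s i)))"
      using I by (intro assms(5)) auto
    then show "fscale (c i) (L (Cycl (tensor_lin (\<beta>s i)))) = fscale (c i) (L' (Cycl (tensor_lin (\<beta>s i))))"
      by simp
  qed
  also have "\<dots> = L' F"
    unfolding F by (rule flinear_sum[OF assms(2) mem, symmetric])
  finally show ?thesis .
qed

text \<open>A linear form \<open>a\<close> contracted into all factors of \<open>\<beta>\<^sub>1 \<otimes> \<dots> \<otimes> \<beta>\<^sub>k\<close>.\<close>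

lemma ins_tlw:
  assumes "homog_forms \<delta>s \<beta>s" "hw (a # z)"
  shows "sg (fst a * sum_list \<delta>s) * ins a (tlw \<beta>s) z =
    (\<Sum>j<length \<beta>s. sg (\<delta>s ! j * sum_list (take j \<delta>s)) * (sg (fst a) * (\<beta>s ! j) [snd a]) *
       tlw (take j \<beta>s @ drop (Suc j) \<beta>s) z)"
  using assms
proof (induction \<delta>s \<beta>s arbitrary: z rule: list_all2_induct)
  case Nil
  then show ?case by (simp add: ins_def)
next
  case (Cons \<delta> \<delta>s \<beta> \<beta>s)
  let ?S = "\<lambda>\<beta>s' z. \<Sum>j<length \<beta>s. sg (\<delta>s ! j * sum_list (take j \<delta>s)) * (sg (fst a) * (\<beta>s ! j) [snd a]) *
       tlw (\<beta>s' (take j \<beta>s @ drop (Suc j) \<beta>s)) z"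
  have a: "snd a \<in> gr (fst a + 1)" using Cons.prems by simp
  have dega: "even (\<delta>' + fst a)" if "\<beta>' \<in> cyc 1" "has_degree \<delta>' \<beta>'" "\<beta>' [snd a] \<noteq> 0" for \<beta>' \<delta>'
    using that a has_degree_linear[of \<beta>' \<delta>'] by (metis even_zero)
  have step: "(\<Sum>j<length (\<beta> # \<beta>s). sg ((\<delta> # \<delta>s) ! j * sum_list (take j (\<delta> # \<delta>s))) * (sg (fst a) * ((\<beta> # \<beta>s) ! j) [snd a]) *
       tlw (take j (\<beta> # \<beta>s) @ drop (Suc j) (\<beta> # \<beta>s)) z) =
    sg (fst a) * \<beta> [snd a] * tlw \<beta>s z +
    (\<Sum>j<length \<beta>s. sg (\<delta>s ! j * (\<delta> + sum_list (take j \<delta>s))) * (sg (fst a) * (\<beta>s ! j) [snd a]) *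
       tlw (\<beta> # (take j \<beta>s @ drop (Suc j) \<beta>s)) z)"
    by (simp add: sum.lessThan_Suc_shift del: sum.lessThan_Suc tlw.simps)
  have tw: "sg (\<delta>s ! j * (\<delta> + sum_list (take j \<delta>s))) * (sg (fst a) * (\<beta>s ! j) [snd a]) =
     sg (fst a * \<delta>) * (sg (\<delta>s ! j * sum_list (take j \<delta>s)) * (sg (fst a) * (\<beta>s ! j) [snd a]))" if "j < length \<beta>s" for j
  proof -
    have "\<beta>s ! j \<in> cyc 1" "has_degree (\<delta>s ! j) (\<beta>s ! j)"
      using Cons(2) that by (auto simp: list_all2_conv_all_nth)
    then have "(\<beta>s ! j) [snd a] \<noteq> 0 \<Longrightarrow> even (\<delta>s ! j + fst a)" by (rule dega)
    then have "sg (\<delta>s ! j * (\<delta> + sum_list (take j \<delta>s))) * (\<beta>s ! j) [snd a] =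
        sg (fst a * \<delta> + \<delta>s ! j * sum_list (take j \<delta>s)) * (\<beta>s ! j) [snd a]"
      by (intro sg_cong) auto
    then show ?thesis by (simp add: sg_add mult_ac)
  qed
  show ?case
  proof (cases z)
    case Nil
    have "sg (fst a * (\<delta> + sum_list \<delta>s)) * (\<beta> [snd a] * tlw \<beta>s []) = sg (fst a) * (\<beta> [snd a] * tlw \<beta>s [])"
    proof (rule sg_cong)
      assume "\<beta> [snd a] * tlw \<beta>s [] \<noteq> 0"
      then have "even (\<delta> + fst a)" "sum_list \<delta>s + wdeg [] = 0"
        using dega[of \<beta> \<delta>] Cons.hyps tlw_degree[OF Cons.hyps(2), of "[]"] by auto
      then show "even (fst a * (\<delta> + sum_list \<delta>s) + fst a)" by auto
    qed
    then show ?thesis unfolding step by (simp add: Nil ins_def mult.assoc)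
  next
    case z: (Cons c z')
    have t1: "tlw (\<beta> # \<beta>s) (a # c # z') = sg (fst a * (fst c + wdeg z')) * \<beta> [snd a] * tlw \<beta>s (c # z')" by simp
    have "ins a (tlw (\<beta> # \<beta>s)) (c # z') = tlw (\<beta> # \<beta>s) (a # c # z') + sg (fst a * fst c) * ins a (\<lambda>v. tlw (\<beta> # \<beta>s) (c # v)) z'"
      by (simp add: ins_def dec_mult[symmetric] distrib_left sg_add mult.assoc)
    also have "ins a (\<lambda>v. tlw (\<beta> # \<beta>s) (c # v)) z' = ins a (\<lambda>v. (sg (fst c * wdeg v) * \<beta> [snd c]) * tlw \<beta>s v) z'"
      by simp
    also have "\<dots> = sg (fst c * (fst a + wdeg z')) * \<beta> [snd c] * ins a (tlw \<beta>s) z'"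
      by (rule ins_wdeg)
    finally have I: "ins a (tlw (\<beta> # \<beta>s)) (c # z') = sg (fst a * (fst c + wdeg z')) * \<beta> [snd a] * tlw \<beta>s (c # z') +
        sg (fst a * fst c) * (sg (fst c * (fst a + wdeg z')) * \<beta> [snd c] * ins a (tlw \<beta>s) z')" unfolding t1 .
    have 1: "sg (fst a * (\<delta> + sum_list \<delta>s)) * (sg (fst a * (fst c + wdeg z')) * \<beta> [snd a] * tlw \<beta>s (c # z')) =
        sg (fst a) * \<beta> [snd a] * tlw \<beta>s (c # z')"
    proof -
      have "sg (fst a * (\<delta> + sum_list \<delta>s) + fst a * (fst c + wdeg z')) * (\<beta> [snd a] * tlw \<beta>s (c # z')) =
          sg (fst a) * (\<beta> [snd a] * tlw \<beta>s (c # z'))"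
      proof (rule sg_cong)
        assume "\<beta> [snd a] * tlw \<beta>s (c # z') \<noteq> 0"
        then have "even (\<delta> + fst a)" "sum_list \<delta>s + wdeg (c # z') = 0"
          using dega[of \<beta> \<delta>] Cons.hyps tlw_degree[OF Cons.hyps(2), of "c # z'"] Cons.prems z by auto
        then have "even (\<delta> + fst a)" "even (sum_list \<delta>s + (fst c + wdeg z'))" by simp_all
        then show "even (fst a * (\<delta> + sum_list \<delta>s) + fst a * (fst c + wdeg z') + fst a)" by auto
      qed
      then show ?thesis by (simp add: sg_add mult.assoc)
    qed
    have sgn: "sg (fst a * fst c) * sg (fst c * (fst a + wdeg z')) = (sg (fst c * wdeg z') :: 'k)"
      unfolding sg_add[symmetric] by (intro sg_eqI) auto
    have "sg (fst a * (\<delta> + sum_list \<delta>s)) * (sg (fst a * fst c) * (sg (fst c * (fst a + wdeg z')) * \<beta> [snd c] * ins a (tlw \<beta>s) z')) =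
      sg (fst a * \<delta>) * ((sg (fst a * fst c) * sg (fst c * (fst a + wdeg z'))) * \<beta> [snd c] * (sg (fst a * sum_list \<delta>s) * ins a (tlw \<beta>s) z'))"
      by (simp add: distrib_left sg_add mult_ac)
    also have "\<dots> = sg (fst a * \<delta>) * (sg (fst c * wdeg z') * \<beta> [snd c] * (\<Sum>j<length \<beta>s. sg (\<delta>s ! j * sum_list (take j \<delta>s)) * (sg (fst a) * (\<beta>s ! j) [snd a]) *
       tlw (take j \<beta>s @ drop (Suc j) \<beta>s) z'))"
      unfolding sgn using Cons.IH[of z'] Cons.prems z by simp
    also have "\<dots> = (\<Sum>j<length \<beta>s. sg (\<delta>s ! j * (\<delta> + sum_list (take j \<delta>s))) * (sg (fst a) * (\<beta>s ! j) [snd a]) *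
       tlw (\<beta> # (take j \<beta>s @ drop (Suc j) \<beta>s)) (c # z'))"
      unfolding sum_distrib_left by (intro sum.cong refl, subst tw, simp, simp add: mult_ac)
    finally show ?thesis
      unfolding step unfolding z I sum_list.Cons distrib_left[of "sg _"] 1 by (simp only:)
  qed
qed

end

section \<open>Consequences of the bracket axioms\<close>

context fd_graded_space
begin

lemma pinczon_bracketD:
  assumes "pinczon_bracket br"
  shows "F \<in> cyc_all \<Longrightarrow> flinear_on cyc_all (br F)"
    and "G \<in> cyc_all \<Longrightarrow> flinear_on cyc_all (\<lambda>F. br F G)"
    and "graded_lie br"
    and "F \<notin> cyc_all \<or> G \<notin> cyc_all \<Longrightarrow> br F G = 0"
    and "F \<in> cyc (k + 1) \<Longrightarrow> G \<in> cyc (k' + 1) \<Longrightarrow> br F G \<in> cyc (k + k')"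
    and "F \<in> cyc 0 \<Longrightarrow> G \<in> cyc_all \<Longrightarrow> br F G = 0"
    and "F \<in> cyc_all \<Longrightarrow> (\<And>G. G \<in> cyc_all \<Longrightarrow> br F G = 0) \<Longrightarrow> Sym F \<in> cyc 0"
    and "\<alpha> \<in> cyc 1 \<Longrightarrow> homog_forms \<delta>s \<beta>s \<Longrightarrow> \<beta>s \<noteq> [] \<Longrightarrow> br \<alpha> (Cycl (tensor_lin \<beta>s)) =
      (\<Sum>j<length \<beta>s. fscale (sg (\<delta>s ! j * sum_list (take j \<delta>s)) * br \<alpha> (\<beta>s ! j) [])
                          (Cycl (tensor_lin (take j \<beta>s @ drop (Suc j) \<beta>s))))"
proof -
  note * = assms[unfolded pinczon_bracket_def bilinear_bracket_def]
  show "F \<in> cyc_all \<Longrightarrow> flinear_on cyc_all (br F)" "G \<in> cyc_all \<Longrightarrow> flinear_on cyc_all (\<lambda>F. br F G)" "graded_lie br"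
    using * by simp_all
  show "F \<notin> cyc_all \<or> G \<notin> cyc_all \<Longrightarrow> br F G = 0" using * by metis
  show "F \<in> cyc (k + 1) \<Longrightarrow> G \<in> cyc (k' + 1) \<Longrightarrow> br F G \<in> cyc (k + k')" using * by simp
  have c: "cyc 0 \<subseteq> center br" "Sym ` center br \<subseteq> cyc 0" using * by simp_all
  show "F \<in> cyc 0 \<Longrightarrow> G \<in> cyc_all \<Longrightarrow> br F G = 0" using c(1) by (auto simp: center_def)
  show "F \<in> cyc_all \<Longrightarrow> (\<And>G. G \<in> cyc_all \<Longrightarrow> br F G = 0) \<Longrightarrow> Sym F \<in> cyc 0" using c(2) by (auto simp: center_def)
  show "\<alpha> \<in> cyc 1 \<Longrightarrow> homog_forms \<delta>s \<beta>s \<Longrightarrow> \<beta>s \<noteq> [] \<Longrightarrow> br \<alpha> (Cycl (tensor_lin \<beta>s)) =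
      (\<Sum>j<length \<beta>s. fscale (sg (\<delta>s ! j * sum_list (take j \<delta>s)) * br \<alpha> (\<beta>s ! j) [])
                          (Cycl (tensor_lin (take j \<beta>s @ drop (Suc j) \<beta>s))))"
    using * by simp
qed

lemma graded_lieD:
  assumes "graded_lie br" "F \<in> cyc_all" "G \<in> cyc_all" "has_degree d F" "has_degree d' G"
  shows "has_degree (d + d' - 2) (br F G)"
    and "br F G = fscale (- sg (d * d')) (br G F)"
    and "H \<in> cyc_all \<Longrightarrow> br F (br G H) = br (br F G) H + fscale (sg (d * d')) (br G (br F H))"
proof -
  have sg: "sg ((d - 2) * (d' - 2)) = (sg (d * d') :: 'k)" by (rule sg_eqI) simp
  have d: "(d - 2) + (d' - 2) + 2 = d + d' - 2" by simp
  have "has_degree ((d - 2) + (d' - 2) + 2) (br F G) \<and>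
        br F G = fscale (- sg ((d - 2) * (d' - 2))) (br G F) \<and>
        (\<forall>H\<in>cyc_all. br F (br G H) = br (br F G) H + fscale (sg ((d - 2) * (d' - 2))) (br G (br F H)))"
    using assms(1)[unfolded graded_lie_def, rule_format] assms(2-) by blast
  note * = this[unfolded sg d]
  show "has_degree (d + d' - 2) (br F G)" by (rule conjunct1[OF *])
  show "br F G = fscale (- sg (d * d')) (br G F)" by (rule conjunct1[OF conjunct2[OF *]])
  show "H \<in> cyc_all \<Longrightarrow> br F (br G H) = br (br F G) H + fscale (sg (d * d')) (br G (br F H))"
    by (rule bspec[OF conjunct2[OF conjunct2[OF *]]])
qed

text \<open>The centre is defined with the central form on the left. The other side follows by
  graded antisymmetry, which needs homogeneous forms and is therefore applied to the spanning
  products.\<close>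

lemma pinczon_bracket_cyc0:
  assumes br: "pinczon_bracket br" and c: "c \<in> cyc 0" and G: "G \<in> cyc_all"
  shows "br c G = 0" "br G c = 0"
proof -
  note cen = pinczon_bracketD(6)[OF br]
  show "br c G = 0" using c G by (rule cen)
  have lin: "flinear_on cyc_all (\<lambda>F. br F c)"
    by (rule pinczon_bracketD(2)[OF br cyc_subset[OF c]])
  have deg: "has_degree 0 c"
    unfolding has_degree_iff
  proof (intro allI impI)
    fix w :: "(int \<times> 'v) list" assume "hw w \<and> ev c w \<noteq> 0"
    then have "w = []" using cyc_arity[OF c, of "map snd w"] by (auto simp: ev_def)
    then show "0 + wdeg w = 0" by simp
  qed
  have lin0: "flinear_on cyc_all (\<lambda>F. 0 :: ('v, 'k) form)"
    by (auto simp: flinear_on_def fscale_def)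
  have pos: "br F c = 0" if "F \<in> cyc n" "n \<ge> 1" for F n
  proof (rule flinear_cyc_eqI[OF lin lin0 that])
    fix \<delta>s \<beta>s assume "homog_forms \<delta>s \<beta>s"
    from cyclic_tensor(1,3)[OF this]
    have *: "Cycl (tensor_lin \<beta>s) \<in> cyc_all" "has_degree (sum_list \<delta>s) (Cycl (tensor_lin \<beta>s))"
      using cyc_subset by blast+
    have "br (Cycl (tensor_lin \<beta>s)) c = fscale (- sg (sum_list \<delta>s * 0)) (br c (Cycl (tensor_lin \<beta>s)))"
      by (rule graded_lieD(2)[OF pinczon_bracketD(3)[OF br] *(1) cyc_subset[OF c] *(2) deg])
    then show "br (Cycl (tensor_lin \<beta>s)) c = 0" using cen[OF c *(1)] by (simp add: fscale_def zero_fun_def)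
  qed
  obtain n where n: "\<And>xs. length xs > n \<Longrightarrow> G xs = 0" using cyc_allE[OF G] by blast
  have k: "comp_arity k G \<in> cyc k" for k by (intro cyc_comp_arity cyc_all_cyclic G)
  have z: "br (comp_arity k G) c = 0" for k
    using k[of k] pos[OF k] cen[OF _ cyc_subset[OF c]] by (cases "k = 0") auto
  have "G = (\<Sum>k\<le>n. fscale 1 (comp_arity k G))"
    by (subst sum_comp_arity[OF n]) (simp_all add: fscale_def)
  then have "br G c = (\<Sum>k\<le>n. fscale 1 (br (comp_arity k G) c))"
    using flinear_sum[OF lin, of "{..n}" "\<lambda>k. comp_arity k G" "\<lambda>_. 1"] cyc_subset[OF k] by simp
  moreover have "fscale 1 0 = (0 :: ('v, 'k) form)" by (auto simp: fscale_def)
  ultimately show "br G c = 0" by (simp only: z sum.neutral_const)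
qed

lemma flinear_eqI:
  assumes "flinear_on cyc_all L" "flinear_on cyc_all L'" "F \<in> cyc_all"
    and "\<And>n G. G \<in> cyc n \<Longrightarrow> L G = L' G"
  shows "L F = L' F"
proof -
  obtain n where n: "\<And>xs. length xs > n \<Longrightarrow> F xs = 0" using cyc_allE[OF assms(3)] by blast
  have k: "comp_arity k F \<in> cyc k" for k by (intro cyc_comp_arity cyc_all_cyclic assms)
  have F: "F = (\<Sum>k\<le>n. fscale 1 (comp_arity k F))"
    by (subst sum_comp_arity[OF n]) (simp_all add: fscale_def)
  have "L (\<Sum>k\<le>n. fscale 1 (comp_arity k F)) = L' (\<Sum>k\<le>n. fscale 1 (comp_arity k F))"
    using flinear_sum[OF assms(1), of "{..n}" "\<lambda>k. comp_arity k F" "\<lambda>_. 1"]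
      flinear_sum[OF assms(2), of "{..n}" "\<lambda>k. comp_arity k F" "\<lambda>_. 1"] cyc_subset[OF k] assms(4)[OF k] by simp
  then show ?thesis using F by simp
qed

text \<open>Cyclicity rotates the letter \<open>a\<close> to the front, and after symmetrisation the
  two exchanged pieces may be joined again; each of the \<open>length w + 1\<close> positions of
  \<open>a\<close> then contributes the same.\<close>

lemma symsum_cyclic:
  assumes F: "cyclic F" and w: "hw (a # w)"
  shows "symsum (a # w) (ev F) = of_nat (length w + 1) * symsum w (\<lambda>z. ev F (a # z))"
proof -
  have "symsum (a # w) (ev F) = symsum w (dec (\<lambda>u v. sg (wdeg u * wdeg v) * ev F (a # v @ u)))"
    unfolding symsum.simps
  proof (rule symsum_cong)
    fix z assume "mset z = mset w"
    then have z: "hw z" using w hw_mset by auto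
    show "ins a (ev F) z = dec (\<lambda>u v. sg (wdeg u * wdeg v) * ev F (a # v @ u)) z"
      unfolding ins_def
    proof (rule dec_cong)
      fix u v assume "z = u @ v"
      then have "ev F (u @ (a # v)) = sg (wdeg u * wdeg (a # v)) * ev F ((a # v) @ u)"
        using z w by (intro cyclic_append[OF F]) auto
      then have *: "ev F (u @ a # v) = sg (wdeg u * (fst a + wdeg v)) * ev F (a # v @ u)" by simp
      have "sg (fst a * wdeg u) * sg (wdeg u * (fst a + wdeg v)) = (sg (wdeg u * wdeg v) :: 'k)"
        unfolding sg_add[symmetric] by (rule sg_eqI) auto
      then show "sg (fst a * wdeg u) * ev F (u @ a # v) = sg (wdeg u * wdeg v) * ev F (a # v @ u)"
        unfolding * by (simp add: mult.assoc[symmetric])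
    qed
  qed
  also have "\<dots> = symsum w (dec (\<lambda>u v. ev F (a # u @ v)))"
    by (subst symsum_dec_swap) (simp add: mult.commute)
  also have "\<dots> = symsum w (\<lambda>z. of_nat (length z + 1) * ev F (a # z))"
    by (intro arg_cong[of _ _ "symsum w"] ext) (rule dec_append_args[of "\<lambda>z. ev F (a # z)"])
  also have "\<dots> = symsum w (\<lambda>z. of_nat (length w + 1) * ev F (a # z))"
    by (rule symsum_cong) (metis mset_eq_length)
  finally show ?thesis by (simp only: symsum_mult)
qed

end

section \<open>The contraction bracket, and brackets up to symmetrisation\<close>

context graded_dual
begin

lemma contraction_eq_brk:
  assumes F: "F \<in> cyc (k + 1)" and G: "G \<in> cyc (k' + 1)"
  shows "contraction k \<epsilon>s es es' F G = brk F G"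
proof -
  have "(\<Sum>i<N. (let e = \<epsilon> i; p = sum_list (take k ds); q = sum_list (drop k ds) in
       sg ((e + q) * (e + p) + e * p) * F (es ! i # take k xs) * G (es' ! i # drop k xs))) =
    (\<Sum>r\<le>length xs. \<Sum>i<N. sg ((\<epsilon> i + sum_list (drop r ds)) * (\<epsilon> i + sum_list (take r ds)) + \<epsilon> i * sum_list (take r ds)) *
       (F (es ! i # take r xs) * G (es' ! i # drop r xs)))" (is "?L = (\<Sum>r\<le>length xs. ?R r)") for ds xs
  proof -
    have R0: "?R r = 0" if "r \<le> length xs" "r \<noteq> k" for r
      using cyc_arity[OF F, of "es ! i # take r xs" for i] that by (intro sum.neutral) auto
    have "?L = (if k \<le> length xs then ?R k else 0)"
      using cyc_arity[OF F, of "es ! i # take k xs" for i] by (simp add: Let_def mult.assoc)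
    also have "\<dots> = (\<Sum>r\<le>length xs. if r = k then ?R k else 0)" by simp
    also have "\<dots> = (\<Sum>r\<le>length xs. ?R r)"
      by (intro sum.cong refl) (use R0 in auto)
    finally show ?thesis .
  qed
  then show ?thesis
    using F G cyc_subset by (simp add: contraction_def brk_def ctrf_def)
qed

text \<open>\<open>contracts\<close> quantifies over all dual bases, whereas \<open>brk\<close> is
  built from one fixed pair; \<open>casimir_indep\<close> closes the gap.\<close>

lemma brk_indep:
  assumes f: "graded_dual scale gr b \<delta>s fs fs'"
  shows "graded_dual.brk scale gr \<delta>s fs fs' F G = brk F G"
proof -
  interpret f: graded_dual scale gr b \<delta>s fs fs' by fact
  show ?thesis
  proof (cases "F \<in> cyc_all \<and> G \<in> cyc_all")
    case True
    have "f.brk F G = brk F G"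
    proof (rule f.brk_eqI[OF mform_brk])
      fix w :: "(int \<times> 'v) list" assume w: "hw w"
      have "f.ctr (ev F) (ev G) = ctr (ev F) (ev G)"
        unfolding f.ctr_def ctr_def
      proof (intro ext dec_cong)
        fix u v
        have m: "mform F" "mform G" using True by (simp_all add: cyc_all_mform)
        show "(\<Sum>i<length fs. sg ((\<delta>s ! i + wdeg v) * (\<delta>s ! i + wdeg u) + \<delta>s ! i * wdeg u) *
            (ev F ((\<delta>s ! i, fs ! i) # u) * ev G ((- 2 - \<delta>s ! i, fs' ! i) # v))) =
          (\<Sum>i<N. sg ((\<epsilon> i + wdeg v) * (\<epsilon> i + wdeg u) + \<epsilon> i * wdeg u) * (ev F (E i # u) * ev G (E' i # v)))"
          using casimir_indep[OF f, where \<phi> = "\<lambda>x y. F (x # map snd u) * G (y # map snd v)" and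
              wt = "\<lambda>n. sg ((n + wdeg v) * (n + wdeg u) + n * wdeg u)"]
          by (simp add: ev_def linear_scalar_iff mform_addD_Cons mform_scaleD_Cons m algebra_simps)
      qed
      then show "ev (f.brk F G) w = ev (brk F G) w"
        using True w by (simp add: ev_brk f.ev_brk)
    qed
    then show ?thesis .
  qed (auto simp: f.brk_def brk_def)
qed

lemma contracts_brk: "contracts brk b k k'"
  unfolding contracts_def
proof (intro ballI allI impI)
  fix F G \<delta>s fs fs' assume FG: "F \<in> cyc (k + 1)" "G \<in> cyc (k' + 1)" and d: "dual_bases b \<delta>s fs fs'"
  have f: "graded_dual scale gr b \<delta>s fs fs'" by unfold_locales (rule nondeg, rule d)
  show "brk F G = contraction k \<delta>s fs fs' F G"
    using graded_dual.contraction_eq_brk[OF f FG] brk_indep[OF f] by simp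
qed

lemma bracket_of_form_brk: "bracket_of_form b brk"
  by (simp add: bracket_of_form_def contracts_brk)

text \<open>A linear form has no argument left after contraction, so only the cut with empty left
  piece contributes.\<close>

lemma ev_brk_linear:
  assumes \<alpha>: "\<alpha> \<in> cyc 1" and F: "F \<in> cyc_all" and w: "hw w"
  shows "ev (brk \<alpha> F) w = (\<Sum>i<N. \<alpha> [es ! i] * (sg ((\<epsilon> i + wdeg w) * \<epsilon> i) * rot (\<lambda>z. ev F (E' i # z)) w))"
proof -
  have "ev (brk \<alpha> F) w = rot (\<lambda>z. \<Sum>i<N. \<alpha> [es ! i] * (sg ((\<epsilon> i + wdeg w) * \<epsilon> i) * ev F (E' i # z))) w"
    unfolding ev_brk[OF cyc_subset[OF \<alpha>] F w]
  proof (rule rot_cong_hw[OF _ w])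
    fix z :: "(int \<times> 'v) list" assume z: "wdeg z = wdeg w"
    have "ctr (ev \<alpha>) (ev F) z = dec (\<lambda>u v. if u = [] then
        \<Sum>i<N. \<alpha> [es ! i] * (sg ((\<epsilon> i + wdeg v) * \<epsilon> i) * ev F (E' i # v)) else 0) z"
      unfolding ctr_def
      by (intro dec_cong) (auto simp: ev_def cyc_arity[OF \<alpha>] mult_ac intro!: sum.neutral sum.cong)
    then show "ctr (ev \<alpha>) (ev F) z = (\<Sum>i<N. \<alpha> [es ! i] * (sg ((\<epsilon> i + wdeg w) * \<epsilon> i) * ev F (E' i # z)))"
      by (simp add: dec_Nil_left z)
  qed
  then show ?thesis by (simp only: rot_sum rot_mult)
qed

lemma brk_linear_value:
  assumes "\<alpha> \<in> cyc 1" "\<beta> \<in> cyc 1"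
  shows "brk \<alpha> \<beta> [] = (\<Sum>i<N. sg (\<epsilon> i) * (\<alpha> [es ! i] * \<beta> [es' ! i]))"
proof -
  have "sg (\<epsilon> i * \<epsilon> i) = (sg (\<epsilon> i) :: 'k)" for i by (rule sg_eqI) auto
  then show ?thesis
    using ev_brk_linear[OF assms(1) cyc_subset[OF assms(2)], of "[]"]
    by (simp add: ev_def rot_def mult_ac)
qed

lemma homog_forms_delete:
  assumes "homog_forms \<delta>s \<beta>s" "j < length \<beta>s"
  shows "homog_forms (take j \<delta>s @ drop (Suc j) \<delta>s) (take j \<beta>s @ drop (Suc j) \<beta>s)"
    and "sum_list (take j \<delta>s @ drop (Suc j) \<delta>s) = sum_list \<delta>s - \<delta>s ! j"
proof -
  show "homog_forms (take j \<delta>s @ drop (Suc j) \<delta>s) (take j \<beta>s @ drop (Suc j) \<beta>s)"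
    using assms(1) by (intro list_all2_appendI list_all2_takeI list_all2_dropI)
  have "j < length \<delta>s" using assms by (simp add: list_all2_lengthD)
  then have "sum_list \<delta>s = sum_list (take j \<delta>s @ \<delta>s ! j # drop (Suc j) \<delta>s)"
    by (simp only: id_take_nth_drop[symmetric])
  then show "sum_list (take j \<delta>s @ drop (Suc j) \<delta>s) = sum_list \<delta>s - \<delta>s ! j" by simp
qed

text \<open>By \<open>rot_Cons\<close> the left side runs over the words y a x, where x @ y is a
  rotation of \<open>w\<close>. Under the outer rotation x and y may be exchanged, and this leaves
  the insertion of \<open>a\<close> at every position.\<close>

lemma rot_tensor_Cons:
  assumes h: "homog_forms \<delta>s \<beta>s" and a: "hw (a # w)"
  shows "rot (\<lambda>z. ev (Cycl (tensor_lin \<beta>s)) (a # z)) w = rot (ins a (tlw \<beta>s)) w"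
proof -
  have "rot (\<lambda>z. ev (Cycl (tensor_lin \<beta>s)) (a # z)) w =
      rot (dec (\<lambda>x y. sg (wdeg y * (fst a + wdeg x)) * tlw \<beta>s (y @ a # x))) w"
    by (rule rot_cong_hw) (use a cyclic_tensor(2)[OF h] in \<open>auto simp: rot_Cons\<close>)
  also have "\<dots> = rot (dec (\<lambda>u v. sg (wdeg u * wdeg v) * (sg (wdeg u * (fst a + wdeg v)) * tlw \<beta>s (u @ a # v)))) w"
    by (rule rot_dec_swap)
  also have "(\<lambda>u v. sg (wdeg u * wdeg v) * (sg (wdeg u * (fst a + wdeg v)) * tlw \<beta>s (u @ a # v))) =
      (\<lambda>u v. sg (fst a * wdeg u) * tlw \<beta>s (u @ a # v))"
  proof (intro ext)
    fix u v :: "(int \<times> 'v) list"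
    have "sg (wdeg u * wdeg v) * sg (wdeg u * (fst a + wdeg v)) = (sg (fst a * wdeg u) :: 'k)"
      unfolding sg_add[symmetric] by (rule sg_eqI) auto
    then show "sg (wdeg u * wdeg v) * (sg (wdeg u * (fst a + wdeg v)) * tlw \<beta>s (u @ a # v)) =
        sg (fst a * wdeg u) * tlw \<beta>s (u @ a # v)" by (simp add: mult.assoc[symmetric])
  qed
  finally show ?thesis by (simp add: ins_def[abs_def])
qed

text \<open>The bracket feeds the vectors es'_i into the cyclised product. By
  \<open>rot_tensor_Cons\<close> this is an insertion at every position, \<open>ins_tlw\<close>
  evaluates the factor that receives the vector, and the sum over i rebuilds the scalar
  brackets.\<close>

lemma brk_derivation:
  assumes \<alpha>: "\<alpha> \<in> cyc 1" and h: "homog_forms \<delta>s \<beta>s"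
  shows "brk \<alpha> (Cycl (tensor_lin \<beta>s)) =
    (\<Sum>j<length \<beta>s. fscale (sg (\<delta>s ! j * sum_list (take j \<delta>s)) * brk \<alpha> (\<beta>s ! j) [])
                          (Cycl (tensor_lin (take j \<beta>s @ drop (Suc j) \<beta>s))))"
proof (rule brk_eqI)
  let ?t = "\<lambda>j. Cycl (tensor_lin (take j \<beta>s @ drop (Suc j) \<beta>s))"
  have t: "?t j \<in> cyc_all" if "j < length \<beta>s" for j
    using cyclic_tensor(1)[OF homog_forms_delete(1)[OF h that]] cyc_subset by blast
  show "mform (\<Sum>j<length \<beta>s. fscale (sg (\<delta>s ! j * sum_list (take j \<delta>s)) * brk \<alpha> (\<beta>s ! j) []) (?t j))"
    by (intro cyc_all_mform cyc_all_sum cyc_all_fscale t) simp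
  fix w :: "(int \<times> 'v) list" assume w: "hw w"
  let ?c = "\<lambda>j. sg (\<delta>s ! j * sum_list (take j \<delta>s)) :: 'k"
  have \<beta>: "\<beta>s ! j \<in> cyc 1" "has_degree (\<delta>s ! j) (\<beta>s ! j)" if "j < length \<beta>s" for j
    using h that by (auto simp: list_all2_conv_all_nth)
  have E: "sg ((\<epsilon> i + wdeg w) * \<epsilon> i) * rot (\<lambda>z. ev (Cycl (tensor_lin \<beta>s)) (E' i # z)) w =
     (\<Sum>j<length \<beta>s. ?c j * (sg (\<epsilon> i) * ((\<beta>s ! j) [es' ! i] * ev (?t j) w)))" if i: "i < N" for i
  proof -
    let ?a = "- 2 - \<epsilon> i" and ?D = "sum_list \<delta>s"
    have "ins (E' i) (tlw \<beta>s) z = sg (?a * ?D) * (\<Sum>j<length \<beta>s. ?c j * (sg ?a * (\<beta>s ! j) [es' ! i]) *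
       tlw (take j \<beta>s @ drop (Suc j) \<beta>s) z)" if "hw z" for z
    proof -
      have "ins (E' i) (tlw \<beta>s) z = sg (?a * ?D) * (sg (?a * ?D) * ins (E' i) (tlw \<beta>s) z)" by simp
      then show ?thesis using ins_tlw[OF h, of "E' i" z] that i by (simp only: hw_E fst_conv snd_conv)
    qed
    then have "rot (ins (E' i) (tlw \<beta>s)) w = rot (\<lambda>z. sg (?a * ?D) * (\<Sum>j<length \<beta>s. ?c j * (sg ?a * (\<beta>s ! j) [es' ! i]) *
       tlw (take j \<beta>s @ drop (Suc j) \<beta>s) z)) w"
      by (intro rot_cong_hw[OF _ w])
    also have "\<dots> = sg (?a * ?D) * (\<Sum>j<length \<beta>s. ?c j * (sg ?a * (\<beta>s ! j) [es' ! i]) * ev (?t j) w)"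
      unfolding rot_mult rot_sum
      by (intro arg_cong[of _ _ "(*) _"] sum.cong refl) (simp add: cyclic_tensor(2)[OF homog_forms_delete(1)[OF h] w])
    finally have "sg ((\<epsilon> i + wdeg w) * \<epsilon> i) * rot (\<lambda>z. ev (Cycl (tensor_lin \<beta>s)) (E' i # z)) w =
      (\<Sum>j<length \<beta>s. sg ((\<epsilon> i + wdeg w) * \<epsilon> i) * (sg (?a * ?D) * (?c j * (sg ?a * (\<beta>s ! j) [es' ! i]) * ev (?t j) w)))"
      using rot_tensor_Cons[OF h, of "E' i" w] i w by (simp only: hw_E sum_distrib_left)
    also have "\<dots> = (\<Sum>j<length \<beta>s. ?c j * (sg (\<epsilon> i) * ((\<beta>s ! j) [es' ! i] * ev (?t j) w)))"
    proof (intro sum.cong refl)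
      fix j assume "j \<in> {..<length \<beta>s}"
      then have j: "j < length \<beta>s" by simp
      have tw: "sg ((\<epsilon> i + wdeg w) * \<epsilon> i + (?a * ?D + ?a)) * ((\<beta>s ! j) [es' ! i] * ev (?t j) w) =
         sg (\<epsilon> i) * ((\<beta>s ! j) [es' ! i] * ev (?t j) w)"
      proof (rule sg_cong)
        assume nz: "(\<beta>s ! j) [es' ! i] * ev (?t j) w \<noteq> 0"
        then have "\<delta>s ! j + ?a = 0"
          using \<beta>(2)[OF j, unfolded has_degree_linear[OF \<beta>(1)[OF j]], rule_format, of "es' ! i" ?a] es'_in[OF i]
          by simp
        moreover have "?D - \<delta>s ! j + wdeg w = 0"
          using cyclic_tensor(3)[OF homog_forms_delete(1)[OF h j]] nz w homog_forms_delete(2)[OF h j]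
          unfolding has_degree_iff by auto
        ultimately have "\<delta>s ! j = 2 + \<epsilon> i" "wdeg w = \<delta>s ! j - ?D" by simp_all
        then show "even ((\<epsilon> i + wdeg w) * \<epsilon> i + (?a * ?D + ?a) + \<epsilon> i)" by auto
      qed
      have "sg ((\<epsilon> i + wdeg w) * \<epsilon> i) * (sg (?a * ?D) * (?c j * (sg ?a * (\<beta>s ! j) [es' ! i]) * ev (?t j) w)) =
        ?c j * (sg ((\<epsilon> i + wdeg w) * \<epsilon> i + (?a * ?D + ?a)) * ((\<beta>s ! j) [es' ! i] * ev (?t j) w))"
        by (simp only: sg_add mult_ac)
      then show "sg ((\<epsilon> i + wdeg w) * \<epsilon> i) * (sg (?a * ?D) * (?c j * (sg ?a * (\<beta>s ! j) [es' ! i]) * ev (?t j) w)) =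
        ?c j * (sg (\<epsilon> i) * ((\<beta>s ! j) [es' ! i] * ev (?t j) w))"
        unfolding tw .
    qed
    finally show ?thesis .
  qed
  have "ev (brk \<alpha> (Cycl (tensor_lin \<beta>s))) w = (\<Sum>i<N. \<alpha> [es ! i] *
     (\<Sum>j<length \<beta>s. ?c j * (sg (\<epsilon> i) * ((\<beta>s ! j) [es' ! i] * ev (?t j) w))))"
    using ev_brk_linear[OF \<alpha> cyc_subset[OF cyclic_tensor(1)[OF h]] w] E by simp
  also have "\<dots> = (\<Sum>j<length \<beta>s. \<Sum>i<N. \<alpha> [es ! i] * (?c j * (sg (\<epsilon> i) * ((\<beta>s ! j) [es' ! i] * ev (?t j) w))))"
    unfolding sum_distrib_left by (rule sum.swap)
  also have "\<dots> = (\<Sum>j<length \<beta>s. ?c j * brk \<alpha> (\<beta>s ! j) [] * ev (?t j) w)"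
  proof (intro sum.cong refl)
    fix j assume "j \<in> {..<length \<beta>s}"
    then show "(\<Sum>i<N. \<alpha> [es ! i] * (?c j * (sg (\<epsilon> i) * ((\<beta>s ! j) [es' ! i] * ev (?t j) w)))) = ?c j * brk \<alpha> (\<beta>s ! j) [] * ev (?t j) w"
      by (simp add: brk_linear_value[OF \<alpha> \<beta>(1)] sum_distrib_left sum_distrib_right mult_ac)
  qed
  finally show "ev (brk \<alpha> (Cycl (tensor_lin \<beta>s))) w =
    ev (\<Sum>j<length \<beta>s. fscale (?c j * brk \<alpha> (\<beta>s ! j) []) (?t j)) w"
    by (simp add: ev_def sum_apply fscale_def)
qed

text \<open>In the bracket with this linear form the sum over dual bases collapses, by
  \<open>expand_es'\<close>, to the substitution of \<open>a\<close> itself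
  (\<open>ev_brk_b_form\<close>).\<close>

definition b_form :: "int \<times> 'v \<Rightarrow> ('v, 'k) form" where
  "b_form a = lf (\<lambda>x. b x (snd a))"

lemma b_form_cyc: "b_form a \<in> cyc 1"
  unfolding b_form_def by (rule lf_cyc[OF blin(2)])

lemma b_form_degree: "hw [a] \<Longrightarrow> has_degree (2 + fst a) (b_form a)"
  unfolding has_degree_linear[OF b_form_cyc]
  using b_orth[of _ _ "snd a" "fst a + 1"] by (fastforce simp: b_form_def)

lemma ev_brk_b_form:
  assumes F: "F \<in> cyc_all" and aw: "hw (a # w)"
  shows "ev (brk (b_form a) F) w = sg ((fst a + wdeg w) * fst a) * rot (\<lambda>z. ev F (a # z)) w"
proof -
  have w: "hw w" and a: "snd a \<in> gr (fst a + 1)" using aw by auto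
  let ?s = "sg ((fst a + wdeg w) * fst a) :: 'k"
  have "ev (brk (b_form a) F) w = (\<Sum>i<N. b (es ! i) (snd a) * (sg ((\<epsilon> i + wdeg w) * \<epsilon> i) * rot (\<lambda>z. ev F (E' i # z)) w))"
    using ev_brk_linear[OF b_form_cyc F w] by (simp add: b_form_def)
  also have "\<dots> = (\<Sum>i<N. ?s * (b (es ! i) (snd a) * rot (\<lambda>z. ev F (E' i # z)) w))"
  proof (intro sum.cong refl)
    fix i assume "i \<in> {..<N}"
    then have "b (es ! i) (snd a) \<noteq> 0 \<Longrightarrow> \<epsilon> i + 1 + (fst a + 1) = 0"
      using b_orth[OF es_in a, of i] by auto
    then have "sg ((\<epsilon> i + wdeg w) * \<epsilon> i) * (b (es ! i) (snd a) * rot (\<lambda>z. ev F (E' i # z)) w) =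
        ?s * (b (es ! i) (snd a) * rot (\<lambda>z. ev F (E' i # z)) w)"
    proof (intro sg_cong)
      assume *: "b (es ! i) (snd a) \<noteq> 0 \<Longrightarrow> \<epsilon> i + 1 + (fst a + 1) = 0" and "b (es ! i) (snd a) * rot (\<lambda>z. ev F (E' i # z)) w \<noteq> 0"
      then have "\<epsilon> i = - 2 - fst a" by force
      then show "even ((\<epsilon> i + wdeg w) * \<epsilon> i + (fst a + wdeg w) * fst a)" by auto
    qed
    then show "b (es ! i) (snd a) * (sg ((\<epsilon> i + wdeg w) * \<epsilon> i) * rot (\<lambda>z. ev F (E' i # z)) w) =
        ?s * (b (es ! i) (snd a) * rot (\<lambda>z. ev F (E' i # z)) w)" by (simp only: mult_ac)
  qed
  also have "\<dots> = ?s * rot (\<lambda>z. \<Sum>i<N. b (es ! i) (snd a) * ev F (E' i # z)) w"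
    by (simp only: sum_distrib_left[symmetric] rot_sum rot_mult)
  also have "(\<lambda>z. \<Sum>i<N. b (es ! i) (snd a) * ev F (E' i # z)) = (\<lambda>z. ev F (a # z))"
  proof
    fix z :: "(int \<times> 'v) list"
    have "F ((\<Sum>i<N. b (es ! i) (snd a) *s es' ! i) # map snd z) = (\<Sum>i<N. b (es ! i) (snd a) * F (es' ! i # map snd z))"
      by (simp only: mform_sum_Cons[OF cyc_all_mform[OF F]] mform_scaleD_Cons[OF cyc_all_mform[OF F]])
    then show "(\<Sum>i<N. b (es ! i) (snd a) * ev F (E' i # z)) = ev F (a # z)"
      by (simp add: ev_def flip: expand_es')
  qed
  finally show ?thesis .
qed

text \<open>Symmetrising absorbs the rotation of \<open>ev_brk_b_form\<close>, and
  \<open>symsum_cyclic\<close> moves the fixed first letter back among the others. Since all factors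
  are invertible, brackets with linear forms determine the symmetrisation of \<open>F\<close> on
  every nonempty word.\<close>

lemma symsum_brk_b_form:
  assumes F: "F \<in> cyc_all" and aw: "hw (a # w)"
  shows "of_nat (length w + 1) * symsum w (ev (brk (b_form a) F)) =
    of_nat (max 1 (length w)) * (sg ((fst a + wdeg w) * fst a) * symsum (a # w) (ev F))"
proof -
  have "symsum w (ev (brk (b_form a) F)) = symsum w (\<lambda>z. sg ((fst a + wdeg w) * fst a) * rot (\<lambda>z. ev F (a # z)) z)"
  proof (rule symsum_cong)
    fix z assume z: "mset z = mset w"
    then have "hw (a # z)" using aw hw_mset[OF z] by auto
    then show "ev (brk (b_form a) F) z = sg ((fst a + wdeg w) * fst a) * rot (\<lambda>z. ev F (a # z)) z"
      using ev_brk_b_form[OF F] wdeg_mset[OF z] by simp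
  qed
  also have "\<dots> = sg ((fst a + wdeg w) * fst a) * (of_nat (max 1 (length w)) * symsum w (\<lambda>z. ev F (a # z)))"
    by (simp only: symsum_mult symsum_rot)
  finally show ?thesis
    unfolding symsum_cyclic[OF cyc_all_cyclic[OF F] aw] by (simp only: mult_ac)
qed

text \<open>\<open>F\<close> need not be homogeneous, so antisymmetry is applied to its parity
  parts. Their brackets with \<open>G\<close> have different parities and cannot cancel each other,
  so each of them vanishes.\<close>

lemma brk_0_commute:
  assumes F: "F \<in> cyc_all" and G: "G \<in> cyc_all" "parity d G" and 0: "brk F G = 0"
  shows "brk G F = 0"
proof -
  let ?F = "\<lambda>p. parity_part p F"
  have F': "?F p \<in> cyc_all" "parity p (?F p)" for p
    using F by (simp_all add: cyc_all_parity_part parity_parity_part cyc_all_mform)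
  have dec: "F = ?F 0 + ?F 1" by (rule parity_decomp[OF cyc_all_mform[OF F]])
  have lin: "brk F G = brk (?F 0) G + brk (?F 1) G" "brk G F = brk G (?F 0) + brk G (?F 1)"
    by (subst dec, simp only: brk_add_left brk_add_right F' G)+
  have z: "ev (brk (?F 0) G) w = 0 \<and> ev (brk (?F 1) G) w = 0" if w: "hw w" for w
  proof -
    have "ev (brk (?F 0) G) w + ev (brk (?F 1) G) w = 0"
      using lin(1) 0 by (metis ev_add ev_def zero_fun_apply)
    moreover have "ev (brk (?F 0) G) w \<noteq> 0 \<Longrightarrow> even (0 + d + wdeg w)" "ev (brk (?F 1) G) w \<noteq> 0 \<Longrightarrow> even (1 + d + wdeg w)"
      using brk_parity[OF F'(1) G(1) F'(2) G(2)] w unfolding parity_def by blast+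
    ultimately show ?thesis by fastforce
  qed
  show ?thesis
  proof (rule brk_eqI)
    fix w :: "(int \<times> 'v) list" assume w: "hw w"
    have "ev (brk G (?F p)) w = - sg (d * p) * ev (brk (?F p) G) w" for p
      using brk_antisym[OF G F'] by (simp add: ev_fscale)
    then show "ev (brk G F) w = ev 0 w" using z[OF w] by (simp add: lin(2) ev_add) (simp add: ev_def)
  qed auto
qed

text \<open>A central form has zero bracket with every \<open>b_form a\<close>, so by
  \<open>symsum_brk_b_form\<close> its symmetrisation vanishes on nonempty words.
  \<open>brk_0_commute\<close> is needed because centrality puts the form on the left.\<close>

lemma center_brk: "cyc 0 \<subseteq> center brk" "Sym ` center brk \<subseteq> cyc 0"
proof -
  show "cyc 0 \<subseteq> center brk"
  proof
    fix F assume F: "F \<in> cyc 0"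
    have "brk F G = 0" if "G \<in> cyc_all" for G
    proof
      fix xs :: "'v list"
      show "brk F G xs = 0 xs"
        using brk_arity[OF cyc_subset[OF F] that, of xs] cyc_arity[OF F] by auto
    qed
    then show "F \<in> center brk" using cyc_subset[OF F] by (simp add: center_def)
  qed
  show "Sym ` center brk \<subseteq> cyc 0"
  proof (rule image_subsetI)
    fix F assume "F \<in> center brk"
    then have F: "F \<in> cyc_all" and 0: "\<And>G. G \<in> cyc_all \<Longrightarrow> brk F G = 0" by (auto simp: center_def)
    have S: "mform (Sym F)" by (rule mform_Sym[OF cyc_all_mform[OF F]])
    have Z: "Sym F xs = 0" if ne: "xs \<noteq> []" for xs
    proof -
      have "Sym F xs = (0 :: ('v, 'k) form) xs"
      proof (rule mform_eqI[OF S])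
        fix w :: "(int \<times> 'v) list" assume w: "hw w" "length w = length xs"
        then obtain a z where az: "w = a # z" using ne by (cases w) auto
        then have a: "hw [a]" using w by simp
        have "brk (b_form a) F = 0"
          by (rule brk_0_commute[OF F cyc_subset[OF b_form_cyc] has_degree_parity[OF b_form_degree[OF a]] 0[OF cyc_subset[OF b_form_cyc]]])
        then have "symsum z (ev (brk (b_form a) F)) = 0" by (simp add: ev_def[abs_def])
        moreover have "of_nat (max 1 (length z)) \<noteq> (0 :: 'k)" by simp
        ultimately have "symsum w (ev F) = 0"
          using symsum_brk_b_form[OF F, of a z] w(1) unfolding az by (metis mult_eq_0_iff sg_nonzero)
        then show "ev (Sym F) w = ev 0 w" using ev_Sym[OF cyc_all_mform[OF F] w(1)] by (simp add: ev_def)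
      qed auto
      then show ?thesis by simp
    qed
    have "cyclic (Sym F)"
      unfolding cyclic_iff using S Z by (auto simp: rot1_def ev_def split: list.split)
    then show "Sym F \<in> cyc 0" using Z by (simp add: cyc_def)
  qed
qed

theorem pinczon_bracket_brk: "pinczon_bracket brk"
  unfolding pinczon_bracket_def
proof (intro conjI allI ballI impI bilinear_brk graded_lie_brk center_brk)
  fix F G assume "F \<notin> cyc_all \<or> G \<notin> cyc_all"
  then show "brk F G = 0" by (auto simp: brk_def)
next
  fix k k' F G assume "F \<in> cyc (k + 1)" "G \<in> cyc (k' + 1)"
  then show "brk F G \<in> cyc (k + k')" by (rule brk_cyc)
next
  fix \<alpha> \<beta>s \<delta>s assume "\<alpha> \<in> cyc 1" "\<beta>s \<noteq> [] \<and> homog_forms \<delta>s \<beta>s"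
  then show "brk \<alpha> (Cycl (tensor_lin \<beta>s)) = (\<Sum>j<length \<beta>s. fscale (sg (\<delta>s ! j * sum_list (take j \<delta>s)) * brk \<alpha> (\<beta>s ! j) [])
                          (Cycl (tensor_lin (take j \<beta>s @ drop (Suc j) \<beta>s))))"
    by (intro brk_derivation) auto
qed

text \<open>Bilinearity reduces the comparison to single arities: constants are central for both
  brackets, and in positive arities the contraction formula is prescribed.\<close>

theorem bracket_unique:
  assumes br: "pinczon_bracket br" and bf: "bracket_of_form b br"
  shows "br = brk"
proof (intro ext)
  fix F G xs
  note lin = pinczon_bracketD(1,2)[OF br] and lin' = pinczon_bracketD(1,2)[OF pinczon_bracket_brk]
  have "br F G = brk F G"
  proof (cases "F \<in> cyc_all \<and> G \<in> cyc_all")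
    case True
    show ?thesis
    proof (rule flinear_eqI[where L = "br F" and L' = "brk F"])
      fix n G assume G: "G \<in> cyc n"
      show "br F G = brk F G"
      proof (rule flinear_eqI[where L = "\<lambda>F. br F G" and L' = "\<lambda>F. brk F G"])
        fix m F assume F: "F \<in> cyc m"
        show "br F G = brk F G"
        proof (cases "m = 0 \<or> n = 0")
          case True
          then show ?thesis
            using pinczon_bracket_cyc0[OF br] pinczon_bracket_cyc0[OF pinczon_bracket_brk] F G cyc_subset by metis
        next
          case False
          then obtain k k' where "m = k + 1" "n = k' + 1" by (metis Suc_eq_plus1 not0_implies_Suc)
          then show ?thesis
            using bf dual F G contraction_eq_brk[of F k G k'] unfolding bracket_of_form_def contracts_def by metis
        qed
      qed (use True lin lin' cyc_subset[OF G] in auto)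
    qed (use True lin lin' in auto)
  next
    case False
    then have "br F G = 0" by (intro pinczon_bracketD(4)[OF br]) blast
    then show ?thesis using False by (auto simp: brk_def)
  qed
  then show "br F G xs = brk F G xs" by simp
qed

text \<open>The derivation axiom reduces the bracket with a linear form to brackets of pairs of
  linear forms, which are given by contraction. No symmetrisation is necessary in this case.\<close>

lemma bracket_linear:
  assumes br: "pinczon_bracket br" and c: "contracts br b 0 0" and \<alpha>: "\<alpha> \<in> cyc 1" and F: "F \<in> cyc_all"
  shows "br \<alpha> F = brk \<alpha> F"
proof (rule flinear_eqI[where L = "br \<alpha>" and L' = "brk \<alpha>"])
  show lin: "flinear_on cyc_all (br \<alpha>)" "flinear_on cyc_all (brk \<alpha>)"
    using pinczon_bracketD(1)[OF br cyc_subset[OF \<alpha>]] pinczon_bracketD(1)[OF pinczon_bracket_brk cyc_subset[OF \<alpha>]]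
    by blast+
  fix n G assume G: "G \<in> cyc n"
  show "br \<alpha> G = brk \<alpha> G"
  proof (cases "n = 0")
    case True
    then show ?thesis
      using pinczon_bracket_cyc0(2)[OF br] pinczon_bracket_cyc0(2)[OF pinczon_bracket_brk] G cyc_subset[OF \<alpha>] by metis
  next
    case False
    show ?thesis
    proof (rule flinear_cyc_eqI[OF lin G])
      fix \<delta>s \<beta>s assume h: "homog_forms \<delta>s \<beta>s" and len: "length \<beta>s = n"
      have v: "br \<alpha> (\<beta>s ! j) = brk \<alpha> (\<beta>s ! j)" if "j < length \<beta>s" for j
      proof -
        have "\<beta>s ! j \<in> cyc (0 + 1)" "\<alpha> \<in> cyc (0 + 1)" using h that \<alpha> by (auto simp: list_all2_conv_all_nth)
        then show ?thesis using c dual contraction_eq_brk unfolding contracts_def by metis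
      qed
      have "br \<alpha> (Cycl (tensor_lin \<beta>s)) = (\<Sum>j<length \<beta>s. fscale (sg (\<delta>s ! j * sum_list (take j \<delta>s)) * br \<alpha> (\<beta>s ! j) [])
                          (Cycl (tensor_lin (take j \<beta>s @ drop (Suc j) \<beta>s))))"
        using len False by (intro pinczon_bracketD(8)[OF br \<alpha> h]) auto
      then show "br \<alpha> (Cycl (tensor_lin \<beta>s)) = brk \<alpha> (Cycl (tensor_lin \<beta>s))"
        unfolding brk_derivation[OF \<alpha> h] by (simp add: v)
    qed (use False in simp)
  qed
qed (use F in simp)

text \<open>Up to symmetrisation a Pinczon bracket is determined by the brackets of linear forms:
  by the Jacobi identity, so is \<open>{\<alpha>, {F, G}}\<close> for linear \<open>\<alpha>\<close>, by induction on the arities, and these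
  brackets give the values of the symmetrisation of \<open>{F, G}\<close>.\<close>

lemma symsum_bracket:
  assumes br: "pinczon_bracket br" and c: "contracts br b 0 0"
    and "F \<in> cyc (k + 1)" "G \<in> cyc (k' + 1)" "has_degree d F" "has_degree d' G" "hw w"
  shows "symsum w (ev (br F G)) = symsum w (ev (brk F G))"
  using assms(3-)
proof (induction "k + k'" arbitrary: k k' F G d d' w rule: less_induct)
  case less
  have FG: "F \<in> cyc_all" "G \<in> cyc_all" using less.prems cyc_subset by blast+
  have BC: "br F G \<in> cyc (k + k')" "brk F G \<in> cyc (k + k')"
    using pinczon_bracketD(5)[OF br] brk_cyc less.prems by blast+
  show ?case
  proof (cases "length w = k + k'")
    case False
    have "symsum w (ev B) = 0" if B: "B \<in> cyc (k + k')" for B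
    proof -
      have "symsum w (ev B) = symsum w (\<lambda>_. 0)"
      proof (rule symsum_cong)
        fix z assume "mset z = mset w"
        then have "length (map snd z) \<noteq> k + k'" using False mset_eq_length by fastforce
        then show "ev B z = 0" using cyc_arity[OF B] by (simp add: ev_def)
      qed
      then show ?thesis by simp
    qed
    then show ?thesis using BC by simp
  next
    case len: True
    show ?thesis
    proof (cases w)
      case Nil
      then have "F \<in> cyc 1" using len less.prems by simp
      then show ?thesis using bracket_linear[OF br c _ FG(2)] by simp
    next
      case (Cons a z)
      then have a: "hw [a]" and z: "hw z" and az: "hw (a # z)" using less.prems by auto
      let ?\<alpha> = "b_form a" and ?d = "2 + fst a"
      have \<alpha>: "?\<alpha> \<in> cyc 1" "?\<alpha> \<in> cyc_all" "has_degree ?d ?\<alpha>"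
        using b_form_cyc b_form_degree[OF a] cyc_subset by blast+
      have lin: "br ?\<alpha> H = brk ?\<alpha> H" if "H \<in> cyc_all" for H
        using bracket_linear[OF br c \<alpha>(1) that] .
      have J: "B ?\<alpha> (B F G) = B (B ?\<alpha> F) G + fscale (sg (?d * d)) (B F (B ?\<alpha> G))"
        if "graded_lie B" for B
        by (rule graded_lieD(3)[OF that \<alpha>(2) FG(1) \<alpha>(3) less.prems(3) FG(2)])
      note gl = pinczon_bracketD(3)[OF br]
      have H: "brk ?\<alpha> H \<in> cyc m" "has_degree (?d + e - 2) (brk ?\<alpha> H)"
        if "H \<in> cyc (m + 1)" "has_degree e H" for H m e
        using brk_cyc[of ?\<alpha> 0 H m] brk_degree[OF \<alpha>(2) cyc_subset[OF that(1)] \<alpha>(3) that(2)] \<alpha>(1) that by auto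
      \<comment> \<open>The bracket with a linear form lowers the arity by one. If \<open>F\<close>
        itself is linear the result is a constant, which is central for both brackets.\<close>
      have 1: "symsum z (ev (br (brk ?\<alpha> F) G)) = symsum z (ev (brk (brk ?\<alpha> F) G))"
      proof (cases k)
        case 0
        then have "brk ?\<alpha> F \<in> cyc 0" using H less.prems by auto
        then show ?thesis
          using pinczon_bracket_cyc0(1)[OF br _ FG(2)] pinczon_bracket_cyc0(1)[OF pinczon_bracket_brk _ FG(2)] by simp
      next
        case (Suc k1)
        then show ?thesis
          using less.hyps[of k1 k' "brk ?\<alpha> F" G _ d' z] H[of F k d] less.prems z by simp
      qed
      have 2: "symsum z (ev (br F (brk ?\<alpha> G))) = symsum z (ev (brk F (brk ?\<alpha> G)))"
      proof (cases k')
        case 0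
        then have "brk ?\<alpha> G \<in> cyc 0" using H less.prems by auto
        then show ?thesis
          using pinczon_bracket_cyc0(2)[OF br _ FG(1)] pinczon_bracket_cyc0(2)[OF pinczon_bracket_brk _ FG(1)] by simp
      next
        case (Suc k1)
        then show ?thesis
          using less.hyps[of k k1 F "brk ?\<alpha> G" d _ z] H[of G k' d'] less.prems z by simp
      qed
      have "symsum z (ev (brk ?\<alpha> (br F G))) = symsum z (ev (brk ?\<alpha> (brk F G)))"
        using 1 2 J[OF gl] J[OF graded_lie_brk] lin FG cyc_subset[OF BC(1)]
        by (simp add: ev_add ev_fscale symsum_add symsum_mult)
      then have "of_nat (max 1 (length z)) * (sg ((fst a + wdeg z) * fst a) * symsum (a # z) (ev (br F G))) =
        of_nat (max 1 (length z)) * (sg ((fst a + wdeg z) * fst a) * symsum (a # z) (ev (brk F G)))"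
        using symsum_brk_b_form[OF cyc_subset[OF BC(1)] az] symsum_brk_b_form[OF cyc_subset[OF BC(2)] az] by simp
      \<comment> \<open>The common factor, a sign times a positive integer, is invertible.\<close>
      then show ?thesis unfolding Cons by (auto simp: max_def split: if_splits)
    qed
  qed
qed

end

section \<open>Existence and uniqueness of the form of a bracket\<close>

context fd_graded_space
begin

lemma linear_inj_imp_surj_fd:
  assumes "Vector_Spaces.linear scale scale T" "\<And>x. T x = 0 \<Longrightarrow> x = 0"
  shows "bij T"
proof -
  obtain \<epsilon>s es where es: "independent (set es)" "span (set es) = UNIV"
    using homogeneous_basis by metis
  interpret fdv: finite_dimensional_vector_space scale "set es"
    by unfold_locales (use es in auto)
  have "inj T"
  proof (rule injI)
    fix x y assume "T x = T y"
    have "T (x + (- 1) *s y) = T x + (- 1) *s T y"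
      using assms(1) unfolding linear_scale_iff by metis
    then have "T (x - y) = 0" using \<open>T x = T y\<close> by simp
    then show "x = y" using assms(2)[of "x - y"] by simp
  qed
  moreover have "surj T"
    by (rule fdv.linear_inj_imp_surj[OF assms(1) \<open>inj T\<close>])
  ultimately show ?thesis by (simp add: bij_def)
qed

lemma homogeneous_expansion:
  fixes f :: "nat \<Rightarrow> 'v"
  assumes "\<And>i. i < n \<Longrightarrow> f i \<in> gr (\<delta> i)" "x = (\<Sum>i<n. c i *s f i)" "x \<in> gr m"
  shows "x = (\<Sum>i<n. (if \<delta> i = m then c i else 0) *s f i)"
proof -
  have hsum: "hcomp m (\<Sum>j\<in>A. c j *s f j) = (\<Sum>j\<in>A. c j *s hcomp m (f j))" for A :: "nat set"
    by (induction A rule: infinite_finite_induct) (auto simp: hcomp_add hcomp_scale)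
  have "x = hcomp m x" using assms(3) by (simp add: hcomp_gr)
  also have "\<dots> = (\<Sum>i<n. c i *s hcomp m (f i))" by (subst assms(2), rule hsum)
  also have "\<dots> = (\<Sum>i<n. (if \<delta> i = m then c i else 0) *s f i)"
    by (intro sum.cong refl) (use hcomp_gr[OF assms(1), of _ m] in auto)
  finally show ?thesis .
qed

end

locale graded_coords = fd_graded_space scale gr
  for scale :: "'k::field_char_0 \<Rightarrow> 'v::ab_group_add \<Rightarrow> 'v" (infixr \<open>*s\<close> 75) and gr :: "int \<Rightarrow> 'v set" +
  fixes \<epsilon>s :: "int list" and es :: "'v list" and cs :: "nat \<Rightarrow> 'v \<Rightarrow> 'k"
  assumes basis: "homog \<epsilon>s es" "distinct es" "independent (set es)" "span (set es) = UNIV"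
    and cs_linear: "\<And>i. Vector_Spaces.linear scale (*) (cs i)"
    and cs_expand: "\<And>x. x = (\<Sum>i<length es. cs i x *s es ! i)"
    and cs_dual: "\<And>i j. i < length es \<Longrightarrow> j < length es \<Longrightarrow> cs i (es ! j) = (if i = j then 1 else 0)"
    and cs_degree: "\<And>i. i < length es \<Longrightarrow> has_degree (- (\<epsilon>s ! i)) (lf (cs i))"
begin

abbreviation "N \<equiv> length es"

lemma cs_eq_0: "(\<And>i. i < N \<Longrightarrow> cs i x = 0) \<Longrightarrow> x = 0"
  by (subst cs_expand) simp

lemma cs_sum: "j < N \<Longrightarrow> cs j (\<Sum>i<N. c i *s es ! i) = c j"
proof -
  assume j: "j < N"
  have "cs j (\<Sum>i<N. c i *s es ! i) = (\<Sum>i<N. c i * cs j (es ! i))"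
    by (rule linear_sum_scale[OF cs_linear])
  also have "\<dots> = (\<Sum>i<N. if i = j then c j else 0)"
    by (intro sum.cong refl) (use cs_dual[OF j] in auto)
  finally show ?thesis using j by simp
qed

lemma es_in: "i < N \<Longrightarrow> es ! i \<in> gr (\<epsilon>s ! i + 1)"
  using basis(1) by (auto simp: homog_def list_all2_conv_all_nth)

lemma linear_eq_on_es:
  assumes "Vector_Spaces.linear scale (*) f" "Vector_Spaces.linear scale (*) g" "\<And>i. i < N \<Longrightarrow> f (es ! i) = g (es ! i)"
  shows "f x = g x"
proof -
  have "f (\<Sum>i<N. cs i x *s es ! i) = g (\<Sum>i<N. cs i x *s es ! i)"
    by (simp add: linear_sum_scale[OF assms(1)] linear_sum_scale[OF assms(2)] assms(3))
  then show ?thesis by (simp flip: cs_expand)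
qed

lemma cyc1_expand:
  assumes "\<alpha> \<in> cyc 1"
  shows "\<alpha> = (\<Sum>i<N. fscale (\<alpha> [es ! i]) (lf (cs i)))"
proof
  fix xs
  have lin: "Vector_Spaces.linear scale (*) (\<lambda>x. \<alpha> [x])" by (rule cyc1_lf(2)[OF assms])
  show "\<alpha> xs = (\<Sum>i<N. fscale (\<alpha> [es ! i]) (lf (cs i))) xs"
  proof (cases "\<exists>x. xs = [x]")
    case True
    then obtain x where x: "xs = [x]" by blast
    have "\<alpha> [x] = \<alpha> [\<Sum>i<N. cs i x *s es ! i]" by (simp flip: cs_expand)
    also have "\<dots> = (\<Sum>i<N. cs i x * \<alpha> [es ! i])" by (rule linear_sum_scale[OF lin])
    finally show ?thesis by (simp add: x sum_apply fscale_def mult.commute)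
  next
    case False
    then have "length xs \<noteq> 1" by (auto simp: length_Suc_conv)
    then show ?thesis using cyc_arity[OF assms] cyc_arity[OF lf_cyc[OF cs_linear]] by (simp add: sum_apply fscale_def)
  qed
qed

text \<open>The map \<open>T\<close> records the pairings of a vector with the basis. Nondegeneracy
  makes it injective, hence bijective in finite dimension, and the dual basis is the preimage of the
  basis.\<close>

lemma dual_bases_exist:
  assumes b: "nondeg_form b"
  obtains es' where "dual_bases b \<epsilon>s es es'"
proof -
  have blin: "Vector_Spaces.linear scale (*) (b x)" "Vector_Spaces.linear scale (*) (\<lambda>x. b x y)" for x y
    using b by (simp_all add: nondeg_form_def)
  define T where "T y = (\<Sum>i<N. b (es ! i) y *s es ! i)" for y
  have "bij T"
  proof (rule linear_inj_imp_surj_fd)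
    show "Vector_Spaces.linear scale scale T"
      using blin(1) unfolding linear_scale_iff linear_scalar_iff T_def
      by (simp add: scale_left_distrib sum.distrib scale_sum_right)
    fix y assume "T y = 0"
    then have "b (es ! i) y = 0" if "i < N" for i
      using cs_sum[OF that, of "\<lambda>i. b (es ! i) y"] linear_sum_scale[OF cs_linear, where A = "{}"] by (simp add: T_def)
    moreover have "Vector_Spaces.linear scale (*) (\<lambda>_ :: 'v. 0 :: 'k)"
      unfolding linear_scalar_iff by simp
    ultimately have "b x y = 0" for x
      using linear_eq_on_es[OF blin(2)[of y]] by blast
    then show "y = 0" by (rule nondeg_right[OF b])
  qed
  then have inv: "T (inv T y) = y" for y by (simp add: bij_is_surj surj_f_inv_f)
  have "b (es ! i) (inv T (es ! j)) = (if i = j then 1 else 0)" if "i < N" "j < N" for i j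
    using cs_sum[OF that(1), of "\<lambda>i. b (es ! i) (inv T (es ! j))"] inv[of "es ! j"] cs_dual[OF that]
    by (simp add: T_def)
  then have "dual_bases b \<epsilon>s es (map (\<lambda>x. inv T x) es)"
    unfolding dual_bases_def using basis by simp
  then show ?thesis by (rule that)
qed

text \<open>The bracket of the i-th and j-th coordinate functionals is, up to a sign depending on i,
  the j-th coordinate of es'_i. So the bracket determines the dual basis, and a form is determined
  by its dual bases.\<close>

lemma form_of_bracket_unique:
  assumes "form_of_bracket br b" "form_of_bracket br b'"
  shows "b = b'"
proof -
  have b: "nondeg_form b" "contracts br b 0 0" and b': "nondeg_form b'" "contracts br b' 0 0"
    using assms by (auto simp: form_of_bracket_def)
  obtain es' where d: "dual_bases b \<epsilon>s es es'" using dual_bases_exist[OF b(1)] .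
  obtain es'' where d': "dual_bases b' \<epsilon>s es es''" using dual_bases_exist[OF b'(1)] .
  interpret B: graded_dual scale gr b \<epsilon>s es es' by unfold_locales (rule b(1), rule d)
  interpret B': graded_dual scale gr b' \<epsilon>s es es'' by unfold_locales (rule b'(1), rule d')
  have eq: "es' ! i = es'' ! i" if i: "i < N" for i
  proof -
    have "cs j (es' ! i) = cs j (es'' ! i)" for j
    proof -
      let ?\<alpha> = "lf (cs i)" and ?\<beta> = "lf (cs j)"
      have c: "?\<alpha> \<in> cyc 1" "?\<beta> \<in> cyc 1" using lf_cyc[OF cs_linear] by auto
      then have c': "?\<alpha> \<in> cyc (0 + 1)" "?\<beta> \<in> cyc (0 + 1)" by auto
      have "br ?\<alpha> ?\<beta> = B.brk ?\<alpha> ?\<beta>" "br ?\<alpha> ?\<beta> = B'.brk ?\<alpha> ?\<beta>"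
        using b(2) b'(2) c' d d' B.contraction_eq_brk B'.contraction_eq_brk unfolding contracts_def by metis+
      then have "(\<Sum>k<N. sg (\<epsilon>s ! k) * (cs i (es ! k) * cs j (es' ! k))) = (\<Sum>k<N. sg (\<epsilon>s ! k) * (cs i (es ! k) * cs j (es'' ! k)))"
        using B.brk_linear_value[OF c] B'.brk_linear_value[OF c] by simp
      moreover have "(\<Sum>k<N. sg (\<epsilon>s ! k) * (cs i (es ! k) * cs j (f ! k))) = sg (\<epsilon>s ! i) * cs j (f ! i)" for f
      proof -
        have "(\<Sum>k<N. sg (\<epsilon>s ! k) * (cs i (es ! k) * cs j (f ! k))) = (\<Sum>k<N. if k = i then sg (\<epsilon>s ! i) * cs j (f ! i) else 0)"
          by (intro sum.cong refl) (use cs_dual[OF i] in auto)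
        then show ?thesis using i by simp
      qed
      ultimately show ?thesis by simp
    qed
    then have "(\<Sum>j<N. cs j (es' ! i) *s es ! j) = (\<Sum>j<N. cs j (es'' ! i) *s es ! j)" by simp
    then show ?thesis by (simp flip: cs_expand)
  qed
  have "b (es ! i) y = b' (es ! i) y" if i: "i < N" for i y
  proof -
    have "b' (es ! i) y = b' (es ! i) (\<Sum>j<N. b (es ! j) y *s es' ! j)" by (simp flip: B.expand_es')
    also have "\<dots> = (\<Sum>j<N. b (es ! j) y * b' (es ! i) (es' ! j))" by (rule linear_sum_scale[OF B'.blin(1)])
    also have "\<dots> = (\<Sum>j<N. if j = i then b (es ! i) y else 0)"
      by (intro sum.cong refl) (use B'.b_dual[OF i] eq in auto)
    finally show ?thesis using i by simp
  qed
  then have "b x y = b' x y" for x y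
    by (rule linear_eq_on_es[OF B.blin(2) B'.blin(2)])
  then show ?thesis by blast
qed

text \<open>The matrix \<open>P\<close> of brackets of coordinate functionals is the inverse, up to
  signs, of the matrix of the form sought. Its invertibility comes from the condition on the centre,
  and its symmetry and degree from the graded Lie structure.\<close>

lemma form_of_bracket_exists:
  assumes br: "pinczon_bracket br"
  shows "\<exists>b. form_of_bracket br b"
proof -
  let ?L = "\<lambda>i. lf (cs i)"
  have L: "?L i \<in> cyc 1" for i by (rule lf_cyc[OF cs_linear])
  define P where "P i j = br (?L i) (?L j) []" for i j
  have val: "br \<alpha> \<beta> [] = (\<Sum>i<N. \<Sum>j<N. \<alpha> [es ! i] * (\<beta> [es ! j] * P i j))" if \<alpha>: "\<alpha> \<in> cyc 1" and \<beta>: "\<beta> \<in> cyc 1" for \<alpha> \<beta>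
  proof -
    have "br \<alpha> \<beta> = (\<Sum>i<N. fscale (\<alpha> [es ! i]) (br (?L i) \<beta>))"
      using flinear_sum[OF pinczon_bracketD(2)[OF br cyc_subset[OF \<beta>]], where A = "{..<N}" and F = ?L and c = "\<lambda>i. \<alpha> [es ! i]"]
        cyc_subset[OF L] cyc1_expand[OF \<alpha>] by simp
    moreover have "br (?L i) \<beta> = (\<Sum>j<N. fscale (\<beta> [es ! j]) (br (?L i) (?L j)))" for i
      using flinear_sum[OF pinczon_bracketD(1)[OF br cyc_subset[OF L[of i]]], where A = "{..<N}" and F = ?L and c = "\<lambda>i. \<beta> [es ! i]"]
        cyc_subset[OF L] cyc1_expand[OF \<beta>] by simp
    ultimately show ?thesis by (simp add: sum_apply fscale_def P_def sum_distrib_left)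
  qed
  have P_deg: "P i j = 0" if "i < N" "j < N" "\<epsilon>s ! i + \<epsilon>s ! j \<noteq> - 2" for i j
  proof (rule ccontr)
    assume "P i j \<noteq> 0"
    moreover have "has_degree (- (\<epsilon>s ! i) + - (\<epsilon>s ! j) - 2) (br (?L i) (?L j))"
      by (rule graded_lieD(1)[OF pinczon_bracketD(3)[OF br] cyc_subset[OF L] cyc_subset[OF L] cs_degree[OF that(1)] cs_degree[OF that(2)]])
    ultimately show False
      using that(3) unfolding has_degree_iff by (auto simp: P_def ev_def dest!: spec[of _ "[]"])
  qed
  have P_sym: "P i j = - (sg (\<epsilon>s ! i * \<epsilon>s ! j) * P j i)" if "i < N" "j < N" for i j
    using graded_lieD(2)[OF pinczon_bracketD(3)[OF br] cyc_subset[OF L] cyc_subset[OF L] cs_degree[OF that(1)] cs_degree[OF that(2)]]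
    by (simp add: P_def fscale_def)
  \<comment> \<open>Such a linear form brackets to zero with all linear forms, hence by the
    derivation axiom with everything, so it is central. In arity one symmetrisation is the identity,
    and the condition on the centre forces it to vanish.\<close>
  have nondeg: "\<alpha> = 0" if \<alpha>: "\<alpha> \<in> cyc 1" and 0: "\<And>j. j < N \<Longrightarrow> br \<alpha> (?L j) [] = 0" for \<alpha>
  proof -
    have lin: "flinear_on cyc_all (br \<alpha>)" by (rule pinczon_bracketD(1)[OF br cyc_subset[OF \<alpha>]])
    have lin0: "flinear_on cyc_all (\<lambda>F. 0 :: ('v, 'k) form)" by (auto simp: flinear_on_def fscale_def)
    have z: "br \<alpha> \<beta> [] = 0" if \<beta>: "\<beta> \<in> cyc 1" for \<beta>
    proof -
      have "br \<alpha> \<beta> = (\<Sum>j<N. fscale (\<beta> [es ! j]) (br \<alpha> (?L j)))"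
        using flinear_sum[OF lin, where A = "{..<N}" and F = ?L and c = "\<lambda>i. \<beta> [es ! i]"] cyc_subset[OF L] cyc1_expand[OF \<beta>] by simp
      then show ?thesis using 0 by (simp add: sum_apply fscale_def)
    qed
    have "br \<alpha> F = 0" if "F \<in> cyc_all" for F
    proof (rule flinear_eqI[OF lin lin0 that])
      fix n G assume G: "G \<in> cyc n"
      show "br \<alpha> G = 0"
      proof (cases "n = 0")
        case True
        then show ?thesis using pinczon_bracket_cyc0(2)[OF br _ cyc_subset[OF \<alpha>]] G by simp
      next
        case False
        show ?thesis
        proof (rule flinear_cyc_eqI[OF lin lin0 G])
          fix \<delta>s \<beta>s assume h: "homog_forms \<delta>s \<beta>s" and len: "length \<beta>s = n"
          have ne: "\<beta>s \<noteq> []" using len False by auto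
          have "br \<alpha> (\<beta>s ! j) [] = 0" if "j < length \<beta>s" for j
            using h that by (intro z) (auto simp: list_all2_conv_all_nth)
          then show "br \<alpha> (Cycl (tensor_lin \<beta>s)) = 0"
            unfolding pinczon_bracketD(8)[OF br \<alpha> h ne]
            by (intro sum.neutral ballI ext) (simp add: fscale_def)
        qed (use False in simp)
      qed
    qed
    then have S: "Sym \<alpha> \<in> cyc 0" by (rule pinczon_bracketD(7)[OF br cyc_subset[OF \<alpha>]])
    have m: "mform \<alpha>" using \<alpha> cyc_subset cyc_all_mform by blast
    show "\<alpha> = 0"
    proof
      fix xs :: "'v list"
      show "\<alpha> xs = 0 xs"
      proof (rule mform_eqI[OF m])
        fix w :: "(int \<times> 'v) list" assume w: "hw w"
        show "ev \<alpha> w = ev 0 w"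
        proof (cases "length w = 1")
          case True
          then obtain a where a: "w = [a]" by (cases w) auto
          have "ev (Sym \<alpha>) w = ev \<alpha> w" using ev_Sym[OF m w] by (simp add: a ins_def)
          moreover have "ev (Sym \<alpha>) w = 0" using cyc_arity[OF S] by (simp add: a ev_def)
          ultimately show ?thesis by (simp add: ev_def)
        next
          case False
          then show ?thesis using cyc_arity[OF \<alpha>] by (simp add: ev_def)
        qed
      qed auto
    qed
  qed
  \<comment> \<open>Forced by \<open>brk_linear_value\<close>: these are the only vectors for which
    contraction with dual bases can reproduce the values \<open>P i j\<close>.\<close>
  define e' where "e' i = sg (\<epsilon>s ! i) *s (\<Sum>j<N. P i j *s es ! j)" for i
  define T where "T x = (\<Sum>i<N. cs i x *s e' i)" for x
  have cs_e': "cs j (e' i) = sg (\<epsilon>s ! i) * P i j" if "j < N" for i j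
    using cs_linear[of j] by (simp add: e'_def linear_scalar_iff cs_sum[OF that])
  have Tlin: "Vector_Spaces.linear scale scale T"
    using cs_linear unfolding linear_scale_iff linear_scalar_iff T_def
    by (simp add: scale_left_distrib sum.distrib scale_sum_right)
  have "bij T"
  proof (rule linear_inj_imp_surj_fd[OF Tlin])
    fix x assume T0: "T x = 0"
    \<comment> \<open>The coefficients are chosen so that the bracket with the j-th coordinate
      functional is the j-th coordinate of \<open>T x\<close>.\<close>
    define \<alpha> where "\<alpha> = lf (\<lambda>y. \<Sum>i<N. cs i x * sg (\<epsilon>s ! i) * cs i y)"
    have \<alpha>: "\<alpha> \<in> cyc 1"
      unfolding \<alpha>_def by (rule lf_cyc)
        (use cs_linear in \<open>simp add: linear_scalar_iff sum.distrib sum_distrib_left algebra_simps\<close>)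
    have \<alpha>e: "\<alpha> [es ! i] = cs i x * sg (\<epsilon>s ! i)" if "i < N" for i
    proof -
      have "\<alpha> [es ! i] = (\<Sum>k<N. if k = i then cs i x * sg (\<epsilon>s ! i) else 0)"
        unfolding \<alpha>_def lf_simps by (intro sum.cong refl) (use cs_dual that in auto)
      then show ?thesis using that by simp
    qed
    have "br \<alpha> (?L j) [] = 0" if j: "j < N" for j
    proof -
      have "(\<Sum>k<N. \<alpha> [es ! i] * (?L j [es ! k] * P i k)) = cs i x * (sg (\<epsilon>s ! i) * P i j)" if "i < N" for i
      proof -
        have "(\<Sum>k<N. \<alpha> [es ! i] * (?L j [es ! k] * P i k)) = (\<Sum>k<N. if k = j then \<alpha> [es ! i] * P i j else 0)"
          by (intro sum.cong refl) (use cs_dual[OF j] in auto)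
        then show ?thesis using j that by (simp add: \<alpha>e)
      qed
      then have "br \<alpha> (?L j) [] = (\<Sum>i<N. cs i x * (sg (\<epsilon>s ! i) * P i j))"
        unfolding val[OF \<alpha> L] by simp
      also have "\<dots> = (\<Sum>i<N. cs i x * cs j (e' i))" by (simp add: cs_e'[OF j])
      also have "\<dots> = cs j (T x)" unfolding T_def by (rule linear_sum_scale[OF cs_linear, symmetric])
      finally show ?thesis using T0 linear_sum_scale[OF cs_linear, where A = "{}"] by simp
    qed
    then have "\<alpha> = 0" by (rule nondeg[OF \<alpha>])
    then have "cs i x = 0" if "i < N" for i using \<alpha>e[OF that] by simp
    then show "x = 0" by (rule cs_eq_0)
  qed
  define R where "R = inv T"
  have TR: "T (R y) = y" and RT: "R (T y) = y" for y
    using \<open>bij T\<close> by (simp_all add: R_def bij_is_surj surj_f_inv_f bij_is_inj inv_f_f)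
  have R_add: "R (x + y) = R x + R y" and R_scale: "R (c *s x) = c *s R x" for x y c
    using Tlin TR RT unfolding linear_scale_iff by metis+
  have Te: "T (es ! i) = e' i" if i: "i < N" for i
  proof -
    have "T (es ! i) = (\<Sum>k<N. if k = i then e' i else 0)"
      unfolding T_def by (intro sum.cong refl) (use cs_dual i in auto)
    then show ?thesis using i by simp
  qed
  \<comment> \<open>\<open>T\<close> sends the basis to the vectors e'_i, so \<open>R\<close> reads
    off coordinates with respect to e'. The formula is the unique bilinear form for which
    \<open>es\<close> and e' are dual.\<close>
  define b where "b x y = (\<Sum>i<N. cs i x * cs i (R y))" for x y
  have bl: "Vector_Spaces.linear scale (*) (b x)" "Vector_Spaces.linear scale (*) (\<lambda>x. b x y)" for x y
    using cs_linear unfolding linear_scalar_iff b_def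
    by (simp_all add: R_add R_scale sum.distrib sum_distrib_left algebra_simps)
  have be': "b x (e' j) = cs j x" if j: "j < N" for x j
  proof -
    have "b x (e' j) = (\<Sum>i<N. if i = j then cs j x else 0)"
      unfolding b_def by (intro sum.cong refl) (use cs_dual j Te[OF j] RT[of "es ! j"] in auto)
    then show ?thesis using j by simp
  qed
  have e'_in: "e' i \<in> gr (- (\<epsilon>s ! i + 1))" if i: "i < N" for i
    unfolding e'_def
  proof (rule gr_scale, rule gr_sum)
    fix j assume "j \<in> {..<N}"
    then have j: "j < N" by simp
    show "P i j *s es ! j \<in> gr (- (\<epsilon>s ! i + 1))"
    proof (cases "\<epsilon>s ! i + \<epsilon>s ! j = - 2")
      case True
      then have "\<epsilon>s ! j + 1 = - (\<epsilon>s ! i + 1)" by simp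
      then show ?thesis using gr_scale[OF es_in[OF j]] by metis
    qed (simp add: P_deg i j)
  qed
  have be: "b (e' i) (e' j) = sg (\<epsilon>s ! i) * P i j" if "i < N" "j < N" for i j
    using be'[OF that(2)] cs_e'[OF that(2)] by simp
  have exp': "x = (\<Sum>i<N. cs i (R x) *s e' i)" for x
    using TR[of x] by (simp add: T_def)
  \<comment> \<open>In the basis e' the form has the matrix sg(\<epsilon>_i) P i j, and the
    antisymmetry of \<open>P\<close> in the shifted degrees becomes graded symmetry in the degrees
    of V. The cut-off coefficients keep only basis vectors of the degrees m and n.\<close>
  have sym: "b x y = sg (m * n) * b y x \<and> (m + n \<noteq> 0 \<longrightarrow> b x y = 0)" if x: "x \<in> gr m" and y: "y \<in> gr n" for m n x y
  proof -
    define c where "c i = (if - (\<epsilon>s ! i + 1) = m then cs i (R x) else 0)" for i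
    define c' where "c' i = (if - (\<epsilon>s ! i + 1) = n then cs i (R y) else 0)" for i
    have X: "x = (\<Sum>i<N. c i *s e' i)" and Y: "y = (\<Sum>i<N. c' i *s e' i)"
      unfolding c_def c'_def using e'_in
      by (intro homogeneous_expansion[where \<delta> = "\<lambda>i. - (\<epsilon>s ! i + 1)"] exp' x y; simp)+
    have bxy: "b (\<Sum>i<N. c i *s e' i) (\<Sum>j<N. c' j *s e' j) = (\<Sum>i<N. \<Sum>j<N. c i * (c' j * b (e' i) (e' j)))" for c c'
    proof -
      have "b (\<Sum>i<N. c i *s e' i) (\<Sum>j<N. c' j *s e' j) = (\<Sum>i<N. c i * b (e' i) (\<Sum>j<N. c' j *s e' j))"
        by (rule linear_sum_scale[OF bl(2)])
      then show ?thesis by (simp only: linear_sum_scale[OF bl(1)] sum_distrib_left)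
    qed
    have t: "c i * (c' j * b (e' i) (e' j)) = sg (m * n) * (c' j * (c i * b (e' j) (e' i))) \<and>
        (m + n \<noteq> 0 \<longrightarrow> c i * (c' j * b (e' i) (e' j)) = 0)" if i: "i < N" and j: "j < N" for i j
    proof (cases "m = - (\<epsilon>s ! i + 1) \<and> n = - (\<epsilon>s ! j + 1)")
      case mn: True
      show ?thesis
      proof (cases "\<epsilon>s ! i + \<epsilon>s ! j = - 2")
        case True
        then have ej: "\<epsilon>s ! j = - 2 - \<epsilon>s ! i" by simp
        have "sg (\<epsilon>s ! i) * - sg (\<epsilon>s ! i * \<epsilon>s ! j) = (sg (m * n) * sg (\<epsilon>s ! j) :: 'k)"
          using mn by (auto simp: ej sg_def)
        then have "b (e' i) (e' j) = sg (m * n) * b (e' j) (e' i)"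
          using be[OF i j] be[OF j i] P_sym[OF i j] by (metis mult.assoc mult_minus_left mult_minus_right)
        moreover have "m + n = 0" using mn True by auto
        ultimately show ?thesis by simp
      next
        case False
        then have "P i j = 0" "P j i = 0" using P_deg i j by (auto simp: add.commute)
        then show ?thesis using be[OF i j] be[OF j i] by simp
      qed
    qed (auto simp: c_def c'_def)
    have bxy': "b x y = (\<Sum>i<N. \<Sum>j<N. c i * (c' j * b (e' i) (e' j)))" unfolding X Y by (rule bxy)
    have "b y x = (\<Sum>j<N. \<Sum>i<N. c' j * (c i * b (e' j) (e' i)))" unfolding X Y by (rule bxy)
    then have byx: "b y x = (\<Sum>i<N. \<Sum>j<N. c' j * (c i * b (e' j) (e' i)))" by (subst sum.swap)
    show ?thesis
    proof (intro conjI impI)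
      show "b x y = sg (m * n) * b y x"
        unfolding bxy' byx sum_distrib_left by (intro sum.cong refl) (use t in auto)
      assume "m + n \<noteq> 0"
      then show "b x y = 0"
        unfolding bxy' by (intro sum.neutral ballI) (use t in blast)
    qed
  qed
  have nd: "nondeg_form b"
    unfolding nondeg_form_def
  proof (intro conjI allI impI ballI bl)
    fix x assume "\<forall>y. b x y = 0"
    then have "cs j x = 0" if "j < N" for j using be'[OF that] by metis
    then show "x = 0" by (rule cs_eq_0)
  qed (use sym in blast)+
  have d: "dual_bases b \<epsilon>s es (map e' [0..<N])"
    unfolding dual_bases_def using basis be' cs_dual by auto
  interpret d: graded_dual scale gr b \<epsilon>s es "map e' [0..<N]" by unfold_locales (rule nd, rule d)
  have "br F G = d.brk F G" if F: "F \<in> cyc 1" and G: "G \<in> cyc 1" for F G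
  proof
    fix xs
    have "br F G \<in> cyc (0 + 0)" "d.brk F G \<in> cyc (0 + 0)"
      using pinczon_bracketD(5)[OF br, of F 0 G 0] d.brk_cyc[of F 0 G 0] F G by auto
    then have c0: "br F G \<in> cyc 0" "d.brk F G \<in> cyc 0" by auto
    have "G [e' i] = sg (\<epsilon>s ! i) * (\<Sum>j<N. P i j * G [es ! j])" for i
      using linear_sum_scale[OF cyc1_lf(2)[OF G]] cyc1_lf(2)[OF G] by (simp add: e'_def linear_scalar_iff)
    then have "d.brk F G [] = (\<Sum>i<N. \<Sum>j<N. F [es ! i] * (G [es ! j] * P i j))"
      using d.brk_linear_value[OF F G] by (simp add: sum_distrib_left mult_ac)
    then have "br F G [] = d.brk F G []" using val[OF F G] by simp
    then show "br F G xs = d.brk F G xs" using cyc_arity[OF c0(1)] cyc_arity[OF c0(2)] by (cases xs) auto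
  qed
  then have "contracts br b 0 0"
    using d.contracts_brk[of 0 0] unfolding contracts_def by auto
  then show ?thesis using nd by (auto simp: form_of_bracket_def)
qed

end

text \<open>The coderivation of the tensor coalgebra replacing a factor \<open>u\<close> by the letter \<open>L u\<close>, acting on functions.\<close>

definition Xw :: "((int \<times> 'a) list \<Rightarrow> int \<times> 'a) \<Rightarrow> ((int \<times> 'a) list \<Rightarrow> 'k::comm_ring_1) \<Rightarrow> (int \<times> 'a) list \<Rightarrow> 'k" where
  "Xw L f = dec (\<lambda>u1 z. sg (wdeg u1) * dec (\<lambda>u2 u3. f (u1 @ L u2 # u3)) z)"

context fd_graded_space
begin

subsection \<open>Symmetric forms\<close>

text \<open>Symmetry under exchanges of neighbours only, which is what can be checked directly;
  \<open>movable_permute\<close> recovers all permutations.\<close>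

definition movable :: "((int \<times> 'v) list \<Rightarrow> 'k) \<Rightarrow> bool" where
  "movable f \<longleftrightarrow> (\<forall>u a c v. hw (u @ a # c # v) \<longrightarrow> f (u @ a # c # v) = sg (fst a * fst c) * f (u @ c # a # v))"

lemma movable_move:
  assumes "movable f" "hw (u @ a # w @ v)"
  shows "f (u @ a # w @ v) = sg (fst a * wdeg w) * f (u @ w @ a # v)"
  using assms(2)
proof (induction w arbitrary: u)
  case (Cons c w)
  have "f (u @ a # (c # w) @ v) = sg (fst a * fst c) * f ((u @ [c]) @ a # w @ v)"
    using assms(1)[unfolded movable_def, rule_format, of u a c "w @ v"] Cons.prems by simp
  also have "f ((u @ [c]) @ a # w @ v) = sg (fst a * wdeg w) * f ((u @ [c]) @ w @ a # v)"
    by (rule Cons.IH) (use Cons.prems in simp)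
  finally show ?case by (simp add: distrib_left sg_add mult.assoc)
qed simp

text \<open>Every permutation inserts the first letter into a permutation of the rest; moving that
  letter to the front reproduces the recursion \<open>ksign_insperm\<close>.\<close>

lemma movable_permute:
  assumes "movable f" "hw w" "\<sigma> permutes {..<length w}"
  shows "f (permute_list \<sigma> w) = ksign (map fst w) \<sigma> * f w"
  using assms
proof (induction w arbitrary: f \<sigma>)
  case (Cons a w)
  have "\<sigma> \<in> (\<lambda>(p, \<sigma>). insperm p \<sigma>) ` ({..length w} \<times> {\<sigma>. \<sigma> permutes {..<length w}})"
    using bij_betw_imp_surj_on[OF bij_insperm[of "length w"]] Cons.prems(3) by simp
  then obtain p \<sigma>' where p: "p \<le> length w" and \<sigma>': "\<sigma>' permutes {..<length w}" and \<sigma>: "\<sigma> = insperm p \<sigma>'"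
    by auto
  let ?L = "permute_list \<sigma>' w"
  have hL: "hw ?L" using Cons.prems(2) hw_mset[OF mset_permute_list[OF \<sigma>']] by simp
  have hT: "hw (take p ?L)" "hw (drop p ?L)"
    using hL hw_simps(3)[of "take p ?L" "drop p ?L"] by simp_all
  have "f ([] @ a # take p ?L @ drop p ?L) = sg (fst a * wdeg (take p ?L)) * f ([] @ take p ?L @ a # drop p ?L)"
    by (rule movable_move[OF Cons.prems(1)]) (use Cons.prems(2) hL in simp)
  then have "f (take p ?L @ a # drop p ?L) = sg (fst a * wdeg (take p ?L)) * f (a # ?L)" by simp
  also have "f (a # ?L) = ksign (map fst w) \<sigma>' * f (a # w)"
  proof (rule Cons.IH[of "\<lambda>z. f (a # z)"])
    show "movable (\<lambda>z. f (a # z))"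
      unfolding movable_def
    proof (intro allI impI)
      fix u c d v assume h: "hw (u @ c # d # v)"
      show "f (a # u @ c # d # v) = sg (fst c * fst d) * f (a # u @ d # c # v)"
        using Cons.prems(1)[unfolded movable_def, rule_format, of "a # u" c d v] Cons.prems(2) h by simp
    qed
  qed (use Cons.prems(2) \<sigma>' in auto)
  finally show ?case
    unfolding \<sigma> permute_list_insperm[OF p \<sigma>'] list.map
    using ksign_insperm[where 'a = 'k, of p "map fst w" \<sigma>' "fst a"] p \<sigma>' by (simp add: permute_list_map take_map wdeg_def mult.assoc)
qed (simp add: ksign_def)

lemma symmetric_iff: "symmetric F \<longleftrightarrow> mform F \<and> movable (ev F)"
proof (intro iffI conjI)
  assume F: "symmetric F"
  then show "mform F" by (simp add: symmetric_def)
  show "movable (ev F)"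
    unfolding movable_def
  proof (intro allI impI)
    fix u v :: "(int \<times> 'v) list" and a c assume h: "hw (u @ a # c # v)"
    let ?w = "u @ a # c # v" and ?i = "length u"
    let ?\<sigma> = "transpose ?i (Suc ?i)"
    have \<sigma>: "?\<sigma> permutes {..<length ?w}" by (rule permutes_swap_id) auto
    have "permute_list ?\<sigma> ?w = u @ c # a # v"
    proof (rule nth_equalityI)
      fix j assume "j < length (permute_list ?\<sigma> ?w)"
      then have "permute_list ?\<sigma> ?w ! j = ?w ! ?\<sigma> j" using permute_list_nth[OF \<sigma>] by simp
      then show "permute_list ?\<sigma> ?w ! j = (u @ c # a # v) ! j"
        by (auto simp: transpose_def nth_append nth_Cons')
    qed simp
    then have p: "permute_list ?\<sigma> (map snd ?w) = map snd (u @ c # a # v)"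
      using \<sigma> by (subst permute_list_map) simp_all
    have "{(i, j). i < j \<and> j < length (map fst ?w) \<and> ?\<sigma> j < ?\<sigma> i} = {(?i, Suc ?i)}"
      by (auto simp: transpose_def split: if_splits)
    then have k: "ksign (map fst ?w) ?\<sigma> = (sg (fst a * fst c) :: 'k)"
      unfolding ksign_def by (simp add: nth_append mult.commute)
    have "F (permute_list ?\<sigma> (map snd ?w)) = ksign (map fst ?w) ?\<sigma> * F (map snd ?w)"
      using F \<sigma> h homog_map_iff[of ?w] unfolding symmetric_def by (metis length_map)
    then have "ev F (u @ c # a # v) = sg (fst a * fst c) * ev F ?w"
      unfolding p k by (simp add: ev_def)
    then show "ev F (u @ a # c # v) = sg (fst a * fst c) * ev F (u @ c # a # v)" by simp
  qed
next
  assume F: "mform F \<and> movable (ev F)"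
  have "F (permute_list \<sigma> xs) = ksign ds \<sigma> * F xs" if h: "homog ds xs" "\<sigma> permutes {..<length xs}" for ds xs \<sigma>
  proof -
    obtain w where w: "hw w" "ds = map fst w" "xs = map snd w" using h(1) by (rule homogE)
    then have "ev F (permute_list \<sigma> w) = ksign (map fst w) \<sigma> * ev F w"
      using F h(2) by (intro movable_permute) auto
    then show ?thesis using h(2) w by (simp add: ev_def permute_list_map)
  qed
  then show "symmetric F" using F by (simp add: symmetric_def)
qed

lemma symmetric_cyclic: "symmetric F \<Longrightarrow> cyclic F"
proof -
  assume F: "symmetric F"
  have "rot1 (ev F) w = ev F w" if "hw w" for w
  proof (cases w)
    case (Cons a z)
    then show ?thesis using movable_move[of "ev F" "[]" a z "[]"] F that by (simp add: symmetric_iff rot1_def)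
  qed (simp add: rot1_def)
  then show ?thesis using F by (simp add: cyclic_iff symmetric_iff)
qed

lemma symmetric_mapsD:
  assumes q: "symmetric_maps q" and \<phi>: "Vector_Spaces.linear scale (*) \<phi>"
  shows "symmetric (\<lambda>xs. \<phi> (q xs))"
proof -
  have lin: "Vector_Spaces.linear scale scale (\<lambda>v. q (xs[i := v]))" if "i < length xs" for xs i
    using q that unfolding symmetric_maps_def by blast
  have "mform (\<lambda>xs. \<phi> (q xs))"
    unfolding mform_def
  proof (intro allI impI)
    fix xs :: "'v list" and i assume "i < length xs"
    from lin[OF this] show "Vector_Spaces.linear scale (*) (\<lambda>v. \<phi> (q (xs[i := v])))"
      using \<phi> unfolding linear_scale_iff linear_scalar_iff by simp
  qed
  moreover have "\<phi> (q (permute_list \<sigma> xs)) = ksign ds \<sigma> * \<phi> (q xs)"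
    if "homog ds xs \<and> \<sigma> permutes {..<length xs}" for ds xs \<sigma>
  proof -
    have "q (permute_list \<sigma> xs) = ksign ds \<sigma> *s q xs"
      using q that unfolding symmetric_maps_def by blast
    then show ?thesis using \<phi> unfolding linear_scalar_iff by simp
  qed
  ultimately show ?thesis unfolding symmetric_def by blast
qed

lemma mform_linear: "mform F \<Longrightarrow> Vector_Spaces.linear scale (*) (\<lambda>x. F (u @ x # v))"
  by (simp add: linear_scalar_iff mform_addD mform_scaleD)

lemma symmetric_maps_mform:
  assumes "symmetric_maps q" "mform F"
  shows "mform (\<lambda>xs. F (u @ q xs # v))"
  using symmetric_mapsD[OF assms(1) mform_linear[OF assms(2)]] by (simp add: symmetric_def)

lemma symmetric_maps_Nil: "symmetric_maps q \<Longrightarrow> q [] = 0"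
  by (simp add: symmetric_maps_def)

lemma linear_separates:
  assumes "\<And>\<phi>. Vector_Spaces.linear scale (*) \<phi> \<Longrightarrow> \<phi> x = \<phi> y"
  shows "x = y"
proof -
  obtain \<epsilon>s es and cs :: "nat \<Rightarrow> 'v \<Rightarrow> 'k" where
    "homog \<epsilon>s es" "distinct es" "independent (set es)" "span (set es) = UNIV"
    and lin: "\<And>i. Vector_Spaces.linear scale (*) (cs i)"
    and exp: "\<And>x. x = (\<Sum>i<length es. cs i x *s es ! i)"
    and "\<And>i j. i < length es \<Longrightarrow> j < length es \<Longrightarrow> cs i (es ! j) = (if i = j then 1 else 0)"
    and "\<And>i. i < length es \<Longrightarrow> has_degree (- (\<epsilon>s ! i)) (lf (cs i))"
    by (rule homogeneous_coordinates) (rule that)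
  have "(\<Sum>i<length es. cs i x *s es ! i) = (\<Sum>i<length es. cs i y *s es ! i)"
    using assms[OF lin] by simp
  then show ?thesis by (simp flip: exp)
qed

subsection \<open>Symmetric maps and their forms\<close>

text \<open>The parity involution. It turns the shifted form B(x, y) into b(par x, y), a formula
  free of degrees, so linearity and nondegeneracy of B can be inherited from
  \<open>b\<close>.\<close>

definition par :: "'v \<Rightarrow> 'v" where
  "par x = (\<Sum>d\<in>degs. sg d *s hcomp (d + 1) x)"

lemma par_linear: "par (x + y) = par x + par y" "par (c *s x) = c *s par x"
  by (simp_all add: par_def hcomp_add hcomp_scale scale_right_distrib sum.distrib scale_sum_right mult.commute)

lemma par_sum: "par (\<Sum>i\<in>A. f i) = (\<Sum>i\<in>A. par (f i))"
proof -
  have "par 0 = 0" by (simp add: par_def)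
  then show ?thesis by (induction A rule: infinite_finite_induct) (simp_all add: par_linear)
qed

lemma par_gr:
  assumes "x \<in> gr (d + 1)"
  shows "par x = sg d *s x"
proof -
  have "par x = (\<Sum>d'\<in>degs. if d' = d then sg d *s x else 0)"
    unfolding par_def by (rule sum.cong) (use hcomp_gr[OF assms] in auto)
  moreover have "d \<notin> degs \<Longrightarrow> x = 0" using assms by (auto simp: degs_def)
  ultimately show ?thesis using finite_degs by auto
qed

lemma par_par [simp]: "par (par x) = x"
proof -
  have "par (par x) = par (par (\<Sum>d\<in>degs. hcomp (d + 1) x))" by (simp add: hcomp_degs)
  also have "\<dots> = (\<Sum>d\<in>degs. par (par (hcomp (d + 1) x)))" by (simp add: par_sum)
  also have "\<dots> = (\<Sum>d\<in>degs. hcomp (d + 1) x)"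
    by (intro sum.cong refl) (simp add: par_gr[OF hcomp_in] par_linear)
  finally show ?thesis by (simp add: hcomp_degs)
qed

end

context graded_dual
begin

lemma shifted_par: "shifted_form b x y = b (par x) y"
  unfolding shifted_form_def par_def
  using linear_sum_scale[OF blin(2)[of y], of sg "\<lambda>d. hcomp (d + 1) x" degs] by simp

lemma shifted_linear: "Vector_Spaces.linear scale (*) (\<lambda>x. shifted_form b x y)" "Vector_Spaces.linear scale (*) (shifted_form b x)"
  unfolding linear_scalar_iff by (simp_all add: shifted_par par_linear b_add)

lemma shifted_gr: "x \<in> gr (d + 1) \<Longrightarrow> shifted_form b x y = sg d * b x y"
  by (simp add: shifted_par par_gr b_add)

lemma shifted_nondeg: "(\<And>y. shifted_form b x y = shifted_form b x' y) \<Longrightarrow> x = x'"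
proof -
  assume *: "\<And>y. shifted_form b x y = shifted_form b x' y"
  have "b (par x - par x') y = 0" for y using *[of y] by (simp add: shifted_par b_diff)
  then have "par x - par x' = 0" using nondeg unfolding nondeg_form_def by blast
  then have "par (par x) = par (par x')" by simp
  then show ?thesis by simp
qed

text \<open>The shift converts symmetry into antisymmetry: the exponents (d + 1)(d' + 1) + d and dd'
  + d' differ by an odd number.\<close>

lemma shifted_antisym:
  assumes x: "x \<in> gr (d + 1)" and y: "y \<in> gr (d' + 1)"
  shows "shifted_form b x y = - (sg (d * d') * shifted_form b y x)"
proof (cases "d + d' = - 2")
  case True
  then have d': "d' = - 2 - d" by simp
  have "sg d * sg ((d + 1) * (d' + 1)) = - (sg (d * d') * sg d' :: 'k)"
    by (auto simp: d' sg_def)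
  then show ?thesis
    unfolding shifted_gr[OF x] shifted_gr[OF y] b_sym[OF x y] by (metis mult.assoc mult_minus_left)
next
  case False
  then show ?thesis
    unfolding shifted_gr[OF x] shifted_gr[OF y] using b_orth[OF x y] b_orth[OF y x] by simp
qed

text \<open>Representation of a functional through the first argument removed: \<open>par\<close>
  cancels the sign inside B and the dual expansion does the rest. The values of \<open>q\<close> are
  obtained from \<Omega> in this way.\<close>

lemma shifted_functional:
  assumes \<phi>: "Vector_Spaces.linear scale (*) \<phi>"
  shows "shifted_form b (par (\<Sum>i<N. \<phi> (es' ! i) *s es ! i)) y = \<phi> y"
proof -
  have "shifted_form b (par (\<Sum>i<N. \<phi> (es' ! i) *s es ! i)) y = (\<Sum>i<N. \<phi> (es' ! i) * b (es ! i) y)"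
    unfolding shifted_par par_par by (rule linear_sum_scale[OF blin(2)])
  also have "\<dots> = \<phi> (\<Sum>i<N. b (es ! i) y *s es' ! i)"
    by (simp add: linear_sum_scale[OF \<phi>] mult.commute)
  finally show ?thesis by (simp flip: expand_es')
qed

lemma linear_is_shifted:
  assumes \<phi>: "Vector_Spaces.linear scale (*) \<phi>"
  obtains y where "\<And>x. \<phi> x = shifted_form b x y"
proof -
  let ?y = "\<Sum>i<N. \<phi> (par (es ! i)) *s es' ! i"
  have "\<phi> x = shifted_form b x ?y" for x
  proof -
    have \<phi>p: "Vector_Spaces.linear scale (*) (\<lambda>x. \<phi> (par x))"
      using \<phi> unfolding linear_scalar_iff by (simp add: par_linear)
    have "shifted_form b x ?y = (\<Sum>i<N. \<phi> (par (es ! i)) * b (par x) (es' ! i))"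
      unfolding shifted_par by (rule linear_sum_scale[OF blin(1)])
    also have "\<dots> = \<phi> (par (\<Sum>i<N. b (par x) (es' ! i) *s es ! i))"
      by (simp add: linear_sum_scale[OF \<phi>p] mult.commute)
    finally show ?thesis by (simp flip: expand_es)
  qed
  then show ?thesis by (rule that)
qed

text \<open>The empty list is covered as well: there the form is 0 by default, in agreement with
  B(0, x) = 0.\<close>

lemma form_of_maps_snoc:
  assumes "q [] = 0"
  shows "form_of_maps b q (xs @ [x]) = shifted_form b (q xs) x"
  using assms shifted_linear(1)[of x] linear_sum_scale[OF shifted_linear(1), where A = "{}"]
  by (cases xs) (auto simp: form_of_maps_def)

lemma ksign_append:
  assumes "\<sigma> permutes {..<length ds}"
  shows "(ksign (ds @ [d]) \<sigma> :: 'a::comm_ring_1) = ksign ds \<sigma>"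
proof -
  have lt: "\<sigma> j < length ds" if "j < length ds" for j using permutes_in_image[OF assms, of j] that by simp
  have n: "\<sigma> (length ds) = length ds" using permutes_not_in[OF assms] by simp
  have S: "{(i, j). i < j \<and> j < length (ds @ [d]) \<and> \<sigma> j < \<sigma> i} = {(i, j). i < j \<and> j < length ds \<and> \<sigma> j < \<sigma> i}"
    using lt n by (auto simp: less_Suc_eq) (metis less_asym)
  show ?thesis
    unfolding ksign_def by (rule prod.cong[OF S]) (use lt in \<open>auto simp: nth_append\<close>)
qed

text \<open>The vector \<open>q xs\<close> represents the functional obtained from \<Omega> by
  filling all slots but the last. Nondegeneracy of B yields uniqueness and transfers multilinearity
  and symmetry from \<Omega> to \<open>q\<close>.\<close>

lemma symmetric_form_maps:
  assumes \<Omega>: "symmetric \<Omega>" "\<And>xs. length xs < 2 \<Longrightarrow> \<Omega> xs = 0"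
  shows "\<exists>!q. symmetric_maps q \<and> \<Omega> = form_of_maps b q"
proof (rule ex1I)
  have m: "mform \<Omega>" using \<Omega>(1) by (simp add: symmetric_def)
  define q where "q xs = par (\<Sum>i<N. \<Omega> (xs @ [es' ! i]) *s es ! i)" for xs
  have Bq: "shifted_form b (q xs) y = \<Omega> (xs @ [y])" for xs y
    unfolding q_def by (rule shifted_functional[of "\<lambda>y. \<Omega> (xs @ [y])"]) (rule mform_linear[OF m])
  have q0: "q [] = 0" using \<Omega>(2) by (simp add: q_def par_def)
  have "\<Omega> xs = form_of_maps b q xs" for xs
  proof (cases "length xs < 2")
    case False
    then have "xs = butlast xs @ [last xs]" by (cases xs) auto
    then show ?thesis using Bq[of "butlast xs" "last xs"] False by (simp add: form_of_maps_def)
  qed (simp add: \<Omega>(2) form_of_maps_def)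
  moreover have "symmetric_maps q"
    unfolding symmetric_maps_def
  proof (intro conjI allI impI q0)
    fix xs :: "'v list" and i assume i: "i < length xs"
    have "q (xs[i := x + y]) = q (xs[i := x]) + q (xs[i := y])" for x y
    proof (rule shifted_nondeg)
      fix z
      show "shifted_form b (q (xs[i := x + y])) z = shifted_form b (q (xs[i := x]) + q (xs[i := y])) z"
        using shifted_linear(1)[of z] i mform_addD[OF m, of "take i xs" x y "drop (Suc i) xs @ [z]"]
        unfolding linear_scalar_iff by (simp add: Bq upd_conv_take_nth_drop)
    qed
    moreover have "q (xs[i := c *s x]) = c *s q (xs[i := x])" for x c
    proof (rule shifted_nondeg)
      fix z
      show "shifted_form b (q (xs[i := c *s x])) z = shifted_form b (c *s q (xs[i := x])) z"
        using shifted_linear(1)[of z] i mform_scaleD[OF m, of "take i xs" c x "drop (Suc i) xs @ [z]"]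
        unfolding linear_scalar_iff by (simp add: Bq upd_conv_take_nth_drop)
    qed
    ultimately show "Vector_Spaces.linear scale scale (\<lambda>v. q (xs[i := v]))"
      by (simp add: linear_scale_iff)
  next
    fix ds xs \<sigma> assume h: "homog ds xs \<and> \<sigma> permutes {..<length xs}"
    have \<sigma>: "\<sigma> permutes {..<Suc (length xs)}"
      using h by (auto intro: permutes_subset)
    have lt: "\<sigma> j < length xs" if "j < length xs" for j
      using permutes_in_image[of \<sigma> "{..<length xs}" j] h that by simp
    have n: "\<sigma> (length xs) = length xs" using h permutes_not_in[of \<sigma> "{..<length xs}"] by simp
    have "\<Omega> (permute_list \<sigma> xs @ [es' ! i]) = ksign ds \<sigma> * \<Omega> (xs @ [es' ! i])" if i: "i < N" for i
    proof -
      have hh: "homog (ds @ [- 2 - \<epsilon> i]) (xs @ [es' ! i])"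
        using h es'_in[OF i] by (auto simp: homog_def intro: list_all2_appendI)
      have "permute_list \<sigma> (xs @ [es' ! i]) = permute_list \<sigma> xs @ [es' ! i]"
        using lt n by (simp add: permute_list_def nth_append)
      moreover have "\<Omega> (permute_list \<sigma> (xs @ [es' ! i])) = ksign (ds @ [- 2 - \<epsilon> i]) \<sigma> * \<Omega> (xs @ [es' ! i])"
        using \<Omega>(1) hh \<sigma> unfolding symmetric_def by simp
      moreover have "ksign (ds @ [- 2 - \<epsilon> i]) \<sigma> = (ksign ds \<sigma> :: 'k)"
        using h length_homog[of ds xs] by (intro ksign_append) auto
      ultimately show ?thesis by simp
    qed
    then have "q (permute_list \<sigma> xs) = par (\<Sum>i<N. ksign ds \<sigma> *s (\<Omega> (xs @ [es' ! i]) *s es ! i))"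
      unfolding q_def by simp
    then show "q (permute_list \<sigma> xs) = ksign ds \<sigma> *s q xs"
      unfolding q_def scale_sum_right[symmetric] par_linear .
  qed
  ultimately show "symmetric_maps q \<and> \<Omega> = form_of_maps b q" by blast
  fix q' assume q': "symmetric_maps q' \<and> \<Omega> = form_of_maps b q'"
  show "q' = q"
  proof
    fix xs
    show "q' xs = q xs"
    proof (rule shifted_nondeg)
      fix y
      have "\<Omega> (xs @ [y]) = shifted_form b (q' xs) y"
        using q' form_of_maps_snoc[of q' xs y] symmetric_maps_Nil by simp
      then show "shifted_form b (q' xs) y = shifted_form b (q xs) y" by (simp add: Bq)
    qed
  qed
qed

text \<open>Exchanges that avoid the last slot are inherited from the symmetry of \<open>q\<close>.
  An exchange of the last two letters is rotated to the front by cyclicity; in arity two it is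
  cyclicity itself.\<close>

lemma symmetric_form_of_maps:
  assumes q: "symmetric_maps q" and B: "B_quadratic b q"
  shows "symmetric (form_of_maps b q)"
proof -
  let ?\<Omega> = "form_of_maps b q"
  have q0: "q [] = 0" by (rule symmetric_maps_Nil[OF q])
  note snoc = form_of_maps_snoc[where q = q, OF q0]
  have cycm: "cyclic (comp_arity (k + 1) ?\<Omega>)" if "k \<ge> 1" for k
    using B that unfolding B_quadratic_def cyc_def by blast
  have cyc: "ev ?\<Omega> (u @ v) = sg (wdeg u * wdeg v) * ev ?\<Omega> (v @ u)" if "hw u" "hw v" for u v
  proof (cases "length (u @ v) < 2")
    case True
    then show ?thesis by (simp add: ev_def form_of_maps_def)
  next
    case False
    define k where "k = length (u @ v) - 1"
    have k: "k \<ge> 1" "length (u @ v) = k + 1" "length (v @ u) = k + 1" using False by (auto simp: k_def)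
    show ?thesis using cyclic_append[OF cycm[OF k(1)] that] k(2,3) by (simp add: ev_def comp_arity_def add.commute)
  qed
  have "mform ?\<Omega>"
  proof (rule mformI)
    fix u v :: "'v list" and x y c
    have eq: "?\<Omega> (u @ x # v) = (if v = [] then shifted_form b (q u) x else shifted_form b (q (u @ x # butlast v)) (last v))" for x
      using snoc[of u x] snoc[of "u @ x # butlast v" "last v"] by auto
    have m: "mform (\<lambda>xs. shifted_form b (q xs) (last v))"
      using symmetric_mapsD[OF q shifted_linear(1)] by (simp add: symmetric_def)
    show "?\<Omega> (u @ (x + y) # v) = ?\<Omega> (u @ x # v) + ?\<Omega> (u @ y # v)" "?\<Omega> (u @ (c *s x) # v) = c * ?\<Omega> (u @ x # v)"
      unfolding eq using shifted_linear(2) mform_addD[OF m] mform_scaleD[OF m] by (auto simp: linear_scalar_iff)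
  qed
  moreover have sw: "ev ?\<Omega> (u @ a # c # v) = sg (fst a * fst c) * ev ?\<Omega> (u @ c # a # v)"
    if h: "hw (u @ a # c # v)" and v: "v \<noteq> []" for u a c v
  proof -
    obtain v' y where v': "v = v' @ [y]" using v by (cases v rule: rev_cases) auto
    have "movable (ev (\<lambda>xs. shifted_form b (q xs) (snd y)))"
      using symmetric_mapsD[OF q shifted_linear(1)] by (simp add: symmetric_iff)
    then have "ev (\<lambda>xs. shifted_form b (q xs) (snd y)) (u @ a # c # v') =
      sg (fst a * fst c) * ev (\<lambda>xs. shifted_form b (q xs) (snd y)) (u @ c # a # v')"
      unfolding movable_def by (elim allE impE) (use h v' in auto)
    then show ?thesis using snoc[of "map snd (u @ a # c # v')" "snd y"] snoc[of "map snd (u @ c # a # v')" "snd y"]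
      by (simp add: ev_def v')
  qed
  moreover have "ev ?\<Omega> (u @ [a, c]) = sg (fst a * fst c) * ev ?\<Omega> (u @ [c, a])" if h: "hw (u @ [a, c])" for u a c
  proof (cases "u = []")
    case True
    then show ?thesis using cyc[of "[a]" "[c]"] h by simp
  next
    case False
    have "ev ?\<Omega> (u @ [a, c]) = sg (wdeg u * (fst a + fst c)) * ev ?\<Omega> ([] @ a # c # u)"
      using cyc[of u "[a, c]"] h by simp
    also have "ev ?\<Omega> ([] @ a # c # u) = sg (fst a * fst c) * ev ?\<Omega> ([] @ c # a # u)"
      by (rule sw) (use h False in auto)
    also have "ev ?\<Omega> ([] @ c # a # u) = sg (wdeg u * (fst a + fst c)) * ev ?\<Omega> (u @ [c, a])"
      using cyc[of "[c, a]" u] h by (simp add: mult.commute add.commute)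
    finally show ?thesis by (simp add: mult.left_commute)
  qed
  ultimately show ?thesis
    unfolding symmetric_iff movable_def by (metis append_Nil2)
qed

lemma B_quadratic_if_symmetric:
  assumes "symmetric \<Omega>" "\<Omega> = form_of_maps b q"
  shows "B_quadratic b q"
  unfolding B_quadratic_def using assms symmetric_cyclic by (auto intro: cyc_comp_arity)

end

section \<open>The symmetrised self-bracket and the square of the maps\<close>

lemma Xw_sum: "Xw L (\<lambda>z. \<Sum>i\<in>A. f i z) = (\<lambda>w. \<Sum>i\<in>A. Xw L (f i) w)"
  by (rule ext) (simp add: Xw_def dec_sum sum_distrib_left)

lemma symsum_eq_0: "(\<And>z. mset z = mset w \<Longrightarrow> f z = 0) \<Longrightarrow> symsum w f = 0"
  using symsum_cong[of w f "\<lambda>_. 0"] by simp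

context fd_graded_space
begin

text \<open>The attached degree is the one \<open>q\<close> should produce; that the vector really
  has it is the content of \<open>degree1\<close>.\<close>

definition lq :: "('v list \<Rightarrow> 'v) \<Rightarrow> (int \<times> 'v) list \<Rightarrow> int \<times> 'v" where
  "lq q u = (wdeg u + 1, q (map snd u))"

definition degree1 :: "('v list \<Rightarrow> 'v) \<Rightarrow> bool" where
  "degree1 q \<longleftrightarrow> (\<forall>u. hw u \<longrightarrow> hw [lq q u])"

text \<open>The quadratic relations of an L-infinity structure: \<open>Xw\<close> lists the signed
  terms q(u1, q(u2), u3) over all ways to cut, symmetrised over all permutations and tested by
  linear functionals.\<close>

definition vanishing_square :: "('v list \<Rightarrow> 'v) \<Rightarrow> bool" where
  "vanishing_square q \<longleftrightarrow> (\<forall>\<phi> w. Vector_Spaces.linear scale (*) \<phi> \<and> hw w \<longrightarrow>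
     symsum w (Xw (lq q) (\<lambda>z. \<phi> (q (map snd z)))) = 0)"

end

context graded_dual
begin

text \<open>The symmetrised self-bracket before cyclisation. Cyclising only multiplies it by a
  positive integer (\<open>symsum_rot\<close>), so the vanishing is the same.\<close>

definition Sq :: "('v, 'k) form \<Rightarrow> (int \<times> 'v) list \<Rightarrow> 'k" where
  "Sq \<Omega> w = symsum w (ctr (ev \<Omega>) (ev \<Omega>))"

text \<open>Since \<Omega> has degree 3, B(q u, y) vanishes on homogeneous y outside a single
  degree; nondegeneracy then identifies \<open>q u\<close> with its component of the complementary
  degree.\<close>

lemma degree1_form:
  assumes \<Omega>: "has_degree 3 \<Omega>" and \<Omega>q: "\<Omega> = form_of_maps b q" and q0: "q [] = 0"
  shows "degree1 q"
  unfolding degree1_def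
proof (intro allI impI)
  fix u :: "(int \<times> 'v) list" assume u: "hw u"
  let ?x = "q (map snd u)"
  have B: "shifted_form b ?x y = 0" if y: "y \<in> gr (d + 1)" "d + (wdeg u + 1) \<noteq> - 2" for y d
  proof (rule ccontr)
    assume "shifted_form b ?x y \<noteq> 0"
    then have "ev \<Omega> (u @ [(d, y)]) \<noteq> 0"
      using form_of_maps_snoc[where q = q, OF q0] \<Omega>q by (simp add: ev_def)
    moreover have "hw (u @ [(d, y)])" using u y by simp
    ultimately have "3 + wdeg (u @ [(d, y)]) = 0" using \<Omega> unfolding has_degree_iff by blast
    then show False using y(2) by simp
  qed
  have "?x = hcomp (wdeg u + 1 + 1) ?x"
  proof (rule shifted_nondeg)
    fix y
    have "shifted_form b ?x (hcomp (d + 1) y) = shifted_form b (hcomp (wdeg u + 1 + 1) ?x) (hcomp (d + 1) y)" for d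
    proof (cases "d + (wdeg u + 1) = - 2")
      case True
      have eq: "- (d + 1) = wdeg u + 1 + 1" using True by simp
      have "hcomp m (par x) = par (hcomp m x)" for m x
      proof -
        have "hcomp m (\<Sum>d\<in>A. sg d *s hcomp (d + 1) x) = (\<Sum>d\<in>A. sg d *s hcomp m (hcomp (d + 1) x))" for A
          by (induction A rule: infinite_finite_induct) (auto simp: hcomp_add hcomp_scale)
        then have "hcomp m (par x) = (\<Sum>d\<in>degs. sg d *s hcomp m (hcomp (d + 1) x))"
          unfolding par_def .
        also have "\<dots> = (\<Sum>d\<in>degs. sg d *s hcomp (d + 1) (hcomp m x))"
          by (intro sum.cong refl) (use hcomp_gr[OF hcomp_in] in auto)
        finally show ?thesis by (simp add: par_def)
      qed
      then show ?thesis
        unfolding shifted_par using nondeg_hcomp(2)[OF nondeg hcomp_in, of "par ?x" "d + 1" y]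
        by (simp only: eq)
    next
      case False
      have "hcomp (wdeg u + 1 + 1) ?x \<in> gr (wdeg u + 1 + 1)" by simp
      then have "shifted_form b (hcomp (wdeg u + 1 + 1) ?x) (hcomp (d + 1) y) = 0"
      proof -
        let ?z = "hcomp (wdeg u + 1 + 1) ?x"
        have "b ?z (hcomp (d + 1) y) = 0" by (rule b_orth[OF hcomp_in hcomp_in]) (use False in simp)
        then show ?thesis using shifted_gr[OF hcomp_in[of "wdeg u + 1 + 1" ?x]] by simp
      qed
      then show ?thesis using B[OF hcomp_in] False by simp
    qed
    then have "(\<Sum>d\<in>degs. 1 * shifted_form b ?x (hcomp (d + 1) y)) = (\<Sum>d\<in>degs. 1 * shifted_form b (hcomp (wdeg u + 1 + 1) ?x) (hcomp (d + 1) y))"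
      by simp
    then have "shifted_form b ?x (\<Sum>d\<in>degs. 1 *s hcomp (d + 1) y) = shifted_form b (hcomp (wdeg u + 1 + 1) ?x) (\<Sum>d\<in>degs. 1 *s hcomp (d + 1) y)"
      by (simp only: linear_sum_scale[OF shifted_linear(2)])
    then show "shifted_form b ?x y = shifted_form b (hcomp (wdeg u + 1 + 1) ?x) y"
      by (simp add: hcomp_degs)
  qed
  then have "?x \<in> gr (wdeg u + 1 + 1)" by (metis hcomp_in)
  then show "hw [lq q u]" by (simp add: lq_def)
qed

lemma has_degree_form:
  assumes d: "degree1 q" and q0: "q [] = 0"
  shows "has_degree 3 (form_of_maps b q)"
  unfolding has_degree_iff
proof (intro allI impI)
  fix w :: "(int \<times> 'v) list" assume w: "hw w \<and> ev (form_of_maps b q) w \<noteq> 0"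
  then have "w \<noteq> []" by (auto simp: ev_def form_of_maps_def)
  then obtain u a where u: "w = u @ [a]" by (cases w rule: rev_cases) auto
  have x: "q (map snd u) \<in> gr (wdeg u + 1 + 1)" and a: "snd a \<in> gr (fst a + 1)"
    using d w u unfolding degree1_def lq_def by auto
  have "shifted_form b (q (map snd u)) (snd a) \<noteq> 0"
    using w form_of_maps_snoc[where q = q, OF q0] by (simp add: ev_def u)
  then have "wdeg u + 1 + 1 + (fst a + 1) = 0"
    using shifted_gr[OF x] b_orth[OF x a] by auto
  then show "3 + wdeg w = 0" by (simp add: u)
qed

context
  fixes q \<Omega>
  assumes q: "symmetric_maps q" and \<Omega>q: "\<Omega> = form_of_maps b q" and \<Omega>: "symmetric \<Omega>" and deg: "degree1 q"
begin

abbreviation "L \<equiv> lq q"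

lemma q0: "q [] = 0" by (rule symmetric_maps_Nil[OF q])

lemma hwL [simp]: "hw u \<Longrightarrow> snd (L u) \<in> gr (wdeg u + 2)"
proof -
  assume "hw u"
  then have "hw [L u]" using deg by (simp add: degree1_def)
  then show ?thesis by (simp add: lq_def add.assoc)
qed

lemma fstL [simp]: "fst (L u) = wdeg u + 1" by (simp add: lq_def)

lemma hwL1: "hw u \<Longrightarrow> hw (L u # v) \<longleftrightarrow> hw v"
  using hwL[of u] by (simp add: add.assoc)

lemma m\<Omega>: "mform \<Omega>" and mv\<Omega>: "movable (ev \<Omega>)"
  using \<Omega> by (simp_all add: symmetric_iff)

lemma deg\<Omega>: "hw w \<Longrightarrow> ev \<Omega> w \<noteq> 0 \<Longrightarrow> even (1 + wdeg w)"
proof -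
  assume "hw w" "ev \<Omega> w \<noteq> 0"
  then have "3 + wdeg w = 0" using has_degree_form[OF deg q0] \<Omega>q unfolding has_degree_iff by blast
  then have "wdeg w = - 3" by simp
  then show "even (1 + wdeg w)" by simp
qed

lemma \<Omega>_snoc: "ev \<Omega> (v @ [x]) = shifted_form b (q (map snd v)) (snd x)"
  using form_of_maps_snoc[where q = q, OF q0] by (simp add: \<Omega>q ev_def)

lemma \<Omega>_move: "hw (a # w @ v) \<Longrightarrow> ev \<Omega> (a # w @ v) = sg (fst a * wdeg w) * ev \<Omega> (w @ a # v)"
  using movable_move[OF mv\<Omega>, of "[]" a w v] by simp

text \<open>Moving e_i to the last slot exhibits \<Omega>(e_i, u) as -b(e_i, q u); the sum over dual
  bases then expands q(u) and substitutes it into the first slot of the second factor. The minus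
  sign cancels the one left by the contraction sign.\<close>

lemma ctr_\<Omega>:
  assumes w: "hw w"
  shows "ctr (ev \<Omega>) (ev \<Omega>) w = dec (\<lambda>u v. ev \<Omega> (L u # v)) w"
  unfolding ctr_def
proof (rule dec_cong)
  fix u v assume uv: "w = u @ v"
  then have u: "hw u" and v: "hw v" using w by auto
  have A: "ev \<Omega> (E i # u) = - b (es ! i) (snd (L u))" if i: "i < N" for i
  proof -
    have x: "snd (L u) \<in> gr (wdeg u + 1 + 1)" using hwL[OF u] by (simp add: add.assoc)
    have "ev \<Omega> (E i # u) = sg (\<epsilon> i * wdeg u) * ev \<Omega> (u @ [E i])"
      using \<Omega>_move[of "E i" u "[]"] u i es_in by simp
    also have "ev \<Omega> (u @ [E i]) = sg (wdeg u + 1) * b (snd (L u)) (es ! i)"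
      using \<Omega>_snoc[of u "E i"] shifted_gr[OF x] by (simp add: lq_def)
    also have "b (snd (L u)) (es ! i) = sg ((wdeg u + 1 + 1) * (\<epsilon> i + 1)) * b (es ! i) (snd (L u))"
      by (rule b_sym[OF x es_in[OF i]])
    finally have "ev \<Omega> (E i # u) = (sg (\<epsilon> i * wdeg u) * (sg (wdeg u + 1) * sg ((wdeg u + 1 + 1) * (\<epsilon> i + 1)))) * b (es ! i) (snd (L u))"
      by (simp add: mult.assoc)
    also have "\<dots> = sg 1 * b (es ! i) (snd (L u))"
      unfolding sg_add[symmetric]
    proof (rule sg_cong)
      assume "b (es ! i) (snd (L u)) \<noteq> 0"
      then have "\<epsilon> i + 1 + (wdeg u + 1 + 1) = 0" using b_orth[OF es_in[OF i] x] by blast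
      then have "\<epsilon> i = - 3 - wdeg u" by simp
      then show "even (\<epsilon> i * wdeg u + (wdeg u + 1 + (wdeg u + 1 + 1) * (\<epsilon> i + 1)) + 1)" by auto
    qed
    finally show ?thesis by (simp add: sg_def)
  qed
  have B: "sg ((\<epsilon> i + wdeg v) * (\<epsilon> i + wdeg u) + \<epsilon> i * wdeg u) * (ev \<Omega> (E i # u) * ev \<Omega> (E' i # v)) =
      b (es ! i) (snd (L u)) * ev \<Omega> (E' i # v)" if i: "i < N" for i
  proof -
    have x: "snd (L u) \<in> gr (wdeg u + 1 + 1)" using hwL[OF u] by (simp add: add.assoc)
    have "sg ((\<epsilon> i + wdeg v) * (\<epsilon> i + wdeg u) + \<epsilon> i * wdeg u) * (b (es ! i) (snd (L u)) * ev \<Omega> (E' i # v)) =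
      sg 1 * (b (es ! i) (snd (L u)) * ev \<Omega> (E' i # v))"
    proof (rule sg_cong)
      assume nz: "b (es ! i) (snd (L u)) * ev \<Omega> (E' i # v) \<noteq> 0"
      then have "\<epsilon> i + 1 + (wdeg u + 1 + 1) = 0" using b_orth[OF es_in[OF i] x] by auto
      then have e: "\<epsilon> i = - 3 - wdeg u" by simp
      have "even (1 + wdeg (E' i # v))" using nz i v by (intro deg\<Omega>) (auto simp del: hw_simps(2))
      then have "even (wdeg u + wdeg v)" by (simp add: e)
      then show "even ((\<epsilon> i + wdeg v) * (\<epsilon> i + wdeg u) + \<epsilon> i * wdeg u + 1)" by (auto simp: e)
    qed
    then show ?thesis using A[OF i] by (simp add: sg_def)
  qed
  have "(\<Sum>i<N. sg ((\<epsilon> i + wdeg v) * (\<epsilon> i + wdeg u) + \<epsilon> i * wdeg u) * (ev \<Omega> (E i # u) * ev \<Omega> (E' i # v))) =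
    (\<Sum>i<N. b (es ! i) (snd (L u)) * \<Omega> (es' ! i # map snd v))"
    by (intro sum.cong refl) (simp add: B, simp add: ev_def)
  also have "\<dots> = \<Omega> ((\<Sum>i<N. b (es ! i) (snd (L u)) *s es' ! i) # map snd v)"
    by (simp add: mform_sum_Cons[OF m\<Omega>] mform_scaleD_Cons[OF m\<Omega>])
  finally show "(\<Sum>i<N. sg ((\<epsilon> i + wdeg v) * (\<epsilon> i + wdeg u) + \<epsilon> i * wdeg u) * (ev \<Omega> (E i # u) * ev \<Omega> (E' i # v))) =
    ev \<Omega> (L u # v)"
    by (simp add: ev_def flip: expand_es')
qed

text \<open>By symmetry of \<open>q\<close> all insertion positions contribute equally; the factor
  counts them.\<close>

lemma ins_L_left:
  assumes h: "hw (y # u)" "hw v"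
  shows "ins y (\<lambda>x. ev \<Omega> (L x # v)) u = of_nat (length u + 1) * ev \<Omega> (L (y # u) # v)"
proof -
  have mv: "movable (ev (\<lambda>xs. \<Omega> (q xs # map snd v)))"
    using symmetric_mapsD[OF q mform_linear[OF m\<Omega>, of "[]" "map snd v"]] by (simp add: symmetric_iff)
  have "ins y (\<lambda>x. ev \<Omega> (L x # v)) u = dec (\<lambda>u1 u2. ev \<Omega> (L (y # u1 @ u2) # v)) u"
    unfolding ins_def
  proof (rule dec_cong)
    fix u1 u2 assume "u = u1 @ u2"
    then have "ev (\<lambda>xs. \<Omega> (q xs # map snd v)) ([] @ y # u1 @ u2) = sg (fst y * wdeg u1) * ev (\<lambda>xs. \<Omega> (q xs # map snd v)) ([] @ u1 @ y # u2)"
      using h by (intro movable_move[OF mv]) auto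
    then show "sg (fst y * wdeg u1) * ev \<Omega> (L (u1 @ y # u2) # v) = ev \<Omega> (L (y # u1 @ u2) # v)"
      by (simp add: ev_def lq_def)
  qed
  then show ?thesis by (simp only: dec_append_args[of "\<lambda>z. ev \<Omega> (L (y # z) # v)"])
qed

lemma ins_L_right:
  assumes h: "hw (y # v)" "hw u"
  shows "ins y (\<lambda>x. ev \<Omega> (L u # x)) v = of_nat (length v + 1) * ev \<Omega> (L u # y # v)"
proof -
  have "ins y (\<lambda>x. ev \<Omega> (L u # x)) v = dec (\<lambda>v1 v2. ev \<Omega> (L u # y # v1 @ v2)) v"
    unfolding ins_def
  proof (rule dec_cong)
    fix v1 v2 assume "v = v1 @ v2"
    then have "ev \<Omega> ([L u] @ y # v1 @ v2) = sg (fst y * wdeg v1) * ev \<Omega> ([L u] @ v1 @ y # v2)"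
      using h by (intro movable_move[OF mv\<Omega>]) (auto simp: hwL1 add.assoc)
    then show "sg (fst y * wdeg v1) * ev \<Omega> (L u # v1 @ y # v2) = ev \<Omega> (L u # y # v1 @ v2)" by simp
  qed
  then show ?thesis by (simp only: dec_append_args[of "\<lambda>z. ev \<Omega> (L u # y # z)"])
qed

text \<open>Both sides are, up to sign, the pairing under B of q(y u) with q(v); the antisymmetry of
  B exchanges which of the two outputs is fed into \<Omega>.\<close>

lemma L_exchange:
  assumes h: "hw (y # u)" "hw v"
  shows "ev \<Omega> (L (y # u) # v) = sg (wdeg v) * ev \<Omega> (L v # y # u)"
proof -
  let ?x = "L (y # u)" and ?z = "L v" and ?d = "fst y + wdeg u + 1"
  have x: "snd ?x \<in> gr (?d + 1)" using hwL[OF h(1)] by (simp add: add.assoc)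
  have z: "snd ?z \<in> gr (wdeg v + 1 + 1)" using hwL[OF h(2)] by (simp add: add.assoc)
  have hx: "hw (?x # v)" and hz: "hw (?z # y # u)" using h by (simp_all only: hwL1)
  have "ev \<Omega> (?x # v) = sg (?d * wdeg v) * ev \<Omega> (v @ [?x])"
    using \<Omega>_move[of ?x v "[]"] hx by simp
  also have "ev \<Omega> (v @ [?x]) = shifted_form b (snd ?z) (snd ?x)"
    using \<Omega>_snoc[of v ?x] by (simp add: lq_def)
  also have "\<dots> = - (sg ((wdeg v + 1) * ?d) * shifted_form b (snd ?x) (snd ?z))"
    by (rule shifted_antisym[OF z x])
  also have "shifted_form b (snd ?x) (snd ?z) = ev \<Omega> ((y # u) @ [?z])"
    using \<Omega>_snoc[of "y # u" ?z] by (simp add: lq_def)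
  also have "\<dots> = sg ((wdeg v + 1) * (fst y + wdeg u)) * ev \<Omega> (?z # y # u)"
    using \<Omega>_move[of ?z "y # u" "[]"] hz by simp
  finally have "ev \<Omega> (?x # v) = - ((sg (?d * wdeg v) * (sg ((wdeg v + 1) * ?d) * sg ((wdeg v + 1) * (fst y + wdeg u)))) * ev \<Omega> (?z # y # u))"
    by (simp add: mult.assoc)
  also have "\<dots> = - (sg (wdeg v + 1) * ev \<Omega> (?z # y # u))"
    unfolding sg_add[symmetric]
  proof (intro arg_cong[of _ _ uminus] sg_cong)
    assume "ev \<Omega> (?z # y # u) \<noteq> 0"
    then have "even (1 + wdeg (?z # y # u))" by (rule deg\<Omega>[OF hz])
    then have "even (wdeg v + (fst y + wdeg u))" by simp
    then show "even (?d * wdeg v + ((wdeg v + 1) * ?d + (wdeg v + 1) * (fst y + wdeg u)) + (wdeg v + 1))" by auto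
  qed
  finally show ?thesis by (simp add: sg_def)
qed

text \<open>The letter \<open>y\<close> enters either the argument of the inner \<open>q\<close> or
  the remaining slots of \<Omega>. \<open>L_exchange\<close> and the exchange of the two pieces make
  the two families equal, hence the factor 2.\<close>

lemma Sq_Cons:
  assumes h: "hw (y # w)"
  shows "Sq \<Omega> (y # w) = 2 * symsum w (dec (\<lambda>u v. sg (fst y * wdeg u) * (of_nat (length v + 1) * ev \<Omega> (L u # y # v))))"
proof -
  let ?G = "\<lambda>u v. sg (fst y * wdeg u) * (of_nat (length v + 1) * ev \<Omega> (L u # y # v))"
  have hz: "hw z" if "mset z = mset w" for z using h hw_mset[OF that] by simp
  have "Sq \<Omega> (y # w) = symsum (y # w) (dec (\<lambda>u v. ev \<Omega> (L u # v)))"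
    unfolding Sq_def
  proof (rule symsum_cong)
    fix z assume "mset z = mset (y # w)"
    then show "ctr (ev \<Omega>) (ev \<Omega>) z = dec (\<lambda>u v. ev \<Omega> (L u # v)) z" using hw_mset h by (intro ctr_\<Omega>) blast
  qed
  also have "\<dots> = symsum w (\<lambda>z. dec (\<lambda>u v. of_nat (length u + 1) * (sg (wdeg v) * ev \<Omega> (L v # y # u))) z + dec ?G z)"
    unfolding symsum.simps
  proof (rule symsum_cong)
    fix z assume "mset z = mset w"
    then have z: "hw z" by (rule hz)
    show "ins y (dec (\<lambda>u v. ev \<Omega> (L u # v))) z =
       dec (\<lambda>u v. of_nat (length u + 1) * (sg (wdeg v) * ev \<Omega> (L v # y # u))) z + dec ?G z"
      unfolding ins_dec dec_add[symmetric]
    proof (rule dec_cong)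
      fix u v assume "z = u @ v"
      then have uv: "hw (y # u)" "hw (y # v)" "hw u" "hw v" using h z by auto
      show "ins y (\<lambda>x. ev \<Omega> (L x # v)) u + sg (fst y * wdeg u) * ins y (\<lambda>x. ev \<Omega> (L u # x)) v =
        of_nat (length u + 1) * (sg (wdeg v) * ev \<Omega> (L v # y # u)) + ?G u v"
        unfolding ins_L_left[OF uv(1,4)] ins_L_right[OF uv(2,3)] L_exchange[OF uv(1,4)] ..
    qed
  qed
  also have "\<dots> = symsum w (dec (\<lambda>u v. of_nat (length u + 1) * (sg (wdeg v) * ev \<Omega> (L v # y # u)))) + symsum w (dec ?G)"
    by (rule symsum_add)
  also have "symsum w (dec (\<lambda>u v. of_nat (length u + 1) * (sg (wdeg v) * ev \<Omega> (L v # y # u)))) =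
     symsum w (dec (\<lambda>u v. sg (wdeg u * wdeg v) * (of_nat (length v + 1) * (sg (wdeg u) * ev \<Omega> (L u # y # v)))))"
    by (rule symsum_dec_swap)
  also have "\<dots> = symsum w (dec ?G)"
  proof (rule symsum_cong, rule dec_cong)
    fix z u v assume z: "mset z = mset w" "z = u @ v"
    then have uv: "hw u" "hw v" using hz[OF z(1)] by auto
    have tw: "sg (wdeg u * wdeg v + wdeg u) * ev \<Omega> (L u # y # v) = sg (fst y * wdeg u) * ev \<Omega> (L u # y # v)"
    proof (rule sg_cong)
      assume nz: "ev \<Omega> (L u # y # v) \<noteq> 0"
      have "hw (L u # y # v)" using uv h by (simp only: hwL1) simp
      then have "even (1 + wdeg (L u # y # v))" using nz by (rule deg\<Omega>)
      then have "even (wdeg u + (fst y + wdeg v))" by simp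
      then show "even (wdeg u * wdeg v + wdeg u + fst y * wdeg u)" by auto
    qed
    have "sg (wdeg u * wdeg v) * (of_nat (length v + 1) * (sg (wdeg u) * ev \<Omega> (L u # y # v))) =
      of_nat (length v + 1) * (sg (wdeg u * wdeg v + wdeg u) * ev \<Omega> (L u # y # v))"
      by (simp only: sg_add mult_ac)
    then show "sg (wdeg u * wdeg v) * (of_nat (length v + 1) * (sg (wdeg u) * ev \<Omega> (L u # y # v))) = ?G u v"
      unfolding tw by (simp only: mult.left_commute)
  qed
  finally show ?thesis by simp
qed

text \<open>Paired with \<open>y\<close>, each term of the square is \<Omega>(u1, q(u2), u3, y).
  With q(u2) moved to the front and the first two pieces exchanged, the two outer pieces join to a
  word \<open>v\<close>, which arises in \<open>length v + 1\<close> ways: the multiplicity found in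
  \<open>Sq_Cons\<close>.\<close>

lemma symsum_square:
  assumes h: "hw (y # w)"
  shows "symsum w (Xw L (\<lambda>z. shifted_form b (q (map snd z)) (snd y))) =
     sg (fst y) * symsum w (dec (\<lambda>u v. sg (fst y * wdeg u) * (of_nat (length v + 1) * ev \<Omega> (L u # y # v))))"
proof -
  have hz: "hw z" if "mset z = mset w" for z using h hw_mset[OF that] by simp
  let ?\<Phi> = "\<lambda>u1 u2 u3. ev \<Omega> (L u2 # u1 @ u3 @ [y])"
  have "symsum w (Xw L (\<lambda>z. shifted_form b (q (map snd z)) (snd y))) =
     symsum w (dec (\<lambda>x u3. dec (\<lambda>u1 u2. sg (wdeg u1 * wdeg u2) * ?\<Phi> u1 u2 u3) x))"
  proof (rule symsum_cong)
    fix z assume "mset z = mset w"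
    then have z: "hw z" by (rule hz)
    have "Xw L (\<lambda>z. shifted_form b (q (map snd z)) (snd y)) z = dec (\<lambda>u1 z. dec (\<lambda>u2 u3. sg (wdeg u1 * wdeg u2) * ?\<Phi> u1 u2 u3) z) z"
      unfolding Xw_def dec_mult[symmetric]
    proof (intro dec_cong)
      fix u1 z' u2 u3 assume "z = u1 @ z'" "z' = u2 @ u3"
      then have u: "hw u1" "hw u2" "hw u3" using z by auto
      have hl: "hw (L u2 # u1 @ u3 @ [y])" using u h by (simp only: hwL1) simp
      have "ev \<Omega> (L u2 # u1 @ (u3 @ [y])) = sg ((wdeg u2 + 1) * wdeg u1) * ev \<Omega> (u1 @ L u2 # (u3 @ [y]))"
        using \<Omega>_move[OF hl] by simp
      moreover have "ev \<Omega> (u1 @ L u2 # u3 @ [y]) = shifted_form b (q (map snd (u1 @ L u2 # u3))) (snd y)"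
        using \<Omega>_snoc[of "u1 @ L u2 # u3" y] by simp
      moreover have "sg (wdeg u1 * wdeg u2) * sg ((wdeg u2 + 1) * wdeg u1) = (sg (wdeg u1) :: 'k)"
        unfolding sg_add[symmetric] by (rule sg_eqI) auto
      ultimately show "sg (wdeg u1) * shifted_form b (q (map snd (u1 @ L u2 # u3))) (snd y) =
         sg (wdeg u1 * wdeg u2) * ev \<Omega> (L u2 # u1 @ u3 @ [y])"
        by (simp add: mult.assoc[symmetric])
    qed
    then show "Xw L (\<lambda>z. shifted_form b (q (map snd z)) (snd y)) z = dec (\<lambda>x u3. dec (\<lambda>u1 u2. sg (wdeg u1 * wdeg u2) * ?\<Phi> u1 u2 u3) x) z"
      by (simp only: dec_assoc)
  qed
  also have "\<dots> = symsum w (dec (\<lambda>x u3. dec (\<lambda>u1 u2. sg (wdeg u1 * wdeg u2) * (sg (wdeg u2 * wdeg u1) * ?\<Phi> u2 u1 u3)) x))"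
    by (rule symsum_dec_swap_left)
  also have "\<dots> = symsum w (dec (\<lambda>x u3. dec (\<lambda>u1 u2. ev \<Omega> (L u1 # u2 @ u3 @ [y])) x))"
    by (simp add: mult.commute)
  also have "\<dots> = symsum w (\<lambda>z. sg (fst y) * dec (\<lambda>u v. sg (fst y * wdeg u) * (of_nat (length v + 1) * ev \<Omega> (L u # y # v))) z)"
  proof (rule symsum_cong)
    fix z assume "mset z = mset w"
    then have z: "hw z" by (rule hz)
    have "dec (\<lambda>x u3. dec (\<lambda>u1 u2. ev \<Omega> (L u1 # u2 @ u3 @ [y])) x) z = dec (\<lambda>u v. dec (\<lambda>u2 u3. ev \<Omega> (L u # (u2 @ u3) @ [y])) v) z"
      by (simp add: dec_assoc)
    also have "\<dots> = dec (\<lambda>u v. of_nat (length v + 1) * ev \<Omega> (L u # v @ [y])) z"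
      by (simp only: dec_append_args[of "\<lambda>z. ev \<Omega> (L u # z @ [y])" for u])
    also have "\<dots> = dec (\<lambda>u v. sg (fst y) * (sg (fst y * wdeg u) * (of_nat (length v + 1) * ev \<Omega> (L u # y # v)))) z"
    proof (rule dec_cong)
      fix u v assume "z = u @ v"
      then have uv: "hw u" "hw v" using z by auto
      have hl: "hw (L u # y # v)" using uv h by (simp only: hwL1) simp
      have "ev \<Omega> ([L u] @ y # v @ []) = sg (fst y * wdeg v) * ev \<Omega> ([L u] @ v @ y # [])"
        by (rule movable_move[OF mv\<Omega>]) (use hl in simp)
      then have "ev \<Omega> (L u # v @ [y]) = sg (fst y * wdeg v) * ev \<Omega> (L u # y # v)" by simp
      also have "\<dots> = sg (fst y + fst y * wdeg u) * ev \<Omega> (L u # y # v)"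
      proof (rule sg_cong)
        assume "ev \<Omega> (L u # y # v) \<noteq> 0"
        then have "even (1 + wdeg (L u # y # v))" by (rule deg\<Omega>[OF hl])
        then have "even (wdeg u + (fst y + wdeg v))" by simp
        then show "even (fst y * wdeg v + (fst y + fst y * wdeg u))" by auto
      qed
      finally show "of_nat (length v + 1) * ev \<Omega> (L u # v @ [y]) = sg (fst y) * (sg (fst y * wdeg u) * (of_nat (length v + 1) * ev \<Omega> (L u # y # v)))"
        by (simp only: sg_add mult_ac)
    qed
    finally show "dec (\<lambda>x u3. dec (\<lambda>u1 u2. ev \<Omega> (L u1 # u2 @ u3 @ [y])) x) z =
      sg (fst y) * dec (\<lambda>u v. sg (fst y * wdeg u) * (of_nat (length v + 1) * ev \<Omega> (L u # y # v))) z"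
      by (simp only: dec_mult)
  qed
  finally show ?thesis by (simp only: symsum_mult)
qed

text \<open>Every functional has the form B(., y), and the homogeneous components of
  \<open>y\<close> can serve as the first letter in \<open>Sq_Cons\<close>; the factor 2 is
  invertible. The empty word is separate, as \<Omega> vanishes on single vectors.\<close>

lemma Sq_iff_square: "(\<forall>w. hw w \<longrightarrow> Sq \<Omega> w = 0) \<longleftrightarrow> vanishing_square q"
proof
  assume S: "\<forall>w. hw w \<longrightarrow> Sq \<Omega> w = 0"
  show "vanishing_square q"
    unfolding vanishing_square_def
  proof (intro allI impI)
    fix \<phi> w assume "Vector_Spaces.linear scale (*) \<phi> \<and> hw w"
    then have \<phi>: "Vector_Spaces.linear scale (*) \<phi>" and w: "hw w" by auto
    obtain y where y: "\<And>x. \<phi> x = shifted_form b x y" by (rule linear_is_shifted[OF \<phi>]) (rule that)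
    have 0: "symsum w (Xw L (\<lambda>z. shifted_form b (q (map snd z)) (hcomp (d + 1) y))) = 0" for d
    proof -
      have "hw ((d, hcomp (d + 1) y) # w)" using w by simp
      then have "2 * symsum w (dec (\<lambda>u v. sg (d * wdeg u) * (of_nat (length v + 1) * ev \<Omega> (L u # (d, hcomp (d + 1) y) # v)))) = 0"
        using Sq_Cons[of "(d, hcomp (d + 1) y)" w] S by simp
      then show ?thesis
        using symsum_square[of "(d, hcomp (d + 1) y)" w] w by simp
    qed
    have "(\<lambda>z :: (int \<times> 'v) list. \<phi> (q (map snd z))) = (\<lambda>z. \<Sum>d\<in>degs. shifted_form b (q (map snd z)) (hcomp (d + 1) y))"
    proof
      fix z :: "(int \<times> 'v) list"
      have "\<phi> (q (map snd z)) = shifted_form b (q (map snd z)) (\<Sum>d\<in>degs. 1 *s hcomp (d + 1) y)"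
        by (simp add: y hcomp_degs)
      also have "\<dots> = (\<Sum>d\<in>degs. 1 * shifted_form b (q (map snd z)) (hcomp (d + 1) y))"
        by (rule linear_sum_scale[OF shifted_linear(2)])
      finally show "\<phi> (q (map snd z)) = (\<Sum>d\<in>degs. shifted_form b (q (map snd z)) (hcomp (d + 1) y))" by simp
    qed
    then have "Xw L (\<lambda>z. \<phi> (q (map snd z))) = (\<lambda>w. \<Sum>d\<in>degs. Xw L (\<lambda>z. shifted_form b (q (map snd z)) (hcomp (d + 1) y)) w)"
      by (simp only: Xw_sum)
    then show "symsum w (Xw L (\<lambda>z. \<phi> (q (map snd z)))) = 0" by (simp add: symsum_sum 0)
  qed
next
  assume Q: "vanishing_square q"
  show "\<forall>w. hw w \<longrightarrow> Sq \<Omega> w = 0"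
  proof (intro allI impI)
    fix w :: "(int \<times> 'v) list" assume w: "hw w"
    show "Sq \<Omega> w = 0"
    proof (cases w)
      case Nil
      have "\<Omega> [x] = 0" for x using \<Omega>q by (simp add: form_of_maps_def)
      then show ?thesis by (simp add: Sq_def ctr_def Nil ev_def)
    next
      case (Cons y z)
      have "symsum z (Xw L (\<lambda>z. shifted_form b (q (map snd z)) (snd y))) = 0"
        using Q[unfolded vanishing_square_def, rule_format, of "\<lambda>x. shifted_form b x (snd y)" z] shifted_linear(1) w Cons by simp
      then have "symsum z (dec (\<lambda>u v. sg (fst y * wdeg u) * (of_nat (length v + 1) * ev \<Omega> (L u # y # v)))) = 0"
        using symsum_square[of y z] w Cons by simp
      then show ?thesis using Sq_Cons[of y z] w Cons by simp
    qed
  qed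
qed

end

lemma mform_by_length: "(\<And>n. mform (H n)) \<Longrightarrow> mform (\<lambda>xs. H (length xs) xs)"
  by (rule mformI) (simp_all add: mform_addD mform_scaleD)

text \<open>A cut fixes the arities of the two factors, so summing over the pairs of components just
  removes the restriction to components.\<close>

lemma comp_arity_brk_sum:
  assumes m: "cyclic \<Omega>" and w: "hw w"
  shows "ev (formal_bracket brk \<Omega> \<Omega>) w = rot (ctr (ev \<Omega>) (ev \<Omega>)) w"
proof -
  let ?n = "length w"
  let ?c = "\<lambda>k. comp_arity k \<Omega>"
  have c: "?c k \<in> cyc_all" for k using cyc_comp_arity[OF m] cyc_subset by blast
  have "ev (formal_bracket brk \<Omega> \<Omega>) w = (\<Sum>k\<le>?n. ev (brk (?c (k + 1)) (?c (?n - k + 1))) w)"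
    by (simp add: ev_def formal_bracket_def)
  also have "\<dots> = rot (\<lambda>z. \<Sum>k\<le>?n. ctr (ev (?c (k + 1))) (ev (?c (?n - k + 1))) z) w"
    by (simp add: ev_brk[OF c c w] rot_sum)
  also have "\<dots> = rot (ctr (ev \<Omega>) (ev \<Omega>)) w"
  proof (rule rot_cong_hw[OF _ w])
    fix z :: "(int \<times> 'v) list" assume len: "length z = length w"
    have "(\<Sum>k\<le>?n. ctr (ev (?c (k + 1))) (ev (?c (?n - k + 1))) z) =
      dec (\<lambda>u v. \<Sum>k\<le>?n. \<Sum>i<N. sg ((\<epsilon> i + wdeg v) * (\<epsilon> i + wdeg u) + \<epsilon> i * wdeg u) *
        (ev (?c (k + 1)) (E i # u) * ev (?c (?n - k + 1)) (E' i # v))) z"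
      by (simp add: ctr_def dec_sum)
    also have "\<dots> = ctr (ev \<Omega>) (ev \<Omega>) z"
      unfolding ctr_def
    proof (rule dec_cong)
      fix u v assume uv: "z = u @ v"
      have lw: "length w = length u + length v" using len uv by simp
      have "(\<Sum>k\<le>?n. \<Sum>i<N. sg ((\<epsilon> i + wdeg v) * (\<epsilon> i + wdeg u) + \<epsilon> i * wdeg u) *
          (ev (?c (k + 1)) (E i # u) * ev (?c (?n - k + 1)) (E' i # v))) =
        (\<Sum>k\<le>?n. if k = length u then \<Sum>i<N. sg ((\<epsilon> i + wdeg v) * (\<epsilon> i + wdeg u) + \<epsilon> i * wdeg u) *
          (ev \<Omega> (E i # u) * ev \<Omega> (E' i # v)) else 0)"
        unfolding lw by (intro sum.cong refl) (auto simp: ev_def comp_arity_def)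
      then show "(\<Sum>k\<le>?n. \<Sum>i<N. sg ((\<epsilon> i + wdeg v) * (\<epsilon> i + wdeg u) + \<epsilon> i * wdeg u) *
          (ev (?c (k + 1)) (E i # u) * ev (?c (?n - k + 1)) (E' i # v))) =
        (\<Sum>i<N. sg ((\<epsilon> i + wdeg v) * (\<epsilon> i + wdeg u) + \<epsilon> i * wdeg u) * (ev \<Omega> (E i # u) * ev \<Omega> (E' i # v)))"
        using len uv by simp
    qed
    finally show "(\<Sum>k\<le>?n. ctr (ev (?c (k + 1))) (ev (?c (?n - k + 1))) z) = ctr (ev \<Omega>) (ev \<Omega>) z" .
  qed
  finally show ?thesis .
qed

lemma has_degree_comp_arity: "has_degree d \<Omega> \<Longrightarrow> has_degree d (comp_arity k \<Omega>)"
  unfolding has_degree_def comp_arity_def by auto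

text \<open>Here the given bracket is replaced by the contraction bracket, arity by arity and only
  after symmetrisation (\<open>symsum_bracket\<close>), which is all that agreement on linear forms
  provides.\<close>

lemma Sym_formal_bracket_iff:
  assumes br: "pinczon_bracket br" "contracts br b 0 0" and \<Omega>: "symmetric \<Omega>" "has_degree 3 \<Omega>"
  shows "Sym (formal_bracket br \<Omega> \<Omega>) = 0 \<longleftrightarrow> (\<forall>w. hw w \<longrightarrow> Sq \<Omega> w = 0)"
proof -
  have cyc: "cyclic \<Omega>" by (rule symmetric_cyclic[OF \<Omega>(1)])
  let ?c = "\<lambda>k. comp_arity k \<Omega>"
  have c: "?c k \<in> cyc k" "has_degree 3 (?c k)" for k
    using cyc_comp_arity[OF cyc] has_degree_comp_arity[OF \<Omega>(2)] by auto
  have B: "br (?c (k + 1)) (?c (k' + 1)) \<in> cyc (k + k')" for k k'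
    by (rule pinczon_bracketD(5)[OF br(1) c(1) c(1)])
  have m: "mform (formal_bracket br \<Omega> \<Omega>)"
    unfolding formal_bracket_def
    by (rule mform_by_length[of "\<lambda>n xs. \<Sum>k\<le>n. br (?c (k + 1)) (?c (n - k + 1)) xs"])
       (intro mform_sum cyc_all_mform[OF cyc_subset[OF B]])
  have mb: "mform (formal_bracket brk \<Omega> \<Omega>)"
    unfolding formal_bracket_def
    by (rule mform_by_length[of "\<lambda>n xs. \<Sum>k\<le>n. brk (?c (k + 1)) (?c (n - k + 1)) xs"])
       (intro mform_sum mform_brk)
  have fb: "symsum w (ev (formal_bracket B \<Omega> \<Omega>)) = (\<Sum>k\<le>length w. symsum w (ev (B (?c (k + 1)) (?c (length w - k + 1)))))" for B w
  proof -
    have "symsum w (ev (formal_bracket B \<Omega> \<Omega>)) = symsum w (\<lambda>z. \<Sum>k\<le>length w. ev (B (?c (k + 1)) (?c (length w - k + 1))) z)"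
    proof (rule symsum_cong)
      fix z assume "mset z = mset w"
      then have "length z = length w" by (rule mset_eq_length)
      then show "ev (formal_bracket B \<Omega> \<Omega>) z = (\<Sum>k\<le>length w. ev (B (?c (k + 1)) (?c (length w - k + 1))) z)"
        by (simp add: ev_def formal_bracket_def)
    qed
    then show ?thesis by (simp only: symsum_sum)
  qed
  have S: "ev (Sym (formal_bracket br \<Omega> \<Omega>)) w = of_nat (max 1 (length w)) * Sq \<Omega> w" if w: "hw w" for w
  proof -
    have "ev (Sym (formal_bracket br \<Omega> \<Omega>)) w = symsum w (ev (formal_bracket br \<Omega> \<Omega>))"
      by (rule ev_Sym[OF m w])
    also have "\<dots> = symsum w (ev (formal_bracket brk \<Omega> \<Omega>))"
      unfolding fb by (intro sum.cong refl symsum_bracket[OF br c(1) c(1) c(2) c(2) w])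
    also have "\<dots> = symsum w (rot (ctr (ev \<Omega>) (ev \<Omega>)))"
      by (rule symsum_cong) (use w hw_mset comp_arity_brk_sum[OF cyc] in blast)
    finally show ?thesis by (simp only: symsum_rot Sq_def)
  qed
  show ?thesis
  proof
    assume 0: "Sym (formal_bracket br \<Omega> \<Omega>) = 0"
    show "\<forall>w. hw w \<longrightarrow> Sq \<Omega> w = 0"
    proof (intro allI impI)
      fix w :: "(int \<times> 'v) list" assume "hw w"
      then have "of_nat (max 1 (length w)) * Sq \<Omega> w = 0" using S 0 by (simp add: ev_def)
      moreover have "of_nat (max 1 (length w)) \<noteq> (0 :: 'k)" by simp
      ultimately show "Sq \<Omega> w = 0" by (metis mult_eq_0_iff)
    qed
  next
    assume 0: "\<forall>w. hw w \<longrightarrow> Sq \<Omega> w = 0"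
    show "Sym (formal_bracket br \<Omega> \<Omega>) = 0"
      by (rule ext, rule mform_eqI[OF mform_Sym[OF m]]) (use 0 S in \<open>auto simp: ev_def\<close>)
  qed
qed

end

section \<open>Word coderivations and reduced cuts\<close>

lemma Xw_cong:
  assumes "\<And>u1 u2 u3. w = u1 @ u2 @ u3 \<Longrightarrow> f (u1 @ L u2 # u3) = g (u1 @ L u2 # u3)"
  shows "Xw L f w = Xw L g w"
  unfolding Xw_def by (intro dec_cong arg_cong[of _ _ "(*) _"]) (simp add: assms)

lemma Xw_add: "Xw L (\<lambda>z. f z + g z) w = Xw L f w + Xw L g w"
  by (simp add: Xw_def dec_add distrib_left)

lemma Xw_mult: "Xw L (\<lambda>z. c * f z) w = c * Xw L f w"
  by (simp add: Xw_def dec_mult[symmetric] mult.left_commute)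

lemma Xw_0: "Xw L (\<lambda>z. 0) w = 0"
  by (simp add: Xw_def)

lemma Xw_dec_args: "Xw L (\<lambda>x. dec (\<lambda>u v. F x u v) z) w = dec (\<lambda>u v. Xw L (\<lambda>x. F x u v) w) z"
  unfolding dec_conv[of _ z] by (simp only: Xw_sum)

lemma Xw_symsum: "Xw L (\<lambda>x. symsum z (F x)) w = symsum z (\<lambda>y. Xw L (\<lambda>x. F x y) w)"
  unfolding sum_permutes[symmetric] by (simp only: Xw_sum Xw_mult)

text \<open>The two words are separate arguments, so each operation sees only the signs of its own
  prefix and the order does not matter. The sign between them is introduced by
  \<open>DX\<close>.\<close>

lemma Xw_Xw_swap: "Xw L (\<lambda>x. Xw L (g x) v) u = Xw L (\<lambda>y. Xw L (\<lambda>x. g x y) u) v"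
proof -
  have "Xw L (\<lambda>x. Xw L (g x) v) u =
      Xw L (\<lambda>x. dec (\<lambda>v1 z. sg (wdeg v1) * dec (\<lambda>v2 v3. g x (v1 @ L v2 # v3)) z) v) u"
    by (simp only: Xw_def[of L "g _"])
  also have "\<dots> = dec (\<lambda>v1 z. sg (wdeg v1) * dec (\<lambda>v2 v3. Xw L (\<lambda>x. g x (v1 @ L v2 # v3)) u) z) v"
    by (simp only: Xw_dec_args Xw_mult)
  finally show ?thesis by (simp only: Xw_def[of L "\<lambda>y. Xw L (\<lambda>x. g x y) u"])
qed

text \<open>The coderivation property on the tensor coalgebra: the replaced factor lies in the left
  piece, or in the right piece after the odd operation has passed the left one.\<close>

lemma Xw_dec: "Xw L (dec \<psi>) w = dec (\<lambda>u v. Xw L (\<lambda>x. \<psi> x v) u + sg (wdeg u) * Xw L (\<psi> u) v) w"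
proof -
  let ?A = "\<lambda>u1 u2 u3. dec (\<lambda>y1 y2. \<psi> y1 (y2 @ L u2 # u3)) u1"
  let ?B = "\<lambda>u1 u2 u3. dec (\<lambda>x1 x2. \<psi> (u1 @ L u2 # x1) x2) u3"
  have "Xw L (dec \<psi>) w = dec (\<lambda>u1 z. sg (wdeg u1) * dec (\<lambda>u2 u3. ?A u1 u2 u3) z) w +
      dec (\<lambda>u1 z. sg (wdeg u1) * dec (\<lambda>u2 u3. ?B u1 u2 u3) z) w"
    by (simp add: Xw_def dec_append dec_add distrib_left)
  also have "dec (\<lambda>u1 z. sg (wdeg u1) * dec (\<lambda>u2 u3. ?B u1 u2 u3) z) w = dec (\<lambda>u v. Xw L (\<lambda>x. \<psi> x v) u) w"
    by (simp only: Xw_def dec_assoc dec_mult)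
  also have "dec (\<lambda>u1 z. sg (wdeg u1) * dec (\<lambda>u2 u3. ?A u1 u2 u3) z) w =
      dec (\<lambda>u1 z. dec (\<lambda>y1 y2. sg (wdeg y1) * (sg (wdeg y2) * dec (\<lambda>u2 u3. \<psi> y1 (y2 @ L u2 # u3)) z)) u1) w"
  proof (rule dec_cong)
    fix u1 z
    have "sg (wdeg u1) * dec (\<lambda>u2 u3. ?A u1 u2 u3) z = dec (\<lambda>y1 y2. sg (wdeg u1) * dec (\<lambda>u2 u3. \<psi> y1 (y2 @ L u2 # u3)) z) u1"
      unfolding dec_dec_swap[of "\<lambda>u2 u3 y1 y2. \<psi> y1 (y2 @ L u2 # u3)" u1 z] dec_mult ..
    also have "\<dots> = dec (\<lambda>y1 y2. sg (wdeg y1) * (sg (wdeg y2) * dec (\<lambda>u2 u3. \<psi> y1 (y2 @ L u2 # u3)) z)) u1"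
      by (rule dec_cong) (simp add: sg_add mult.assoc)
    finally show "sg (wdeg u1) * dec (\<lambda>u2 u3. ?A u1 u2 u3) z =
      dec (\<lambda>y1 y2. sg (wdeg y1) * (sg (wdeg y2) * dec (\<lambda>u2 u3. \<psi> y1 (y2 @ L u2 # u3)) z)) u1" .
  qed
  also have "\<dots> = dec (\<lambda>u v. sg (wdeg u) * Xw L (\<psi> u) v) w"
    by (simp only: dec_assoc dec_mult Xw_def)
  finally show ?thesis by (simp only: dec_add add.commute)
qed

text \<open>Restricts cuts to two nonempty pieces, since the coproduct in question is the reduced
  one.\<close>

definition nonempty2 :: "('a list \<Rightarrow> 'b list \<Rightarrow> 'k) \<Rightarrow> 'a list \<Rightarrow> 'b list \<Rightarrow> 'k::zero" where
  "nonempty2 g u v = (if u = [] \<or> v = [] then 0 else g u v)"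

lemma wdeg_nths: "wdeg (nths w I) + wdeg (nths w (- I)) = wdeg w"
proof (induction w arbitrary: I)
  case (Cons a w)
  have "{j. Suc j \<in> - I} = - {j. Suc j \<in> I}" by auto
  then show ?case using Cons[of "{j. Suc j \<in> I}"] by (simp add: wdeg_nths_Cons)
qed simp

lemma nths_empty_iff: "nths w I = [] \<longleftrightarrow> I \<inter> {..<length w} = {}"
  using set_nths[of w I] by (auto simp: set_empty[symmetric] simp del: set_empty)

text \<open>In \<open>symsum_dec\<close> the empty and the full subset give an empty piece; removing
  them leaves exactly the index set of the coproduct.\<close>

lemma symsum_dec_nonempty:
  "symsum w (dec (nonempty2 g)) = (\<Sum>I | I \<noteq> {} \<and> I \<subset> {..<length w}.
     usign (map fst w) I * symsum (nths w I) (\<lambda>u. symsum (nths w (- I)) (g u)))"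
  unfolding symsum_dec
proof (rule sum.mono_neutral_cong_right)
  show "\<forall>I\<in>Pow {..<length w} - {I. I \<noteq> {} \<and> I \<subset> {..<length w}}.
    usign (map fst w) I * symsum (nths w I) (\<lambda>u. symsum (nths w (- I)) (nonempty2 g u)) = 0"
  proof
    fix I assume "I \<in> Pow {..<length w} - {I. I \<noteq> {} \<and> I \<subset> {..<length w}}"
    then have "I = {} \<or> I = {..<length w}" by auto
    then have "nths w I = [] \<or> nths w (- I) = []" by (auto simp: nths_empty_iff)
    then show "usign (map fst w) I * symsum (nths w I) (\<lambda>u. symsum (nths w (- I)) (nonempty2 g u)) = 0"
      by (auto simp: nonempty2_def[abs_def])
  qed
next
  fix I assume "I \<in> {I. I \<noteq> {} \<and> I \<subset> {..<length w}}"
  then have ne: "nths w I \<noteq> []" "nths w (- I) \<noteq> []" by (auto simp: nths_empty_iff)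
  have "symsum (nths w I) (\<lambda>u. symsum (nths w (- I)) (nonempty2 g u)) = symsum (nths w I) (\<lambda>u. symsum (nths w (- I)) (g u))"
  proof (rule symsum_cong, rule symsum_cong)
    fix u v assume "mset u = mset (nths w I)" "mset v = mset (nths w (- I))"
    then have "u \<noteq> []" "v \<noteq> []" using ne by auto
    then show "nonempty2 g u v = g u v" by (simp add: nonempty2_def)
  qed
  then show "usign (map fst w) I * symsum (nths w I) (\<lambda>u. symsum (nths w (- I)) (nonempty2 g u)) =
    usign (map fst w) I * symsum (nths w I) (\<lambda>u. symsum (nths w (- I)) (g u))" by simp
qed auto

context fd_graded_space
begin

subsection \<open>Spans of functions\<close>

lemma vector_space_fscale: "vector_space (fscale :: 'k \<Rightarrow> ('x \<Rightarrow> 'k) \<Rightarrow> 'x \<Rightarrow> 'k)"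
  by unfold_locales (auto simp: fscale_def algebra_simps)

lemma fspan_base: "t \<in> S \<Longrightarrow> t \<in> fspan S"
  and fspan_add: "t \<in> fspan S \<Longrightarrow> u \<in> fspan S \<Longrightarrow> t + u \<in> fspan S"
  and fspan_fscale: "t \<in> fspan S \<Longrightarrow> fscale c t \<in> fspan S"
  and fspan_sum: "(\<And>i. i \<in> A \<Longrightarrow> f i \<in> fspan S) \<Longrightarrow> (\<Sum>i\<in>A. f i) \<in> fspan S"
  and fspan_mono: "S \<subseteq> S' \<Longrightarrow> fspan S \<subseteq> fspan S'"
  for S :: "('x \<Rightarrow> 'k) set"
proof -
  interpret fs: vector_space "fscale :: 'k \<Rightarrow> ('x \<Rightarrow> 'k) \<Rightarrow> 'x \<Rightarrow> 'k" by (rule vector_space_fscale)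
  show "t \<in> S \<Longrightarrow> t \<in> fspan S" "t \<in> fspan S \<Longrightarrow> u \<in> fspan S \<Longrightarrow> t + u \<in> fspan S"
    "t \<in> fspan S \<Longrightarrow> fscale c t \<in> fspan S" "(\<And>i. i \<in> A \<Longrightarrow> f i \<in> fspan S) \<Longrightarrow> (\<Sum>i\<in>A. f i) \<in> fspan S"
    "S \<subseteq> S' \<Longrightarrow> fspan S \<subseteq> fspan S'"
    unfolding fspan_def
    by (auto intro: fs.span_base fs.span_add fs.span_scale fs.span_sum dest: fs.span_mono)
qed

lemma fspan_induct:
  fixes S :: "('x \<Rightarrow> 'k) set"
  assumes "t \<in> fspan S" "\<And>s. s \<in> S \<Longrightarrow> P s" "P 0"
    "\<And>t u. P t \<Longrightarrow> P u \<Longrightarrow> P (t + u)" "\<And>c t. P t \<Longrightarrow> P (fscale c t)"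
  shows "P t"
proof -
  interpret fs: vector_space "fscale :: 'k \<Rightarrow> ('x \<Rightarrow> 'k) \<Rightarrow> 'x \<Rightarrow> 'k" by (rule vector_space_fscale)
  have "fs.subspace {t. P t}" by (rule fs.subspaceI) (use assms in auto)
  then show ?thesis using fs.span_minimal[of S "{t. P t}"] assms(1,2) unfolding fspan_def by blast
qed


subsection \<open>The explicit coproduct and coderivation\<close>

definition sp :: "(int \<times> 'v) list \<Rightarrow> ('v, 'k) tensor" where
  "sp w = sprod (map fst w) (map snd w)"

lemma sp_eval: "sp w F = (if mform F then symsum w (ev F) else 0)"
proof -
  have "sp w F = (\<Sum>\<sigma> | \<sigma> permutes {..<length w}. ksign (map fst w) \<sigma> * pure (permute_list \<sigma> (map snd w)) F)"
    by (simp add: sp_def sprod_def sum_apply fscale_def)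
  also have "\<dots> = (if mform F then \<Sum>\<sigma> | \<sigma> permutes {..<length w}. ksign (map fst w) \<sigma> * ev F (permute_list \<sigma> w) else 0)"
    by (auto simp: pure_def ev_def permute_list_map intro!: sum.cong)
  finally show ?thesis by (simp add: sum_permutes)
qed

lemma Splus_sp: "hw w \<Longrightarrow> w \<noteq> [] \<Longrightarrow> sp w \<in> Splus"
  and Splus_deg_sp: "hw w \<Longrightarrow> w \<noteq> [] \<Longrightarrow> sp w \<in> Splus_deg (wdeg w)"
proof -
  assume w: "hw w" "w \<noteq> []"
  then have "homog (map fst w) (map snd w) \<and> map snd w \<noteq> []" by simp
  then show "sp w \<in> Splus" "sp w \<in> Splus_deg (wdeg w)"
    unfolding Splus_def Splus_deg_def sp_def wdeg_def by (blast intro: fspan_base)+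
qed

lemma Splus_induct [consumes 1, case_names sp zero add scale]:
  assumes "t \<in> Splus" "\<And>w. hw w \<Longrightarrow> w \<noteq> [] \<Longrightarrow> P (sp w)" "P 0"
    "\<And>t u. P t \<Longrightarrow> P u \<Longrightarrow> P (t + u)" "\<And>c t. P t \<Longrightarrow> P (fscale c t)"
  shows "P t"
  using assms(1) unfolding Splus_def
proof (rule fspan_induct)
  fix s assume "s \<in> {sprod ds xs |ds xs. homog ds xs \<and> xs \<noteq> []}"
  then obtain ds xs where "s = sprod ds xs" "homog ds xs" "xs \<noteq> []" by blast
  then obtain w where "hw w" "s = sp w" "w \<noteq> []" using homogE[of ds xs] by (metis list.map_disc_iff sp_def)
  then show "P s" using assms(2) by blast
qed (fact assms)+

lemma Splus_deg_induct:
  assumes "t \<in> Splus_deg d" "\<And>w. hw w \<Longrightarrow> w \<noteq> [] \<Longrightarrow> wdeg w = d \<Longrightarrow> P (sp w)" "P 0"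
    "\<And>t u. P t \<Longrightarrow> P u \<Longrightarrow> P (t + u)" "\<And>c t. P t \<Longrightarrow> P (fscale c t)"
  shows "P t"
  using assms(1) unfolding Splus_deg_def
proof (rule fspan_induct)
  fix s assume "s \<in> {sprod ds xs |ds xs. homog ds xs \<and> xs \<noteq> [] \<and> sum_list ds = d}"
  then obtain ds xs where "s = sprod ds xs" "homog ds xs" "xs \<noteq> []" "sum_list ds = d" by blast
  then obtain w where "hw w" "s = sp w" "w \<noteq> []" "wdeg w = d"
    using homogE[of ds xs] by (metis list.map_disc_iff sp_def wdeg_def)
  then show "P s" using assms(2) by blast
qed (fact assms)+

lemma Splus_deg_subset: "Splus_deg d \<subseteq> Splus"
  unfolding Splus_def Splus_deg_def by (rule fspan_mono) blast

lemma Splus_add: "t \<in> Splus \<Longrightarrow> u \<in> Splus \<Longrightarrow> t + u \<in> Splus"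
  and Splus_fscale: "t \<in> Splus \<Longrightarrow> fscale c t \<in> Splus"
  by (simp_all add: Splus_def fspan_add fspan_fscale)

lemma mform_split:
  assumes "\<And>ys. mform (\<lambda>xs. H xs ys)" "\<And>xs. mform (H xs)"
  shows "mform (\<lambda>zs. H (take r zs) (drop r zs))"
proof (rule mformI)
  fix u v :: "'v list" and x y c
  show "H (take r (u @ (x + y) # v)) (drop r (u @ (x + y) # v)) =
      H (take r (u @ x # v)) (drop r (u @ x # v)) + H (take r (u @ y # v)) (drop r (u @ y # v))"
    using assms by (cases "r \<le> length u") (auto simp: take_Cons' drop_Cons' mform_addD mform_addD[OF assms(1)])
  show "H (take r (u @ (c *s x) # v)) (drop r (u @ (c *s x) # v)) = c * H (take r (u @ x # v)) (drop r (u @ x # v))"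
    using assms by (cases "r \<le> length u") (auto simp: take_Cons' drop_Cons' mform_scaleD mform_scaleD[OF assms(1)])
qed

lemma mform_symsum: "(\<And>v. mform (\<lambda>xs. H xs v)) \<Longrightarrow> mform (\<lambda>xs. symsum w (H xs))"
  unfolding sum_permutes[symmetric] by (intro mform_sum mform_mult)

lemma mform_Xw: "(\<And>v. mform (\<lambda>xs. H xs v)) \<Longrightarrow> mform (\<lambda>xs. Xw L (H xs) v)"
  unfolding Xw_def dec_conv by (intro mform_sum mform_mult)

definition bim :: "('v list \<Rightarrow> 'v list \<Rightarrow> 'k) \<Rightarrow> bool" where
  "bim G \<longleftrightarrow> (\<forall>xs. mform (G xs)) \<and> (\<forall>ys. mform (\<lambda>xs. G xs ys))"

definition evb :: "('v list \<Rightarrow> 'v list \<Rightarrow> 'k) \<Rightarrow> (int \<times> 'v) list \<Rightarrow> (int \<times> 'v) list \<Rightarrow> 'k" where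
  "evb G u v = G (map snd u) (map snd v)"

text \<open>Joins a function of two lists into one form by summing over all cuts, the operation on
  forms dual to deconcatenation of tensors.\<close>

definition decf :: "('v list \<Rightarrow> 'v list \<Rightarrow> 'k) \<Rightarrow> ('v, 'k) form" where
  "decf G = (\<lambda>zs. \<Sum>r\<le>length zs. G (take r zs) (drop r zs))"

text \<open>The transpose of cutting: a tensor is a functional on forms, so its coproduct is
  evaluated by composing with \<open>decf\<close>. No choice of a representation as a sum of
  products is involved.\<close>

definition Delta :: "('v, 'k) tensor \<Rightarrow> ('v, 'k) tensor2" where
  "Delta t G = (if bim G then t (decf (nonempty2 G)) else 0)"

lemma bim_nonempty2: "bim G \<Longrightarrow> bim (nonempty2 G)"
proof -
  assume G: "bim G"
  have "mform (nonempty2 G xs)" for xs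
  proof -
    have "mform (\<lambda>ys. if length ys \<noteq> 0 \<and> xs \<noteq> [] then G xs ys else 0)"
      using G mform_if_length[of "G xs" "\<lambda>n. n \<noteq> 0 \<and> xs \<noteq> []"] by (simp add: bim_def)
    moreover have "nonempty2 G xs = (\<lambda>ys. if length ys \<noteq> 0 \<and> xs \<noteq> [] then G xs ys else 0)"
      by (auto simp: nonempty2_def)
    ultimately show ?thesis by (simp only:)
  qed
  moreover have "mform (\<lambda>xs. nonempty2 G xs ys)" for ys
  proof -
    have "mform (\<lambda>xs. if length xs \<noteq> 0 \<and> ys \<noteq> [] then G xs ys else 0)"
      using G mform_if_length[of "\<lambda>xs. G xs ys" "\<lambda>n. n \<noteq> 0 \<and> ys \<noteq> []"] by (simp add: bim_def)
    moreover have "(\<lambda>xs. nonempty2 G xs ys) = (\<lambda>xs. if length xs \<noteq> 0 \<and> ys \<noteq> [] then G xs ys else 0)"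
      by (auto simp: nonempty2_def)
    ultimately show ?thesis by (simp only:)
  qed
  ultimately show ?thesis by (simp add: bim_def)
qed

lemma mform_decf: "bim G \<Longrightarrow> mform (decf G)"
  unfolding decf_def
  by (rule mform_sum_length[of "\<lambda>n. {..n}" "\<lambda>r zs. G (take r zs) (drop r zs)"]) (auto simp: bim_def intro!: mform_split)

lemma ev_decf: "ev (decf (nonempty2 G)) = dec (nonempty2 (evb G))"
  by (rule ext) (auto simp: ev_def decf_def dec_conv nonempty2_def evb_def take_map drop_map intro!: sum.cong)

lemma mform_sp: "bim G \<Longrightarrow> mform (\<lambda>xs. sp w (G xs))"
  using mform_symsum[of "\<lambda>xs v. G xs (map snd v)" w] by (simp add: sp_eval bim_def ev_def[abs_def])

lemma tprod_eval:
  assumes "bim G"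
  shows "tprod t u G = t (\<lambda>xs. u (G xs))"
  using assms by (simp add: tprod_def bim_def)

lemma tprod_not_bim: "\<not> bim G \<Longrightarrow> tprod t u G = 0"
  by (auto simp: tprod_def bim_def)

lemma tprod_sp:
  assumes "bim G"
  shows "tprod (sp w1) (sp w2) G = symsum w1 (\<lambda>u. symsum w2 (evb G u))"
proof -
  have "mform (G xs)" for xs using assms by (simp add: bim_def)
  then have "ev (\<lambda>xs. sp w2 (G xs)) = (\<lambda>u. symsum w2 (evb G u))"
    by (intro ext) (simp add: ev_def[abs_def] sp_eval evb_def[abs_def])
  then show ?thesis
    unfolding tprod_eval[OF assms] using mform_sp[OF assms] by (simp add: sp_eval)
qed

lemma sp_nths: "sprod (nths (map fst w) I) (nths (map snd w) I) = sp (nths w I)"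
  by (simp add: sp_def nths_map)

lemma Delta_add: "Delta (t + u) = Delta t + Delta u" and Delta_fscale: "Delta (fscale c t) = fscale c (Delta t)"
  by (auto simp: Delta_def fscale_def)

lemma Delta_sp:
  assumes G: "bim G"
  shows "Delta (sp w) G = symsum w (dec (nonempty2 (evb G)))"
  using mform_decf[OF bim_nonempty2[OF G]] G by (simp add: Delta_def sp_eval ev_decf)

lemma coproduct_sp: "coproduct \<Delta> \<longleftrightarrow> flinear_on Splus \<Delta> \<and> (\<forall>w. hw w \<and> w \<noteq> [] \<longrightarrow>
    \<Delta> (sp w) = (\<Sum>I | I \<noteq> {} \<and> I \<subset> {..<length w}. fscale (usign (map fst w) I) (tprod (sp (nths w I)) (sp (nths w (- I))))))"
  unfolding coproduct_def
proof (intro conj_cong refl iffI allI impI)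
  fix w :: "(int \<times> 'v) list"
  assume *: "\<forall>ds xs. homog ds xs \<and> xs \<noteq> [] \<longrightarrow>
        \<Delta> (sprod ds xs) = (\<Sum>I | I \<noteq> {} \<and> I \<subset> {..<length xs}.
           fscale (usign ds I) (tprod (sprod (nths ds I) (nths xs I)) (sprod (nths ds (- I)) (nths xs (- I)))))"
    and w: "hw w \<and> w \<noteq> []"
  show "\<Delta> (sp w) = (\<Sum>I | I \<noteq> {} \<and> I \<subset> {..<length w}. fscale (usign (map fst w) I) (tprod (sp (nths w I)) (sp (nths w (- I)))))"
    using *[rule_format, of "map fst w" "map snd w"] w by (simp add: sp_nths flip: sp_def)
next
  fix ds xs
  assume *: "\<forall>w. hw w \<and> w \<noteq> [] \<longrightarrow>
    \<Delta> (sp w) = (\<Sum>I | I \<noteq> {} \<and> I \<subset> {..<length w}. fscale (usign (map fst w) I) (tprod (sp (nths w I)) (sp (nths w (- I)))))"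
    and h: "homog ds xs \<and> xs \<noteq> []"
  obtain w where w: "hw w" "ds = map fst w" "xs = map snd w" using h homogE by metis
  then show "\<Delta> (sprod ds xs) = (\<Sum>I | I \<noteq> {} \<and> I \<subset> {..<length xs}.
           fscale (usign ds I) (tprod (sprod (nths ds I) (nths xs I)) (sprod (nths ds (- I)) (nths xs (- I)))))"
    using *[rule_format, of w] h by (simp add: sp_nths flip: sp_def)
qed

lemma coproduct_Delta: "coproduct Delta"
  unfolding coproduct_sp
proof (intro conjI allI impI)
  show "flinear_on Splus Delta" by (simp add: flinear_on_def Delta_add Delta_fscale)
  fix w :: "(int \<times> 'v) list"
  show "Delta (sp w) = (\<Sum>I | I \<noteq> {} \<and> I \<subset> {..<length w}. fscale (usign (map fst w) I) (tprod (sp (nths w I)) (sp (nths w (- I)))))"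
  proof
    fix G
    show "Delta (sp w) G = (\<Sum>I | I \<noteq> {} \<and> I \<subset> {..<length w}. fscale (usign (map fst w) I) (tprod (sp (nths w I)) (sp (nths w (- I))))) G"
    proof (cases "bim G")
      case True
      then show ?thesis by (simp add: Delta_sp symsum_dec_nonempty sum_apply fscale_def tprod_sp)
    next
      case False
      then show ?thesis by (simp add: sum_apply fscale_def tprod_not_bim) (simp add: Delta_def)
    qed
  qed
qed

lemma coderivation1_sp: "coderivation1 \<Delta> D \<longleftrightarrow> flinear_on Splus D \<and> (\<forall>d. \<forall>t\<in>Splus_deg d. D t \<in> Splus_deg (d + 1)) \<and>
   (\<forall>w. hw w \<and> w \<noteq> [] \<longrightarrow> \<Delta> (D (sp w)) = (\<Sum>I | I \<noteq> {} \<and> I \<subset> {..<length w}. fscale (usign (map fst w) I)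
      (tprod (D (sp (nths w I))) (sp (nths w (- I))) + fscale (sg (wdeg (nths w I))) (tprod (sp (nths w I)) (D (sp (nths w (- I))))))))"
  unfolding coderivation1_def Let_def
proof (intro conj_cong refl iffI allI impI)
  fix w :: "(int \<times> 'v) list"
  assume *: "\<forall>ds xs. homog ds xs \<and> xs \<noteq> [] \<longrightarrow>
        \<Delta> (D (sprod ds xs)) = (\<Sum>I | I \<noteq> {} \<and> I \<subset> {..<length xs}.
            fscale (usign ds I) (tprod (D (sprod (nths ds I) (nths xs I))) (sprod (nths ds (- I)) (nths xs (- I))) +
              fscale (sg (sum_list (nths ds I))) (tprod (sprod (nths ds I) (nths xs I)) (D (sprod (nths ds (- I)) (nths xs (- I)))))))"
    and w: "hw w \<and> w \<noteq> []"
  show "\<Delta> (D (sp w)) = (\<Sum>I | I \<noteq> {} \<and> I \<subset> {..<length w}. fscale (usign (map fst w) I)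
      (tprod (D (sp (nths w I))) (sp (nths w (- I))) + fscale (sg (wdeg (nths w I))) (tprod (sp (nths w I)) (D (sp (nths w (- I)))))))"
  proof -
    have "homog (map fst w) (map snd w) \<and> map snd w \<noteq> []" using w by simp
    from *[rule_format, OF this] show ?thesis
      by (simp only: sp_nths sp_def[symmetric] wdeg_def nths_map length_map)
  qed
next
  fix ds xs
  assume *: "\<forall>w. hw w \<and> w \<noteq> [] \<longrightarrow> \<Delta> (D (sp w)) = (\<Sum>I | I \<noteq> {} \<and> I \<subset> {..<length w}. fscale (usign (map fst w) I)
      (tprod (D (sp (nths w I))) (sp (nths w (- I))) + fscale (sg (wdeg (nths w I))) (tprod (sp (nths w I)) (D (sp (nths w (- I)))))))"
    and h: "homog ds xs \<and> xs \<noteq> []"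
  obtain w where w: "hw w" "ds = map fst w" "xs = map snd w" using h homogE by metis
  then have ne: "w \<noteq> []" using h by auto
  show "\<Delta> (D (sprod ds xs)) = (\<Sum>I | I \<noteq> {} \<and> I \<subset> {..<length xs}.
            fscale (usign ds I) (tprod (D (sprod (nths ds I) (nths xs I))) (sprod (nths ds (- I)) (nths xs (- I))) +
              fscale (sg (sum_list (nths ds I))) (tprod (sprod (nths ds I) (nths xs I)) (D (sprod (nths ds (- I)) (nths xs (- I)))))))"
    using *[rule_format, OF conjI[OF w(1) ne]] w by (simp only: sp_nths sp_def[symmetric] wdeg_def nths_map length_map)
qed

lemma taylor_coeffs_sp: "taylor_coeffs D q \<longleftrightarrow> (\<forall>w. hw w \<and> w \<noteq> [] \<longrightarrow>
   (\<forall>F. mform F \<longrightarrow> D (sp w) (comp_arity 1 F) = symsum w (\<lambda>z. F [q (map snd z)])))"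
proof -
  have *: "((\<lambda>F. if mform F then D (sp w) (comp_arity 1 F) else 0) =
        pure [\<Sum>\<sigma> | \<sigma> permutes {..<length w}. ksign (map fst w) \<sigma> *s q (permute_list \<sigma> (map snd w))]) \<longleftrightarrow>
     (\<forall>F. mform F \<longrightarrow> D (sp w) (comp_arity 1 F) = symsum w (\<lambda>z. F [q (map snd z)]))" for w
  proof -
    have "F [\<Sum>\<sigma> | \<sigma> permutes {..<length w}. ksign (map fst w) \<sigma> *s q (permute_list \<sigma> (map snd w))] = symsum w (\<lambda>z. F [q (map snd z)])"
      if F: "mform F" for F
    proof -
      have "F [\<Sum>\<sigma> | \<sigma> permutes {..<length w}. ksign (map fst w) \<sigma> *s q (permute_list \<sigma> (map snd w))] =
        (\<Sum>\<sigma> | \<sigma> permutes {..<length w}. ksign (map fst w) \<sigma> * F [q (map snd (permute_list \<sigma> w))])"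
        unfolding mform_sum_Cons[OF F] mform_scaleD_Cons[OF F] by (intro sum.cong refl) (simp add: permute_list_map)
      then show ?thesis by (simp only: sum_permutes[of w "\<lambda>z. F [q (map snd z)]"])
    qed
    then show ?thesis by (auto simp: fun_eq_iff pure_def)
  qed
  show ?thesis
    unfolding taylor_coeffs_def
  proof (intro iffI allI impI)
    fix w :: "(int \<times> 'v) list" and F
    assume h: "\<forall>ds xs. homog ds xs \<and> xs \<noteq> [] \<longrightarrow> (\<lambda>F. if mform F then D (sprod ds xs) (comp_arity 1 F) else 0) =
        pure [\<Sum>\<sigma> | \<sigma> permutes {..<length xs}. ksign ds \<sigma> *s q (permute_list \<sigma> xs)]"
      and w: "hw w \<and> w \<noteq> []" and F: "mform F"
    have "(\<lambda>F. if mform F then D (sp w) (comp_arity 1 F) else 0) =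
        pure [\<Sum>\<sigma> | \<sigma> permutes {..<length w}. ksign (map fst w) \<sigma> *s q (permute_list \<sigma> (map snd w))]"
    proof -
      have "homog (map fst w) (map snd w) \<and> map snd w \<noteq> []" using w by simp
      from h[rule_format, OF this] show ?thesis by (simp only: sp_def[symmetric] length_map)
    qed
    then show "D (sp w) (comp_arity 1 F) = symsum w (\<lambda>z. F [q (map snd z)])" using * F by blast
  next
    fix ds xs
    assume h: "\<forall>w. hw w \<and> w \<noteq> [] \<longrightarrow> (\<forall>F. mform F \<longrightarrow> D (sp w) (comp_arity 1 F) = symsum w (\<lambda>z. F [q (map snd z)]))"
      and hx: "homog ds xs \<and> xs \<noteq> []"
    obtain w where w: "hw w" "ds = map fst w" "xs = map snd w" using hx homogE by metis
    then have "w \<noteq> []" using hx by auto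
    then have "(\<lambda>F. if mform F then D (sp w) (comp_arity 1 F) else 0) =
        pure [\<Sum>\<sigma> | \<sigma> permutes {..<length w}. ksign (map fst w) \<sigma> *s q (permute_list \<sigma> (map snd w))]"
      using h w(1) * by blast
    then show "(\<lambda>F. if mform F then D (sprod ds xs) (comp_arity 1 F) else 0) =
        pure [\<Sum>\<sigma> | \<sigma> permutes {..<length xs}. ksign ds \<sigma> *s q (permute_list \<sigma> xs)]"
      by (simp only: w sp_def length_map)
  qed
qed

text \<open>Primitive elements: a symmetric tensor of vanishing coproduct has arity one.\<close>

lemma Splus_zeroI:
  assumes t: "t \<in> Splus" and D: "Delta t = 0" and 1: "\<And>F. mform F \<Longrightarrow> t (comp_arity 1 F) = 0"
  shows "t = 0"
proof -
  \<comment> \<open>What distinguishes members of \<open>Splus\<close> from arbitrary functionals: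
    they are additive, vanish off multilinear forms and see only finitely many arities, none of them
    zero.\<close>
  let ?P = "\<lambda>t. (\<forall>F. \<not> mform F \<longrightarrow> t F = 0) \<and> (\<forall>F G. mform F \<longrightarrow> mform G \<longrightarrow> t (\<lambda>xs. F xs + G xs) = t F + t G) \<and>
     (\<exists>n. \<forall>F. mform F \<longrightarrow> (\<forall>xs. xs \<noteq> [] \<and> length xs \<le> n \<longrightarrow> F xs = 0) \<longrightarrow> t F = (0 :: 'k))"
  have "?P t" using t
  proof (induction t rule: Splus_induct)
    case (sp w)
    have "sp w F = 0" if "mform F" "\<forall>xs. xs \<noteq> [] \<and> length xs \<le> length w \<longrightarrow> F xs = 0" for F
    proof -
      have "symsum w (ev F) = 0"
      proof (rule symsum_eq_0)
        fix z assume "mset z = mset w"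
        then have "length z = length w" "z \<noteq> []" using \<open>w \<noteq> []\<close> by (auto dest: mset_eq_length)
        then show "ev F z = 0" using that(2) by (simp add: ev_def)
      qed
      then show ?thesis by (simp add: sp_eval)
    qed
    moreover have "sp w (\<lambda>xs. F xs + G xs) = sp w F + sp w G" if "mform F" "mform G" for F G
      using that mform_add[OF that] by (simp add: sp_eval symsum_add[symmetric] ev_def[abs_def])
    ultimately show ?case by (auto simp: sp_eval)
  next
    case (add t u)
    obtain n m where n: "\<And>F. mform F \<Longrightarrow> (\<forall>xs. xs \<noteq> [] \<and> length xs \<le> n \<longrightarrow> F xs = 0) \<Longrightarrow> t F = 0"
      and m: "\<And>F. mform F \<Longrightarrow> (\<forall>xs. xs \<noteq> [] \<and> length xs \<le> m \<longrightarrow> F xs = 0) \<Longrightarrow> u F = 0"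
      using add by metis
    have "(t + u) F = 0" if "mform F" "\<forall>xs. xs \<noteq> [] \<and> length xs \<le> max n m \<longrightarrow> F xs = 0" for F
    proof -
      have "t F = 0" using that by (intro n) auto
      moreover have "u F = 0" using that by (intro m) auto
      ultimately show ?thesis by simp
    qed
    moreover have "(t + u) (\<lambda>xs. F xs + G xs) = (t + u) F + (t + u) G" if "mform F" "mform G" for F G
      using add that by (simp add: algebra_simps)
    moreover have "(t + u) F = 0" if "\<not> mform F" for F
      using add that by simp
    ultimately show ?case by blast
  next
    case (scale c t)
    obtain n where n: "\<And>F. mform F \<Longrightarrow> (\<forall>xs. xs \<noteq> [] \<and> length xs \<le> n \<longrightarrow> F xs = 0) \<Longrightarrow> t F = 0"
      using scale by metis
    have "fscale c t F = 0" if "mform F" "\<forall>xs. xs \<noteq> [] \<and> length xs \<le> n \<longrightarrow> F xs = 0" for F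
      using n[OF that] by (simp add: fscale_def)
    moreover have "fscale c t (\<lambda>xs. F xs + G xs) = fscale c t F + fscale c t G" if "mform F" "mform G" for F G
      using scale that by (simp add: fscale_def algebra_simps)
    moreover have "fscale c t F = 0" if "\<not> mform F" for F
      using scale that by (simp add: fscale_def)
    ultimately show ?case by blast
  qed auto
  then obtain n where nm: "\<And>F. \<not> mform F \<Longrightarrow> t F = 0"
    and add: "\<And>F G. mform F \<Longrightarrow> mform G \<Longrightarrow> t (\<lambda>xs. F xs + G xs) = t F + t G"
    and n: "\<And>F. mform F \<Longrightarrow> (\<forall>xs. xs \<noteq> [] \<and> length xs \<le> n \<longrightarrow> F xs = 0) \<Longrightarrow> t F = 0"
    by blast
  have k: "t (comp_arity k F) = 0" if F: "mform F" for k F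
  proof -
    consider "k = 0" | "k = 1" | "k \<ge> 2" by linarith
    then show ?thesis
    proof cases
      case 1
      then show ?thesis by (intro n mform_comp_arity[OF F]) (simp add: comp_arity_def)
    next
      case 2
      then show ?thesis using assms(3)[OF F] by simp
    next
      case k: 3
      \<comment> \<open>A test function that splits off the first argument; among all cuts it keeps
        one, so joining it again gives back the component of arity \<open>k\<close>.\<close>
      define G where "G xs ys = (if length xs = 1 \<and> length ys = k - 1 then F (xs @ ys) else 0)" for xs ys
      have "mform (G xs)" for xs
        using mform_if_length[OF mform_append_left[OF F, of xs], of "\<lambda>n. length xs = 1 \<and> n = k - 1"] by (simp add: G_def[abs_def])
      moreover have "mform (\<lambda>xs. G xs ys)" for ys
        using mform_if_length[OF mform_append_right[OF F, of ys], of "\<lambda>n. n = 1 \<and> length ys = k - 1"] by (simp add: G_def)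
      ultimately have G: "bim G" by (simp add: bim_def)
      have "decf (nonempty2 G) zs = comp_arity k F zs" for zs
      proof -
        have "decf (nonempty2 G) zs = (\<Sum>r\<le>length zs. if r = 1 then comp_arity k F zs else 0)"
          unfolding decf_def
        proof (intro sum.cong refl)
          fix r assume r: "r \<in> {..length zs}"
          show "nonempty2 G (take r zs) (drop r zs) = (if r = 1 then comp_arity k F zs else 0)"
            using r k by (auto simp: nonempty2_def G_def comp_arity_def)
        qed
        also have "\<dots> = comp_arity k F zs" using k by (cases zs) (auto simp: comp_arity_def)
        finally show ?thesis .
      qed
      then have "decf (nonempty2 G) = comp_arity k F" by blast
      then show ?thesis using fun_cong[OF D, of G] G by (simp add: Delta_def)
    qed
  qed
  show ?thesis
  proof
    fix F
    show "t F = 0 F"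
    proof (cases "mform F")
      case F: True
      have s: "t (\<lambda>xs. \<Sum>k\<in>A. comp_arity k F xs) = 0" if "finite A" for A
        using that
      proof (induction A)
        case empty
        then show ?case by (intro n) auto
      next
        case (insert k A)
        have "t (\<lambda>xs. comp_arity k F xs + (\<Sum>k\<in>A. comp_arity k F xs)) = t (comp_arity k F) + t (\<lambda>xs. \<Sum>k\<in>A. comp_arity k F xs)"
          by (intro add mform_sum mform_comp_arity F)
        then show ?case using insert k[OF F] by simp
      qed
      \<comment> \<open>A form may have infinitely many components; those above \<open>n\<close> are
        invisible to \<open>t\<close>, and finitely many remain.\<close>
      let ?R = "\<lambda>xs. if length xs > n then F xs else 0"
      have "t ?R = 0" by (intro n mform_if_length F) auto
      moreover have "t (\<lambda>xs. ?R xs + (\<Sum>k\<in>{..n}. comp_arity k F xs)) = t ?R + t (\<lambda>xs. \<Sum>k\<in>{..n}. comp_arity k F xs)"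
        by (intro add mform_sum mform_comp_arity mform_if_length F)
      moreover have "(\<lambda>xs. ?R xs + (\<Sum>k\<in>{..n}. comp_arity k F xs)) = F"
        by (rule ext) (auto simp: comp_arity_def)
      ultimately show ?thesis using s[of "{..n}"] by simp
    qed (use nm in simp)
  qed
qed

end

section \<open>The coderivation on pairs of words\<close>

lemma dec_Nil_right: "dec (\<lambda>u v. if v = [] then f u else 0) w = f w"
proof -
  have "dec (\<lambda>u v. if v = [] then f u else 0) w = (\<Sum>r\<le>length w. if r = length w then f w else 0)"
    unfolding dec_conv by (rule sum.cong) auto
  then show ?thesis by simp
qed

lemma symsum_symsum_swap: "symsum w (\<lambda>u. symsum z (f u)) = symsum z (\<lambda>v. symsum w (\<lambda>u. f u v))"
  unfolding sum_permutes[symmetric, of z] by (simp only: symsum_sum symsum_mult)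

lemma ksign_sq: "ksign ds \<sigma> * ksign ds \<sigma> = (1 :: 'k::comm_ring_1)"
  by (simp add: ksign_def prod.distrib[symmetric] case_prod_unfold)

lemma Xw_wdeg:
  assumes "\<And>u. fst (L u) = wdeg u + 1"
  shows "Xw L (\<lambda>x. h (wdeg x) * f x) w = h (wdeg w + 1) * Xw L f w"
proof -
  have "Xw L (\<lambda>x. h (wdeg x) * f x) w = Xw L (\<lambda>x. h (wdeg w + 1) * f x) w"
    by (rule Xw_cong) (simp add: assms algebra_simps)
  then show ?thesis by (simp add: Xw_mult)
qed

lemma dec_assoc_fun: "dec (\<lambda>x y. dec (\<lambda>x1 x2. \<Phi> x1 x2 y) x) = dec (\<lambda>x1 z. dec (\<Phi> x1) z)"
  by (rule ext) (rule dec_assoc)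

text \<open>The operation D tensor id + id tensor D, acting on functions of two words.\<close>

definition DX where
  "DX L g u v = Xw L (\<lambda>x. g x v) u + sg (wdeg u) * Xw L (g u) v"

text \<open>\<open>Xw\<close> also replaces the empty factor and so inserts the letter
  \<open>L []\<close>, whose vector is 0 in the application. Functions of this kind ignore such
  terms.\<close>

definition zv :: "((int \<times> 'a::zero) list \<Rightarrow> (int \<times> 'a) list \<Rightarrow> 'k::comm_ring_1) \<Rightarrow> bool" where
  "zv g \<longleftrightarrow> (\<forall>u v. 0 \<in> snd ` set u \<union> snd ` set v \<longrightarrow> g u v = 0)"

lemma zvD: "zv g \<Longrightarrow> 0 \<in> snd ` set u \<union> snd ` set v \<Longrightarrow> g u v = 0"
  unfolding zv_def by blast

text \<open>The restriction to nonempty pieces can fail to commute with \<open>Xw\<close> only where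
  \<open>L []\<close> is inserted into an empty piece, and such terms vanish.\<close>

lemma Xw_nonempty2:
  assumes g: "zv g" and L: "snd (L []) = 0"
  shows "Xw L (dec (nonempty2 g)) w = dec (nonempty2 (DX L g)) w"
  unfolding Xw_dec
proof (rule dec_cong)
  fix u v
  have x: "Xw L (\<lambda>x. nonempty2 g x v) u = (if u = [] \<or> v = [] then 0 else Xw L (\<lambda>x. g x v) u)"
  proof (cases "v = []")
    case True
    then show ?thesis by (simp add: nonempty2_def Xw_0)
  next
    case False
    then have "Xw L (\<lambda>x. nonempty2 g x v) u = Xw L (\<lambda>x. g x v) u"
      by (intro Xw_cong) (simp add: nonempty2_def)
    moreover have "Xw L (\<lambda>x. g x v) [] = 0"
      using zvD[OF g, of "[L []]" v] L by (simp add: Xw_def)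
    ultimately show ?thesis using False by simp
  qed
  have y: "Xw L (nonempty2 g u) v = (if u = [] \<or> v = [] then 0 else Xw L (g u) v)"
  proof (cases "u = []")
    case True
    then have "Xw L (nonempty2 g u) v = Xw L (\<lambda>_. 0) v"
      by (intro Xw_cong) (simp add: nonempty2_def)
    then show ?thesis using True by (simp add: Xw_0)
  next
    case False
    then have "Xw L (nonempty2 g u) v = Xw L (g u) v"
      by (intro Xw_cong) (simp add: nonempty2_def)
    moreover have "Xw L (g u) [] = 0"
      using zvD[OF g, of u "[L []]"] L by (simp add: Xw_def)
    ultimately show ?thesis using False by simp
  qed
  show "Xw L (\<lambda>x. nonempty2 g x v) u + sg (wdeg u) * Xw L (nonempty2 g u) v = nonempty2 (DX L g) u v"
    unfolding x y by (simp add: nonempty2_def DX_def)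
qed

lemma Xw_zero_letter:
  assumes f: "\<And>x. 0 \<in> snd ` set x \<Longrightarrow> f x = 0"
    and L: "\<And>u. 0 \<in> snd ` set u \<Longrightarrow> snd (L u) = 0" and w: "0 \<in> snd ` set w"
  shows "Xw L f w = 0"
proof -
  have "Xw L f w = Xw L (\<lambda>_. 0) w"
  proof (rule Xw_cong)
    fix u1 u2 u3 assume "w = u1 @ u2 @ u3"
    then have "0 \<in> snd ` set (u1 @ L u2 # u3)" using w L[of u2] by (auto simp: image_iff)
    then show "f (u1 @ L u2 # u3) = 0" by (rule f)
  qed
  then show ?thesis by (simp add: Xw_0)
qed

text \<open>Allows \<open>Xw_nonempty2\<close> to be applied a second time, for the square of the
  coderivation.\<close>

lemma zv_DX:
  fixes g :: "(int \<times> 'a::zero) list \<Rightarrow> (int \<times> 'a) list \<Rightarrow> 'k::comm_ring_1"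
  assumes g: "zv g" and L: "\<And>u. 0 \<in> snd ` set u \<Longrightarrow> snd (L u) = 0"
  shows "zv (DX L g)"
  unfolding zv_def
proof (intro allI impI)
  fix u v :: "(int \<times> 'a) list" assume h: "0 \<in> snd ` set u \<union> snd ` set v"
  have "Xw L (\<lambda>x. g x v) u = 0 \<and> Xw L (g u) v = 0"
  proof (cases "0 \<in> snd ` set u")
    case True
    then have "Xw L (g u) v = Xw L (\<lambda>_. 0) v" by (intro Xw_cong zvD[OF g]) simp
    moreover have "Xw L (\<lambda>x. g x v) u = 0"
      by (rule Xw_zero_letter[OF _ L True]) (rule zvD[OF g], simp)
    ultimately show ?thesis by (simp add: Xw_0)
  next
    case False
    then have v: "0 \<in> snd ` set v" using h by blast
    then have "Xw L (\<lambda>x. g x v) u = Xw L (\<lambda>_. 0) u" by (intro Xw_cong zvD[OF g]) simp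
    moreover have "Xw L (g u) v = 0"
      by (rule Xw_zero_letter[OF _ L v]) (rule zvD[OF g], simp)
    ultimately show ?thesis by (simp add: Xw_0)
  qed
  then show "DX L g u v = 0" by (simp add: DX_def)
qed

text \<open>The mixed terms cancel because \<open>L\<close> is odd.\<close>

lemma DX_DX:
  assumes L: "\<And>u. fst (L u) = wdeg u + 1"
  shows "DX L (DX L g) u v = Xw L (Xw L (\<lambda>x. g x v)) u + Xw L (Xw L (g u)) v"
proof -
  have "Xw L (\<lambda>x. DX L g x v) u = Xw L (Xw L (\<lambda>x. g x v)) u + sg (wdeg u + 1) * Xw L (\<lambda>x. Xw L (g x) v) u"
    unfolding DX_def Xw_add by (simp only: Xw_wdeg[OF L, of sg])
  moreover have "Xw L (DX L g u) v = Xw L (\<lambda>x. Xw L (g x) v) u + sg (wdeg u) * Xw L (Xw L (g u)) v"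
    unfolding DX_def[abs_def] Xw_add Xw_mult by (simp only: Xw_Xw_swap[of L g v u])
  ultimately have "DX L (DX L g) u v =
      Xw L (Xw L (\<lambda>x. g x v)) u + sg (wdeg u + 1) * Xw L (\<lambda>x. Xw L (g x) v) u +
      sg (wdeg u) * (Xw L (\<lambda>x. Xw L (g x) v) u + sg (wdeg u) * Xw L (Xw L (g u)) v)"
    by (simp only: DX_def[of L "DX L g"])
  then show ?thesis by (simp add: distrib_left sg_add sg_def)
qed

text \<open>The usual shape of a coderivation, a signed sum of q(x_I) followed by x_J: exchanging
  the first two of the three pieces puts the replaced one in front, and what remains is the
  insertion of the letter \<open>L u\<close> into the rest.\<close>

lemma symsum_Xw:
  assumes L: "\<And>u. fst (L u) = wdeg u + 1"
  shows "symsum w (Xw L f) = (\<Sum>I\<in>Pow {..<length w}.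
    usign (map fst w) I * symsum (nths w I) (\<lambda>u. symsum (L u # nths w (- I)) f))"
proof -
  have "symsum w (Xw L f) = symsum w (dec (\<lambda>x y. dec (\<lambda>u v. sg (wdeg u) * f (u @ L v # y)) x))"
    by (simp only: Xw_def[abs_def] dec_assoc_fun dec_mult)
  also have "\<dots> = symsum w (dec (\<lambda>x y. dec (\<lambda>u v. sg (wdeg u * wdeg v) * (sg (wdeg v) * f (v @ L u # y))) x))"
    by (rule symsum_dec_swap_left)
  also have "\<dots> = symsum w (dec (\<lambda>u z. dec (\<lambda>v y. sg (wdeg u * wdeg v) * (sg (wdeg v) * f (v @ L u # y))) z))"
    by (simp only: dec_assoc_fun)
  also have "(\<lambda>u z. dec (\<lambda>v y. sg (wdeg u * wdeg v) * (sg (wdeg v) * f (v @ L u # y))) z) = (\<lambda>u. ins (L u) f)"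
    by (intro ext) (simp add: ins_def L sg_add distrib_right mult.assoc)
  finally show ?thesis by (simp add: symsum_dec)
qed

section \<open>The coderivation with given Taylor coefficients\<close>

context fd_graded_space
begin

lemma symsum_symmetric:
  assumes F: "symmetric F" and w: "hw w"
  shows "symsum w (ev F) = fact (length w) * ev F w"
proof -
  have "symsum w (ev F) = (\<Sum>\<sigma> | \<sigma> permutes {..<length w}. ev F w)"
    unfolding sum_permutes[symmetric]
  proof (intro sum.cong refl)
    fix \<sigma> assume s: "\<sigma> \<in> {\<sigma>. \<sigma> permutes {..<length w}}"
    have "homog (map fst w) (map snd w) \<and> \<sigma> permutes {..<length (map snd w)}" using w s by simp
    then have "F (permute_list \<sigma> (map snd w)) = ksign (map fst w) \<sigma> * F (map snd w)"
      using F unfolding symmetric_def by blast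
    then show "ksign (map fst w) \<sigma> * ev F (permute_list \<sigma> w) = ev F w"
      using s by (simp add: ev_def permute_list_map mult.assoc[symmetric] ksign_sq)
  qed
  also have "\<dots> = fact (length w) * ev F w"
    using card_permutations[of "{..<length w}" "length w"] by simp
  finally show ?thesis .
qed

text \<open>\<open>Xw\<close> as an operation on forms: \<open>q\<close> of consecutive arguments is
  fed into one slot, and \<open>D0\<close> is its transpose. The summands with \<open>k = 0\<close>
  feed in \<open>q [] = 0\<close> and vanish on multilinear forms.\<close>

definition Xf :: "('v list \<Rightarrow> 'v) \<Rightarrow> ('v, 'k) form \<Rightarrow> ('v, 'k) form" where
  "Xf q F = mext (\<lambda>ds xs. \<Sum>i\<le>length xs. sg (sum_list (take i ds)) *
     (\<Sum>k\<le>length (drop i xs). F (take i xs @ q (take k (drop i xs)) # drop k (drop i xs))))"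

definition D0 :: "('v list \<Rightarrow> 'v) \<Rightarrow> ('v, 'k) tensor \<Rightarrow> ('v, 'k) tensor" where
  "D0 q t F = (if mform F then t (Xf q F) else 0)"

lemma D0_add: "D0 q (t + u) = D0 q t + D0 q u" and D0_fscale: "D0 q (fscale c t) = fscale c (D0 q t)"
  and D0_0: "D0 q 0 = 0"
  by (auto simp: D0_def fscale_def)

lemma fst_lq [simp]: "fst (lq q u) = wdeg u + 1" and snd_lq [simp]: "snd (lq q u) = q (map snd u)"
  by (simp_all add: lq_def)

lemma degree1D: "degree1 q \<Longrightarrow> hw u \<Longrightarrow> q (map snd u) \<in> gr (wdeg u + 1 + 1)"
  by (auto simp: degree1_def lq_def)

lemma Splus_deg_closed: "t \<in> Splus_deg d \<Longrightarrow> u \<in> Splus_deg d \<Longrightarrow> t + u \<in> Splus_deg d"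
  "t \<in> Splus_deg d \<Longrightarrow> fscale c t \<in> Splus_deg d" "0 \<in> Splus_deg d"
  "(\<And>i. i \<in> A \<Longrightarrow> f i \<in> Splus_deg d) \<Longrightarrow> (\<Sum>i\<in>A. f i) \<in> Splus_deg d"
  unfolding Splus_deg_def using fspan_sum[of "{}" "\<lambda>_. 0" "{sprod ds xs |ds xs. homog ds xs \<and> xs \<noteq> [] \<and> sum_list ds = d}"]
  by (auto intro: fspan_add fspan_fscale fspan_sum)

lemma mform_bim: "bim G \<Longrightarrow> mform (G xs)" "bim G \<Longrightarrow> mform (\<lambda>xs. G xs ys)"
  by (auto simp: bim_def)

lemma evb_ev: "evb G u = ev (G (map snd u))" "(\<lambda>x. evb G x v) = ev (\<lambda>xs. G xs (map snd v))"
  by (auto simp: evb_def ev_def)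

text \<open>Replacing a factor leaves a single letter only if the factor was the whole word.\<close>

lemma Xw_arity1: "Xw L (ev (comp_arity 1 F)) z = F [snd (L z)]"
proof -
  have "Xw L (ev (comp_arity 1 F)) z =
     dec (\<lambda>u1 z. if u1 = [] then dec (\<lambda>u2 u3. if u3 = [] then F [snd (L u2)] else 0) z else 0) z"
    unfolding Xw_def
  proof (rule dec_cong)
    fix u1 x :: "(int \<times> 'v) list"
    show "sg (wdeg u1) * dec (\<lambda>u2 u3. ev (comp_arity 1 F) (u1 @ L u2 # u3)) x =
      (if u1 = [] then dec (\<lambda>u2 u3. if u3 = [] then F [snd (L u2)] else 0) x else 0)"
    proof (cases "u1 = []")
      case True
      have "ev (comp_arity 1 F) (u1 @ L u2 # u3) = (if u3 = [] then F [snd (L u2)] else 0)" for u2 u3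
        using True by (simp add: ev_def comp_arity_def)
      then show ?thesis using True by (simp add: sg_def)
    next
      case False
      then have "ev (comp_arity 1 F) (u1 @ L u2 # u3) = 0" for u2 u3
        by (simp add: ev_def comp_arity_def)
      then show ?thesis using False by simp
    qed
  qed
  then show ?thesis by (simp only: dec_Nil_left dec_Nil_right)
qed

end

locale graded_maps = fd_graded_space +
  fixes q
  assumes q: "symmetric_maps q"
begin

lemma q_Nil: "q [] = 0"
  using q by (rule symmetric_maps_Nil)

lemma q_zero: "0 \<in> set xs \<Longrightarrow> q xs = 0"
proof (rule linear_separates)
  fix \<phi> :: "'b \<Rightarrow> 'a" assume "0 \<in> set xs" and \<phi>: "Vector_Spaces.linear scale (*) \<phi>"
  have "mform (\<lambda>xs. \<phi> (q xs))" using symmetric_mapsD[OF q \<phi>] by (simp add: symmetric_def)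
  moreover have "\<phi> 0 = 0" using \<phi> unfolding linear_scalar_iff by (metis mult_zero_left scale_zero_left)
  ultimately show "\<phi> (q xs) = \<phi> 0" using mform_zero \<open>0 \<in> set xs\<close> by metis
qed

lemma mform_Xf_summand:
  assumes F: "mform F"
  shows "mform (\<lambda>xs. \<Sum>i\<le>length xs. sg (sum_list (take i ds)) *
     (\<Sum>k\<le>length (drop i xs). F (take i xs @ q (take k (drop i xs)) # drop k (drop i xs))))"
proof -
  have inner: "mform (\<lambda>ys. \<Sum>k\<le>length ys. F (xs @ q (take k ys) # drop k ys))" for xs
  proof (rule mform_sum_length[of "\<lambda>n. {..n}" "\<lambda>k ys. F (xs @ q (take k ys) # drop k ys)"])
    fix n k
    show "mform (\<lambda>ys. F (xs @ q (take k ys) # drop k ys))"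
    proof (rule mform_split[of "\<lambda>y z. F (xs @ q y # z)"])
      show "mform (\<lambda>y. F (xs @ q y # z))" for z by (rule symmetric_maps_mform[OF q F])
      show "mform (\<lambda>z. F (xs @ q y # z))" for y using mform_append_left[OF F, of "xs @ [q y]"] by simp
    qed
  qed
  show ?thesis
  proof (rule mform_sum_length[of "\<lambda>n. {..n}" "\<lambda>i xs. sg (sum_list (take i ds)) *
     (\<Sum>k\<le>length (drop i xs). F (take i xs @ q (take k (drop i xs)) # drop k (drop i xs)))"])
    fix n i
    have "mform (\<lambda>xs. \<Sum>k\<le>length (drop i xs). F (take i xs @ q (take k (drop i xs)) # drop k (drop i xs)))"
    proof (rule mform_split[of "\<lambda>xs ys. \<Sum>k\<le>length ys. F (xs @ q (take k ys) # drop k ys)"])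
      show "mform (\<lambda>xs. \<Sum>k\<le>length ys. F (xs @ q (take k ys) # drop k ys))" for ys
        by (intro mform_sum mform_append_right F)
    qed (rule inner)
    then show "mform (\<lambda>xs. sg (sum_list (take i ds)) *
       (\<Sum>k\<le>length (drop i xs). F (take i xs @ q (take k (drop i xs)) # drop k (drop i xs))))"
      by (rule mform_mult)
  qed
qed

lemma mform_Xf: "mform F \<Longrightarrow> mform (Xf q F)"
  unfolding Xf_def by (rule mform_mext) (rule mform_Xf_summand)

lemma ev_Xf:
  assumes F: "mform F" and w: "hw w"
  shows "ev (Xf q F) w = Xw (lq q) (ev F) w"
  unfolding Xf_def ev_mext[OF mform_Xf_summand[OF F] w]
  by (simp add: Xw_def dec_conv ev_def wdeg_def take_map drop_map)

lemma D0_sp: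
  assumes F: "mform F" and w: "hw w"
  shows "D0 q (sp w) F = symsum w (Xw (lq q) (ev F))"
proof -
  have "symsum w (ev (Xf q F)) = symsum w (Xw (lq q) (ev F))"
    by (rule symsum_cong) (simp add: ev_Xf[OF F] hw_mset[OF _ w])
  then show ?thesis using F by (simp add: D0_def sp_eval mform_Xf)
qed

lemma zv_evb:
  assumes G: "bim G"
  shows "zv (evb G)"
  unfolding zv_def evb_def
proof (intro allI impI)
  fix u v :: "(int \<times> 'b) list" assume "0 \<in> snd ` set u \<union> snd ` set v"
  then have "0 \<in> set (map snd u) \<or> 0 \<in> set (map snd v)" by simp
  then show "G (map snd u) (map snd v) = 0"
    using mform_zero[OF mform_bim(1)[OF G, of "map snd u"]] mform_zero[OF mform_bim(2)[OF G, of "map snd v"]] by blast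
qed

lemma snd_lq_zero: "0 \<in> snd ` set u \<Longrightarrow> snd (lq q u) = 0"
  using q_zero[of "map snd u"] by simp

lemma snd_lq_Nil: "snd (lq q []) = 0"
  using q_Nil by simp

lemma D0_taylor:
  assumes "mform F" "hw w"
  shows "D0 q (sp w) (comp_arity 1 F) = symsum w (\<lambda>z. F [q (map snd z)])"
proof -
  have "Xw (lq q) (ev (comp_arity 1 F)) = (\<lambda>z. F [q (map snd z)])"
    by (rule ext) (simp only: Xw_arity1 snd_lq)
  then show ?thesis using D0_sp[OF mform_comp_arity[OF assms(1)] assms(2), of 1] by (simp only:)
qed

lemma mform_D0_sp:
  assumes "bim G" "hw w"
  shows "mform (\<lambda>xs. D0 q (sp w) (G xs))"
proof -
  have "mform (\<lambda>xs. symsum w (Xw (lq q) (\<lambda>z. G xs (map snd z))))"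
    by (intro mform_symsum mform_Xw mform_bim(2) assms)
  then show ?thesis by (simp add: D0_sp[OF mform_bim(1)] assms ev_def[abs_def])
qed

lemma Delta_D0_sp:
  assumes G: "bim G" and w: "hw w"
  shows "Delta (D0 q (sp w)) G = symsum w (dec (nonempty2 (DX (lq q) (evb G))))"
proof -
  have "Delta (D0 q (sp w)) G = symsum w (Xw (lq q) (dec (nonempty2 (evb G))))"
    using G D0_sp[OF mform_decf[OF bim_nonempty2[OF G]] w] by (simp add: Delta_def ev_decf)
  also have "Xw (lq q) (dec (nonempty2 (evb G))) = dec (nonempty2 (DX (lq q) (evb G)))"
    by (rule ext) (rule Xw_nonempty2[of "evb G" "lq q", OF zv_evb[OF G] snd_lq_Nil])
  finally show ?thesis .
qed

lemma hw_nths: "hw w \<Longrightarrow> hw (nths w I)"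
  using set_nths_subset[of w I] unfolding hw_def by blast

text \<open>Through transposition the claim becomes \<open>Xw_nonempty2\<close>; unshuffling the
  reduced cuts then separates the two pieces, and the two summands of \<open>DX\<close> are the two
  summands of the coderivation rule.\<close>

lemma D0_coderivation:
  assumes w: "hw w"
  shows "Delta (D0 q (sp w)) = (\<Sum>I | I \<noteq> {} \<and> I \<subset> {..<length w}. fscale (usign (map fst w) I)
      (tprod (D0 q (sp (nths w I))) (sp (nths w (- I))) +
       fscale (sg (wdeg (nths w I))) (tprod (sp (nths w I)) (D0 q (sp (nths w (- I)))))))"
proof
  fix G :: "'b list \<Rightarrow> 'b list \<Rightarrow> 'a"
  show "Delta (D0 q (sp w)) G = (\<Sum>I | I \<noteq> {} \<and> I \<subset> {..<length w}. fscale (usign (map fst w) I)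
      (tprod (D0 q (sp (nths w I))) (sp (nths w (- I))) +
       fscale (sg (wdeg (nths w I))) (tprod (sp (nths w I)) (D0 q (sp (nths w (- I))))))) G"
  proof (cases "bim G")
    case False
    then show ?thesis by (simp add: sum_apply fscale_def tprod_not_bim) (simp add: Delta_def)
  next
    case G: True
    have 1: "tprod (D0 q (sp u)) (sp v) G = symsum u (\<lambda>y. symsum v (\<lambda>z. Xw (lq q) (\<lambda>x. evb G x z) y))" if "hw u" for u v
    proof -
      have e: "ev (\<lambda>xs. sp v (G xs)) = (\<lambda>x. symsum v (evb G x))"
        by (rule ext) (simp only: ev_def evb_ev(1) sp_eval mform_bim(1)[OF G] if_True)
      show ?thesis
        unfolding tprod_eval[OF G] D0_sp[OF mform_sp[OF G] that] e Xw_symsum[abs_def] ..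
    qed
    have 2: "tprod (sp u) (D0 q (sp v)) G = symsum u (\<lambda>y. symsum v (Xw (lq q) (evb G y)))" if "hw v" for u v
    proof -
      have "ev (\<lambda>xs. D0 q (sp v) (G xs)) = (\<lambda>y. symsum v (Xw (lq q) (evb G y)))"
        by (rule ext) (simp only: ev_def evb_ev(1) D0_sp[OF mform_bim(1)[OF G] that])
      then show ?thesis
        unfolding tprod_eval[OF G] using mform_D0_sp[OF G that] by (simp add: sp_eval)
    qed
    have "symsum u (\<lambda>y. symsum v (DX (lq q) (evb G) y)) =
        tprod (D0 q (sp u)) (sp v) G + sg (wdeg u) * tprod (sp u) (D0 q (sp v)) G" if "hw u" "hw v" for u v
      unfolding 1[OF that(1)] 2[OF that(2)] DX_def[abs_def] symsum_add symsum_mult symsum_wdeg[of u sg] ..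
    then show ?thesis
      unfolding Delta_D0_sp[OF G w] symsum_dec_nonempty
      by (simp add: sum_apply fscale_def hw_nths[OF w])
  qed
qed

end

lemma length_nths_less:
  assumes "nths w (- I) \<noteq> []"
  shows "length (nths w I) < length w"
proof -
  obtain i where "i < length w" "i \<notin> I" using assms by (auto simp: nths_empty_iff)
  then have "card {i. i < length w \<and> i \<in> I} < card {..<length w}" by (intro psubset_card_mono) auto
  then show ?thesis by (simp add: length_nths)
qed

context graded_maps
begin

lemma fscale_0: "fscale c 0 = (0 :: 'x \<Rightarrow> 'a)"
  by (rule ext) (simp add: fscale_def)

lemma D0_D0_sp:
  assumes d: "degree1 q" and F: "mform F" and w: "hw w"
  shows "D0 q (D0 q (sp w)) F = symsum w (Xw (lq q) (Xw (lq q) (ev F)))"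
proof -
  have "D0 q (D0 q (sp w)) F = symsum w (Xw (lq q) (ev (Xf q F)))"
    using F D0_sp[OF mform_Xf[OF F] w] by (simp add: D0_def[of q "D0 q (sp w)"])
  also have "\<dots> = symsum w (Xw (lq q) (Xw (lq q) (ev F)))"
  proof (rule symsum_cong, rule Xw_cong)
    fix z u1 u2 u3 assume "mset z = mset w" "z = u1 @ u2 @ u3"
    then have "hw (u1 @ u2 @ u3)" using hw_mset w by metis
    then have "hw (u1 @ lq q u2 # u3)" using degree1D[OF d, of u2] by simp
    then show "ev (Xf q F) (u1 @ lq q u2 # u3) = Xw (lq q) (ev F) (u1 @ lq q u2 # u3)"
      by (rule ev_Xf[OF F])
  qed
  finally show ?thesis .
qed

text \<open>\<open>D0\<close> is defined as a transpose, so it is not evident that its values are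
  combinations of symmetric products; this expansion shows it and gives the degree.\<close>

lemma D0_sp_sum:
  assumes w: "hw w"
  shows "D0 q (sp w) = (\<Sum>I\<in>Pow {..<length w}. fscale (usign (map fst w) I)
    (\<Sum>\<sigma> | \<sigma> permutes {..<length (nths w I)}. fscale (ksign (map fst (nths w I)) \<sigma>)
       (sp (lq q (permute_list \<sigma> (nths w I)) # nths w (- I)))))"
proof
  fix F
  show "D0 q (sp w) F = (\<Sum>I\<in>Pow {..<length w}. fscale (usign (map fst w) I)
    (\<Sum>\<sigma> | \<sigma> permutes {..<length (nths w I)}. fscale (ksign (map fst (nths w I)) \<sigma>)
       (sp (lq q (permute_list \<sigma> (nths w I)) # nths w (- I))))) F"
  proof (cases "mform F")
    case True
    have "symsum w (Xw (lq q) (ev F)) = (\<Sum>I\<in>Pow {..<length w}. usign (map fst w) I *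
       symsum (nths w I) (\<lambda>u. symsum (lq q u # nths w (- I)) (ev F)))"
      by (rule symsum_Xw) simp
    then show ?thesis
      unfolding D0_sp[OF True w] sum_permutes[symmetric, of "nths w _"]
      using True by (simp only: sum_apply fscale_def sp_eval if_True)
  next
    case False
    then show ?thesis by (simp add: D0_def sum_apply fscale_def sp_eval)
  qed
qed

lemma D0_Splus_deg:
  assumes d: "degree1 q" and t: "t \<in> Splus_deg e"
  shows "D0 q t \<in> Splus_deg (e + 1)"
  using t
proof (rule Splus_deg_induct)
  fix w :: "(int \<times> 'b) list" assume w: "hw w" "wdeg w = e"
  have "sp (lq q (permute_list \<sigma> (nths w I)) # nths w (- I)) \<in> Splus_deg (e + 1)"
    if s: "\<sigma> permutes {..<length (nths w I)}" for \<sigma> I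
  proof -
    let ?u = "permute_list \<sigma> (nths w I)"
    have m: "mset ?u = mset (nths w I)" using s by simp
    have "hw ?u" using hw_mset[OF m] hw_nths[OF w(1)] by blast
    then have "hw (lq q ?u # nths w (- I))" using degree1D[OF d, of ?u] hw_nths[OF w(1)] by simp
    moreover have "wdeg (lq q ?u # nths w (- I)) = e + 1"
      using wdeg_mset[OF m] wdeg_nths[of w I] w(2) by simp
    ultimately show ?thesis by (metis Splus_deg_sp list.distinct(1))
  qed
  then show "D0 q (sp w) \<in> Splus_deg (e + 1)"
    unfolding D0_sp_sum[OF w(1)] by (intro Splus_deg_closed) simp
qed (simp_all only: D0_add D0_fscale D0_0 Splus_deg_closed)

text \<open>By \<open>DX_DX\<close> the coproduct of the square involves only squares on the two
  proper sub-words, which vanish by induction. The square is then primitive, and its arity-one part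
  is the symmetrised composite of \<open>q\<close> with itself.\<close>

lemma D0_square:
  assumes d: "degree1 q" and v: "vanishing_square q" and w: "hw w" "w \<noteq> []"
  shows "D0 q (D0 q (sp w)) = 0"
  using w
proof (induction w rule: length_induct)
  case (1 w)
  have IH: "symsum (nths w I) (Xw (lq q) (Xw (lq q) (ev F))) = 0"
    if I: "nths w I \<noteq> []" "nths w (- I) \<noteq> []" and F: "mform F" for I F
  proof -
    have "length (nths w I) < length w" using length_nths_less[OF I(2)] by simp
    then have "D0 q (D0 q (sp (nths w I))) = 0" using "1.IH" I(1) hw_nths[OF "1.prems"(1)] by blast
    then show ?thesis using D0_D0_sp[OF d F hw_nths[OF "1.prems"(1)], of I] by simp
  qed
  show ?case
  proof (rule Splus_zeroI)
    have "D0 q (D0 q (sp w)) \<in> Splus_deg (wdeg w + 1 + 1)"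
      by (intro D0_Splus_deg d Splus_deg_sp "1.prems")
    then show "D0 q (D0 q (sp w)) \<in> Splus" using Splus_deg_subset by blast
    show "Delta (D0 q (D0 q (sp w))) = 0"
    proof
      fix G :: "'b list \<Rightarrow> 'b list \<Rightarrow> 'a"
      show "Delta (D0 q (D0 q (sp w))) G = 0 G"
      proof (cases "bim G")
        case G: True
        let ?L = "lq q"
        have x1: "Xw ?L (dec (nonempty2 (evb G))) = dec (nonempty2 (DX ?L (evb G)))"
          by (rule ext) (rule Xw_nonempty2[of "evb G" "lq q", OF zv_evb[OF G] snd_lq_Nil])
        have x2: "Xw ?L (dec (nonempty2 (DX ?L (evb G)))) = dec (nonempty2 (DX ?L (DX ?L (evb G))))"
          by (rule ext) (rule Xw_nonempty2[of "DX ?L (evb G)" "lq q", OF zv_DX[OF zv_evb[OF G]] snd_lq_Nil], rule snd_lq_zero)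
        have x3: "DX ?L (DX ?L (evb G)) u v = Xw ?L (Xw ?L (ev (\<lambda>xs. G xs (map snd v)))) u +
            Xw ?L (Xw ?L (ev (G (map snd u)))) v" for u v
          unfolding DX_DX[of ?L, OF fst_lq] by (simp only: evb_ev(2)) (simp only: evb_ev(1))
        have "Delta (D0 q (D0 q (sp w))) G = symsum w (Xw ?L (Xw ?L (dec (nonempty2 (evb G)))))"
          using G D0_D0_sp[OF d mform_decf[OF bim_nonempty2[OF G]] "1.prems"(1)] by (simp add: Delta_def ev_decf)
        also have "\<dots> = (\<Sum>I | I \<noteq> {} \<and> I \<subset> {..<length w}. usign (map fst w) I *
            symsum (nths w I) (\<lambda>u. symsum (nths w (- I)) (DX ?L (DX ?L (evb G)) u)))"
          unfolding x1 x2 symsum_dec_nonempty ..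
        also have "\<dots> = 0"
        proof (rule sum.neutral, rule ballI)
          fix I assume "I \<in> {I. I \<noteq> {} \<and> I \<subset> {..<length w}}"
          then have ne: "nths w I \<noteq> []" "nths w (- I) \<noteq> []" by (auto simp: nths_empty_iff)
          have "symsum (nths w I) (\<lambda>u. symsum (nths w (- I)) (\<lambda>v. Xw ?L (Xw ?L (ev (\<lambda>xs. G xs (map snd v)))) u)) = 0"
            unfolding symsum_symsum_swap[of "nths w I"] using IH[OF ne mform_bim(2)[OF G]] by simp
          moreover have "symsum (nths w I) (\<lambda>u. symsum (nths w (- I)) (Xw ?L (Xw ?L (ev (G (map snd u)))))) = 0"
            using IH[of "- I", OF ne(2) _ mform_bim(1)[OF G]] ne(1) by simp
          ultimately show "usign (map fst w) I * symsum (nths w I) (\<lambda>u. symsum (nths w (- I)) (DX ?L (DX ?L (evb G)) u)) = 0"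
            unfolding x3[abs_def] symsum_add by simp
        qed
        finally show ?thesis by simp
      qed (simp add: Delta_def)
    qed
    fix F assume F: "mform F"
    have "Xw (lq q) (ev (comp_arity 1 F)) = (\<lambda>z. F [q (map snd z)])"
      by (rule ext) (simp only: Xw_arity1 snd_lq)
    then show "D0 q (D0 q (sp w)) (comp_arity 1 F) = 0"
      using D0_D0_sp[OF d mform_comp_arity[OF F] "1.prems"(1), of 1]
        v[unfolded vanishing_square_def, rule_format, of "\<lambda>x. F [x]" w] "1.prems"(1) mform_linear[OF F, of "[]" "[]"] by simp
  qed
qed

section \<open>Square-zero coderivations and the quadratic relations\<close>

lemma L_infinityI:
  assumes d: "degree1 q" and v: "vanishing_square q"
  shows "L_infinity q"
proof -
  have "D0 q (D0 q t) = 0" if "t \<in> Splus" for t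
    using that
  proof (induction t rule: Splus_induct)
    case (scale c t)
    show ?case unfolding D0_fscale scale fscale_0 ..
  next
    case (add t u)
    show ?case unfolding D0_add add by (rule ext) simp
  next
    case zero
    show ?case unfolding D0_0 ..
  qed (rule D0_square[OF d v])
  moreover have "coderivation1 Delta (D0 q)"
    unfolding coderivation1_sp flinear_on_def
    by (intro conjI allI ballI impI D0_add D0_fscale D0_Splus_deg[OF d]) (assumption | rule D0_coderivation, blast)+
  moreover have "taylor_coeffs (D0 q) q"
    unfolding taylor_coeffs_sp by (intro allI impI D0_taylor) auto
  ultimately show ?thesis unfolding L_infinity_def using coproduct_Delta
    by (intro exI[of _ Delta] exI[of _ "D0 q"]) simp
qed

text \<open>The given coproduct and coderivation are arbitrary off \<open>Splus\<close>, but on it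
  they are forced to be \<open>Delta\<close> and \<open>D0 q\<close>, so the square can be computed
  there. That \<open>q\<close> has degree 1 is not part of \<open>symmetric_maps\<close> and has to
  come from the degree of \<open>D\<close>.\<close>

lemma L_infinityD:
  assumes "L_infinity q"
  shows "degree1 q" "vanishing_square q"
proof -
  obtain \<Delta> D where \<Delta>: "coproduct \<Delta>" and D: "coderivation1 \<Delta> D"
    and DD: "\<And>t. t \<in> Splus \<Longrightarrow> D (D t) + D (D t) = 0" and T: "taylor_coeffs D q"
    using assms unfolding L_infinity_def by blast
  have T': "D (sp w) (comp_arity 1 F) = symsum w (\<lambda>z. F [q (map snd z)])" if "hw w" "w \<noteq> []" "mform F" for w F
    using T that unfolding taylor_coeffs_sp by blast
  have lin: "\<And>t u. t \<in> Splus \<Longrightarrow> u \<in> Splus \<Longrightarrow> D (t + u) = D t + D u"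
    "\<And>c t. t \<in> Splus \<Longrightarrow> D (fscale c t) = fscale c (D t)"
    and deg: "\<And>e t. t \<in> Splus_deg e \<Longrightarrow> D t \<in> Splus_deg (e + 1)"
    using D unfolding coderivation1_def flinear_on_def by blast+
  have linc: "\<And>t u. t \<in> Splus \<Longrightarrow> u \<in> Splus \<Longrightarrow> \<Delta> (t + u) = \<Delta> t + \<Delta> u"
    "\<And>c t. t \<in> Splus \<Longrightarrow> \<Delta> (fscale c t) = fscale c (\<Delta> t)"
    using \<Delta> unfolding coproduct_def flinear_on_def by blast+
  show d: "degree1 q"
    unfolding degree1_def
  proof (intro allI impI)
    fix u :: "(int \<times> 'b) list" assume u: "hw u"
    let ?e = "wdeg u + 1" and ?x = "q (map snd u)"
    show "hw [lq q u]"
    proof (cases "u = []")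
      case True
      then show ?thesis using q_Nil by simp
    next
      case False
      \<comment> \<open>The functional kills the arity-one part of \<open>D (sp u)\<close>, which
        lies in a fixed degree. That part is the Taylor coefficient, a factorial times q(u) by
        symmetry, and factorials are invertible.\<close>
      have van: "\<phi> ?x = 0" if \<phi>: "Vector_Spaces.linear scale (*) \<phi>" and z: "\<And>x. x \<in> gr (?e + 1) \<Longrightarrow> \<phi> x = 0" for \<phi>
      proof -
        have F: "mform (lf \<phi>)" using lf_cyc[OF \<phi>] by (simp add: cyc_def cyclic_def)
        have "t (comp_arity 1 (lf \<phi>)) = 0" if "t \<in> Splus_deg ?e" for t
          using that
        proof (rule Splus_deg_induct)
          fix w :: "(int \<times> 'b) list" assume w: "hw w" "wdeg w = ?e"
          have "symsum w (ev (comp_arity 1 (lf \<phi>))) = 0"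
          proof (rule symsum_eq_0)
            fix y assume y: "mset y = mset w"
            have hy: "hw y" "wdeg y = ?e" using hw_mset[OF y w(1)] wdeg_mset[OF y] w(2) by simp_all
            show "ev (comp_arity 1 (lf \<phi>)) y = 0"
            proof (cases "length y = 1")
              case True
              then obtain a where "y = [a]" by (auto simp: length_Suc_conv)
              then show ?thesis using hy z[of "snd a"] by (simp add: ev_def comp_arity_def)
            qed (simp add: ev_def comp_arity_def)
          qed
          then show "sp w (comp_arity 1 (lf \<phi>)) = 0" by (simp add: sp_eval)
        qed (simp_all add: fscale_def)
        then have "D (sp u) (comp_arity 1 (lf \<phi>)) = 0"
          using deg Splus_deg_sp[OF u False] by blast
        then have "symsum u (ev (\<lambda>xs. \<phi> (q xs))) = 0"
          using T'[OF u False F] by (simp add: ev_def[abs_def])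
        then show ?thesis
          using symsum_symmetric[OF symmetric_mapsD[OF q \<phi>] u] by (simp add: ev_def)
      qed
      have "?x = hcomp (?e + 1) ?x"
      proof (rule linear_separates)
        fix \<phi> :: "'b \<Rightarrow> 'a" assume \<phi>: "Vector_Spaces.linear scale (*) \<phi>"
        let ?\<psi> = "\<lambda>x. \<phi> x - \<phi> (hcomp (?e + 1) x)"
        have "Vector_Spaces.linear scale (*) ?\<psi>"
          using \<phi> unfolding linear_scalar_iff
          by (simp add: hcomp_add hcomp_scale algebra_simps)
        then have "?\<psi> ?x = 0" by (rule van) (simp add: hcomp_gr)
        then show "\<phi> ?x = \<phi> (hcomp (?e + 1) ?x)" by simp
      qed
      then have "?x \<in> gr (?e + 1)" using hcomp_in[of "?e + 1" ?x] by metis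
      then show ?thesis by (simp add: lq_def)
    qed
  qed
  have 0: "(0 :: ('b, 'a) tensor) \<in> Splus"
    using Splus_deg_closed(3)[of 0] Splus_deg_subset by blast
  have fscale0: "fscale 0 t = 0" for t :: "'x \<Rightarrow> 'a" by (auto simp: fscale_def)
  have \<Delta>_eq: "\<Delta> t = Delta t" if "t \<in> Splus" for t
  proof -
    have "t \<in> Splus \<and> \<Delta> t = Delta t" using that
    proof (induction t rule: Splus_induct)
      case (sp w)
      then show ?case using \<Delta> coproduct_Delta Splus_sp unfolding coproduct_sp by auto
    next
      case zero
      have "\<Delta> 0 = 0" using linc(2)[OF 0, of 0] by (simp only: fscale0)
      moreover have "Delta 0 = (0 :: ('b, 'a) tensor2)" by (auto simp: Delta_def)
      ultimately show ?case by (intro conjI 0) (simp only:)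
    next
      case (add t u)
      then show ?case using Splus_add linc(1) Delta_add by metis
    next
      case (scale c t)
      then show ?case using Splus_fscale linc(2) Delta_fscale by metis
    qed
    then show ?thesis by blast
  qed
  \<comment> \<open>Uniqueness of the coderivation: by induction both values have the same
    coproduct, so their difference is primitive, and equal Taylor coefficients remove its arity-one
    part.\<close>
  have D_sp: "D (sp w) = D0 q (sp w)" if "hw w" "w \<noteq> []" for w
    using that
  proof (induction w rule: length_induct)
    case (1 w)
    have in1: "D (sp w) \<in> Splus" and in2: "D0 q (sp w) \<in> Splus"
      using deg D0_Splus_deg[OF d] Splus_deg_sp[OF "1.prems"] Splus_deg_subset by blast+
    have IH: "D (sp (nths w I)) = D0 q (sp (nths w I))" if I: "nths w I \<noteq> []" "nths w (- I) \<noteq> []" for I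
    proof -
      have "length (nths w I) < length w"
        using length_nths_less[OF I(2)] by simp
      then show ?thesis using "1.IH" I(1) hw_nths[OF "1.prems"(1)] by blast
    qed
    have "Delta (D (sp w)) = \<Delta> (D (sp w))" using \<Delta>_eq[OF in1] by simp
    also have "\<dots> = (\<Sum>I | I \<noteq> {} \<and> I \<subset> {..<length w}. fscale (usign (map fst w) I)
      (tprod (D (sp (nths w I))) (sp (nths w (- I))) + fscale (sg (wdeg (nths w I))) (tprod (sp (nths w I)) (D (sp (nths w (- I)))))))"
      using D "1.prems" unfolding coderivation1_sp by blast
    also have "\<dots> = (\<Sum>I | I \<noteq> {} \<and> I \<subset> {..<length w}. fscale (usign (map fst w) I)
      (tprod (D0 q (sp (nths w I))) (sp (nths w (- I))) + fscale (sg (wdeg (nths w I))) (tprod (sp (nths w I)) (D0 q (sp (nths w (- I)))))))"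
    proof (rule sum.cong[OF refl])
      fix I assume "I \<in> {I. I \<noteq> {} \<and> I \<subset> {..<length w}}"
      then have ne: "nths w I \<noteq> []" "nths w (- I) \<noteq> []" by (auto simp: nths_empty_iff)
      have "D (sp (nths w I)) = D0 q (sp (nths w I))" "D (sp (nths w (- I))) = D0 q (sp (nths w (- I)))"
        using IH[of I] IH[of "- I"] ne by simp_all
      then show "fscale (usign (map fst w) I)
        (tprod (D (sp (nths w I))) (sp (nths w (- I))) + fscale (sg (wdeg (nths w I))) (tprod (sp (nths w I)) (D (sp (nths w (- I)))))) =
       fscale (usign (map fst w) I)
        (tprod (D0 q (sp (nths w I))) (sp (nths w (- I))) + fscale (sg (wdeg (nths w I))) (tprod (sp (nths w I)) (D0 q (sp (nths w (- I))))))"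
        by (simp only:)
    qed
    also have "\<dots> = Delta (D0 q (sp w))" by (rule D0_coderivation[OF "1.prems"(1), symmetric])
    finally have De: "Delta (D (sp w)) = Delta (D0 q (sp w))" .
    have "D (sp w) + fscale (- 1) (D0 q (sp w)) = 0"
    proof (rule Splus_zeroI)
      show "D (sp w) + fscale (- 1) (D0 q (sp w)) \<in> Splus" by (intro Splus_add Splus_fscale in1 in2)
      show "Delta (D (sp w) + fscale (- 1) (D0 q (sp w))) = 0"
        unfolding Delta_add Delta_fscale De by (auto simp: fscale_def)
      fix F assume "mform F"
      then show "(D (sp w) + fscale (- 1) (D0 q (sp w))) (comp_arity 1 F) = 0"
        using T'[OF "1.prems"] D0_taylor[OF _ "1.prems"(1)] by (simp only: plus_fun_apply fscale_def) simp
    qed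
    then show ?case by (auto simp: fscale_def fun_eq_iff)
  qed
  have D_eq: "D t = D0 q t" if "t \<in> Splus" for t
  proof -
    have "t \<in> Splus \<and> D t = D0 q t" using that
    proof (induction t rule: Splus_induct)
      case zero
      have "D 0 = 0" using lin(2)[OF 0, of 0] by (simp only: fscale0)
      then show ?case by (intro conjI 0) (simp only: D0_0)
    next
      case (add t u)
      then show ?case using Splus_add lin(1) D0_add by metis
    next
      case (scale c t)
      then show ?case using Splus_fscale lin(2) D0_fscale by metis
    qed (use Splus_sp D_sp in blast)
    then show ?thesis by blast
  qed
  show "vanishing_square q"
    unfolding vanishing_square_def
  proof (intro allI impI, elim conjE)
    fix \<phi> and w :: "(int \<times> 'b) list"
    assume \<phi>: "Vector_Spaces.linear scale (*) \<phi>" and w: "hw w"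
    show "symsum w (Xw (lq q) (\<lambda>z. \<phi> (q (map snd z)))) = 0"
    proof (cases "w = []")
      case True
      have "\<phi> 0 = 0" using \<phi> unfolding linear_scalar_iff by (metis mult_zero_left scale_zero_left)
      then show ?thesis using True q_zero[of "[0]"] q_Nil by (simp add: Xw_def)
    next
      case False
      have F: "mform (lf \<phi>)" using lf_cyc[OF \<phi>] by (simp add: cyc_def cyclic_def)
      have "D0 q (sp w) \<in> Splus" using D0_Splus_deg[OF d] Splus_deg_sp[OF w False] Splus_deg_subset by blast
      then have "D (D (sp w)) = D0 q (D0 q (sp w))" using D_eq Splus_sp[OF w False] by simp
      \<comment> \<open>The bracket of the odd \<open>D\<close> with itself is twice its square, so
        2 has to be cancelled.\<close>
      moreover have "D (D (sp w)) = 0"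
      proof
        fix F
        have "(D (D (sp w)) + D (D (sp w))) F = 0 F"
          by (rule fun_cong[OF DD[OF Splus_sp[OF w False]]])
        then have "2 * D (D (sp w)) F = 0 F" by (simp only: mult_2 plus_fun_apply)
        then show "D (D (sp w)) F = 0 F" by (simp only: zero_fun_apply mult_eq_0_iff) simp
      qed
      ultimately have "D0 q (D0 q (sp w)) (comp_arity 1 (lf \<phi>)) = 0" by simp
      moreover have "Xw (lq q) (ev (comp_arity 1 (lf \<phi>))) = (\<lambda>z. \<phi> (q (map snd z)))"
        by (rule ext) (simp only: Xw_arity1 snd_lq lf_simps)
      ultimately show ?thesis using D0_D0_sp[OF d mform_comp_arity[OF F] w, of 1] by (simp only:)
    qed
  qed
qed

end

context fd_graded_space
begin

lemma L_infinity_iff: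
  assumes "symmetric_maps q"
  shows "L_infinity q \<longleftrightarrow> degree1 q \<and> vanishing_square q"
proof -
  interpret graded_maps scale gr q by unfold_locales (rule assms)
  show ?thesis using L_infinityI L_infinityD by blast
qed

end

section \<open>Both directions of the correspondence\<close>

context fd_graded_space
begin

lemma graded_coordsE:
  obtains \<epsilon>s es and cs :: "nat \<Rightarrow> 'v \<Rightarrow> 'k" where "graded_coords scale gr \<epsilon>s es cs"
proof (rule homogeneous_coordinates)
  fix \<epsilon>s es and cs :: "nat \<Rightarrow> 'v \<Rightarrow> 'k"
  assume "homog \<epsilon>s es" "distinct es" "independent (set es)" "span (set es) = UNIV"
    "\<And>i. Vector_Spaces.linear scale (*) (cs i)" "\<And>x. x = (\<Sum>i<length es. cs i x *s es ! i)"
    "\<And>i j. i < length es \<Longrightarrow> j < length es \<Longrightarrow> cs i (es ! j) = (if i = j then 1 else 0)"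
    "\<And>i. i < length es \<Longrightarrow> has_degree (- (\<epsilon>s ! i)) (lf (cs i))"
  note graded_coords_axioms.intro[OF this]
  then have "graded_coords scale gr \<epsilon>s es cs"
    by (intro graded_coords.intro fd_graded_space_axioms)
  then show thesis by (rule that)
qed

lemma form_of_bracket_ex1:
  assumes "pinczon_bracket br"
  shows "\<exists>!b. form_of_bracket br b"
proof -
  obtain \<epsilon>s es and cs :: "nat \<Rightarrow> 'v \<Rightarrow> 'k" where "graded_coords scale gr \<epsilon>s es cs"
    by (rule graded_coordsE)
  then interpret graded_coords scale gr \<epsilon>s es cs .
  obtain b where "form_of_bracket br b" using form_of_bracket_exists[OF assms] by blast
  then show ?thesis using form_of_bracket_unique by (intro ex1I) auto
qed

lemma graded_dualE:
  assumes b: "nondeg_form b"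
  obtains \<epsilon>s es es' where "graded_dual scale gr b \<epsilon>s es es'"
proof -
  obtain \<epsilon>s es and cs :: "nat \<Rightarrow> 'v \<Rightarrow> 'k" where "graded_coords scale gr \<epsilon>s es cs"
    by (rule graded_coordsE)
  then interpret graded_coords scale gr \<epsilon>s es cs .
  obtain es' where d: "dual_bases b \<epsilon>s es es'" using dual_bases_exist[OF b] .
  have "graded_dual scale gr b \<epsilon>s es es'" by unfold_locales (rule b, rule d)
  then show thesis by (rule that)
qed

lemma pinczon_lie_maps:
  assumes L: "pinczon_lie br \<Omega>" and b: "form_of_bracket br b"
  shows "\<exists>!q. symmetric_maps q \<and> \<Omega> = form_of_maps b q"
    and "symmetric_maps q \<Longrightarrow> \<Omega> = form_of_maps b q \<Longrightarrow> L_infinity q \<and> B_quadratic b q"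
proof -
  have br: "pinczon_bracket br" and \<Omega>: "symmetric \<Omega>" "has_degree 3 \<Omega>" "\<And>xs. length xs < 2 \<Longrightarrow> \<Omega> xs = 0"
    and 0: "Sym (formal_bracket br \<Omega> \<Omega>) = 0"
    using L unfolding pinczon_lie_def by blast+
  have nb: "nondeg_form b" "contracts br b 0 0" using b by (simp_all add: form_of_bracket_def)
  obtain \<epsilon>s es es' where "graded_dual scale gr b \<epsilon>s es es'" using graded_dualE[OF nb(1)] .
  then interpret graded_dual scale gr b \<epsilon>s es es' .
  show "\<exists>!q. symmetric_maps q \<and> \<Omega> = form_of_maps b q" by (rule symmetric_form_maps[OF \<Omega>(1,3)])
  assume q: "symmetric_maps q" and \<Omega>q: "\<Omega> = form_of_maps b q"
  have d: "degree1 q" by (rule degree1_form[OF \<Omega>(2) \<Omega>q symmetric_maps_Nil[OF q]])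
  have "vanishing_square q"
    using 0 Sym_formal_bracket_iff[OF br nb(2) \<Omega>(1,2)] Sq_iff_square[OF q \<Omega>q \<Omega>(1) d] by blast
  then show "L_infinity q \<and> B_quadratic b q"
    using L_infinity_iff[OF q] d B_quadratic_if_symmetric[OF \<Omega>(1) \<Omega>q] by blast
qed

text \<open>Uniqueness concerns only the bracket: the contraction formula in all arities determines
  it (\<open>bracket_unique\<close>), while the form is prescribed.\<close>

lemma maps_pinczon_lie:
  assumes b: "nondeg_form b" and q: "symmetric_maps q" and L: "L_infinity q" and B: "B_quadratic b q"
  shows "\<exists>!S. pinczon_lie (fst S) (snd S) \<and> bracket_of_form b (fst S) \<and> snd S = form_of_maps b q"
proof -
  obtain \<epsilon>s es es' where "graded_dual scale gr b \<epsilon>s es es'" using graded_dualE[OF b] .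
  then interpret graded_dual scale gr b \<epsilon>s es es' .
  let ?\<Omega> = "form_of_maps b q"
  have d: "degree1 q" "vanishing_square q" using L L_infinity_iff[OF q] by blast+
  have \<Omega>: "symmetric ?\<Omega>" "has_degree 3 ?\<Omega>"
    by (rule symmetric_form_of_maps[OF q B], rule has_degree_form[OF d(1) symmetric_maps_Nil[OF q]])
  have "Sym (formal_bracket brk ?\<Omega> ?\<Omega>) = 0"
    using d(2) Sym_formal_bracket_iff[OF pinczon_bracket_brk contracts_brk \<Omega>] Sq_iff_square[OF q refl \<Omega>(1) d(1)] by blast
  then have "pinczon_lie brk ?\<Omega>"
    unfolding pinczon_lie_def using \<Omega> pinczon_bracket_brk by (simp add: form_of_maps_def)
  then show ?thesis
  proof (intro ex1I[of _ "(brk, ?\<Omega>)"])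
    fix S assume "pinczon_lie (fst S) (snd S) \<and> bracket_of_form b (fst S) \<and> snd S = ?\<Omega>"
    then have "fst S = brk" "snd S = ?\<Omega>" using bracket_unique unfolding pinczon_lie_def by blast+
    then show "S = (brk, ?\<Omega>)" by (simp add: prod_eq_iff)
  qed (simp add: bracket_of_form_brk)
qed

end

theorem proposition6p3:
  fixes scale :: "'k::field_char_0 \<Rightarrow> 'v::ab_group_add \<Rightarrow> 'v"
    and gr :: "int \<Rightarrow> 'v set"
  assumes "fd_graded_space scale gr"
  shows
    "(\<forall>br \<Omega>. fd_graded_space.pinczon_lie scale gr br \<Omega> \<longrightarrow>
        (\<exists>!b. fd_graded_space.form_of_bracket scale gr br b) \<and>
        (\<forall>b. fd_graded_space.form_of_bracket scale gr br b \<longrightarrow>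
           (\<exists>!q. fd_graded_space.symmetric_maps scale gr q \<and>
                 \<Omega> = fd_graded_space.form_of_maps gr b q) \<and>
           (\<forall>q. fd_graded_space.symmetric_maps scale gr q \<and>
                \<Omega> = fd_graded_space.form_of_maps gr b q \<longrightarrow>
                fd_graded_space.L_infinity scale gr q \<and>
                fd_graded_space.B_quadratic scale gr b q))) \<and>
     (\<forall>b q. fd_graded_space.nondeg_form scale gr b \<and>
        fd_graded_space.symmetric_maps scale gr q \<and>
        fd_graded_space.L_infinity scale gr q \<and>
        fd_graded_space.B_quadratic scale gr b q \<longrightarrow>
        (\<exists>!S. fd_graded_space.pinczon_lie scale gr (fst S) (snd S) \<and>
              fd_graded_space.bracket_of_form scale gr b (fst S) \<and>
              snd S = fd_graded_space.form_of_maps gr b q))"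
proof -
  interpret fd_graded_space scale gr by (rule assms)
  show ?thesis
  proof (rule conjI; (intro allI impI conjI)?)
    fix br \<Omega> assume L: "pinczon_lie br \<Omega>"
    then show "\<exists>!b. form_of_bracket br b" by (intro form_of_bracket_ex1) (simp add: pinczon_lie_def)
    fix b assume b: "form_of_bracket br b"
    show "\<exists>!q. symmetric_maps q \<and> \<Omega> = form_of_maps b q" by (rule pinczon_lie_maps(1)[OF L b])
    fix q assume q: "symmetric_maps q \<and> \<Omega> = form_of_maps b q"
    show "L_infinity q" "B_quadratic b q" using pinczon_lie_maps(2)[OF L b] q by blast+
  next
    fix b q assume "nondeg_form b \<and> symmetric_maps q \<and> L_infinity q \<and> B_quadratic b q"
    then show "\<exists>!S. pinczon_lie (fst S) (snd S) \<and> bracket_of_form b (fst S) \<and> snd S = form_of_maps b q"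
      by (intro maps_pinczon_lie) blast+
  qed
qed

end
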